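(* Let $s\in(0,1)$ and $n,m\in\mathbb{N}$ (with $n,m\ge 1$). Let $\Omega\subset\mathbb{R}^n$ be an open, bounded and smooth domain and $\Omega_e:=\mathbb{R}^n\setminus\overline{\Omega}$. Let $W_1,W_2\subset\Omega_e$ be nonempty open Lipschitz domains with $\overline{W}_k\cap\overline{\Omega}=\emptyset$ for $k\in\{1,2\}$. Let $g_1,\dots,g_m\in L^\infty(\Omega)$ be orthonormal with respect to the $L^2(\Omega)$ scalar product, and let $0<C_0<\infty$. Then there exists a constant $C_1>0$, depending only on the geometry of the domains $W_1,W_2$, on the functions $g_1,\dots,g_m$, on $C_0$ and on $m$ (for the fixed $s,n,\Omega$), with the following property. For all $q_1,q_2\in L^\infty(\Omega)$ such that $$q_1,q_2\in\operatorname{span}\{g_1,\dots,g_m\},\qquad \|q_1\|_{L^\infty(\Omega)},\ \|q_2\|_{L^\infty(\Omega)}\le C_0,$$ and such that for each $k\in\{1,2\}$ zero is not a Dirichlet eigenvalue of $(-\Delta)^s+q_k$ in $\Omega$, there exist data $\{\tilde f^{(k)}_1,\dots,\tilde f^{(k)}_m\}\subset\widetilde H^s(W_k)$ with $\|\tilde f^{(k)}_j\|_{\widetilde H^s(W_k)}=1$ for $j\in\{1,\dots,m\}$, $k\in\{1,2\}$ (possibly depending on $q_1,q_2$), such that $$\|q_1-q_2\|_{L^\infty(\Omega)}\le C_1\inf\Big\{\|(\Lambda_{q_1}-\Lambda_{q_2})\tilde f^{(1)}\|_{H^{-s}(W_2)},\ \|(\Lambda_{q_1}-\Lambda_{q_2})\tilde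 f^{(2)}\|_{H^{-s}(W_1)}\Big\},$$ where $\tilde f^{(k)}:=(\tilde f^{(k)}_1,\dots,\tilde f^{(k)}_m)$ and $(\Lambda_{q_1}-\Lambda_{q_2})\tilde f^{(k)}:=\big((\Lambda_{q_1}-\Lambda_{q_2})\tilde f^{(k)}_1,\dots,(\Lambda_{q_1}-\Lambda_{q_2})\tilde f^{(k)}_m\big)$.
   Context: All functions are real valued. $(-\Delta)^s$ is the Fourier multiplier with symbol $|\xi|^{2s}$. For an open set $W\subset\mathbb{R}^n$ and $s\in\mathbb{R}$: $H^s(W)$ is the space of restrictions to $W$ of elements of $H^s(\mathbb{R}^n)$ with the quotient norm $\|y\|_{H^s(W)}=\inf\{\|Y\|_{H^s(\mathbb{R}^n)}:Y|_W=y\}$; $\widetilde H^s(W)$ is the closure of $C_c^\infty(W)$ in $H^s(\mathbb{R}^n)$, with the $H^s(\mathbb{R}^n)$ norm; $H^{-s}(W)$ is identified with the dual of $\widetilde H^s(W)$. For $q\in L^\infty(\Omega)$ put $B_q(u,v):=((-\Delta)^{s/2}u,(-\Delta)^{s/2}v)_{L^2(\mathbb{R}^n)}+(qu,v)_{L^2(\Omega)}$ for $u,v\in H^s(\mathbb{R}^n)$. Given $f\in H^s(\mathbb{R}^n)$, a (weak) solution of $((-\Delta)^s+q)u=0$ in $\Omega$, $u=f$ in $\Omega_e$, is $u\in H^s(\mathbb{R}^n)$ with $u-f\in\widetilde H^s(\Omega)$ and $B_q(u,w)=0$ for all $w\in\widetilde H^s(\Omega)$. "Zero is not a Dirichlet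 eigenvalue of $(-\Delta)^s+q$ in $\Omega$" means: the only solution with $f=0$ is $u\equiv0$. In that case for every $f$ there is a unique solution $u_f$, and the Dirichlet-to-Neumann map is defined by $(\Lambda_q f,g):=B_q(u_f,g)$ for exterior data $f,g$ (formally $\Lambda_qf=(-\Delta)^su_f|_{\Omega_e}$). For $f\in\widetilde H^s(W_k)$ (extended by zero) and $l\in\{1,2\}$, $\Lambda_qf$ is viewed as an element of $H^{-s}(W_l)=(\widetilde H^s(W_l))^*$ through $g\mapsto B_q(u_f,g)$, $g\in\widetilde H^s(W_l)$. The norm of an $m$-tuple of elements of $H^{-s}(W_l)$ is the maximum of the norms of its components. *)

theory Defs
  imports "HOL-Analysis.Analysis" "HOL-Probability.Essential_Supremum"
begin

text \<open>
  Elements of the function spaces are represented by Borel functions and are compared up to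
  Lebesgue null sets; every class of Lebesgue measurable functions has a Borel representative.
  Functions in Sobolev spaces are defined on the whole space.
\<close>

section \<open>Smooth functions and domains\<close>

primrec Ck :: "nat \<Rightarrow> ('a::euclidean_space \<Rightarrow> real) \<Rightarrow> bool" where
  "Ck 0 f \<longleftrightarrow> continuous_on UNIV f"
| "Ck (Suc k) f \<longleftrightarrow>
     (\<forall>x. f differentiable (at x)) \<and> (\<forall>v. Ck k (\<lambda>x. frechet_derivative f (at x) v))"

definition smooth :: "('a::euclidean_space \<Rightarrow> real) \<Rightarrow> bool" where
  "smooth f \<longleftrightarrow> (\<forall>k. Ck k f)"

definition test_functions :: "'a::euclidean_space set \<Rightarrow> ('a \<Rightarrow> real) set" where
  "test_functions W =
     {f. smooth f \<and> compact (closure {x. f x \<noteq> 0}) \<and> closure {x. f x \<noteq> 0} \<subseteq> W}"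

text \<open>
  Near each boundary point the set is, in suitable Cartesian coordinates, the region above a
  graph: \<open>e\<close> is the vertical direction, and \<open>\<gamma>\<close> is only evaluated at the
  projection of \<open>x\<close> to the hyperplane orthogonal to \<open>e\<close>.
\<close>

definition locally_epigraph ::
    "(('a::euclidean_space \<Rightarrow> real) \<Rightarrow> bool) \<Rightarrow> 'a set \<Rightarrow> bool" where
  "locally_epigraph P U \<longleftrightarrow>
     (\<forall>p\<in>frontier U. \<exists>e \<gamma> r. norm e = 1 \<and> P \<gamma> \<and> r > 0 \<and>
        (\<forall>x\<in>ball p r. x \<in> U \<longleftrightarrow> \<gamma> (x - (x \<bullet> e) *\<^sub>R e) < x \<bullet> e))"

definition smooth_domain :: "'a::euclidean_space set \<Rightarrow> bool" where
  "smooth_domain U \<longleftrightarrow> open U \<and> connected U \<and> locally_epigraph smooth U"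

definition lipschitz_domain :: "'a::euclidean_space set \<Rightarrow> bool" where
  "lipschitz_domain U \<longleftrightarrow>
     open U \<and> connected U \<and> locally_epigraph (\<lambda>\<gamma>. \<exists>L. L-lipschitz_on UNIV \<gamma>) U"

section \<open>Lebesgue spaces\<close>

definition L2 :: "('a::euclidean_space \<Rightarrow> 'b::real_normed_vector) set" where
  "L2 = {u \<in> borel_measurable lborel. integrable lborel (\<lambda>x. (norm (u x))\<^sup>2)}"

definition Linf :: "'a::euclidean_space set \<Rightarrow> ('a \<Rightarrow> real) set" where
  "Linf \<Omega> = {q \<in> borel_measurable (restrict_space lborel \<Omega>).
     esssup (restrict_space lborel \<Omega>) (\<lambda>x. ereal \<bar>q x\<bar>) < \<infinity>}"

definition Linf_norm :: "'a::euclidean_space set \<Rightarrow> ('a \<Rightarrow> real) \<Rightarrow> real" where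
  "Linf_norm \<Omega> q = real_of_ereal (esssup (restrict_space lborel \<Omega>) (\<lambda>x. ereal \<bar>q x\<bar>))"

definition Linf_span ::
    "'a::euclidean_space set \<Rightarrow> nat \<Rightarrow> (nat \<Rightarrow> 'a \<Rightarrow> real) \<Rightarrow> ('a \<Rightarrow> real) set" where
  "Linf_span \<Omega> m g =
     {q \<in> Linf \<Omega>. \<exists>c :: nat \<Rightarrow> real.
        AE x in restrict_space lborel \<Omega>. q x = (\<Sum>j=1..m. c j * g j x)}"

definition L2_orthonormal ::
    "'a::euclidean_space set \<Rightarrow> nat \<Rightarrow> (nat \<Rightarrow> 'a \<Rightarrow> real) \<Rightarrow> bool" where
  "L2_orthonormal \<Omega> m g \<longleftrightarrow>
     (\<forall>i\<in>{1..m}. \<forall>j\<in>{1..m}.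
        (LINT x:\<Omega>|lborel. g i x * g j x) = (if i = j then 1 else 0))"

section \<open>Fourier transform and fractional Laplacian\<close>

text \<open>
  Unitary normalisation, so that the Sobolev norm of order 0 is the \<open>L2\<close> norm. On
  \<open>L2\<close> the transform is the \<open>L2\<close> limit of the transforms of the truncations
  to balls (Plancherel); it is determined almost everywhere. Likewise \<open>fractional_laplacian\<close>
  is determined almost everywhere, for \<open>u\<close> in the Sobolev space of order
  \<open>2 * \<sigma>\<close>.
\<close>

definition fourier_L1 :: "('a::euclidean_space \<Rightarrow> real) \<Rightarrow> 'a \<Rightarrow> complex" where
  "fourier_L1 u \<xi> =
     complex_of_real ((2 * pi) powr (- (real DIM('a) / 2))) *
     (LINT x|lborel. cis (- (x \<bullet> \<xi>)) * complex_of_real (u x))"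

definition fourier :: "('a::euclidean_space \<Rightarrow> real) \<Rightarrow> 'a \<Rightarrow> complex" where
  "fourier u = (SOME U. U \<in> L2 \<and>
     ((\<lambda>R. \<integral>\<^sup>+ \<xi>. ennreal ((cmod (fourier_L1 (\<lambda>x. indicator (ball 0 R) x * u x) \<xi> - U \<xi>))\<^sup>2) \<partial>lborel)
        \<longlongrightarrow> 0) at_top)"

definition fractional_laplacian ::
    "real \<Rightarrow> ('a::euclidean_space \<Rightarrow> real) \<Rightarrow> 'a \<Rightarrow> real" where
  "fractional_laplacian \<sigma> u = (SOME v. v \<in> L2 \<and>
     (AE \<xi> in lborel. fourier v \<xi> = complex_of_real (norm \<xi> powr (2 * \<sigma>)) * fourier u \<xi>))"

section \<open>Sobolev spaces\<close>

text \<open>\<open>Hs\<close> is the Bessel potential space for orders \<open>s \<ge> 0\<close>.\<close>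

definition Hs :: "real \<Rightarrow> ('a::euclidean_space \<Rightarrow> real) set" where
  "Hs s = {u \<in> L2. integrable lborel (\<lambda>\<xi>. (1 + (norm \<xi>)\<^sup>2) powr s * (cmod (fourier u \<xi>))\<^sup>2)}"

definition Hs_norm :: "real \<Rightarrow> ('a::euclidean_space \<Rightarrow> real) \<Rightarrow> real" where
  "Hs_norm s u = sqrt (LINT \<xi>|lborel. (1 + (norm \<xi>)\<^sup>2) powr s * (cmod (fourier u \<xi>))\<^sup>2)"

definition Hs_tilde :: "real \<Rightarrow> 'a::euclidean_space set \<Rightarrow> ('a \<Rightarrow> real) set" where
  "Hs_tilde s W =
     {u \<in> Hs s. \<forall>\<epsilon>>0. \<exists>\<phi>\<in>test_functions W. Hs_norm s (\<lambda>x. u x - \<phi> x) < \<epsilon>}"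

text \<open>
  Elements of \<open>H^{-s}(W)\<close> are bounded linear functionals on \<open>Hs_tilde s W\<close>, with the
  dual norm.
\<close>

definition Hs_dual_norm ::
    "real \<Rightarrow> 'a::euclidean_space set \<Rightarrow> (('a \<Rightarrow> real) \<Rightarrow> real) \<Rightarrow> real" where
  "Hs_dual_norm s W T = (SUP h\<in>{h \<in> Hs_tilde s W. Hs_norm s h \<le> 1}. \<bar>T h\<bar>)"

section \<open>The Dirichlet problem and the Dirichlet-to-Neumann map\<close>

definition bilinear_form ::
    "real \<Rightarrow> 'a::euclidean_space set \<Rightarrow> ('a \<Rightarrow> real) \<Rightarrow> ('a \<Rightarrow> real) \<Rightarrow> ('a \<Rightarrow> real) \<Rightarrow> real" where
  "bilinear_form s \<Omega> q u v =
     (LINT x|lborel. fractional_laplacian (s / 2) u x * fractional_laplacian (s / 2) v x) +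
     (LINT x:\<Omega>|lborel. q x * u x * v x)"

definition weak_solution ::
    "real \<Rightarrow> 'a::euclidean_space set \<Rightarrow> ('a \<Rightarrow> real) \<Rightarrow> ('a \<Rightarrow> real) \<Rightarrow> ('a \<Rightarrow> real) \<Rightarrow> bool" where
  "weak_solution s \<Omega> q f u \<longleftrightarrow>
     u \<in> Hs s \<and> (\<lambda>x. u x - f x) \<in> Hs_tilde s \<Omega> \<and>
     (\<forall>w\<in>Hs_tilde s \<Omega>. bilinear_form s \<Omega> q u w = 0)"

definition zero_not_dirichlet_eigenvalue ::
    "real \<Rightarrow> 'a::euclidean_space set \<Rightarrow> ('a \<Rightarrow> real) \<Rightarrow> bool" where
  "zero_not_dirichlet_eigenvalue s \<Omega> q \<longleftrightarrow>
     (\<forall>u. weak_solution s \<Omega> q (\<lambda>x. 0) u \<longrightarrow> (AE x in lborel. u x = 0))"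

text \<open>
  Meaningful when zero is not a Dirichlet eigenvalue; the solution is then unique up to a null
  set, so that \<open>DN_map\<close> does not depend on the choice.
\<close>

definition solution ::
    "real \<Rightarrow> 'a::euclidean_space set \<Rightarrow> ('a \<Rightarrow> real) \<Rightarrow> ('a \<Rightarrow> real) \<Rightarrow> 'a \<Rightarrow> real" where
  "solution s \<Omega> q f = (SOME u. weak_solution s \<Omega> q f u)"

definition DN_map ::
    "real \<Rightarrow> 'a::euclidean_space set \<Rightarrow> ('a \<Rightarrow> real) \<Rightarrow> ('a \<Rightarrow> real) \<Rightarrow> ('a \<Rightarrow> real) \<Rightarrow> real" where
  "DN_map s \<Omega> q f h = bilinear_form s \<Omega> q (solution s \<Omega> q f) h"

definition DN_difference_norm ::
    "real \<Rightarrow> 'a::euclidean_space set \<Rightarrow> 'a set \<Rightarrow> nat \<Rightarrow> ('a \<Rightarrow> real) \<Rightarrow> ('a \<Rightarrow> real) \<Rightarrow>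
     (nat \<Rightarrow> 'a \<Rightarrow> real) \<Rightarrow> real" where
  "DN_difference_norm s \<Omega> W m q\<^sub>1 q\<^sub>2 f =
     Max ((\<lambda>j. Hs_dual_norm s W (\<lambda>h. DN_map s \<Omega> q\<^sub>1 (f j) h - DN_map s \<Omega> q\<^sub>2 (f j) h)) ` {1..m})"

end

theory Submission
  imports Defs "HOL-Probability.Characteristic_Functions"
begin

text \<open>
  Let \<open>d\<close> be the largest coefficient of \<open>q\<^sub>1 - q\<^sub>2\<close>, say that of \<open>g k\<close>, in absolute
  value. If \<open>u\<^sub>1\<close>, \<open>u\<^sub>2\<close> are solutions for \<open>q\<^sub>1\<close>, \<open>q\<^sub>2\<close> with exterior data \<open>f\<close>, \<open>h\<close>, then the difference of the
  Dirichlet-to-Neumann maps, applied to \<open>f\<close> and tested with \<open>h\<close>, is the integral of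
  \<open>(q\<^sub>1 - q\<^sub>2) * u\<^sub>1 * u\<^sub>2\<close> over \<open>\<Omega>\<close>. When \<open>u\<^sub>1\<close> and \<open>u\<^sub>2\<close> are close in \<open>L2\<close> to \<open>g k\<close> and to
  \<open>1\<close>, this integral is at least \<open>d / 2\<close>, while the supremum norm of \<open>q\<^sub>1 - q\<^sub>2\<close> is at most
  a constant times \<open>d\<close>.

  Such data exist by the Runge approximation property, which follows from unique continuation:
  the energies \<open>w \<mapsto> energy s f w\<close> of exterior data \<open>f\<close> are dense in the dual of
  \<open>Hs_tilde s \<Omega>\<close>. For a constant that does not depend on the potentials, finitely many
  exterior data are fixed whose annihilator consists of functions with so much high frequency
  content that all forms with potentials bounded by a given constant are uniformly coercive
  on it. Every equation is then solvable, with uniform bounds, up to a combination of these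
  finitely many energies.

  Unique continuation: if the energies of \<open>u\<close>, supported in a compact set, against all test
  functions of an open set \<open>W\<close> off the support vanish, then so does on \<open>W\<close> the integral of \<open>u\<close>
  against the kernel \<open>1 / \<bar>x - y\<bar> ^ (n + 2 * s)\<close>. Applying the Laplacian in \<open>x\<close> repeatedly gives
  the same for all kernels with exponent \<open>n + 2 * s + 2 * k\<close>. By the Weierstrass theorem in the
  variable \<open>1 / \<bar>x - y\<bar>\<^sup>2\<close>, \<open>u\<close> is orthogonal to all Gaussians centred in \<open>W\<close>. For centres in a
  ball these span an algebra, so \<open>u = 0\<close> by the Stone-Weierstrass theorem.
\<close>

section \<open>Complete semi-inner product spaces of functions\<close>

text \<open>The constant must be uniform although admissible potentials may come arbitrarily close
  to ones for which zero is a Dirichlet eigenvalue, where the solution operators blow up. So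
  prescribed data are never solved for with a uniform bound. Datum and solution are chosen together:
  one solves on the annihilator of the fixed data, where bounds depend only on the size of the
  potential, and moves the leftover combination of energies into the exterior datum. Nonresonance
  enters only qualitatively: it makes the Dirichlet-to-Neumann map well defined and the datum
  nonzero. Normalising the datum is a rescaling, and only an upper bound for its original norm
  enters the constant. Orthonormality reads off the coefficient of \<open>g k\<close> from the
  integral and bounds all coefficients of an admissible potential, so that finitely many functionals
  are approximated in advance. Which k occurs depends on the pair of potentials; hence targets for
  all \<open>g j\<close> are prepared, and one datum, repeated m times, serves as the whole
  tuple.\<close>

text \<open>Stated for all real coefficients because semi-definite forms produce the degenerate case
  \<open>C = 0\<close>, and because with \<open>A = 0\<close> it forces \<open>B = 0\<close>, which
  is the first-order condition at a minimiser.\<close>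

lemma quadratic_nonneg_imp_discriminant:
  fixes A B C :: real
  assumes "\<And>t. 0 \<le> A + 2 * t * B + t\<^sup>2 * C"
  shows "B\<^sup>2 \<le> A * C"
proof (cases "C = 0")
  case True
  have "B = 0"
  proof (rule ccontr)
    assume "B \<noteq> 0"
    \<comment> \<open>The value of t at which the remaining linear expression equals -1.\<close>
    then have "2 * ((- A - 1) / (2 * B)) * B = - A - 1" by (simp add: field_simps)
    then show False
      using assms[of "(- A - 1) / (2 * B)"] True by simp
  qed
  then show ?thesis using True by simp
next
  case False
  have "C > 0"
  proof (rule ccontr)
    assume "\<not> C > 0"
    then have C: "C < 0" using False by simp
    \<comment> \<open>Large enough that the negative quadratic term outweighs the other two; the
      summand 1 makes t at least 1.\<close>
    define t where "t = (1 + \<bar>A\<bar> + 2 * \<bar>B\<bar>) / (- C) + 1"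
    have t1: "t \<ge> 1" unfolding t_def using C by (simp add: divide_nonneg_neg)
    have "t * (- C) \<ge> 1 + \<bar>A\<bar> + 2 * \<bar>B\<bar>"
      unfolding t_def using C by (simp add: field_simps)
    then have "t * (t * (- C)) \<ge> t * (1 + \<bar>A\<bar> + 2 * \<bar>B\<bar>)"
      using t1 by (intro mult_left_mono) auto
    then have "t\<^sup>2 * C \<le> - t * (1 + \<bar>A\<bar>) - 2 * t * \<bar>B\<bar>"
      by (simp add: power2_eq_square algebra_simps)
    moreover have "2 * t * B \<le> 2 * t * \<bar>B\<bar>" using t1 by (simp add: mult_left_mono)
    moreover have "t * (1 + \<bar>A\<bar>) \<ge> 1 * (1 + \<bar>A\<bar>)" using t1 by (intro mult_right_mono) auto
    ultimately show False using assms[of t] abs_ge_self[of A] by (simp add: algebra_simps)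
  qed
  \<comment> \<open>The value at the vertex - B / C, multiplied by C.\<close>
  have "0 \<le> C * (A + 2 * (- B / C) * B + (- B / C)\<^sup>2 * C)"
    using assms[of "- B / C"] \<open>C > 0\<close> by (intro mult_nonneg_nonneg) auto
  also have "\<dots> = A * C - B\<^sup>2"
    using False by (simp add: field_simps power2_eq_square)
  finally show ?thesis by simp
qed

text \<open>Elements are functions, not classes modulo null sets, so the form is only semi-definite
  and the operations are pointwise. Carrier and form are parameters because the same arguments serve
  square integrable functions, Sobolev spaces, their closed subspaces, and subspaces on which the
  form of a potential is the inner product.\<close>

locale semi_inner =
  fixes V :: "('x \<Rightarrow> real) set" and I :: "('x \<Rightarrow> real) \<Rightarrow> ('x \<Rightarrow> real) \<Rightarrow> real"
  assumes lin: "u \<in> V \<Longrightarrow> v \<in> V \<Longrightarrow> (\<lambda>x. a * u x + b * v x) \<in> V"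
    and zero: "(\<lambda>x. 0) \<in> V"
    and I_lin: "u \<in> V \<Longrightarrow> v \<in> V \<Longrightarrow> w \<in> V \<Longrightarrow> I (\<lambda>x. a * u x + b * v x) w = a * I u w + b * I v w"
    and I_sym: "u \<in> V \<Longrightarrow> v \<in> V \<Longrightarrow> I u v = I v u"
    and I_nonneg: "u \<in> V \<Longrightarrow> 0 \<le> I u u"
begin

definition nrm where "nrm u = sqrt (I u u)"

text \<open>Functionals are defined on all functions, but only their behaviour on \<open>V\<close>
  is constrained; two functionals are compared on \<open>V\<close> alone.\<close>

definition bdd_lin where
  "bdd_lin F \<longleftrightarrow> (\<forall>u\<in>V. \<forall>v\<in>V. \<forall>a b. F (\<lambda>x. a * u x + b * v x) = a * F u + b * F v) \<and>
     (\<exists>K\<ge>0. \<forall>u\<in>V. \<bar>F u\<bar> \<le> K * nrm u)"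

lemma add: "u \<in> V \<Longrightarrow> v \<in> V \<Longrightarrow> (\<lambda>x. u x + v x) \<in> V"
  using lin[of u v 1 1] by simp

lemma diff: "u \<in> V \<Longrightarrow> v \<in> V \<Longrightarrow> (\<lambda>x. u x - v x) \<in> V"
  using lin[of u v 1 "-1"] by simp

lemma scale: "u \<in> V \<Longrightarrow> (\<lambda>x. a * u x) \<in> V"
  using lin[of u u a 0] by simp

lemma I_diff: "u \<in> V \<Longrightarrow> v \<in> V \<Longrightarrow> w \<in> V \<Longrightarrow> I (\<lambda>x. u x - v x) w = I u w - I v w"
  using I_lin[of u v w 1 "-1"] by simp

lemma I_square:
  assumes "u \<in> V" "v \<in> V"
  shows "I (\<lambda>x. a * u x + b * v x) (\<lambda>x. a * u x + b * v x)
    = a\<^sup>2 * I u u + 2 * a * b * I u v + b\<^sup>2 * I v v"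
proof -
  have l: "(\<lambda>x. a * u x + b * v x) \<in> V" using assms by (rule lin)
  have "I u (\<lambda>x. a * u x + b * v x) = a * I u u + b * I u v"
    using I_sym[OF assms(1) l] I_lin[of u v u a b] I_sym[of v u] assms by simp
  moreover have "I v (\<lambda>x. a * u x + b * v x) = a * I u v + b * I v v"
    using I_sym[OF assms(2) l] I_lin[of u v v a b] assms by simp
  ultimately show ?thesis
    using I_lin[OF assms l, of a b] by (simp add: power2_eq_square algebra_simps)
qed

lemma nrm_nonneg[simp]: "u \<in> V \<Longrightarrow> 0 \<le> nrm u"
  unfolding nrm_def by (simp add: I_nonneg)

lemma nrm_sq: "u \<in> V \<Longrightarrow> (nrm u)\<^sup>2 = I u u"
  unfolding nrm_def by (simp add: I_nonneg)

lemma cauchy_schwarz: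
  assumes "u \<in> V" "v \<in> V"
  shows "\<bar>I u v\<bar> \<le> nrm u * nrm v"
proof -
  have "(I u v)\<^sup>2 \<le> I u u * I v v"
  proof (rule quadratic_nonneg_imp_discriminant)
    fix t
    show "0 \<le> I u u + 2 * t * I u v + t\<^sup>2 * I v v"
      using I_square[OF assms, of 1 t] I_nonneg[OF lin[OF assms, of 1 t]] by simp
  qed
  then have "sqrt ((I u v)\<^sup>2) \<le> sqrt (I u u * I v v)" by (rule real_sqrt_le_mono)
  then show ?thesis unfolding nrm_def by (simp add: real_sqrt_mult)
qed

lemma nrm_triangle:
  assumes "u \<in> V" "v \<in> V"
  shows "nrm (\<lambda>x. u x + v x) \<le> nrm u + nrm v"
proof (rule power2_le_imp_le)
  have "(nrm (\<lambda>x. u x + v x))\<^sup>2 = I u u + 2 * I u v + I v v"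
    using I_square[OF assms, of 1 1] nrm_sq[OF add[OF assms]] by simp
  also have "\<dots> \<le> (nrm u)\<^sup>2 + 2 * (nrm u * nrm v) + (nrm v)\<^sup>2"
    using cauchy_schwarz[OF assms] nrm_sq assms by simp
  finally show "(nrm (\<lambda>x. u x + v x))\<^sup>2 \<le> (nrm u + nrm v)\<^sup>2"
    by (simp add: power2_eq_square algebra_simps)
  show "0 \<le> nrm u + nrm v" using assms by simp
qed

lemma nrm_scale: "u \<in> V \<Longrightarrow> nrm (\<lambda>x. a * u x) = \<bar>a\<bar> * nrm u"
  using I_square[of u u a 0] unfolding nrm_def by (simp add: real_sqrt_mult)

lemma nrm_minus_commute:
  assumes "u \<in> V" "v \<in> V" shows "nrm (\<lambda>x. u x - v x) = nrm (\<lambda>x. v x - u x)"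
  using nrm_scale[OF diff[OF assms], of "-1"] by simp

lemma nrm_triangle_diff:
  assumes "u \<in> V" "v \<in> V" "w \<in> V"
  shows "nrm (\<lambda>x. u x - w x) \<le> nrm (\<lambda>x. u x - v x) + nrm (\<lambda>x. v x - w x)"
  using nrm_triangle[OF diff[OF assms(1,2)] diff[OF assms(2,3)]] by simp

lemma bdd_linD:
  assumes "bdd_lin F" "u \<in> V" "v \<in> V"
  shows "F (\<lambda>x. a * u x + b * v x) = a * F u + b * F v"
  using assms unfolding bdd_lin_def by blast

lemma bdd_linI:
  assumes "\<And>u v a b. u \<in> V \<Longrightarrow> v \<in> V \<Longrightarrow> F (\<lambda>x. a * u x + b * v x) = a * F u + b * F v"
    and "\<And>u. u \<in> V \<Longrightarrow> \<bar>F u\<bar> \<le> K * nrm u"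
  shows "bdd_lin F"
proof -
  have "\<bar>F u\<bar> \<le> max K 0 * nrm u" if "u \<in> V" for u
    using assms(2)[OF that] mult_right_mono[of K "max K 0" "nrm u"] nrm_nonneg[OF that]
    by linarith
  then show ?thesis unfolding bdd_lin_def using assms(1) by (meson max.cobounded2)
qed

lemma bdd_lin_I: "u \<in> V \<Longrightarrow> bdd_lin (I u)"
  using I_lin I_sym lin cauchy_schwarz by (intro bdd_linI[where K="nrm u"]) (auto simp: mult.commute)

lemma bdd_lin_combination:
  assumes "bdd_lin F" "bdd_lin G"
  shows "bdd_lin (\<lambda>w. a * F w + b * G w)"
proof -
  obtain K L where K: "K \<ge> 0" "\<forall>u\<in>V. \<bar>F u\<bar> \<le> K * nrm u" and L: "L \<ge> 0" "\<forall>u\<in>V. \<bar>G u\<bar> \<le> L * nrm u"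
    using assms unfolding bdd_lin_def by blast
  show ?thesis
  proof (rule bdd_linI[where K="\<bar>a\<bar> * K + \<bar>b\<bar> * L"])
    fix u assume u: "u \<in> V"
    have "\<bar>a * F u + b * G u\<bar> \<le> \<bar>a\<bar> * \<bar>F u\<bar> + \<bar>b\<bar> * \<bar>G u\<bar>"
      by (metis abs_mult abs_triangle_ineq)
    also have "\<dots> \<le> \<bar>a\<bar> * (K * nrm u) + \<bar>b\<bar> * (L * nrm u)"
      using K L u by (intro add_mono mult_left_mono) auto
    finally show "\<bar>a * F u + b * G u\<bar> \<le> (\<bar>a\<bar> * K + \<bar>b\<bar> * L) * nrm u"
      by (simp add: algebra_simps)
  qed (simp add: bdd_linD[OF assms(1)] bdd_linD[OF assms(2)] algebra_simps)
qed

text \<open>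
  The coefficients are bounded because, after discarding redundant functionals, they are the
  values of \<open>F\<close> at a dual basis.
\<close>

lemma functional_in_span:
  fixes l :: "nat \<Rightarrow> ('x \<Rightarrow> real) \<Rightarrow> real"
  assumes "\<forall>i<N. bdd_lin (l i)"
  shows "\<exists>M\<ge>0. \<forall>F \<delta>. bdd_lin F \<longrightarrow> 0 \<le> \<delta> \<longrightarrow> (\<forall>w\<in>V. \<bar>F w\<bar> \<le> \<delta> * nrm w) \<longrightarrow>
     (\<forall>w\<in>V. (\<forall>i<N. l i w = 0) \<longrightarrow> F w = 0) \<longrightarrow>
     (\<exists>c. (\<forall>i<N. \<bar>c i\<bar> \<le> M * \<delta>) \<and> (\<forall>w\<in>V. F w = (\<Sum>i<N. c i * l i w)))"
  using assms
proof (induction N)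
  case 0
  then show ?case by (intro exI[of _ 0]) auto
next
  case (Suc N)
  have l': "\<forall>i<N. bdd_lin (l i)" using Suc.prems by simp
  obtain M where M: "M \<ge> 0" and M': "\<forall>F \<delta>. bdd_lin F \<longrightarrow> 0 \<le> \<delta> \<longrightarrow> (\<forall>w\<in>V. \<bar>F w\<bar> \<le> \<delta> * nrm w) \<longrightarrow>
     (\<forall>w\<in>V. (\<forall>i<N. l i w = 0) \<longrightarrow> F w = 0) \<longrightarrow>
     (\<exists>c. (\<forall>i<N. \<bar>c i\<bar> \<le> M * \<delta>) \<and> (\<forall>w\<in>V. F w = (\<Sum>i<N. c i * l i w)))"
    using Suc.IH[OF l'] by (elim exE conjE) (rule that)
  show ?case
  proof (cases "\<exists>w\<in>V. (\<forall>i<N. l i w = 0) \<and> l N w \<noteq> 0")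
    \<comment> \<open>The last functional vanishes on the common kernel of the others, so it is
      redundant and gets coefficient 0.\<close>
    case False
    show ?thesis
    proof (intro exI[of _ M] conjI allI impI, fact M)
      fix F \<delta>
      assume F: "bdd_lin F" "0 \<le> \<delta>" "\<forall>w\<in>V. \<bar>F w\<bar> \<le> \<delta> * nrm w"
        "\<forall>w\<in>V. (\<forall>i<Suc N. l i w = 0) \<longrightarrow> F w = 0"
      have "\<forall>w\<in>V. (\<forall>i<N. l i w = 0) \<longrightarrow> F w = 0"
        using F(4) False by (metis less_Suc_eq)
      from M'[THEN spec, THEN spec, THEN mp, OF F(1), THEN mp, OF F(2), THEN mp, OF F(3), THEN mp, OF this]
      obtain c where c: "\<forall>i<N. \<bar>c i\<bar> \<le> M * \<delta>"
        "\<forall>w\<in>V. F w = (\<Sum>i<N. c i * l i w)" by blast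
      show "\<exists>c. (\<forall>i<Suc N. \<bar>c i\<bar> \<le> M * \<delta>) \<and> (\<forall>w\<in>V. F w = (\<Sum>i<Suc N. c i * l i w))"
        using c M F(2) by (intro exI[of _ "c(N := 0)"]) (auto simp: less_Suc_eq)
    qed
  next
    case True
    then obtain w where w: "w \<in> V" "\<forall>i<N. l i w = 0" "l N w \<noteq> 0" by blast
    \<comment> \<open>A dual vector of the last functional: annihilated by the earlier ones, with
      value 1 on \<open>l N\<close>.\<close>
    define x where "x = (\<lambda>t. (1 / l N w) * w t)"
    have lN: "bdd_lin (l N)" using Suc.prems by simp
    have xV: "x \<in> V" unfolding x_def using w(1) by (rule scale)
    have lx: "l i x = (1 / l N w) * l i w" if "i \<le> N" for i
      using bdd_linD[of "l i" w w "1 / l N w" 0] Suc.prems[rule_format, of i] that w(1) unfolding x_def by simp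
    have lx0: "\<forall>i<N. l i x = 0" and lxN: "l N x = 1" using lx w by auto
    obtain K where K: "K \<ge> 0" "\<forall>u\<in>V. \<bar>l N u\<bar> \<le> K * nrm u"
      using lN unfolding bdd_lin_def by blast
    \<comment> \<open>The first summand bounds the coefficients of \<open>F'\<close>, whose norm
      exceeds that of \<open>F\<close> by the factor \<open>1 + nrm x * K\<close>; the second bounds
      the new coefficient \<open>F x\<close>.\<close>
    define M' where "M' = M * (1 + nrm x * K) + nrm x"
    have M'0: "M' \<ge> 0" "M * (1 + nrm x * K) \<le> M'" "nrm x \<le> M'"
      unfolding M'_def using M K(1) xV by auto
    show ?thesis
    proof (intro exI[of _ M'] conjI allI impI, fact M'0)
      fix F \<delta>
      assume F: "bdd_lin F" "0 \<le> \<delta>" "\<forall>w\<in>V. \<bar>F w\<bar> \<le> \<delta> * nrm w"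
        "\<forall>w\<in>V. (\<forall>i<Suc N. l i w = 0) \<longrightarrow> F w = 0"
      \<comment> \<open>Removing the component along \<open>l N\<close> leaves a functional that
        vanishes wherever the first N functionals do, so the induction hypothesis applies to
        it.\<close>
      define F' where "F' = (\<lambda>u. 1 * F u + (- F x) * l N u)"
      have 1: "bdd_lin F'" unfolding F'_def by (rule bdd_lin_combination[OF F(1) lN])
      have 2: "\<forall>u\<in>V. \<bar>F' u\<bar> \<le> (\<delta> * (1 + nrm x * K)) * nrm u"
      proof
        fix u assume u: "u \<in> V"
        have "\<bar>F' u\<bar> \<le> \<bar>F u\<bar> + \<bar>F x\<bar> * \<bar>l N u\<bar>"
          unfolding F'_def using abs_triangle_ineq[of "F u" "- F x * l N u"] by (simp add: abs_mult)
        also have "\<dots> \<le> \<delta> * nrm u + (\<delta> * nrm x) * (K * nrm u)"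
          using F(3) K u xV F(2) by (intro add_mono mult_mono) auto
        finally show "\<bar>F' u\<bar> \<le> (\<delta> * (1 + nrm x * K)) * nrm u" by (simp add: algebra_simps)
      qed
      have 3: "\<forall>u\<in>V. (\<forall>i<N. l i u = 0) \<longrightarrow> F' u = 0"
      proof (intro ballI impI)
        fix u assume u: "u \<in> V" "\<forall>i<N. l i u = 0"
        \<comment> \<open>Projection of u to the kernel of \<open>l N\<close> along x; it stays in
          the kernels of the earlier functionals.\<close>
        define u' where "u' = (\<lambda>t. 1 * u t + (- l N u) * x t)"
        have u'V: "u' \<in> V" unfolding u'_def using u xV by (intro lin)
        have "l i u' = 1 * l i u + (- l N u) * l i x" if "i \<le> N" for i
          unfolding u'_def using bdd_linD[of "l i" u x 1 "- l N u"] u xV Suc.prems[rule_format, of i] that by simp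
        then have "\<forall>i<Suc N. l i u' = 0" using u(2) lx0 lxN by (auto simp: less_Suc_eq)
        then have "F u' = 0" using F(4) u'V by blast
        moreover have "F u' = 1 * F u + (- l N u) * F x"
          unfolding u'_def using u xV by (intro bdd_linD F(1))
        ultimately show "F' u = 0" unfolding F'_def by simp
      qed
      have "0 \<le> \<delta> * (1 + nrm x * K)" using F(2) K(1) xV by simp
      from M'[THEN spec, THEN spec, THEN mp, OF 1, THEN mp, OF this, THEN mp, OF 2, THEN mp, OF 3]
      obtain c where c: "\<forall>i<N. \<bar>c i\<bar> \<le> M * (\<delta> * (1 + nrm x * K))"
        "\<forall>w\<in>V. F' w = (\<Sum>i<N. c i * l i w)" by blast
      have "\<bar>c i\<bar> \<le> M' * \<delta>" if "i < N" for i
        using c(1) that mult_right_mono[OF M'0(2) F(2)] by (fastforce simp: mult_ac)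
      moreover have "\<bar>F x\<bar> \<le> M' * \<delta>"
        using F(3) xV mult_right_mono[OF M'0(3) F(2)] by (fastforce simp: mult_ac)
      moreover have "F w = (\<Sum>i<N. c i * l i w) + F x * l N w" if "w \<in> V" for w
        using c(2) that unfolding F'_def by (simp add: algebra_simps)
      ultimately show "\<exists>c. (\<forall>i<Suc N. \<bar>c i\<bar> \<le> M' * \<delta>) \<and> (\<forall>w\<in>V. F w = (\<Sum>i<Suc N. c i * l i w))"
        by (intro exI[of _ "c(N := F x)"]) (auto simp: less_Suc_eq)
    qed
  qed
qed

end

text \<open>The limit need not be unique, since the seminorm may vanish on nonzero
  functions.\<close>

locale semi_hilbert = semi_inner +
  assumes complete: "(\<And>n::nat. f n \<in> V) \<Longrightarrow>
    (\<And>e. e > 0 \<Longrightarrow> \<exists>M. \<forall>m\<ge>M. \<forall>n\<ge>M. nrm (\<lambda>x. f m x - f n x) < e) \<Longrightarrow>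
    \<exists>l\<in>V. (\<lambda>n. nrm (\<lambda>x. f n x - l x)) \<longlonglongrightarrow> 0"
begin

text \<open>
  Minimise \<open>I w w - 2 * F w\<close> over \<open>S\<close>: by the parallelogram law a minimising sequence is
  a Cauchy sequence.
\<close>

lemma riesz_on_subspace:
  assumes S: "S \<subseteq> V" "(\<lambda>x. 0) \<in> S"
      "\<And>u v a b. u \<in> S \<Longrightarrow> v \<in> S \<Longrightarrow> (\<lambda>x. a * u x + b * v x) \<in> S"
    and F: "bdd_lin F"
  shows "\<exists>z\<in>V. (\<forall>w\<in>S. I z w = F w) \<and> (\<forall>e>0. \<exists>s\<in>S. nrm (\<lambda>x. s x - z x) < e)"
proof -
  define J where "J w = I w w - 2 * F w" for w
  obtain K where K: "K \<ge> 0" "\<And>u. u \<in> V \<Longrightarrow> \<bar>F u\<bar> \<le> K * nrm u"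
    using F unfolding bdd_lin_def by blast
  have J_lower: "- K\<^sup>2 \<le> J w" if "w \<in> V" for w
  proof -
    \<comment> \<open>Completing the square shows that the functional to be minimised is bounded
      below.\<close>
    have "0 \<le> (nrm w - K)\<^sup>2" by simp
    then have "2 * (K * nrm w) \<le> I w w + K\<^sup>2"
      using nrm_sq[OF that] by (simp add: power2_diff mult_ac)
    then show ?thesis using K(2)[OF that] unfolding J_def by linarith
  qed
  define j where "j = Inf (J ` S)"
  have bdd: "bdd_below (J ` S)" using J_lower S(1) by (intro bdd_belowI[of _ "- K\<^sup>2"]) auto
  have j_le: "j \<le> J w" if "w \<in> S" for w
    unfolding j_def using that bdd by (intro cInf_lower) auto
  have ex: "\<exists>w\<in>S. J w < j + 1 / (real n + 1)" for n
  proof -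
    have "Inf (J ` S) < j + 1 / (real n + 1)" unfolding j_def by simp
    moreover have "J ` S \<noteq> {}" using S(2) by blast
    ultimately obtain y where "y \<in> J ` S" "y < j + 1 / (real n + 1)"
      using cInf_lessD[of "J ` S" "j + 1 / (real n + 1)"] by blast
    then show ?thesis by blast
  qed
  then obtain s where s: "\<And>n. s n \<in> S" "\<And>n. J (s n) < j + 1 / (real n + 1)" by metis
  have sV: "s n \<in> V" for n using s S(1) by blast
  have par: "I (\<lambda>x. s m x - s n x) (\<lambda>x. s m x - s n x) \<le> 2 / (real m + 1) + 2 / (real n + 1)" for m n
  proof -
    \<comment> \<open>The midpoint stays in \<open>S\<close>, so its value is at least the infimum;
      this turns the parallelogram law into an upper bound for the distance.\<close>
    define mid where "mid = (\<lambda>x. (1/2) * s m x + (1/2) * s n x)"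
    have mid: "mid \<in> S" unfolding mid_def using s by (intro S(3))
    have 1: "I (\<lambda>x. s m x - s n x) (\<lambda>x. s m x - s n x) = I (s m) (s m) - 2 * I (s m) (s n) + I (s n) (s n)"
      using I_square[OF sV sV, of 1 m "-1" n] by simp
    have 2: "I mid mid = (1/4) * I (s m) (s m) + (1/2) * I (s m) (s n) + (1/4) * I (s n) (s n)"
      using I_square[OF sV sV, of "1/2" m "1/2" n] unfolding mid_def by (simp add: power2_eq_square)
    have 3: "F mid = (1/2) * F (s m) + (1/2) * F (s n)"
      unfolding mid_def by (rule bdd_linD[OF F sV sV])
    have "I (\<lambda>x. s m x - s n x) (\<lambda>x. s m x - s n x) = 2 * J (s m) + 2 * J (s n) - 4 * J mid"
      unfolding 1 J_def 2 3 by simp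
    then show ?thesis using j_le[OF mid] s(2)[of m] s(2)[of n] by linarith
  qed
  have cauchy: "\<exists>M. \<forall>m\<ge>M. \<forall>n\<ge>M. nrm (\<lambda>x. s m x - s n x) < e" if "e > 0" for e
  proof -
    obtain M where M: "4 / e\<^sup>2 < real M" using reals_Archimedean2 by blast
    have "nrm (\<lambda>x. s m x - s n x) < e" if "m \<ge> M" "n \<ge> M" for m n
    proof (rule power2_less_imp_less)
      have k: "2 / (real k + 1) < e\<^sup>2 / 2" if "k \<ge> M" for k
      proof -
        have "4 / e\<^sup>2 < real k + 1" using M that by linarith
        then show ?thesis using \<open>e > 0\<close> by (simp add: field_simps)
      qed
      have "(nrm (\<lambda>x. s m x - s n x))\<^sup>2 = I (\<lambda>x. s m x - s n x) (\<lambda>x. s m x - s n x)"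
        using nrm_sq diff sV by blast
      then show "(nrm (\<lambda>x. s m x - s n x))\<^sup>2 < e\<^sup>2"
        using par[of m n] k[OF that(1)] k[OF that(2)] by linarith
    qed (use \<open>e > 0\<close> in simp)
    then show ?thesis by blast
  qed
  from complete[OF sV cauchy] obtain z where z: "z \<in> V" "(\<lambda>n. nrm (\<lambda>x. s n x - z x)) \<longlonglongrightarrow> 0"
    by blast
  have "I z w = F w" if w: "w \<in> S" for w
  proof -
    have wV: "w \<in> V" using w S(1) by blast
    have lim: "(\<lambda>n. I (s n) w) \<longlonglongrightarrow> I z w"
    proof (rule LIM_zero_cancel, rule tendsto_rabs_zero_cancel, rule tendsto_sandwich[of "\<lambda>n. 0"])
      show "\<forall>\<^sub>F n in sequentially. \<bar>I (s n) w - I z w\<bar> \<le> nrm (\<lambda>x. s n x - z x) * nrm w"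
        using cauchy_schwarz[OF diff[OF sV z(1)] wV] I_diff[OF sV z(1) wV] by simp
      show "(\<lambda>n. nrm (\<lambda>x. s n x - z x) * nrm w) \<longlonglongrightarrow> 0"
        using tendsto_mult_right[OF z(2), of "nrm w"] by simp
    qed auto
    \<comment> \<open>First variation: comparing \<open>s n + t w\<close> with the infimum and
      letting n tend to infinity gives a nonnegative quadratic in t without constant term, so its
      linear coefficient vanishes.\<close>
    have quad: "0 \<le> 0 + 2 * t * (I z w - F w) + t\<^sup>2 * I w w" for t
    proof -
      have le: "- 1 / (real n + 1) \<le> 2 * t * (I (s n) w - F w) + t\<^sup>2 * I w w" for n
      proof -
        have "(\<lambda>x. 1 * s n x + t * w x) \<in> S" by (intro S(3) s w)
        then have "j \<le> J (\<lambda>x. 1 * s n x + t * w x)" by (rule j_le)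
        also have "\<dots> = J (s n) + 2 * t * (I (s n) w - F w) + t\<^sup>2 * I w w"
          unfolding J_def I_square[OF sV wV] bdd_linD[OF F sV wV] by (simp add: algebra_simps)
        finally show ?thesis using s(2)[of n] by simp
      qed
      have "(\<lambda>n. - 1 / (real n + 1)) \<longlonglongrightarrow> 0"
        using tendsto_minus[OF LIMSEQ_inverse_real_of_nat] by (simp add: inverse_eq_divide add.commute)
      moreover have "(\<lambda>n. 2 * t * (I (s n) w - F w) + t\<^sup>2 * I w w) \<longlonglongrightarrow> 2 * t * (I z w - F w) + t\<^sup>2 * I w w"
        by (intro tendsto_intros lim)
      ultimately show ?thesis using LIMSEQ_le[of "\<lambda>n. - 1 / (real n + 1)" 0] le by auto
    qed
    have "(I z w - F w)\<^sup>2 \<le> 0 * I w w" by (rule quadratic_nonneg_imp_discriminant[OF quad])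
    then show ?thesis by simp
  qed
  moreover have "\<exists>s\<in>S. nrm (\<lambda>x. s x - z x) < e" if "e > 0" for e
  proof -
    have "\<forall>\<^sub>F n in sequentially. nrm (\<lambda>x. s n x - z x) < e"
      using order_tendstoD(2)[OF z(2) that] .
    then obtain n where "nrm (\<lambda>x. s n x - z x) < e" by (auto dest: eventually_happens)
    then show ?thesis using s(1) by blast
  qed
  ultimately show ?thesis using z(1) by blast
qed

lemma riesz: "bdd_lin F \<Longrightarrow> \<exists>z\<in>V. \<forall>w\<in>V. I z w = F w"
  using riesz_on_subspace[of V F] lin zero by blast

text \<open>Density in the dual norm. The representers of the functionals in \<open>LL\<close> form
  a subspace; the representer of \<open>G\<close> is projected onto its closure. The residual is
  orthogonal to all representers, that is, annihilated by all of \<open>LL\<close>, and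
  \<open>sep\<close> makes it null.\<close>

lemma separating_functionals_dense:
  assumes LL: "\<And>L. L \<in> LL \<Longrightarrow> bdd_lin L" "LL \<noteq> {}"
      "\<And>L L' a b. L \<in> LL \<Longrightarrow> L' \<in> LL \<Longrightarrow> (\<lambda>w. a * L w + b * L' w) \<in> LL"
    and sep: "\<And>y. y \<in> V \<Longrightarrow> (\<And>L. L \<in> LL \<Longrightarrow> L y = 0) \<Longrightarrow> I y y = 0"
    and G: "bdd_lin G" and e: "e > 0"
  shows "\<exists>L\<in>LL. \<forall>w\<in>V. \<bar>G w - L w\<bar> \<le> e * nrm w"
proof -
  define S where "S = {r \<in> V. \<exists>L\<in>LL. \<forall>w\<in>V. I r w = L w}"
  obtain g where g: "g \<in> V" "\<And>w. w \<in> V \<Longrightarrow> I g w = G w" using riesz[OF G] by blast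
  obtain L0 where L0: "L0 \<in> LL" using LL(2) by blast
  have "(\<lambda>w. 0 * L0 w + 0 * L0 w) \<in> LL" by (rule LL(3)[OF L0 L0])
  moreover have "I (\<lambda>x. 0) w = 0" if "w \<in> V" for w using I_lin[OF zero zero that, of 0 0] by simp
  ultimately have zS: "(\<lambda>x. 0) \<in> S" unfolding S_def using zero by auto
  have linS: "(\<lambda>x. a * u x + b * v x) \<in> S" if "u \<in> S" "v \<in> S" for u v a b
  proof -
    obtain L L' where L: "L \<in> LL" "\<forall>w\<in>V. I u w = L w" and L': "L' \<in> LL" "\<forall>w\<in>V. I v w = L' w"
      and uv: "u \<in> V" "v \<in> V"
      using \<open>u \<in> S\<close> \<open>v \<in> S\<close> unfolding S_def by blast
    have "\<forall>w\<in>V. I (\<lambda>x. a * u x + b * v x) w = a * L w + b * L' w"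
      using I_lin uv L(2) L'(2) by simp
    then show ?thesis unfolding S_def
      by (intro CollectI conjI lin uv bexI[OF _ LL(3)[OF L(1) L'(1)]])
  qed
  have SV: "S \<subseteq> V" unfolding S_def by blast
  obtain z where z: "z \<in> V" "\<And>w. w \<in> S \<Longrightarrow> I z w = G w" "\<And>e. e > 0 \<Longrightarrow> \<exists>s\<in>S. nrm (\<lambda>x. s x - z x) < e"
    using riesz_on_subspace[OF SV zS linS G] by blast
  define y where "y = (\<lambda>x. g x - z x)"
  have yV: "y \<in> V" unfolding y_def by (rule diff[OF g(1) z(1)])
  have "I y y = 0"
  proof (rule sep[OF yV])
    fix L assume L: "L \<in> LL"
    obtain r where r: "r \<in> V" "\<forall>w\<in>V. I r w = L w" using riesz[OF LL(1)[OF L]] by blast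
    then have rS: "r \<in> S" unfolding S_def using L by blast
    have "L y = I r y" using r(2) yV by simp
    also have "\<dots> = I y r" by (rule I_sym[OF r(1) yV])
    also have "\<dots> = I g r - I z r" unfolding y_def by (rule I_diff[OF g(1) z(1) r(1)])
    also have "\<dots> = 0" using g(2)[OF r(1)] z(2)[OF rS] by simp
    finally show "L y = 0" .
  qed
  then have ny: "nrm y = 0" unfolding nrm_def by simp
  obtain s where s: "s \<in> S" "nrm (\<lambda>x. s x - z x) < e" using z(3)[OF e] by blast
  then obtain L where L: "L \<in> LL" "\<And>w. w \<in> V \<Longrightarrow> I s w = L w" and sV: "s \<in> V" unfolding S_def by blast
  have "\<bar>G w - L w\<bar> \<le> e * nrm w" if w: "w \<in> V" for w
  proof -
    have zs: "(\<lambda>x. z x - s x) \<in> V" by (rule diff[OF z(1) sV])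
    have "G w - L w = I y w + I (\<lambda>x. z x - s x) w"
      unfolding y_def I_diff[OF g(1) z(1) w] I_diff[OF z(1) sV w] using g(2)[OF w] L(2)[OF w] by simp
    moreover have "\<bar>I y w\<bar> \<le> 0" using cauchy_schwarz[OF yV w] ny by simp
    moreover have "\<bar>I (\<lambda>x. z x - s x) w\<bar> \<le> nrm (\<lambda>x. z x - s x) * nrm w" by (rule cauchy_schwarz[OF zs w])
    moreover have "nrm (\<lambda>x. z x - s x) * nrm w \<le> e * nrm w"
      using s(2) nrm_minus_commute[OF sV z(1)] w by (intro mult_right_mono) auto
    ultimately show ?thesis by linarith
  qed
  then show ?thesis using L(1) by blast
qed

end

section \<open>The space of square integrable functions\<close>

text \<open>The target is any normed space, so that real functions and their complex Fourier
  transforms share one norm.\<close>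

definition l2n :: "('a::euclidean_space \<Rightarrow> 'b::real_normed_vector) \<Rightarrow> real" where
  "l2n f = sqrt (LINT x|lborel. (norm (f x))\<^sup>2)"

lemma l2n_nonneg[simp]: "0 \<le> l2n f"
  unfolding l2n_def by simp

lemma l2n_sq: "(l2n f)\<^sup>2 = (LINT x|lborel. (norm (f x))\<^sup>2)"
  unfolding l2n_def by simp

lemma L2_measurable[measurable_dest]: "u \<in> L2 \<Longrightarrow> u \<in> borel_measurable borel"
  unfolding L2_def by simp

lemma L2_integrable: "u \<in> L2 \<Longrightarrow> integrable lborel (\<lambda>x. (norm (u x))\<^sup>2)"
  unfolding L2_def by simp

lemma L2_I: "u \<in> borel_measurable borel \<Longrightarrow> integrable lborel (\<lambda>x. (norm (u x))\<^sup>2) \<Longrightarrow> u \<in> L2"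
  unfolding L2_def by simp

lemma L2_zero: "(\<lambda>x. 0) \<in> L2"
  by (rule L2_I) auto

lemma L2_nn_integral:
  assumes "u \<in> L2"
  shows "(\<integral>\<^sup>+x. ennreal ((norm (u x))\<^sup>2) \<partial>lborel) = ennreal ((l2n u)\<^sup>2)"
  unfolding l2n_sq by (rule nn_integral_eq_integral) (auto simp: L2_integrable assms)

lemma L2_I_nn_integral:
  fixes u :: "'a::euclidean_space \<Rightarrow> 'b::{real_normed_vector, second_countable_topology}"
  assumes [measurable]: "u \<in> borel_measurable borel"
    and "(\<integral>\<^sup>+x. ennreal ((norm (u x))\<^sup>2) \<partial>lborel) < \<infinity>"
  shows "u \<in> L2"
  using assms by (intro L2_I integrableI_bounded) auto

lemma l2n_le_nn_integral:
  fixes u :: "'a::euclidean_space \<Rightarrow> 'b::{real_normed_vector, second_countable_topology}"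
  assumes [measurable]: "u \<in> borel_measurable borel"
    and "(\<integral>\<^sup>+x. ennreal ((norm (u x))\<^sup>2) \<partial>lborel) \<le> ennreal (c\<^sup>2)" "0 \<le> c"
  shows "u \<in> L2" "l2n u \<le> c"
proof -
  show u: "u \<in> L2"
    using assms(2) by (intro L2_I_nn_integral) (auto intro: le_less_trans)
  have "(l2n u)\<^sup>2 \<le> c\<^sup>2" using assms(2) unfolding L2_nn_integral[OF u] by simp
  then show "l2n u \<le> c" by (rule power2_le_imp_le[OF _ assms(3)])
qed

lemma L2_dominated:
  fixes u :: "'a::euclidean_space \<Rightarrow> 'b::{real_normed_vector, second_countable_topology}"
    and v :: "'a::euclidean_space \<Rightarrow> 'c::{real_normed_vector, second_countable_topology}"
  assumes [measurable]: "u \<in> borel_measurable borel" and v: "v \<in> L2"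
    and le: "AE x in lborel. norm (u x) \<le> C * norm (v x)"
  shows "u \<in> L2"
proof (rule L2_I)
  show "integrable lborel (\<lambda>x. (norm (u x))\<^sup>2)"
  proof (rule Bochner_Integration.integrable_bound)
    show "integrable lborel (\<lambda>x. C\<^sup>2 * (norm (v x))\<^sup>2)" using L2_integrable[OF v] by simp
    show "AE x in lborel. norm ((norm (u x))\<^sup>2) \<le> norm (C\<^sup>2 * (norm (v x))\<^sup>2)"
      using le
    proof eventually_elim
      case (elim x)
      then have "(norm (u x))\<^sup>2 \<le> (C * norm (v x))\<^sup>2" by (intro power_mono) auto
      then show ?case by (simp add: power_mult_distrib)
    qed
  qed auto
qed fact

lemma L2_cong_AE:
  fixes u v :: "'a::euclidean_space \<Rightarrow> 'b::{real_normed_vector, second_countable_topology}"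
  assumes "u \<in> borel_measurable borel" "v \<in> L2" "AE x in lborel. u x = v x"
  shows "u \<in> L2"
  by (rule L2_dominated[OF assms(1,2), where C=1]) (use assms(3) in auto)

lemma l2n_cong_AE:
  fixes u v :: "'a::euclidean_space \<Rightarrow> 'b::{real_normed_vector, second_countable_topology}"
  assumes [measurable]: "u \<in> borel_measurable borel" "v \<in> borel_measurable borel"
    and "AE x in lborel. u x = v x"
  shows "l2n u = l2n v"
  unfolding l2n_def using assms(3) by (intro arg_cong[where f=sqrt] integral_cong_AE) auto

lemma L2_norm: 
  fixes u :: "'a::euclidean_space \<Rightarrow> 'b::{real_normed_vector, second_countable_topology}"
  shows "u \<in> L2 \<Longrightarrow> (\<lambda>x. norm (u x)) \<in> L2"
  by (rule L2_dominated[where C=1 and v=u]) (auto dest: L2_measurable)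

lemma l2n_norm: "l2n (\<lambda>x. norm (u x)) = l2n u"
  unfolding l2n_def by simp

lemma L2_scaleR:
  fixes u :: "'a::euclidean_space \<Rightarrow> 'b::{real_normed_vector, second_countable_topology}"
  shows "u \<in> L2 \<Longrightarrow> (\<lambda>x. c *\<^sub>R u x) \<in> L2"
  by (rule L2_dominated[where C="\<bar>c\<bar>" and v=u]) (auto dest: L2_measurable)

lemma L2_cmult:
  fixes u :: "'a::euclidean_space \<Rightarrow> 'b::{real_normed_algebra, second_countable_topology}"
  shows "u \<in> L2 \<Longrightarrow> (\<lambda>x. c * u x) \<in> L2"
  by (rule L2_dominated[where C="norm c" and v=u]) (auto dest: L2_measurable intro: norm_mult_ineq)

lemma L2_add:
  fixes u v :: "'a::euclidean_space \<Rightarrow> 'b::{real_normed_vector, second_countable_topology}"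
  assumes "u \<in> L2" "v \<in> L2"
  shows "(\<lambda>x. u x + v x) \<in> L2"
proof (rule L2_I)
  note [measurable] = assms[THEN L2_measurable]
  show "integrable lborel (\<lambda>x. (norm (u x + v x))\<^sup>2)"
  proof (rule Bochner_Integration.integrable_bound)
    show "integrable lborel (\<lambda>x. 2 * (norm (u x))\<^sup>2 + 2 * (norm (v x))\<^sup>2)"
      using assms[THEN L2_integrable] by simp
    show "AE x in lborel. norm ((norm (u x + v x))\<^sup>2) \<le> norm (2 * (norm (u x))\<^sup>2 + 2 * (norm (v x))\<^sup>2)"
    proof (rule AE_I2)
      fix x
      have "(norm (u x + v x))\<^sup>2 \<le> (norm (u x) + norm (v x))\<^sup>2"
        by (intro power_mono norm_triangle_ineq) auto
      also have "\<dots> \<le> 2 * (norm (u x))\<^sup>2 + 2 * (norm (v x))\<^sup>2"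
        using sum_squares_bound[of "norm (u x)" "norm (v x)"] by (simp add: power2_sum)
      finally show "norm ((norm (u x + v x))\<^sup>2) \<le> norm (2 * (norm (u x))\<^sup>2 + 2 * (norm (v x))\<^sup>2)"
        by simp
    qed
  qed auto
qed (use assms in \<open>auto dest: L2_measurable\<close>)

lemma L2_diff:
  fixes u v :: "'a::euclidean_space \<Rightarrow> 'b::{real_normed_vector, second_countable_topology}"
  assumes "u \<in> L2" "v \<in> L2"
  shows "(\<lambda>x. u x - v x) \<in> L2"
  using L2_add[OF assms(1) L2_scaleR[OF assms(2), of "-1"]] by simp

lemma L2_mult_integrable:
  fixes u v :: "'a::euclidean_space \<Rightarrow> 'b::{real_normed_algebra, second_countable_topology, banach}"
  assumes "u \<in> L2" "v \<in> L2"
  shows "integrable lborel (\<lambda>x. u x * v x)"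
proof (rule Bochner_Integration.integrable_bound)
  note [measurable] = assms[THEN L2_measurable]
  show "integrable lborel (\<lambda>x. (norm (u x))\<^sup>2 + (norm (v x))\<^sup>2)"
    using assms[THEN L2_integrable] by simp
  show "AE x in lborel. norm (u x * v x) \<le> norm ((norm (u x))\<^sup>2 + (norm (v x))\<^sup>2)"
  proof (rule AE_I2)
    fix x
    have "norm (u x * v x) \<le> norm (u x) * norm (v x)" by (rule norm_mult_ineq)
    also have "\<dots> \<le> 2 * norm (u x) * norm (v x)" by simp
    also have "\<dots> \<le> (norm (u x))\<^sup>2 + (norm (v x))\<^sup>2" by (rule sum_squares_bound)
    finally show "norm (u x * v x) \<le> norm ((norm (u x))\<^sup>2 + (norm (v x))\<^sup>2)" by simp
  qed
  show "(\<lambda>x. u x * v x) \<in> borel_measurable lborel" by measurable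
qed

interpretation L2: semi_inner "L2 :: ('a::euclidean_space \<Rightarrow> real) set" "\<lambda>u v. LINT x|lborel. u x * v x"
  rewrites "semi_inner.nrm (\<lambda>u v::'a \<Rightarrow> real. LINT x|lborel. u x * v x) = l2n"
proof -
  show "semi_inner (L2 :: ('a \<Rightarrow> real) set) (\<lambda>u v. LINT x|lborel. u x * v x)"
  proof
    fix u v w :: "'a \<Rightarrow> real" and a b :: real
    assume uv: "u \<in> L2" "v \<in> L2"
    show "(\<lambda>x. a * u x + b * v x) \<in> L2" by (intro L2_add L2_cmult uv)
    show "(LINT x|lborel. u x * v x) = (LINT x|lborel. v x * u x)" by (simp add: mult.commute)
    assume w: "w \<in> L2"
    show "(LINT x|lborel. (a * u x + b * v x) * w x) =
       a * (LINT x|lborel. u x * w x) + b * (LINT x|lborel. v x * w x)"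
      using L2_mult_integrable[OF uv(1) w] L2_mult_integrable[OF uv(2) w] by (simp add: algebra_simps)
  qed (auto intro!: L2_zero)
  then interpret semi_inner "L2 :: ('a \<Rightarrow> real) set" "\<lambda>u v. LINT x|lborel. u x * v x" .
  show "semi_inner.nrm (\<lambda>u v::'a \<Rightarrow> real. LINT x|lborel. u x * v x) = l2n"
    by (rule ext) (simp add: nrm_def l2n_def power2_eq_square)
qed

lemma L2_norm_mult_integral_le:
  fixes u :: "'a::euclidean_space \<Rightarrow> 'b::{real_normed_vector, second_countable_topology}"
    and v :: "'a::euclidean_space \<Rightarrow> 'c::{real_normed_vector, second_countable_topology}"
  assumes "u \<in> L2" "v \<in> L2"
  shows "(LINT x|lborel. norm (u x) * norm (v x)) \<le> l2n u * l2n v"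
  using L2.cauchy_schwarz[OF L2_norm[OF assms(1)] L2_norm[OF assms(2)]] by (simp add: l2n_norm)

lemma l2n_mono:
  fixes u :: "'a::euclidean_space \<Rightarrow> 'b::{real_normed_vector, second_countable_topology}"
    and v :: "'a::euclidean_space \<Rightarrow> 'c::{real_normed_vector, second_countable_topology}"
  assumes "u \<in> L2" "v \<in> L2" "AE x in lborel. norm (u x) \<le> norm (v x)"
  shows "l2n u \<le> l2n v"
  unfolding l2n_def
proof (intro real_sqrt_le_mono integral_mono_AE L2_integrable assms)
  show "AE x in lborel. (norm (u x))\<^sup>2 \<le> (norm (v x))\<^sup>2"
    using assms(3) by eventually_elim (simp add: power_mono)
qed

text \<open>Reduced to the real case by passing to pointwise norms, since the inner product space is
  set up for real functions.\<close>

lemma l2n_triangle: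
  fixes u v :: "'a::euclidean_space \<Rightarrow> 'b::{real_normed_vector, second_countable_topology}"
  assumes "u \<in> L2" "v \<in> L2"
  shows "l2n (\<lambda>x. u x + v x) \<le> l2n u + l2n v"
proof -
  have "l2n (\<lambda>x. u x + v x) \<le> l2n (\<lambda>x. norm (u x) + norm (v x))"
    using assms by (intro l2n_mono L2_add L2_norm) (auto intro: norm_triangle_ineq order_trans)
  also have "\<dots> \<le> l2n (\<lambda>x. norm (u x)) + l2n (\<lambda>x. norm (v x))"
    by (rule L2.nrm_triangle[OF L2_norm[OF assms(1)] L2_norm[OF assms(2)]])
  finally show ?thesis by (simp add: l2n_norm)
qed

lemma l2n_triangle_diff:
  fixes u v w :: "'a::euclidean_space \<Rightarrow> 'b::{real_normed_vector, second_countable_topology}"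
  assumes "u \<in> L2" "v \<in> L2" "w \<in> L2"
  shows "l2n (\<lambda>x. u x - w x) \<le> l2n (\<lambda>x. u x - v x) + l2n (\<lambda>x. v x - w x)"
  using l2n_triangle[OF L2_diff[OF assms(1,2)] L2_diff[OF assms(2,3)]] by simp

lemma l2n_scaleR: "l2n (\<lambda>x. c *\<^sub>R u x) = \<bar>c\<bar> * l2n u"
  unfolding l2n_def by (simp add: power_mult_distrib real_sqrt_mult)

lemma l2n_minus_commute: "l2n (\<lambda>x. u x - v x) = l2n (\<lambda>x. v x - u x)"
  unfolding l2n_def by (simp add: norm_minus_commute)

lemma l2n_diff_le:
  fixes u v :: "'a::euclidean_space \<Rightarrow> 'b::{real_normed_vector, second_countable_topology}"
  assumes "u \<in> L2" "v \<in> L2"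
  shows "\<bar>l2n u - l2n v\<bar> \<le> l2n (\<lambda>x. u x - v x)"
  using l2n_triangle_diff[OF assms L2_zero] l2n_triangle_diff[OF assms(2,1) L2_zero]
    l2n_minus_commute[of u v] by simp

lemma l2n_eq_0:
  assumes "u \<in> L2" "l2n u = 0"
  shows "AE x in lborel. u x = 0"
  using assms integral_nonneg_eq_0_iff_AE[OF L2_integrable[OF assms(1)]] unfolding l2n_def by simp

lemma suminf_ge_term: "f k \<le> (\<Sum>k. f k)" for f :: "nat \<Rightarrow> ennreal"
  using sum_le_suminf[of f "{k}"] by simp

lemma L2_subseq_AE:
  fixes f :: "nat \<Rightarrow> 'a::euclidean_space \<Rightarrow> 'b::{banach, second_countable_topology}"
  assumes f: "\<And>n. f n \<in> L2" "l \<in> L2" and lim: "(\<lambda>n. l2n (\<lambda>x. f n x - l x)) \<longlonglongrightarrow> 0"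
  shows "\<exists>r. strict_mono r \<and> (AE x in lborel. (\<lambda>n. f (r n) x) \<longlonglongrightarrow> l x)"
proof -
  have "\<exists>r. strict_mono r \<and> (AE x in lborel. (\<lambda>n. (norm (f (r n) x - l x))\<^sup>2) \<longlonglongrightarrow> 0)"
  proof (rule tendsto_L1_AE_subseq)
    show "integrable lborel (\<lambda>x. (norm (f n x - l x))\<^sup>2)" for n
      by (intro L2_integrable L2_diff f)
    show "(\<lambda>n. LINT x|lborel. norm ((norm (f n x - l x))\<^sup>2)) \<longlonglongrightarrow> 0"
      using tendsto_power[OF lim, of 2] by (simp add: l2n_sq)
  qed
  then obtain r where r: "strict_mono r" "AE x in lborel. (\<lambda>n. (norm (f (r n) x - l x))\<^sup>2) \<longlonglongrightarrow> 0"
    by blast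
  from r(2) have "AE x in lborel. (\<lambda>n. f (r n) x) \<longlonglongrightarrow> l x"
  proof eventually_elim
    case (elim x)
    have "(\<lambda>n. sqrt ((norm (f (r n) x - l x))\<^sup>2)) \<longlonglongrightarrow> sqrt 0"
      by (intro tendsto_real_sqrt elim)
    then show ?case by (simp add: tendsto_norm_zero_iff LIM_zero_iff)
  qed
  with r(1) show ?thesis by blast
qed

text \<open>The usual way below to place a limit in \<open>L2\<close>: an almost everywhere limit
  inherits a norm bound. The bound is assumed from some index on, as it comes out for differences
  with a fixed member of a Cauchy sequence.\<close>

lemma L2_Fatou:
  fixes f :: "nat \<Rightarrow> 'a::euclidean_space \<Rightarrow> 'b::{banach, second_countable_topology}"
  assumes f: "\<And>n. f n \<in> L2" and [measurable]: "g \<in> borel_measurable borel"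
    and lim: "AE x in lborel. (\<lambda>n. f n x) \<longlonglongrightarrow> g x"
    and le: "\<And>n. n \<ge> N \<Longrightarrow> l2n (f n) \<le> c"
  shows "g \<in> L2" "l2n g \<le> c"
proof -
  have c: "0 \<le> c" using le[of N] l2n_nonneg[of "f N"] by linarith
  note [measurable] = f[THEN L2_measurable]
  have "(\<integral>\<^sup>+x. ennreal ((norm (g x))\<^sup>2) \<partial>lborel) = (\<integral>\<^sup>+x. liminf (\<lambda>n. ennreal ((norm (f n x))\<^sup>2)) \<partial>lborel)"
  proof (rule nn_integral_cong_AE, use lim in eventually_elim)
    case (elim x)
    have "(\<lambda>n. ennreal ((norm (f n x))\<^sup>2)) \<longlonglongrightarrow> ennreal ((norm (g x))\<^sup>2)"
      by (intro tendsto_intros elim)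
    from lim_imp_Liminf[OF _ this] show ?case by simp
  qed
  also have "\<dots> \<le> liminf (\<lambda>n. \<integral>\<^sup>+x. ennreal ((norm (f n x))\<^sup>2) \<partial>lborel)"
    by (rule nn_integral_liminf) simp
  also have "\<dots> \<le> liminf (\<lambda>n::nat. ennreal (c\<^sup>2))"
  proof (rule Liminf_mono)
    show "\<forall>\<^sub>F n in sequentially. (\<integral>\<^sup>+x. ennreal ((norm (f n x))\<^sup>2) \<partial>lborel) \<le> ennreal (c\<^sup>2)"
      unfolding eventually_sequentially using le
      by (intro exI[of _ N]) (auto simp: L2_nn_integral[OF f] intro!: power_mono ennreal_leI)
  qed
  also have "\<dots> = ennreal (c\<^sup>2)" by (simp add: Liminf_const)
  finally have "(\<integral>\<^sup>+x. ennreal ((norm (g x))\<^sup>2) \<partial>lborel) \<le> ennreal (c\<^sup>2)" .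
  from l2n_le_nn_integral[OF _ this c] show "g \<in> L2" "l2n g \<le> c" by auto
qed

text \<open>Riesz-Fischer by a fast subsequence: it converges almost everywhere, and Fatou carries
  the Cauchy estimates over to the distance between the whole sequence and the limit.\<close>

lemma L2_complete:
  fixes f :: "nat \<Rightarrow> 'a::euclidean_space \<Rightarrow> 'b::{banach, second_countable_topology}"
  assumes f: "\<And>n. f n \<in> L2"
    and cauchy: "\<And>e. e > 0 \<Longrightarrow> \<exists>M. \<forall>m\<ge>M. \<forall>n\<ge>M. l2n (\<lambda>x. f m x - f n x) < e"
  shows "\<exists>l\<in>L2. (\<lambda>n. l2n (\<lambda>x. f n x - l x)) \<longlonglongrightarrow> 0"
proof -
  note [measurable] = f[THEN L2_measurable]
  have "\<exists>r. \<forall>k. (\<forall>m\<ge>r k. \<forall>n\<ge>r k. l2n (\<lambda>x. f m x - f n x) < (1/4)^k) \<and> r k < r (Suc k)"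
  proof (rule dependent_nat_choice)
    show "\<exists>x. \<forall>m\<ge>x. \<forall>n\<ge>x. l2n (\<lambda>y. f m y - f n y) < (1/4)^0" using cauchy[of 1] by simp
    fix x k
    obtain M where "\<forall>m\<ge>M. \<forall>n\<ge>M. l2n (\<lambda>y. f m y - f n y) < (1/4)^Suc k" using cauchy[of "(1/4)^Suc k"] by auto
    then show "\<exists>y. (\<forall>m\<ge>y. \<forall>n\<ge>y. l2n (\<lambda>x. f m x - f n x) < (1/4)^Suc k) \<and> x < y"
      by (intro exI[of _ "max M (Suc x)"]) auto
  qed
  then obtain r where r: "\<And>k m n. m \<ge> r k \<Longrightarrow> n \<ge> r k \<Longrightarrow> l2n (\<lambda>x. f m x - f n x) < (1/4)^k"
    and rS: "\<And>k. r k < r (Suc k)" by blast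
  have mono: "strict_mono r" using rS by (simp add: strict_mono_Suc_iff)
  define d where "d k x = norm (f (r (Suc k)) x - f (r k) x)" for k x
  have [measurable]: "d k \<in> borel_measurable borel" for k unfolding d_def by measurable
  \<comment> \<open>The increments have norm below 4 to the power -k, so their squares can carry the
    weight \<open>4^k\<close> and still be summable. Finiteness of the weighted sum at a point then
    bounds the increments there by a geometric sequence of ratio 1/2.\<close>
  have int_d: "(\<integral>\<^sup>+x. ennreal (4^k * (d k x)\<^sup>2) \<partial>lborel) \<le> ennreal ((1/4)^k)" for k
  proof -
    have dL: "(\<lambda>x. f (r (Suc k)) x - f (r k) x) \<in> L2" by (intro L2_diff f)
    have "(\<integral>\<^sup>+x. ennreal (4^k * (d k x)\<^sup>2) \<partial>lborel) = (\<integral>\<^sup>+x. ennreal (4^k) * ennreal ((d k x)\<^sup>2) \<partial>lborel)"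
      by (simp add: ennreal_mult)
    also have "\<dots> = ennreal (4^k) * (\<integral>\<^sup>+x. ennreal ((d k x)\<^sup>2) \<partial>lborel)"
      by (rule nn_integral_cmult) simp
    also have "\<dots> = ennreal (4^k * (l2n (\<lambda>x. f (r (Suc k)) x - f (r k) x))\<^sup>2)"
      unfolding d_def L2_nn_integral[OF dL] by (simp add: ennreal_mult)
    also have "\<dots> \<le> ennreal (4^k * ((1/4)^k)\<^sup>2)"
      using r[of k "r (Suc k)" "r k"] rS[of k] by (intro ennreal_leI mult_left_mono power_mono) auto
    also have "4^k * ((1/4)^k)\<^sup>2 = (1/4::real)^k"
      by (simp add: power2_eq_square power_one_over)
    finally show ?thesis .
  qed
  have "(\<integral>\<^sup>+x. (\<Sum>k. ennreal (4^k * (d k x)\<^sup>2)) \<partial>lborel) = (\<Sum>k. \<integral>\<^sup>+x. ennreal (4^k * (d k x)\<^sup>2) \<partial>lborel)"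
    by (rule nn_integral_suminf) simp
  also have "\<dots> \<le> (\<Sum>k. ennreal ((1/4)^k))" by (intro suminf_le int_d) auto
  also have "\<dots> = ennreal (\<Sum>k. (1/4)^k)" by (rule suminf_ennreal2) (auto intro: summable_geometric)
  also have "\<dots> < \<infinity>" by simp
  finally have "AE x in lborel. (\<Sum>k. ennreal (4^k * (d k x)\<^sup>2)) \<noteq> \<infinity>"
    by (intro nn_integral_PInf_AE) auto
  then have conv: "AE x in lborel. convergent (\<lambda>k. f (r k) x)"
  proof eventually_elim
    case (elim x)
    then obtain C where C: "(\<Sum>k. ennreal (4^k * (d k x)\<^sup>2)) = ennreal C" "0 \<le> C"
      by (metis ennreal_cases infinity_ennreal_def)
    have dk: "d k x \<le> sqrt C * (1/2)^k" for k
    proof (rule power2_le_imp_le)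
      have "ennreal (4^k * (d k x)\<^sup>2) \<le> (\<Sum>k. ennreal (4^k * (d k x)\<^sup>2))"
        by (rule suminf_ge_term)
      then have "4^k * (d k x)\<^sup>2 \<le> C" unfolding C(1) using C(2) by (subst (asm) ennreal_le_iff)
      then have "(d k x)\<^sup>2 \<le> C * (1/4)^k" by (simp add: power_one_over pos_le_divide_eq mult.commute)
      also have "((1/2::real)^k)\<^sup>2 = (1/4)^k" by (simp add: power2_eq_square flip: power_mult_distrib)
      then have "C * (1/4)^k = (sqrt C * (1/2)^k)\<^sup>2"
        using C(2) by (simp add: power_mult_distrib)
      finally show "(d k x)\<^sup>2 \<le> (sqrt C * (1/2)^k)\<^sup>2" .
    qed (use C in simp)
    have "summable (\<lambda>k. f (r (Suc k)) x - f (r k) x)"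
    proof (rule summable_comparison_test')
      show "summable (\<lambda>k. sqrt C * (1/2)^k)" by (intro summable_mult summable_geometric) simp
      show "norm (f (r (Suc k)) x - f (r k) x) \<le> sqrt C * (1/2)^k" if "k \<ge> 0" for k
        using dk[of k] unfolding d_def .
    qed
    then have "convergent (\<lambda>n. \<Sum>k<n. f (r (Suc k)) x - f (r k) x)"
      by (simp add: summable_iff_convergent)
    then have "convergent (\<lambda>n. (f (r n) x - f (r 0) x) + f (r 0) x)"
      unfolding sum_lessThan_telescope[of "\<lambda>k. f (r k) x"] by (intro convergent_add convergent_const)
    then show ?case by simp
  qed
  define l where "l x = lim (\<lambda>k. f (r k) x)" for x
  have [measurable]: "l \<in> borel_measurable borel" unfolding l_def by measurable
  have AEl: "AE x in lborel. (\<lambda>k. f (r k) x) \<longlonglongrightarrow> l x"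
    using conv unfolding l_def by eventually_elim (simp add: convergent_LIMSEQ_iff)
  have key: "(\<lambda>x. f n x - l x) \<in> L2 \<and> l2n (\<lambda>x. f n x - l x) \<le> (1/4)^k" if "n \<ge> r k" for n k
  proof -
    have "AE x in lborel. (\<lambda>m. f n x - f (r m) x) \<longlonglongrightarrow> f n x - l x"
      using AEl by eventually_elim (intro tendsto_intros)
    moreover have "l2n (\<lambda>x. f n x - f (r m) x) \<le> (1/4)^k" if "m \<ge> k" for m
      using r[of k n "r m"] \<open>n \<ge> r k\<close> strict_mono_leD[OF mono that] by simp
    ultimately show ?thesis
      using L2_Fatou[of "\<lambda>m x. f n x - f (r m) x" "\<lambda>x. f n x - l x" k "(1/4)^k"] L2_diff f by auto
  qed
  have "l \<in> L2" using L2_diff[OF f[of "r 0"] key[of 0 "r 0", THEN conjunct1]] by simp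
  moreover have "(\<lambda>n. l2n (\<lambda>x. f n x - l x)) \<longlonglongrightarrow> 0"
  proof (rule LIMSEQ_I)
    fix e :: real assume "e > 0"
    obtain k where k: "(1/4)^k < e" using real_arch_pow_inv[OF \<open>e > 0\<close>, of "1/4"] by auto
    show "\<exists>no. \<forall>n\<ge>no. norm (l2n (\<lambda>x. f n x - l x) - 0) < e"
      using key[of k] k by (intro exI[of _ "r k"]) (auto intro: le_less_trans)
  qed
  ultimately show ?thesis by blast
qed

interpretation L2: semi_hilbert "L2 :: ('a::euclidean_space \<Rightarrow> real) set" "\<lambda>u v. LINT x|lborel. u x * v x"
  rewrites "semi_inner.nrm (\<lambda>u v::'a \<Rightarrow> real. LINT x|lborel. u x * v x) = l2n"
proof -
  have n: "semi_inner.nrm (\<lambda>u v::'a \<Rightarrow> real. LINT x|lborel. u x * v x) = l2n"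
    by (rule ext) (simp add: semi_inner.nrm_def[OF L2.semi_inner_axioms] l2n_def power2_eq_square)
  show "semi_inner.nrm (\<lambda>u v::'a \<Rightarrow> real. LINT x|lborel. u x * v x) = l2n" by (rule n)
  show "semi_hilbert (L2 :: ('a \<Rightarrow> real) set) (\<lambda>u v. LINT x|lborel. u x * v x)"
    by unfold_locales (unfold n, rule L2_complete)
qed

lemma L2_inner_tendsto:
  fixes f h :: "nat \<Rightarrow> 'a::euclidean_space \<Rightarrow> real"
  assumes f: "\<And>n. f n \<in> L2" "l \<in> L2" "(\<lambda>n. l2n (\<lambda>x. f n x - l x)) \<longlonglongrightarrow> 0"
    and h: "\<And>n. h n \<in> L2" "k \<in> L2" "(\<lambda>n. l2n (\<lambda>x. h n x - k x)) \<longlonglongrightarrow> 0"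
  shows "(\<lambda>n. LINT x|lborel. f n x * h n x) \<longlonglongrightarrow> (LINT x|lborel. l x * k x)"
proof (rule LIM_zero_cancel, rule tendsto_rabs_zero_cancel, rule tendsto_sandwich[of "\<lambda>n. 0"])
  let ?a = "\<lambda>n. l2n (\<lambda>x. f n x - l x)" and ?b = "\<lambda>n. l2n (\<lambda>x. h n x - k x)"
  have "\<bar>(LINT x|lborel. f n x * h n x) - (LINT x|lborel. l x * k x)\<bar>
    \<le> ?a n * ?b n + ?a n * l2n k + l2n l * ?b n" for n
  proof -
    have e: "f n x * h n x - l x * k x = (f n x - l x) * (h n x - k x) + (f n x - l x) * k x + l x * (h n x - k x)" for x
      by (simp add: algebra_simps)
    have d: "(\<lambda>x. f n x - l x) \<in> L2" "(\<lambda>x. h n x - k x) \<in> L2" by (intro L2_diff f h)+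
    have "(LINT x|lborel. f n x * h n x) - (LINT x|lborel. l x * k x) = (LINT x|lborel. f n x * h n x - l x * k x)"
      by (rule Bochner_Integration.integral_diff[symmetric]) (intro L2_mult_integrable f h)+
    also have "\<dots> = (LINT x|lborel. (f n x - l x) * (h n x - k x) + (f n x - l x) * k x + l x * (h n x - k x))"
      by (simp only: e)
    also have "\<dots> = (LINT x|lborel. (f n x - l x) * (h n x - k x)) + (LINT x|lborel. (f n x - l x) * k x) + (LINT x|lborel. l x * (h n x - k x))"
      using L2_mult_integrable[OF d] L2_mult_integrable[OF d(1) h(2)] L2_mult_integrable[OF f(2) d(2)] by simp
    finally have "(LINT x|lborel. f n x * h n x) - (LINT x|lborel. l x * k x) = (LINT x|lborel. (f n x - l x) * (h n x - k x)) + (LINT x|lborel. (f n x - l x) * k x) + (LINT x|lborel. l x * (h n x - k x))" .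
    then show ?thesis
      using L2.cauchy_schwarz[OF d] L2.cauchy_schwarz[OF d(1) h(2)] L2.cauchy_schwarz[OF f(2) d(2)] by linarith
  qed
  then show "\<forall>\<^sub>F n in sequentially. \<bar>(LINT x|lborel. f n x * h n x) - (LINT x|lborel. l x * k x)\<bar>
    \<le> ?a n * ?b n + ?a n * l2n k + l2n l * ?b n" by simp
  have "(\<lambda>n. ?a n * ?b n + ?a n * l2n k + l2n l * ?b n) \<longlonglongrightarrow> 0 * 0 + 0 * l2n k + l2n l * 0"
    by (intro tendsto_intros f h)
  then show "(\<lambda>n. ?a n * ?b n + ?a n * l2n k + l2n l * ?b n) \<longlonglongrightarrow> 0" by simp
qed auto

section \<open>Test functions\<close>

lemma Ck_imp_continuous: "Ck k f \<Longrightarrow> continuous_on UNIV f"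
proof (cases k)
  case (Suc j)
  assume "Ck k f"
  then have "\<And>x. f differentiable (at x)" using Suc by simp
  then show ?thesis
    by (intro differentiable_imp_continuous_on) (simp add: differentiable_on_def)
qed simp

lemma Ck_Suc_imp: "Ck (Suc k) f \<Longrightarrow> Ck k f"
proof (induction k arbitrary: f)
  case 0
  then show ?case using Ck_imp_continuous[of "Suc 0" f] by simp
next
  case (Suc k)
  then show ?case by (metis Ck.simps(2))
qed

lemma Ck_const: "Ck k (\<lambda>x. c)"
  by (induction k arbitrary: c) auto

lemma Ck_add: "Ck k f \<Longrightarrow> Ck k g \<Longrightarrow> Ck k (\<lambda>x. f x + g x)"
proof (induction k arbitrary: f g)
  case 0
  then show ?case by (auto intro: continuous_on_add)
next
  case (Suc k)
  have "frechet_derivative (\<lambda>x. f x + g x) (at x) v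
      = frechet_derivative f (at x) v + frechet_derivative g (at x) v" for x v
  proof -
    have "((\<lambda>x. f x + g x) has_derivative
        (\<lambda>v. frechet_derivative f (at x) v + frechet_derivative g (at x) v)) (at x)"
      using Suc.prems by (intro derivative_intros) (auto simp flip: frechet_derivative_works)
    from frechet_derivative_at[OF this, symmetric] show ?thesis by simp
  qed
  then show ?case using Suc by (auto intro: differentiable_add)
qed

lemma Ck_mult: "Ck k f \<Longrightarrow> Ck k g \<Longrightarrow> Ck k (\<lambda>x. f x * g x)"
proof (induction k arbitrary: f g)
  case 0
  then show ?case by (auto intro: continuous_on_mult)
next
  case (Suc k)
  have "frechet_derivative (\<lambda>x. f x * g x) (at x) v
      = f x * frechet_derivative g (at x) v + frechet_derivative f (at x) v * g x" for x v
  proof -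
    have "((\<lambda>x. f x * g x) has_derivative
        (\<lambda>v. f x * frechet_derivative g (at x) v + frechet_derivative f (at x) v * g x)) (at x)"
      using Suc.prems by (intro has_derivative_mult) (auto simp flip: frechet_derivative_works)
    from frechet_derivative_at[OF this, symmetric] show ?thesis by simp
  qed
  moreover have "(\<lambda>x. f x * g x) differentiable (at x)" for x
    using Suc.prems by (intro differentiable_mult) auto
  moreover have "Ck k (\<lambda>x. f x * frechet_derivative g (at x) v + frechet_derivative f (at x) v * g x)" for v
    using Suc.prems by (intro Ck_add Suc.IH Ck_Suc_imp[OF Suc.prems(1)] Ck_Suc_imp[OF Suc.prems(2)]) auto
  ultimately show ?case by simp
qed

lemma Ck_prod: "finite A \<Longrightarrow> (\<And>i. i \<in> A \<Longrightarrow> Ck k (f i)) \<Longrightarrow> Ck k (\<lambda>x. \<Prod>i\<in>A. f i x)"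
  by (induction A rule: finite_induct) (auto intro: Ck_const Ck_mult)

section \<open>Smooth cutoff functions built from exp (- 1 / t)\<close>

text \<open>Polynomials in 1 / t times exp (- 1 / t) are closed under differentiation, so one family
  covers the basic flat function together with all its derivatives.\<close>

definition flat_fun :: "real poly \<Rightarrow> real \<Rightarrow> real" where
  "flat_fun p t = (if t > 0 then poly p (1 / t) * exp (- (1 / t)) else 0)"

lemma poly_times_exp_tendsto_0: "((\<lambda>s. poly p s * exp (- s)) \<longlongrightarrow> (0::real)) at_top"
proof -
  have "((\<lambda>s. \<Sum>i\<le>degree p. coeff p i * (s ^ i / exp s)) \<longlongrightarrow> (\<Sum>i\<le>degree p. coeff p i * 0)) at_top"
    by (intro tendsto_intros tendsto_power_div_exp_0)
  then show ?thesis
    by (simp add: poly_altdef sum_distrib_right exp_minus divide_inverse mult.assoc)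
qed

lemma flat_fun_tendsto_0: "(flat_fun p \<longlongrightarrow> 0) (at 0)"
proof (rule filterlim_split_at_real)
  show "(flat_fun p \<longlongrightarrow> 0) (at_left 0)"
    by (rule tendsto_eventually) (auto simp: flat_fun_def eventually_at_left_field intro: exI[of _ "-1"])
  have "((\<lambda>t. poly p (inverse t) * exp (- inverse t)) \<longlongrightarrow> 0) (at_right 0)"
    by (rule filterlim_compose[OF poly_times_exp_tendsto_0 filterlim_inverse_at_top_right])
  moreover have "\<forall>\<^sub>F t in at_right 0. poly p (inverse t) * exp (- inverse t) = flat_fun p t"
    using eventually_at_right_less[of "0::real"]
    by eventually_elim (simp add: flat_fun_def inverse_eq_divide)
  ultimately show "(flat_fun p \<longlongrightarrow> 0) (at_right 0)"
    by (rule Lim_transform_eventually)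
qed

text \<open>With s = 1 / t one has ds/dt = - s^2, so p(s) exp (- s) has derivative s^2 (p - p')(s)
  exp (- s); the factor s^2 is the polynomial \<open>[:0, 0, 1:]\<close>.\<close>

lemma flat_fun_deriv:
  "(flat_fun p has_real_derivative flat_fun ([:0, 0, 1:] * (p - pderiv p)) t) (at t)"
proof -
  consider "t > 0" | "t < 0" | "t = 0" by linarith
  then show ?thesis
  proof cases
    case 1
    have "((\<lambda>t. poly p (1 / t) * exp (- (1 / t))) has_real_derivative
        poly ([:0, 0, 1:] * (p - pderiv p)) (1 / t) * exp (- (1 / t))) (at t)"
      using 1 by (auto intro!: derivative_eq_intros DERIV_chain2[OF poly_DERIV]
          simp: field_simps power2_eq_square)
    moreover have "\<forall>\<^sub>F x in nhds t. poly p (1 / x) * exp (- (1 / x)) = flat_fun p x"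
      using eventually_nhds_in_open[of "{0<..}" t] 1
      by (auto elim!: eventually_mono simp: flat_fun_def)
    ultimately show ?thesis
      using 1 DERIV_cong_ev[OF refl _ refl] by (fastforce simp: flat_fun_def)
  next
    case 2
    have "((\<lambda>t. 0) has_real_derivative 0) (at t)" by simp
    moreover have "\<forall>\<^sub>F x in nhds t. 0 = flat_fun p x"
      using eventually_nhds_in_open[of "{..<0}" t] 2
      by (auto elim!: eventually_mono simp: flat_fun_def)
    ultimately show ?thesis
      using 2 DERIV_cong_ev[OF refl _ refl] by (fastforce simp: flat_fun_def)
  next
    case 3
    \<comment> \<open>Dividing by h multiplies the polynomial by its variable 1 / h, so the
      difference quotient at 0 is again a flat function and tends to 0.\<close>
    have e: "(flat_fun p (0 + h) - flat_fun p 0) / h = flat_fun ([:0, 1:] * p) h" for h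
      by (simp add: flat_fun_def)
    have "((\<lambda>h. (flat_fun p (0 + h) - flat_fun p 0) / h) \<longlongrightarrow> 0) (at 0)"
      unfolding e by (rule flat_fun_tendsto_0)
    moreover have "flat_fun ([:0, 0, 1:] * (p - pderiv p)) 0 = 0" unfolding flat_fun_def by simp
    ultimately show ?thesis unfolding 3 DERIV_def by simp
  qed
qed

text \<open>The induction runs over all polynomials at once, because every directional derivative is
  a function of the same form times a constant.\<close>

lemma Ck_flat_fun: "Ck k (\<lambda>x::'a::euclidean_space. flat_fun p (c * (x \<bullet> b) + d))"
proof (induction k arbitrary: p)
  case (Suc k p)
  have der: "((\<lambda>x::'a. flat_fun p (c * (x \<bullet> b) + d)) has_derivative
      (\<lambda>v. flat_fun ([:0, 0, 1:] * (p - pderiv p)) (c * (x \<bullet> b) + d) * (c * (v \<bullet> b)))) (at x)" for x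
  proof -
    have "(flat_fun p has_derivative (\<lambda>h. flat_fun ([:0, 0, 1:] * (p - pderiv p)) (c * (x \<bullet> b) + d) * h))
        (at (c * (x \<bullet> b) + d))"
      using flat_fun_deriv unfolding has_field_derivative_def .
    then show ?thesis
      by (rule has_derivative_compose[rotated]) (auto intro!: derivative_eq_intros)
  qed
  then have "frechet_derivative (\<lambda>x::'a. flat_fun p (c * (x \<bullet> b) + d)) (at x) =
      (\<lambda>v. flat_fun ([:0, 0, 1:] * (p - pderiv p)) (c * (x \<bullet> b) + d) * (c * (v \<bullet> b)))" for x
    by (metis frechet_derivative_at)
  moreover have "(\<lambda>x::'a. flat_fun p (c * (x \<bullet> b) + d)) differentiable (at x)" for x
    using der differentiable_def by blast
  ultimately show ?case using Suc by (auto intro!: Ck_mult Ck_const)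
next
  case (0 p)
  have "isCont (flat_fun p) t" for t using flat_fun_deriv by (rule DERIV_isCont)
  then have "continuous_on UNIV (flat_fun p)" by (simp add: continuous_on_eq_continuous_at)
  then have "continuous_on UNIV (\<lambda>x::'a. flat_fun p (c * (x \<bullet> b) + d))"
    by (rule continuous_on_compose2) (auto intro!: continuous_intros)
  then show ?case by simp
qed

text \<open>
  Vanishes outside a compact subset of \<open>box a b\<close> (shrunk by \<open>1 / k\<close>) and
  increases to its indicator function as \<open>k\<close> tends to infinity.
\<close>

definition box_bump :: "'a::euclidean_space \<Rightarrow> 'a \<Rightarrow> real \<Rightarrow> 'a \<Rightarrow> real" where
  "box_bump a b k x = (\<Prod>i\<in>Basis. flat_fun 1 (k * (x \<bullet> i) + (- k * (a \<bullet> i) - 1)) *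
     flat_fun 1 ((- k) * (x \<bullet> i) + (k * (b \<bullet> i) - 1)))"

lemma flat_fun_1: "flat_fun 1 t = (if t > 0 then exp (- (1 / t)) else 0)"
  by (simp add: flat_fun_def)

lemma flat_fun_1_bounds: "0 \<le> flat_fun 1 t" "flat_fun 1 t \<le> 1"
  by (auto simp: flat_fun_1)

lemma box_bump_bounds: "0 \<le> box_bump a b k x" "box_bump a b k x \<le> 1"
  unfolding box_bump_def
  by (auto intro!: prod_nonneg prod_le_1 mult_nonneg_nonneg mult_le_one simp: flat_fun_1_bounds)

lemma smooth_box_bump: "smooth (box_bump a b k)"
  unfolding smooth_def box_bump_def by (intro allI Ck_prod Ck_mult Ck_flat_fun) auto

lemma box_bump_nonzero:
  assumes "k > 0" "box_bump a b k x \<noteq> 0" "i \<in> Basis"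
  shows "a \<bullet> i + 1 / k < x \<bullet> i" "x \<bullet> i < b \<bullet> i - 1 / k"
proof -
  have "flat_fun 1 (k * (x \<bullet> i) + (- k * (a \<bullet> i) - 1)) \<noteq> 0"
      "flat_fun 1 ((- k) * (x \<bullet> i) + (k * (b \<bullet> i) - 1)) \<noteq> 0"
    using assms(2,3) unfolding box_bump_def by auto
  then have "k * (x \<bullet> i) + (- k * (a \<bullet> i) - 1) > 0" "(- k) * (x \<bullet> i) + (k * (b \<bullet> i) - 1) > 0"
    by (auto simp: flat_fun_1 split: if_splits)
  then show "a \<bullet> i + 1 / k < x \<bullet> i" "x \<bullet> i < b \<bullet> i - 1 / k"
    using assms(1) by (auto simp: field_simps)
qed

lemma box_bump_zero_outside: "k > 0 \<Longrightarrow> x \<notin> box a b \<Longrightarrow> box_bump a b k x = 0"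
proof (rule ccontr)
  assume k: "k > 0" "x \<notin> box a b" "box_bump a b k x \<noteq> 0"
  then have "\<forall>i\<in>Basis. a \<bullet> i < x \<bullet> i \<and> x \<bullet> i < b \<bullet> i"
    using box_bump_nonzero[OF k(1,3)] by (smt (verit, best) divide_pos_pos)
  then show False using k(2) by (simp add: mem_box)
qed

lemma box_bump_test_function:
  assumes "k > 0" "box a b \<subseteq> W"
  shows "box_bump a b k \<in> test_functions W"
proof -
  let ?a = "a + (1 / k) *\<^sub>R One" and ?b = "b - (1 / k) *\<^sub>R One"
  have "{x. box_bump a b k x \<noteq> 0} \<subseteq> cbox ?a ?b"
  proof
    fix x assume "x \<in> {x. box_bump a b k x \<noteq> 0}"
    then have "box_bump a b k x \<noteq> 0" by simp
    from box_bump_nonzero[OF assms(1) this] show "x \<in> cbox ?a ?b"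
      by (auto simp: mem_box inner_add_left inner_diff_left less_imp_le)
  qed
  then have c: "closure {x. box_bump a b k x \<noteq> 0} \<subseteq> cbox ?a ?b"
    by (rule closure_minimal) (rule closed_cbox)
  then have "compact (closure {x. box_bump a b k x \<noteq> 0})"
    by (meson bounded_cbox bounded_subset closed_closure compact_eq_bounded_closed)
  moreover have "cbox ?a ?b \<subseteq> box a b"
  proof
    fix x assume x: "x \<in> cbox ?a ?b"
    have p: "0 < 1 / k" using assms(1) by simp
    show "x \<in> box a b" unfolding mem_box
    proof
      fix i :: 'a assume i: "i \<in> Basis"
      then have "a \<bullet> i + 1 / k \<le> x \<bullet> i" "x \<bullet> i \<le> b \<bullet> i - 1 / k"
        using x by (auto simp: mem_box inner_add_left inner_diff_left)
      then show "a \<bullet> i < x \<bullet> i \<and> x \<bullet> i < b \<bullet> i" using p by linarith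
    qed
  qed
  ultimately show ?thesis
    unfolding test_functions_def using smooth_box_bump c assms(2) by blast
qed

lemma box_bump_tendsto:
  assumes "x \<in> box a b"
  shows "(\<lambda>k. box_bump a b (real (Suc k)) x) \<longlonglongrightarrow> 1"
proof -
  have l: "(\<lambda>k. flat_fun 1 (real (Suc k) * y - 1)) \<longlonglongrightarrow> 1" if "y > 0" for y
  proof -
    have t: "filterlim (\<lambda>k. real (Suc k) * y - 1) at_top sequentially"
      using that by real_asymp
    have "((\<lambda>t. flat_fun 1 t) \<longlongrightarrow> 1) at_top"
    proof (rule Lim_transform_eventually)
      show "((\<lambda>t::real. exp (- (1 / t))) \<longlongrightarrow> 1) at_top" by real_asymp
      show "\<forall>\<^sub>F t in at_top. exp (- (1 / t)) = flat_fun 1 t"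
        using eventually_gt_at_top[of 0] by eventually_elim (simp add: flat_fun_1)
    qed
    then show ?thesis using t by (rule filterlim_compose)
  qed
  have "(\<lambda>k. \<Prod>i\<in>Basis. flat_fun 1 (real (Suc k) * (x \<bullet> i - a \<bullet> i) - 1) *
      flat_fun 1 (real (Suc k) * (b \<bullet> i - x \<bullet> i) - 1)) \<longlonglongrightarrow> (\<Prod>i\<in>(Basis::'a set). 1 * 1)"
    using assms by (intro tendsto_prod tendsto_mult l) (auto simp: mem_box)
  then show ?thesis
    unfolding box_bump_def by (simp add: algebra_simps)
qed

section \<open>Boundedness, integrability and Lipschitz continuity of test functions\<close>

lemma test_functions_mono: "U \<subseteq> W \<Longrightarrow> test_functions U \<subseteq> test_functions W"
  unfolding test_functions_def by blast

lemma test_functions_zero: "(\<lambda>x. 0) \<in> test_functions W"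
  unfolding test_functions_def smooth_def by (auto intro: Ck_const)

lemma test_functions_lin:
  assumes "f \<in> test_functions W" "g \<in> test_functions W"
  shows "(\<lambda>x. a * f x + b * g x) \<in> test_functions W"
proof -
  have c: "closure {x. a * f x + b * g x \<noteq> 0} \<subseteq> closure {x. f x \<noteq> 0} \<union> closure {x. g x \<noteq> 0}"
    unfolding closure_Un[symmetric] by (rule closure_mono) auto
  moreover have "compact (closure {x. f x \<noteq> 0} \<union> closure {x. g x \<noteq> 0})"
    using assms unfolding test_functions_def by (auto intro: compact_Un)
  ultimately have "compact (closure {x. a * f x + b * g x \<noteq> 0})"
    by (meson bounded_subset closed_closure compact_eq_bounded_closed)
  then show ?thesis
    using assms c unfolding test_functions_def smooth_def
    by (auto intro!: Ck_add Ck_mult Ck_const)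
qed

lemma test_functions_zero_outside: "f \<in> test_functions W \<Longrightarrow> x \<notin> W \<Longrightarrow> f x = 0"
  unfolding test_functions_def using closure_subset[of "{x. f x \<noteq> 0}"] by blast

lemma test_functions_continuous: "f \<in> test_functions W \<Longrightarrow> continuous_on UNIV f"
  unfolding test_functions_def smooth_def using Ck_imp_continuous by blast

lemma test_functions_measurable: "f \<in> test_functions W \<Longrightarrow> f \<in> borel_measurable borel"
  using test_functions_continuous by (rule borel_measurable_continuous_onI)

lemma test_functions_bounded_support:
  assumes "f \<in> test_functions W"
  obtains R where "\<And>x. f x \<noteq> 0 \<Longrightarrow> norm x \<le> R"
proof -
  have "bounded {x. f x \<noteq> 0}"
    using assms bounded_subset[OF compact_imp_bounded closure_subset] unfolding test_functions_def
    by blast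
  then show ?thesis using that by (auto simp: bounded_iff)
qed

lemma test_functions_bounded:
  assumes "f \<in> test_functions W"
  obtains B where "B \<ge> 0" "\<And>x. \<bar>f x\<bar> \<le> B"
proof -
  let ?K = "closure {x. f x \<noteq> 0}"
  have "compact (f ` ?K)"
    using assms test_functions_continuous[OF assms] unfolding test_functions_def
    by (auto intro!: compact_continuous_image intro: continuous_on_subset)
  then obtain B where B: "\<And>x. x \<in> ?K \<Longrightarrow> \<bar>f x\<bar> \<le> B"
    using compact_imp_bounded by (fastforce simp: bounded_iff)
  have "\<bar>f x\<bar> \<le> max B 0" for x
  proof (cases "f x = 0")
    case False
    then have "x \<in> ?K" using closure_subset[of "{x. f x \<noteq> 0}"] by auto
    then show ?thesis using B[of x] by simp
  qed simp
  then show ?thesis using that[of "max B 0"] by simp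
qed

lemma integrable_indicator_ball: "integrable lborel (indicator (cball 0 R :: 'a::euclidean_space set) :: 'a \<Rightarrow> real)"
  using emeasure_bounded_finite[OF bounded_cball, of "0::'a" R] by (intro integrable_real_indicator) auto

lemma test_functions_L2:
  assumes f: "f \<in> test_functions W"
  shows "f \<in> L2" "integrable lborel f"
proof -
  obtain R where R: "\<And>x. f x \<noteq> 0 \<Longrightarrow> norm x \<le> R" using test_functions_bounded_support[OF f] by blast
  obtain B where B: "B \<ge> 0" "\<And>x. \<bar>f x\<bar> \<le> B" using test_functions_bounded[OF f] by blast
  note [measurable] = test_functions_measurable[OF f]
  have le: "\<bar>f x\<bar> \<le> B * indicator (cball 0 R) x" for x
    using R[of x] B by (cases "f x = 0") auto
  show "integrable lborel f"
  proof (rule Bochner_Integration.integrable_bound)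
    show "integrable lborel (\<lambda>x. B * indicator (cball 0 R) x)"
      by (simp add: integrable_indicator_ball)
  qed (use le B in \<open>auto intro!: AE_I2\<close>)
  have "indicator (cball 0 R) \<in> (L2 :: ('a \<Rightarrow> real) set)"
  proof (rule L2_I)
    have "(norm (indicator (cball 0 R) x :: real))\<^sup>2 = indicator (cball 0 R) x" for x :: 'a
      by (auto simp: indicator_def)
    then show "integrable lborel (\<lambda>x::'a. (norm (indicator (cball 0 R) x :: real))\<^sup>2)"
      by (simp add: integrable_indicator_ball)
  qed (intro borel_measurable_indicator borel_closed closed_cball)
  then show "f \<in> L2" by (rule L2_dominated[rotated, where C=B]) (use le B in auto)
qed

text \<open>The partial derivatives are continuous with compact support, hence bounded, and the mean
  value inequality applies. Lipschitz continuity together with bounded support is what the heat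
  defect estimate below consumes.\<close>

lemma test_functions_Lipschitz:
  fixes f :: "'a::euclidean_space \<Rightarrow> real"
  assumes f: "f \<in> test_functions W"
  obtains C where "C \<ge> 0" "\<And>x y. \<bar>f x - f y\<bar> \<le> C * norm (x - y)"
proof -
  let ?K = "closure {x. f x \<noteq> 0}"
  define D where "D x = frechet_derivative f (at x)" for x
  have "Ck (Suc 0) f" using f unfolding test_functions_def smooth_def by blast
  then have d: "\<And>x. f differentiable (at x)" and c: "\<And>v. continuous_on UNIV (\<lambda>x. D x v)"
    unfolding D_def by auto
  have D: "(f has_derivative D x) (at x)" for x
    using d frechet_derivative_works unfolding D_def by blast
  have D0: "D x v = 0" if "x \<notin> ?K" for x v
  proof -
    have "((\<lambda>x. 0) has_derivative (\<lambda>v. 0)) (at x)" by simp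
    then have "(f has_derivative (\<lambda>v. 0)) (at x)"
    proof (rule has_derivative_transform_within_open[of _ _ _ _ "- ?K"])
      show "0 = f y" if "y \<in> - ?K" for y
        using that closure_subset[of "{x. f x \<noteq> 0}"] by auto
    qed (use that in auto)
    then show ?thesis using has_derivative_unique[OF D] by metis
  qed
  have "\<exists>B\<ge>0. \<forall>x. \<bar>D x i\<bar> \<le> B" for i
  proof -
    have "compact ((\<lambda>x. D x i) ` ?K)"
      using f c unfolding test_functions_def
      by (auto intro!: compact_continuous_image intro: continuous_on_subset)
    then obtain B where B: "\<And>x. x \<in> ?K \<Longrightarrow> \<bar>D x i\<bar> \<le> B"
      using compact_imp_bounded by (fastforce simp: bounded_iff)
    have "\<bar>D x i\<bar> \<le> max B 0" for x
      using B[of x] D0[of x i] by (cases "x \<in> ?K") auto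
    then show ?thesis by (intro exI[of _ "max B 0"]) auto
  qed
  then obtain B where B: "\<And>i. B i \<ge> 0" "\<And>i x. \<bar>D x i\<bar> \<le> B i" by metis
  define C where "C = (\<Sum>i\<in>Basis. B i)"
  have C: "C \<ge> 0" unfolding C_def using B by (simp add: sum_nonneg)
  have bound: "norm (D x v) \<le> C * norm v" for x v
  proof -
    have lin: "linear (D x)" using D has_derivative_linear by blast
    have "D x v = D x (\<Sum>i\<in>Basis. (v \<bullet> i) *\<^sub>R i)" by (simp add: euclidean_representation)
    also have "\<dots> = (\<Sum>i\<in>Basis. (v \<bullet> i) * D x i)"
      by (simp add: linear_sum[OF lin] linear_scale[OF lin])
    finally have "norm (D x v) \<le> (\<Sum>i\<in>Basis. norm ((v \<bullet> i) * D x i))"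
      using norm_sum by metis
    also have "\<dots> \<le> (\<Sum>i\<in>Basis. norm v * B i)"
      using B Basis_le_norm by (intro sum_mono) (auto simp: abs_mult intro!: mult_mono)
    finally show ?thesis by (simp add: C_def sum_distrib_left mult.commute)
  qed
  have "norm (f x - f y) \<le> C * norm (x - y)" for x y
    by (rule differentiable_bound[of UNIV f D]) (use D bound C in \<open>auto intro!: onorm_bound\<close>)
  then show ?thesis using that[OF C] by simp
qed

section \<open>Test functions separate and are dense\<close>

text \<open>The sets over which the integral vanishes form a Dynkin class, and boxes are an
  intersection-stable generator. The vanishing total integral is what closes the class under
  complements.\<close>

lemma AE_zero_if_zero_on_boxes:
  fixes f :: "'a::euclidean_space \<Rightarrow> real"
  assumes f: "integrable lborel f" and UN: "(LINT x|lborel. f x) = 0"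
    and box: "\<And>a b. (LINT x:box a b|lborel. f x) = 0"
  shows "AE x in lborel. f x = 0"
proof (rule sigma_finite_measure.density_zero[OF lborel.sigma_finite_measure_axioms f])
  fix A :: "'a set" assume "A \<in> sets lborel"
  have G: "range (\<lambda>(a, b). box a b) \<subseteq> Pow (UNIV :: 'a set)" by simp
  then have borel: "sets borel = sigma_sets UNIV (range (\<lambda>(a, b). box a b :: 'a set))"
    unfolding borel_eq_box by (rule sets_measure_of)
  have A: "A \<in> sigma_sets UNIV (range (\<lambda>(a, b). box a b :: 'a set))"
    using \<open>A \<in> sets lborel\<close> borel by simp
  have si: "set_integrable lborel B f" if "B \<in> sigma_sets UNIV (range (\<lambda>(a, b). box a b :: 'a set))" for B
    using that f unfolding set_integrable_def borel[symmetric]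
    by (intro integrable_mult_indicator) auto
  have st: "Int_stable (range (\<lambda>(a, b). box a b :: 'a set))"
  proof (rule Int_stableI)
    fix A B :: "'a set" assume "A \<in> range (\<lambda>(a, b). box a b)" "B \<in> range (\<lambda>(a, b). box a b)"
    then obtain a b c d where "A = box a b" "B = box c d" by auto
    then have "A \<inter> B = (\<lambda>(a, b). box a b) (\<Sum>i\<in>Basis. max (a \<bullet> i) (c \<bullet> i) *\<^sub>R i, \<Sum>i\<in>Basis. min (b \<bullet> i) (d \<bullet> i) *\<^sub>R i)"
      by (simp add: box_Int_box)
    then show "A \<inter> B \<in> range (\<lambda>(a, b). box a b)" by (rule range_eqI)
  qed
  show "(LINT x:A|lborel. f x) = 0"
    using st G A
  proof (induction rule: sigma_sets_induct_disjoint)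
    case (basic A)
    then show ?case using box by auto
  next
    case empty
    show ?case unfolding set_lebesgue_integral_def by simp
  next
    case (compl A)
    have "(LINT x:UNIV - A|lborel. f x) = (LINT x|lborel. f x - indicator A x * f x)"
      unfolding set_lebesgue_integral_def
      by (intro Bochner_Integration.integral_cong) (auto simp: indicator_def)
    also have "\<dots> = (LINT x|lborel. f x) - (LINT x:A|lborel. f x)"
      using si[OF compl(1)] f unfolding set_integrable_def set_lebesgue_integral_def by simp
    finally show ?case using UN compl(2) by simp
  next
    case (union A)
    have "(LINT x:(\<Union>i. A i)|lborel. f x) = (\<Sum>i. (LINT x:(A i)|lborel. f x))"
    proof (rule lebesgue_integral_countable_add)
      show "A i \<in> sets lborel" for i using union(2) borel by auto
      then show "set_integrable lborel (\<Union>i. A i) f"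
        using f unfolding set_integrable_def by (intro integrable_mult_indicator) auto
      show "A i \<inter> A j = {}" if "i \<noteq> j" for i j
        using union(1) that unfolding disjoint_family_on_def by blast
    qed
    then show ?case using union(3) by simp
  qed
qed

text \<open>Bump functions tend to the indicator of a box, so the integral over every box inside
  \<open>W\<close> vanishes, and countably many such boxes cover \<open>W\<close>.\<close>

lemma AE_zero_if_orthogonal_test_functions:
  fixes v :: "'a::euclidean_space \<Rightarrow> real"
  assumes v: "v \<in> L2" and W: "open W"
    and orth: "\<And>f. f \<in> test_functions W \<Longrightarrow> (LINT x|lborel. v x * f x) = 0"
  shows "AE x in lborel. x \<in> W \<longrightarrow> v x = 0"
proof -
  note [measurable] = L2_measurable[OF v]
  have ind: "indicator (box a b) \<in> (L2 :: ('a \<Rightarrow> real) set)" for a b :: 'a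
  proof (rule L2_I)
    have "(norm (indicator (box a b) x :: real))\<^sup>2 = indicator (box a b) x" for x :: 'a
      by (auto simp: indicator_def)
    then show "integrable lborel (\<lambda>x::'a. (norm (indicator (box a b) x :: real))\<^sup>2)"
      using emeasure_bounded_finite[OF bounded_box, of a b] by (simp add: integrable_real_indicator)
  qed simp
  have int: "integrable lborel (\<lambda>x. indicator (box a b) x * v x)" for a b
    by (rule L2_mult_integrable[OF ind v])
  have box0: "(LINT x:box a b|lborel. v x) = 0" if ab: "box a b \<subseteq> W" for a b
  proof -
    have "(\<lambda>k. LINT x|lborel. v x * box_bump a b (real (Suc k)) x) \<longlonglongrightarrow> (LINT x|lborel. v x * indicator (box a b) x)"
    proof (rule integral_dominated_convergence)
      show "integrable lborel (\<lambda>x. \<bar>indicator (box a b) x * v x\<bar>)" using int by (rule integrable_abs)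
      show "AE x in lborel. norm (v x * box_bump a b (real (Suc k)) x) \<le> \<bar>indicator (box a b) x * v x\<bar>" for k
      proof (rule AE_I2)
        fix x
        show "norm (v x * box_bump a b (real (Suc k)) x) \<le> \<bar>indicator (box a b) x * v x\<bar>"
        proof (cases "x \<in> box a b")
          case True
          then show ?thesis using box_bump_bounds[of a b "real (Suc k)" x]
            by (simp add: abs_mult mult_left_le)
        next
          case False
          then show ?thesis using box_bump_zero_outside[of "real (Suc k)" x a b] by simp
        qed
      qed
      show "AE x in lborel. (\<lambda>k. v x * box_bump a b (real (Suc k)) x) \<longlonglongrightarrow> v x * indicator (box a b) x"
      proof (rule AE_I2)
        fix x
        show "(\<lambda>k. v x * box_bump a b (real (Suc k)) x) \<longlonglongrightarrow> v x * indicator (box a b) x"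
        proof (cases "x \<in> box a b")
          case True
          then show ?thesis using tendsto_mult[OF tendsto_const box_bump_tendsto[OF True], of "v x"] by simp
        next
          case False
          then have "box_bump a b (real (Suc k)) x = 0" for k by (intro box_bump_zero_outside) auto
          then show ?thesis using False by simp
        qed
      qed
      show "(\<lambda>x. v x * box_bump a b (real (Suc k)) x) \<in> borel_measurable lborel" for k
        using test_functions_measurable[OF box_bump_test_function[of "real (Suc k)" a b UNIV]] by simp
    qed simp
    moreover have "(LINT x|lborel. v x * box_bump a b (real (Suc k)) x) = 0" for k
      using ab by (intro orth box_bump_test_function) auto
    ultimately have "(LINT x|lborel. v x * indicator (box a b) x) = 0" by (simp add: LIMSEQ_const_iff)
    then show ?thesis unfolding set_lebesgue_integral_def by (simp add: mult.commute)
  qed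
  \<comment> \<open>After cutting off by one box inside \<open>W\<close>, integrals over arbitrary
    boxes become integrals of v over intersections, which are again boxes inside
    \<open>W\<close>.\<close>
  have Q: "AE x in lborel. indicator (box a b) x * v x = 0" if "box a b \<subseteq> W" for a b
  proof (rule AE_zero_if_zero_on_boxes[OF int])
    show "(LINT x|lborel. indicator (box a b) x * v x) = 0"
      using box0[OF that] unfolding set_lebesgue_integral_def by simp
    fix c d
    obtain e f where ef: "box a b \<inter> box c d = box e f" using box_Int_box by blast
    have "(LINT x:box c d|lborel. indicator (box a b) x * v x) = (LINT x:box e f|lborel. v x)"
      unfolding set_lebesgue_integral_def ef[symmetric]
      by (intro Bochner_Integration.integral_cong) (auto simp: indicator_def)
    also have "\<dots> = 0" using box0[of e f] ef that by auto
    finally show "(LINT x:box c d|lborel. indicator (box a b) x * v x) = 0" .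
  qed
  obtain \<D> where D: "countable \<D>" "\<D> \<subseteq> Pow W" "\<And>X. X \<in> \<D> \<Longrightarrow> \<exists>a b. X = box a b" "\<Union>\<D> = W"
    using open_countable_Union_open_box[OF W] by blast
  have "AE x in lborel. \<forall>X\<in>\<D>. indicator X x * v x = 0"
  proof (rule AE_ball_countable'[OF _ D(1)])
    fix X assume X: "X \<in> \<D>"
    then obtain a b where "X = box a b" using D(3) by blast
    then show "AE x in lborel. indicator X x * v x = 0" using Q[of a b] X D(2) by auto
  qed
  then show ?thesis
  proof eventually_elim
    case (elim x)
    show ?case
    proof
      assume "x \<in> W"
      then obtain X where "X \<in> \<D>" "x \<in> X" using D(4) by blast
      then show "v x = 0" using elim by fastforce
    qed
  qed
qed

text \<open>Outside \<open>W\<close> the distance from z to an approximant is the size of z itself,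
  so the part of z outside \<open>W\<close> has norm below every e.\<close>

lemma l2n_AE_zero_outside_limit:
  fixes z :: "'a::euclidean_space \<Rightarrow> real"
  assumes z: "z \<in> L2" and lim: "\<And>e. e > 0 \<Longrightarrow> \<exists>f\<in>L2. (AE x in lborel. x \<notin> W \<longrightarrow> f x = 0) \<and> l2n (\<lambda>x. f x - z x) < e"
    and W: "W \<in> sets borel"
  shows "AE x in lborel. x \<notin> W \<longrightarrow> z x = 0"
proof -
  note [measurable] = W L2_measurable[OF z]
  define y where "y x = indicator (- W) x * z x" for x
  have y: "y \<in> L2" unfolding y_def by (rule L2_dominated[OF _ z, where C=1]) (auto simp: indicator_def)
  have "l2n y \<le> e" if e: "e > 0" for e
  proof -
    obtain f where f: "f \<in> L2" "AE x in lborel. x \<notin> W \<longrightarrow> f x = 0" "l2n (\<lambda>x. f x - z x) < e"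
      using lim[OF e] by blast
    have "l2n y \<le> l2n (\<lambda>x. f x - z x)"
    proof (rule l2n_mono[OF y L2_diff[OF f(1) z]])
      show "AE x in lborel. norm (y x) \<le> norm (f x - z x)"
        using f(2) by eventually_elim (auto simp: y_def indicator_def)
    qed
    then show ?thesis using f(3) by simp
  qed
  then have "l2n y \<le> 0" using field_le_epsilon[of "l2n y" 0] by simp
  then have "l2n y = 0" using l2n_nonneg[of y] by linarith
  then have "AE x in lborel. y x = 0" by (rule l2n_eq_0[OF y])
  then show ?thesis by eventually_elim (auto simp: y_def indicator_def)
qed

text \<open>The projection of \<open>u\<close> onto the closure of the test functions differs from
  \<open>u\<close> by a function orthogonal to all of them, which vanishes on \<open>W\<close>;
  outside \<open>W\<close> both vanish.\<close>

lemma test_functions_dense: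
  fixes u :: "'a::euclidean_space \<Rightarrow> real"
  assumes u: "u \<in> L2" and W: "open W" and out: "AE x in lborel. x \<notin> W \<longrightarrow> u x = 0" and e: "e > 0"
  shows "\<exists>f\<in>test_functions W. l2n (\<lambda>x. u x - f x) < e"
proof -
  have sub: "test_functions W \<subseteq> (L2 :: ('a \<Rightarrow> real) set)" using test_functions_L2 by blast
  have "\<exists>z\<in>L2. (\<forall>f\<in>test_functions W. (LINT x|lborel. z x * f x) = (LINT x|lborel. u x * f x)) \<and>
    (\<forall>e>0. \<exists>f\<in>test_functions W. l2n (\<lambda>x. f x - z x) < e)"
    by (rule L2.riesz_on_subspace[OF sub test_functions_zero _ L2.bdd_lin_I[OF u]]) (rule test_functions_lin)
  then obtain z where z: "z \<in> L2" "\<forall>f\<in>test_functions W. (LINT x|lborel. z x * f x) = (LINT x|lborel. u x * f x)"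
    "\<forall>e>0. \<exists>f\<in>test_functions W. l2n (\<lambda>x. f x - z x) < e"
    by (elim bexE conjE) (rule that)
  have d: "(\<lambda>x. u x - z x) \<in> L2" by (rule L2_diff[OF u z(1)])
  have "AE x in lborel. x \<in> W \<longrightarrow> u x - z x = 0"
  proof (rule AE_zero_if_orthogonal_test_functions[OF d W])
    fix f assume f: "f \<in> test_functions W"
    show "(LINT x|lborel. (u x - z x) * f x) = 0"
      using L2.I_diff[OF u z(1) test_functions_L2(1)[OF f]] bspec[OF z(2) f] by simp
  qed
  moreover have "AE x in lborel. x \<notin> W \<longrightarrow> z x = 0"
  proof (rule l2n_AE_zero_outside_limit[OF z(1)])
    show "\<exists>f\<in>L2. (AE x in lborel. x \<notin> W \<longrightarrow> f x = 0) \<and> l2n (\<lambda>x. f x - z x) < e" if "e > 0" for e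
    proof -
      obtain f where f: "f \<in> test_functions W" "l2n (\<lambda>x. f x - z x) < e" using z(3) \<open>e > 0\<close> by blast
      then show ?thesis using test_functions_L2(1)[OF f(1)] test_functions_zero_outside[OF f(1)]
        by (intro bexI[of _ f]) auto
    qed
  qed (use W in simp)
  ultimately have "AE x in lborel. u x - z x = 0" using out by eventually_elim auto
  then have "l2n (\<lambda>x. u x - z x) = 0"
    using l2n_cong_AE[of "\<lambda>x. u x - z x" "\<lambda>x. 0"] L2_measurable[OF d] by (simp add: l2n_def)
  moreover obtain f where f: "f \<in> test_functions W" "l2n (\<lambda>x. f x - z x) < e" using z(3) e by blast
  moreover have "l2n (\<lambda>x. u x - f x) \<le> l2n (\<lambda>x. u x - z x) + l2n (\<lambda>x. z x - f x)"
    by (rule l2n_triangle_diff[OF u z(1) test_functions_L2(1)[OF f(1)]])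
  ultimately show ?thesis using l2n_minus_commute[of z f] by (intro bexI[OF _ f(1)]) simp
qed

section \<open>Gaussians and the heat kernel\<close>

text \<open>Fubini over all coordinates at once, through Lebesgue measure as the image of a product
  of one-dimensional measures.\<close>

lemma lborel_integral_prod:
  fixes f :: "'a::euclidean_space \<Rightarrow> real \<Rightarrow> 'b::{real_normed_field, banach, second_countable_topology}"
  assumes f: "\<And>b. b \<in> Basis \<Longrightarrow> integrable lborel (f b)"
  shows "integrable lborel (\<lambda>x. \<Prod>b\<in>Basis. f b (x \<bullet> b))"
    and "(LINT x|lborel. (\<Prod>b\<in>Basis. f b (x \<bullet> b))) = (\<Prod>b\<in>Basis. LINT y|lborel. f b y)"
proof -
  interpret product_sigma_finite "\<lambda>_::'a. lborel :: real measure" by standard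
  have [measurable]: "b \<in> Basis \<Longrightarrow> f b \<in> borel_measurable borel" for b
    using f[of b] by auto
  have s: "(\<Sum>b\<in>Basis. y b *\<^sub>R b) \<bullet> c = y c" if "c \<in> Basis" for y and c :: 'a
    using that by simp
  have e: "(\<Prod>b\<in>Basis. f b ((\<Sum>b\<in>Basis. y b *\<^sub>R b) \<bullet> b)) = (\<Prod>b\<in>Basis. f b (y b))" for y
    by (intro prod.cong refl) (simp add: s)
  have m: "(\<lambda>x::'a. \<Prod>b\<in>Basis. f b (x \<bullet> b)) \<in> borel_measurable borel" by measurable
  have m2: "(\<lambda>y. \<Sum>b\<in>(Basis::'a set). y b *\<^sub>R b) \<in> (\<Pi>\<^sub>M b\<in>(Basis::'a set). lborel) \<rightarrow>\<^sub>M borel"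
    by measurable
  have "integrable (\<Pi>\<^sub>M b\<in>(Basis::'a set). lborel) (\<lambda>y. \<Prod>b\<in>Basis. f b (y b))"
    by (rule product_integrable_prod) (use f in auto)
  then show "integrable lborel (\<lambda>x. \<Prod>b\<in>Basis. f b (x \<bullet> b))"
    by (subst lborel_eq) (simp add: integrable_distr_eq[OF m2 m] e)
  show "(LINT x|lborel. (\<Prod>b\<in>Basis. f b (x \<bullet> b))) = (\<Prod>b\<in>Basis. LINT y|lborel. f b y)"
    by (subst lborel_eq) (simp add: integral_distr[OF m2 m] e product_integral_prod f)
qed

lemma lborel_reflect: "distr lborel borel (\<lambda>y. x - y) = (lborel :: 'a::euclidean_space measure)"
proof -
  have "lborel = density (distr lborel borel (\<lambda>y. x + (-1) *\<^sub>R y)) (\<lambda>_. \<bar>-1::real\<bar>^DIM('a))"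
    by (rule lborel_affine) simp
  also have "\<dots> = distr lborel borel (\<lambda>y. x + (-1) *\<^sub>R y)"
    using density_1[of "distr lborel borel (\<lambda>y. x + (-1) *\<^sub>R y)"] by (simp add: one_ennreal_def)
  finally show ?thesis by simp
qed

lemma lborel_integral_reflect:
  fixes f :: "'a::euclidean_space \<Rightarrow> 'b::{banach, second_countable_topology}"
  assumes [measurable]: "f \<in> borel_measurable borel"
  shows "(LINT y|lborel. f (x - y)) = (LINT y|lborel. f y)"
    and "integrable lborel (\<lambda>y. f (x - y)) \<longleftrightarrow> integrable lborel f"
proof -
  have "(LINT y|lborel. f y) = (LINT y|distr lborel borel (\<lambda>y. x - y). f y)" by (simp add: lborel_reflect)
  also have "\<dots> = (LINT y|lborel. f (x - y))" by (rule integral_distr) auto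
  finally show "(LINT y|lborel. f (x - y)) = (LINT y|lborel. f y)" by simp
  have "integrable lborel f = integrable (distr lborel borel (\<lambda>y. x - y)) f" by (simp add: lborel_reflect)
  also have "\<dots> = integrable lborel (\<lambda>y. f (x - y))" by (rule integrable_distr_eq) auto
  finally show "integrable lborel (\<lambda>y. f (x - y)) \<longleftrightarrow> integrable lborel f" by simp
qed

text \<open>A rescaling of the characteristic function of the standard normal distribution.\<close>

lemma gaussian_fourier_1d:
  assumes t: "t > 0"
  shows "integrable lborel (\<lambda>\<xi>::real. complex_of_real (exp (- t * \<xi>\<^sup>2)) * cis (x * \<xi>))"
    and "(LINT \<xi>|lborel. complex_of_real (exp (- t * \<xi>\<^sup>2)) * cis (x * \<xi>))
      = complex_of_real (sqrt (pi / t) * exp (- x\<^sup>2 / (4 * t)))"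
proof -
  \<comment> \<open>Chosen so that the substitution y = c \<xi> turns exp (- y^2 / 2) into exp (- t
    \<xi>^2).\<close>
  define c where "c = sqrt (2 * t)"
  have c: "c > 0" "c\<^sup>2 = 2 * t" unfolding c_def using t by auto
  define f where "f y = complex_of_real (exp (- y\<^sup>2 / 2)) * cis (x / c * y)" for y :: real
  have fc: "f (0 + c * \<xi>) = complex_of_real (exp (- t * \<xi>\<^sup>2)) * cis (x * \<xi>)" for \<xi>
    unfolding f_def using c by (simp add: power_mult_distrib)
  have si: "integrable lborel (\<lambda>y. exp (- y\<^sup>2 / 2) :: real)"
  proof -
    have "integrable lborel (\<lambda>y. sqrt (2 * pi) * std_normal_density y)"
      using integrable_normal_density[of 1 0] by simp
    then show ?thesis by (simp add: std_normal_density_def)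
  qed
  have int_f: "integrable lborel f"
    unfolding f_def
    by (rule Bochner_Integration.integrable_bound[OF si]) (auto simp: norm_mult cis_conv_exp)
  have "complex_of_real (exp (- ((x / c)\<^sup>2) / 2)) = char std_normal_distribution (x / c)"
    by (simp add: char_std_normal_distribution)
  also have "\<dots> = (LINT y|lborel. std_normal_density y *\<^sub>R iexp (x / c * y))"
    unfolding char_def by (subst integral_density) auto
  also have "\<dots> = (LINT y|lborel. complex_of_real (1 / sqrt (2 * pi)) * f y)"
    unfolding std_normal_density_def f_def
    by (intro Bochner_Integration.integral_cong) (auto simp: scaleR_conv_of_real cis_conv_exp)
  also have "\<dots> = complex_of_real (1 / sqrt (2 * pi)) * (LINT y|lborel. f y)"
    by simp
  finally have "(LINT y|lborel. f y) = complex_of_real (sqrt (2 * pi) * exp (- ((x / c)\<^sup>2) / 2))"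
    by (simp add: field_simps)
  also have "- (x / c)\<^sup>2 / 2 = - x\<^sup>2 / (4 * t)" using c by (simp add: power_divide)
  finally have F: "(LINT y|lborel. f y) = complex_of_real (sqrt (2 * pi) * exp (- x\<^sup>2 / (4 * t)))" by simp
  show "integrable lborel (\<lambda>\<xi>::real. complex_of_real (exp (- t * \<xi>\<^sup>2)) * cis (x * \<xi>))"
    using lborel_integrable_real_affine[OF int_f, of c 0] c unfolding fc by simp
  have "(LINT y|lborel. f y) = \<bar>c\<bar> *\<^sub>R (LINT \<xi>|lborel. f (0 + c * \<xi>))"
    using c by (intro lborel_integral_real_affine) simp
  then have "(LINT \<xi>|lborel. f (0 + c * \<xi>)) = (LINT y|lborel. f y) / complex_of_real c"
    using c by (simp add: scaleR_conv_of_real)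
  also have "\<dots> = complex_of_real (sqrt (2 * pi) / c * exp (- x\<^sup>2 / (4 * t)))" unfolding F by simp
  also have "sqrt (2 * pi) / c = sqrt (pi / t)" unfolding c_def by (simp flip: real_sqrt_divide)
  finally show "(LINT \<xi>|lborel. complex_of_real (exp (- t * \<xi>\<^sup>2)) * cis (x * \<xi>))
      = complex_of_real (sqrt (pi / t) * exp (- x\<^sup>2 / (4 * t)))" unfolding fc .
qed

lemma norm_sq_eq_sum_Basis: "(norm x)\<^sup>2 = (\<Sum>b\<in>Basis. (x \<bullet> b)\<^sup>2)"
  unfolding power2_norm_eq_inner by (subst euclidean_inner) (simp add: power2_eq_square)

lemma cis_sum: "finite A \<Longrightarrow> cis (sum f A) = (\<Prod>b\<in>A. cis (f b))"
  by (induction A rule: finite_induct) (auto simp: cis_mult[symmetric])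

lemma gaussian_fourier:
  fixes x :: "'a::euclidean_space"
  assumes t: "t > 0"
  shows "integrable lborel (\<lambda>\<xi>::'a. complex_of_real (exp (- t * (norm \<xi>)\<^sup>2)) * cis (x \<bullet> \<xi>))"
    and "(LINT \<xi>|lborel. complex_of_real (exp (- t * (norm \<xi>)\<^sup>2)) * cis (x \<bullet> \<xi>))
      = complex_of_real (sqrt (pi / t) ^ DIM('a) * exp (- (norm x)\<^sup>2 / (4 * t)))"
proof -
  define f where "f b y = complex_of_real (exp (- t * y\<^sup>2)) * cis ((x \<bullet> b) * y)" for b and y :: real
  have e1: "cis (x \<bullet> \<xi>) = (\<Prod>b\<in>Basis. cis ((x \<bullet> b) * (\<xi> \<bullet> b)))" for \<xi>
    by (subst euclidean_inner) (rule cis_sum[OF finite_Basis])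
  have e2: "exp (- t * (norm \<xi>)\<^sup>2) = (\<Prod>b\<in>Basis. exp (- t * (\<xi> \<bullet> b)\<^sup>2))" for \<xi> :: 'a
    unfolding norm_sq_eq_sum_Basis sum_distrib_left by (rule exp_sum[OF finite_Basis])
  have e: "complex_of_real (exp (- t * (norm \<xi>)\<^sup>2)) * cis (x \<bullet> \<xi>) = (\<Prod>b\<in>Basis. f b (\<xi> \<bullet> b))" for \<xi>
    unfolding f_def e1 e2 of_real_prod by (simp only: prod.distrib)
  have i: "integrable lborel (f b)" for b unfolding f_def by (rule gaussian_fourier_1d[OF t])
  show "integrable lborel (\<lambda>\<xi>::'a. complex_of_real (exp (- t * (norm \<xi>)\<^sup>2)) * cis (x \<bullet> \<xi>))"
    unfolding e by (rule lborel_integral_prod[OF i])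
  have "(LINT \<xi>|lborel. complex_of_real (exp (- t * (norm \<xi>)\<^sup>2)) * cis (x \<bullet> \<xi>))
      = (\<Prod>b\<in>Basis. complex_of_real (sqrt (pi / t) * exp (- (x \<bullet> b)\<^sup>2 / (4 * t))))"
    unfolding e lborel_integral_prod(2)[OF i] unfolding f_def gaussian_fourier_1d(2)[OF t] ..
  also have "\<dots> = complex_of_real (sqrt (pi / t) ^ DIM('a) * exp (- (norm x)\<^sup>2 / (4 * t)))"
  proof -
    have "exp (- (norm x)\<^sup>2 / (4 * t)) = (\<Prod>b\<in>Basis. exp (- (x \<bullet> b)\<^sup>2 / (4 * t)))"
      unfolding norm_sq_eq_sum_Basis sum_negf[symmetric] sum_divide_distrib by (rule exp_sum[OF finite_Basis])
    then show ?thesis by (simp only: of_real_prod[symmetric] prod.distrib prod_constant)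
  qed
  finally show "(LINT \<xi>|lborel. complex_of_real (exp (- t * (norm \<xi>)\<^sup>2)) * cis (x \<bullet> \<xi>))
      = complex_of_real (sqrt (pi / t) ^ DIM('a) * exp (- (norm x)\<^sup>2 / (4 * t)))" .
qed

lemma gaussian_integral:
  assumes t: "t > 0"
  shows "integrable lborel (\<lambda>\<xi>::'a::euclidean_space. exp (- t * (norm \<xi>)\<^sup>2))"
    and "(LINT \<xi>|lborel. exp (- t * (norm (\<xi>::'a))\<^sup>2)) = sqrt (pi / t) ^ DIM('a)"
proof -
  have e: "complex_of_real (exp (- t * (norm \<xi>)\<^sup>2)) * cis (0 \<bullet> \<xi>) = complex_of_real (exp (- t * (norm \<xi>)\<^sup>2))" for \<xi> :: 'a
    by simp
  show "integrable lborel (\<lambda>\<xi>::'a. exp (- t * (norm \<xi>)\<^sup>2))"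
    using gaussian_fourier(1)[OF t, of "0::'a"] unfolding e by (simp only: complex_of_real_integrable_eq)
  show "(LINT \<xi>|lborel. exp (- t * (norm (\<xi>::'a))\<^sup>2)) = sqrt (pi / t) ^ DIM('a)"
    using gaussian_fourier(2)[OF t, of "0::'a"] unfolding e integral_complex_of_real of_real_eq_iff by simp
qed

text \<open>The fundamental solution of the heat equation for t > 0, with mass one; convolution with
  it damps the Fourier transform by exp (- t |\<xi>|^2).\<close>

definition heat_kernel :: "real \<Rightarrow> 'a::euclidean_space \<Rightarrow> real" where
  "heat_kernel t z = (1 / sqrt (4 * pi * t)) ^ DIM('a) * exp (- (norm z)\<^sup>2 / (4 * t))"

lemma heat_kernel_nonneg: "t > 0 \<Longrightarrow> 0 \<le> heat_kernel t z"
  unfolding heat_kernel_def by simp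

lemma heat_kernel_measurable[measurable]: "heat_kernel t \<in> borel_measurable borel"
  unfolding heat_kernel_def by measurable

lemma heat_kernel_commute: "heat_kernel t (x - y) = heat_kernel t (y - x)"
  unfolding heat_kernel_def by (simp add: norm_minus_commute)

lemma heat_kernel_integral_0:
  assumes t: "t > 0"
  shows "integrable lborel (heat_kernel t :: 'a::euclidean_space \<Rightarrow> real)"
    "(LINT y|lborel. heat_kernel t (y :: 'a)) = 1"
proof -
  have e: "heat_kernel t = (\<lambda>y::'a. (1 / sqrt (4 * pi * t)) ^ DIM('a) * exp (- (1 / (4 * t)) * (norm y)\<^sup>2))"
    unfolding heat_kernel_def by (rule ext) simp
  have p: "1 / (4 * t) > 0" using t by simp
  have e2: "pi / (1 / (4 * t)) = 4 * pi * t" by simp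
  show "integrable lborel (heat_kernel t :: 'a::euclidean_space \<Rightarrow> real)"
    unfolding e by (intro integrable_mult_right gaussian_integral p)
  show "(LINT y|lborel. heat_kernel t (y :: 'a)) = 1"
    unfolding e integral_mult_right_zero gaussian_integral(2)[OF p] e2 power_mult_distrib[symmetric]
    using t by simp
qed

lemma heat_kernel_integral:
  assumes t: "t > 0"
  shows "integrable lborel (\<lambda>y::'a::euclidean_space. heat_kernel t (x - y))"
    "(LINT y|lborel. heat_kernel t (x - y :: 'a)) = 1"
    "integrable lborel (\<lambda>y::'a::euclidean_space. heat_kernel t (y - x))"
    "(LINT y|lborel. heat_kernel t (y - x :: 'a)) = 1"
  using lborel_integral_reflect[of "heat_kernel t :: 'a \<Rightarrow> real" x] heat_kernel_integral_0[OF t, where 'a='a]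
  by (auto simp: heat_kernel_commute[of t _ x])

lemma integrable_tensor:
  fixes u :: "'a::euclidean_space \<Rightarrow> 'c::{real_normed_field, banach, second_countable_topology}" 
    and v :: "'b::euclidean_space \<Rightarrow> 'c"
  assumes u: "integrable lborel u" and v: "integrable lborel v"
  shows "integrable (lborel \<Otimes>\<^sub>M lborel) (\<lambda>(x, y). u x * v y)"
proof (rule lborel_pair.Fubini_integrable)
  have [measurable]: "u \<in> borel_measurable borel" "v \<in> borel_measurable borel" using u v by auto
  show "(\<lambda>(x, y). u x * v y) \<in> borel_measurable (lborel \<Otimes>\<^sub>M lborel)" by measurable
  show "AE x in lborel. integrable lborel (\<lambda>y. case (x, y) of (x, y) \<Rightarrow> u x * v y)"
    using v by (intro AE_I2) simp
  show "integrable lborel (\<lambda>x. LINT y|lborel. norm (case (x, y) of (x, y) \<Rightarrow> u x * v y))"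
    using u by (simp add: norm_mult)
qed

section \<open>The Fourier transform of integrable functions\<close>

lemma cis_measurable[measurable]: "cis \<in> borel_measurable borel"
  unfolding cis_conv_exp[abs_def] by measurable

lemma integrable_cis_mult:
  fixes u :: "'a::euclidean_space \<Rightarrow> real"
  assumes u: "integrable lborel u" and [measurable]: "h \<in> borel_measurable borel"
  shows "integrable lborel (\<lambda>x. cis (h x) * complex_of_real (u x))"
proof -
  have [measurable]: "u \<in> borel_measurable borel" using u by auto
  show ?thesis
    by (rule Bochner_Integration.integrable_bound[OF u]) (auto simp: norm_mult)
qed

lemma fourier_L1_lin:
  assumes "integrable lborel u" "integrable lborel v"
  shows "fourier_L1 (\<lambda>x. a * u x + b * v x) \<xi> = of_real a * fourier_L1 u \<xi> + of_real b * fourier_L1 v \<xi>"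
proof -
  have "(LINT x|lborel. cis (- (x \<bullet> \<xi>)) * complex_of_real (a * u x + b * v x)) =
    (LINT x|lborel. of_real a * (cis (- (x \<bullet> \<xi>)) * complex_of_real (u x)) + of_real b * (cis (- (x \<bullet> \<xi>)) * complex_of_real (v x)))"
    by (intro Bochner_Integration.integral_cong) (auto simp: algebra_simps)
  also have "\<dots> = of_real a * (LINT x|lborel. cis (- (x \<bullet> \<xi>)) * complex_of_real (u x))
      + of_real b * (LINT x|lborel. cis (- (x \<bullet> \<xi>)) * complex_of_real (v x))"
    using integrable_cis_mult[OF assms(1)] integrable_cis_mult[OF assms(2)] by simp
  finally show ?thesis unfolding fourier_L1_def by (simp add: algebra_simps)
qed

lemma fourier_L1_measurable[measurable]:
  fixes u :: "'a::euclidean_space \<Rightarrow> real"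
  assumes [measurable]: "u \<in> borel_measurable borel"
  shows "fourier_L1 u \<in> borel_measurable borel"
proof -
  have "(\<lambda>\<xi>. LINT x|lborel. cis (- (x \<bullet> \<xi>)) * complex_of_real (u x)) \<in> borel_measurable borel"
    by (intro lborel.borel_measurable_lebesgue_integral) measurable
  then show ?thesis unfolding fourier_L1_def[abs_def] by measurable
qed

lemma fourier_L1_bound:
  fixes u :: "'a::euclidean_space \<Rightarrow> real"
  assumes u: "integrable lborel u"
  shows "cmod (fourier_L1 u \<xi>) \<le> (2 * pi) powr (- (real DIM('a) / 2)) * (LINT x|lborel. \<bar>u x\<bar>)"
proof -
  have "cmod (LINT x|lborel. cis (- (x \<bullet> \<xi>)) * complex_of_real (u x)) \<le> (LINT x|lborel. cmod (cis (- (x \<bullet> \<xi>)) * complex_of_real (u x)))"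
    by (rule integral_norm_bound)
  also have "\<dots> = (LINT x|lborel. \<bar>u x\<bar>)" by (simp add: norm_mult)
  finally show ?thesis unfolding fourier_L1_def by (simp add: norm_mult mult_left_mono)
qed

text \<open>Writing out both transforms and integrating over the frequency first leaves the
  transform of a Gaussian, which is the heat kernel. The damping makes the triple integral
  absolutely convergent, so Fubini does the work of an inversion theorem.\<close>

lemma heat_pairing:
  fixes u v :: "'a::euclidean_space \<Rightarrow> real"
  assumes u: "integrable lborel u" and v: "integrable lborel v" and t: "t > 0"
  shows "(LINT \<xi>|lborel. complex_of_real (exp (- t * (norm \<xi>)\<^sup>2)) * (fourier_L1 u \<xi> * cnj (fourier_L1 v \<xi>)))
    = complex_of_real (LINT z|(lborel \<Otimes>\<^sub>M lborel). u (fst z) * v (snd z) * heat_kernel t (fst z - snd z))"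
proof -
  have [measurable]: "u \<in> borel_measurable borel" "v \<in> borel_measurable borel" using u v by auto
  \<comment> \<open>The product of the two normalising constants, that is, (2 pi) to the power
    -n.\<close>
  define c where "c = ((2 * pi) powr (- (real DIM('a) / 2)))\<^sup>2"
  have c: "c = (1 / (2 * pi)) ^ DIM('a)"
  proof -
    have "c = (2 * pi) powr (- (real DIM('a) / 2) * 2)" unfolding c_def
      by (subst powr_powr[symmetric]) (simp add: powr_realpow)
    also have "\<dots> = inverse ((2 * pi) powr real DIM('a))" by (simp add: powr_minus)
    also have "\<dots> = inverse ((2 * pi) ^ DIM('a))" by (simp add: powr_realpow)
    finally show ?thesis by (simp add: power_one_over inverse_eq_divide)
  qed
  define w where "w z = u (fst z) * v (snd z)" for z
  define g where "g \<xi> = exp (- t * (norm \<xi>)\<^sup>2)" for \<xi> :: 'a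
  define F where "F \<xi> z = complex_of_real c * (complex_of_real (g \<xi>) * complex_of_real (w z) * cis ((snd z - fst z) \<bullet> \<xi>))" for \<xi> z
  have [measurable]: "w \<in> borel_measurable (lborel \<Otimes>\<^sub>M lborel)" "g \<in> borel_measurable borel"
    unfolding w_def g_def by measurable
  have w_int: "integrable (lborel \<Otimes>\<^sub>M lborel) w"
    using integrable_tensor[OF u v] unfolding w_def by (simp add: case_prod_beta')
  have w_int': "integrable lborel w" using w_int by (simp add: lborel_prod)
  have g_int: "integrable lborel g" unfolding g_def by (rule gaussian_integral[OF t])
  have F_int: "integrable (lborel \<Otimes>\<^sub>M lborel) (case_prod F)"
  proof (rule Bochner_Integration.integrable_bound)
    show "integrable (lborel \<Otimes>\<^sub>M lborel) (\<lambda>x. c * (case x of (\<xi>, z) \<Rightarrow> g \<xi> * w z))"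
      by (intro integrable_mult_right integrable_tensor g_int w_int')
    have [measurable]: "w \<in> borel_measurable borel" using w_int' by auto
    have [measurable]: "(fst :: 'a \<times> 'a \<times> 'a \<Rightarrow> 'a) \<in> borel \<rightarrow>\<^sub>M borel" "(snd :: 'a \<times> 'a \<times> 'a \<Rightarrow> 'a \<times> 'a) \<in> borel \<rightarrow>\<^sub>M borel"
      "(\<lambda>x :: 'a \<times> 'a \<times> 'a. cis ((snd (snd x) - fst (snd x)) \<bullet> fst x)) \<in> borel \<rightarrow>\<^sub>M borel"
      by (intro borel_measurable_continuous_onI continuous_intros)+
    have "(\<lambda>x. F (fst x) (snd x)) \<in> borel_measurable borel" unfolding F_def by measurable
    then show "case_prod F \<in> borel_measurable (lborel \<Otimes>\<^sub>M lborel)" by (simp add: lborel_prod case_prod_beta')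
    show "AE x in lborel \<Otimes>\<^sub>M lborel. norm (case_prod F x) \<le> norm (c * (case x of (\<xi>, z) \<Rightarrow> g \<xi> * w z))"
      by (intro AE_I2) (auto simp: F_def norm_mult)
  qed
  have 1: "complex_of_real (g \<xi>) * (fourier_L1 u \<xi> * cnj (fourier_L1 v \<xi>)) = (LINT z|lborel. F \<xi> z)" for \<xi>
  proof -
    have "fourier_L1 u \<xi> * cnj (fourier_L1 v \<xi>) = complex_of_real c *
       ((LINT x|lborel. cis (- (x \<bullet> \<xi>)) * complex_of_real (u x)) * cnj (LINT y|lborel. cis (- (y \<bullet> \<xi>)) * complex_of_real (v y)))"
      unfolding fourier_L1_def c_def by (simp add: power2_eq_square algebra_simps)
    also have "cnj (LINT y|lborel. cis (- (y \<bullet> \<xi>)) * complex_of_real (v y)) = (LINT y|lborel. cis (y \<bullet> \<xi>) * complex_of_real (v y))"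
    proof -
      have "cnj (cis (- (y \<bullet> \<xi>)) * complex_of_real (v y)) = cis (y \<bullet> \<xi>) * complex_of_real (v y)" for y
        by (simp add: cis_cnj)
      then show ?thesis using Bochner_Integration.integral_cnj[of lborel "\<lambda>y. cis (- (y \<bullet> \<xi>)) * complex_of_real (v y)"] by (simp only:)
    qed
    also have "(LINT x|lborel. cis (- (x \<bullet> \<xi>)) * complex_of_real (u x)) * (LINT y|lborel. cis (y \<bullet> \<xi>) * complex_of_real (v y)) =
      (LINT x|lborel. (LINT y|lborel. (cis (- (x \<bullet> \<xi>)) * complex_of_real (u x)) * (cis (y \<bullet> \<xi>) * complex_of_real (v y))))"
      by simp
    also have "\<dots> = (LINT z|(lborel \<Otimes>\<^sub>M lborel). (case z of (x, y) \<Rightarrow> (cis (- (x \<bullet> \<xi>)) * complex_of_real (u x)) * (cis (y \<bullet> \<xi>) * complex_of_real (v y))))"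
    proof -
      have "integrable (lborel \<Otimes>\<^sub>M lborel) (\<lambda>(x, y). (cis (- (x \<bullet> \<xi>)) * complex_of_real (u x)) * (cis (y \<bullet> \<xi>) * complex_of_real (v y)))"
        by (intro integrable_tensor integrable_cis_mult u v; measurable)
      from lborel_pair.integral_fst'[OF this] show ?thesis by (simp only: prod.case)
    qed
    also have "\<dots> = (LINT z|lborel. complex_of_real (w z) * cis ((snd z - fst z) \<bullet> \<xi>))"
      unfolding lborel_prod w_def
      by (intro Bochner_Integration.integral_cong)
        (auto simp: case_prod_beta' inner_diff_left cis_mult[symmetric] diff_conv_add_uminus algebra_simps simp del: add_uminus_conv_diff)
    finally show ?thesis unfolding F_def by (simp add: mult_ac)
  qed
  have "(LINT \<xi>|lborel. complex_of_real (g \<xi>) * (fourier_L1 u \<xi> * cnj (fourier_L1 v \<xi>))) = (LINT \<xi>|lborel. LINT z|lborel. F \<xi> z)"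
    by (simp only: 1)
  also have "\<dots> = (LINT z|lborel. LINT \<xi>|lborel. F \<xi> z)"
    by (rule lborel_pair.Fubini_integral[symmetric]) (rule F_int)
  also have "\<dots> = (LINT z|lborel. complex_of_real (w z * heat_kernel t (fst z - snd z)))"
  proof (intro Bochner_Integration.integral_cong refl)
    fix z :: "'a \<times> 'a"
    have "(LINT \<xi>|lborel. F \<xi> z) = complex_of_real c * complex_of_real (w z) *
      (LINT \<xi>|lborel. complex_of_real (exp (- t * (norm \<xi>)\<^sup>2)) * cis ((snd z - fst z) \<bullet> \<xi>))"
      unfolding F_def g_def by (simp add: mult_ac flip: integral_mult_right_zero)
    also have "\<dots> = complex_of_real (w z * (c * sqrt (pi / t) ^ DIM('a)) * exp (- (norm (snd z - fst z))\<^sup>2 / (4 * t)))"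
      unfolding gaussian_fourier(2)[OF t] by (simp add: mult_ac)
    also have "c * sqrt (pi / t) ^ DIM('a) = (1 / sqrt (4 * pi * t)) ^ DIM('a)"
    proof -
      have "1 / (2 * pi) * sqrt (pi / t) = 1 / sqrt (4 * pi * t)"
      proof (rule power2_eq_imp_eq)
        show "(1 / (2 * pi) * sqrt (pi / t))\<^sup>2 = (1 / sqrt (4 * pi * t))\<^sup>2"
          using t by (simp add: power_mult_distrib power_divide field_simps power2_eq_square)
      qed (use t in auto)
      then show ?thesis unfolding c by (metis power_mult_distrib)
    qed
    finally show "(LINT \<xi>|lborel. F \<xi> z) = complex_of_real (w z * heat_kernel t (fst z - snd z))"
      unfolding heat_kernel_def by (simp add: norm_minus_commute mult_ac)
  qed
  also have "\<dots> = complex_of_real (LINT z|(lborel \<Otimes>\<^sub>M lborel). w z * heat_kernel t (fst z - snd z))"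
    unfolding lborel_prod by (rule integral_complex_of_real)
  finally show ?thesis unfolding g_def w_def .
qed

section \<open>Small-time heat asymptotics and the Plancherel identity for test functions\<close>

text \<open>The kernel has mass one in either variable, so the variable on which f does not depend
  integrates out.\<close>

lemma integrable_heat_kernel_tensor:
  fixes f :: "'a::euclidean_space \<Rightarrow> real"
  assumes f: "integrable lborel f" and t: "t > 0"
  shows "integrable (lborel \<Otimes>\<^sub>M lborel) (\<lambda>z. f (fst z) * heat_kernel t (fst z - snd z))"
    and "(LINT z|(lborel \<Otimes>\<^sub>M lborel). f (fst z) * heat_kernel t (fst z - snd z)) = (LINT x|lborel. f x)"
    and "integrable (lborel \<Otimes>\<^sub>M lborel) (\<lambda>z. f (snd z) * heat_kernel t (fst z - snd z))"
    and "(LINT z|(lborel \<Otimes>\<^sub>M lborel). f (snd z) * heat_kernel t (fst z - snd z)) = (LINT x|lborel. f x)"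
proof -
  have [measurable]: "f \<in> borel_measurable borel" using f by auto
  note K = heat_kernel_integral[OF t, where 'a='a]
  have i: "integrable (lborel \<Otimes>\<^sub>M lborel) (\<lambda>(x, y). f x * heat_kernel t (x - y))"
  proof (rule lborel_pair.Fubini_integrable)
    show "(\<lambda>(x, y). f x * heat_kernel t (x - y)) \<in> borel_measurable (lborel \<Otimes>\<^sub>M lborel)" by measurable
    show "AE x in lborel. integrable lborel (\<lambda>y. case (x, y) of (x, y) \<Rightarrow> f x * heat_kernel t (x - y))"
      using K by (intro AE_I2) simp
    show "integrable lborel (\<lambda>x. LINT y|lborel. norm (case (x, y) of (x, y) \<Rightarrow> f x * heat_kernel t (x - y)))"
      using f by (simp add: abs_mult abs_of_nonneg[OF heat_kernel_nonneg[OF t]] K)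
  qed
  have i2: "integrable (lborel \<Otimes>\<^sub>M lborel) (\<lambda>(x, y). f y * heat_kernel t (x - y))"
    using lborel_pair.integrable_product_swap[OF i] by (simp add: case_prod_beta' heat_kernel_commute)
  show "integrable (lborel \<Otimes>\<^sub>M lborel) (\<lambda>z. f (fst z) * heat_kernel t (fst z - snd z))"
    using i by (simp add: case_prod_beta')
  show "integrable (lborel \<Otimes>\<^sub>M lborel) (\<lambda>z. f (snd z) * heat_kernel t (fst z - snd z))"
    using i2 by (simp add: case_prod_beta')
  show "(LINT z|(lborel \<Otimes>\<^sub>M lborel). f (fst z) * heat_kernel t (fst z - snd z)) = (LINT x|lborel. f x)"
    using lborel_pair.integral_fst'[OF i] K by (simp add: case_prod_beta')
  show "(LINT z|(lborel \<Otimes>\<^sub>M lborel). f (snd z) * heat_kernel t (fst z - snd z)) = (LINT x|lborel. f x)"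
    using lborel_pair.integral_snd[of "\<lambda>x y. f y * heat_kernel t (x - y)"] i2 K by (simp add: case_prod_beta')
qed

text \<open>Polarisation 2 a b = a^2 + b^2 - (a - b)^2 under the double integral of
  \<open>heat_pairing\<close>, with mass one in both variables. Nonnegativity of the defect gives
  Bessel's inequality, and its decay as t tends to 0 will give equality.\<close>

lemma heat_defect:
  fixes u :: "'a::euclidean_space \<Rightarrow> real"
  assumes u: "integrable lborel u" "u \<in> L2" and t: "t > 0"
  shows "(LINT \<xi>|lborel. exp (- t * (norm \<xi>)\<^sup>2) * (cmod (fourier_L1 u \<xi>))\<^sup>2) =
     (l2n u)\<^sup>2 - (1/2) * (LINT z|(lborel \<Otimes>\<^sub>M lborel). (u (fst z) - u (snd z))\<^sup>2 * heat_kernel t (fst z - snd z))"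
    (is "?L = _ - (1/2) * ?D")
proof -
  let ?P = "lborel \<Otimes>\<^sub>M lborel :: ('a \<times> 'a) measure"
  let ?h = "\<lambda>z::'a \<times> 'a. heat_kernel t (fst z - snd z)"
  have [measurable]: "u \<in> borel_measurable borel" using u by auto
  have u2: "integrable lborel (\<lambda>x. (u x)\<^sup>2)" using L2_integrable[OF u(2)] by simp
  have i1: "integrable ?P (\<lambda>z. (u (fst z))\<^sup>2 * ?h z)" "integrable ?P (\<lambda>z. (u (snd z))\<^sup>2 * ?h z)"
    using integrable_heat_kernel_tensor[OF u2 t] by auto
  have e1: "(LINT z|?P. (u (fst z))\<^sup>2 * ?h z) = (l2n u)\<^sup>2" "(LINT z|?P. (u (snd z))\<^sup>2 * ?h z) = (l2n u)\<^sup>2"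
    using integrable_heat_kernel_tensor[OF u2 t] by (auto simp: l2n_sq)
  have i2: "integrable ?P (\<lambda>z. u (fst z) * u (snd z) * ?h z)"
  proof (rule Bochner_Integration.integrable_bound)
    show "integrable ?P (\<lambda>z. (u (fst z))\<^sup>2 * ?h z + (u (snd z))\<^sup>2 * ?h z)" using i1 by simp
    show "AE z in ?P. norm (u (fst z) * u (snd z) * ?h z) \<le> norm ((u (fst z))\<^sup>2 * ?h z + (u (snd z))\<^sup>2 * ?h z)"
    proof (rule AE_I2)
      fix z :: "'a \<times> 'a"
      have "\<bar>u (fst z) * u (snd z)\<bar> \<le> (u (fst z))\<^sup>2 + (u (snd z))\<^sup>2"
      proof -
        have "2 * (\<bar>u (fst z)\<bar> * \<bar>u (snd z)\<bar>) \<le> (u (fst z))\<^sup>2 + (u (snd z))\<^sup>2"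
          using sum_squares_bound[of "\<bar>u (fst z)\<bar>" "\<bar>u (snd z)\<bar>"] by (simp add: mult.assoc)
        moreover have "0 \<le> \<bar>u (fst z)\<bar> * \<bar>u (snd z)\<bar>" by simp
        ultimately show ?thesis unfolding abs_mult by linarith
      qed
      then have "\<bar>u (fst z) * u (snd z)\<bar> * ?h z \<le> ((u (fst z))\<^sup>2 + (u (snd z))\<^sup>2) * ?h z"
        by (intro mult_right_mono heat_kernel_nonneg t)
      then show "norm (u (fst z) * u (snd z) * ?h z) \<le> norm ((u (fst z))\<^sup>2 * ?h z + (u (snd z))\<^sup>2 * ?h z)"
        using heat_kernel_nonneg[OF t, of "fst z - snd z"] by (simp add: abs_mult distrib_right)
    qed
  qed measurable
  have "complex_of_real ?L = (LINT \<xi>|lborel. complex_of_real (exp (- t * (norm \<xi>)\<^sup>2)) * (fourier_L1 u \<xi> * cnj (fourier_L1 u \<xi>)))"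
    unfolding integral_complex_of_real[symmetric] by (intro Bochner_Integration.integral_cong) (auto simp: complex_norm_square[symmetric])
  also have "\<dots> = complex_of_real (LINT z|?P. u (fst z) * u (snd z) * ?h z)"
    by (rule heat_pairing[OF u(1) u(1) t])
  finally have L: "?L = (LINT z|?P. u (fst z) * u (snd z) * ?h z)" by (simp only: of_real_eq_iff)
  have "?D = (LINT z|?P. (u (fst z))\<^sup>2 * ?h z + (u (snd z))\<^sup>2 * ?h z - 2 * (u (fst z) * u (snd z) * ?h z))"
    by (intro Bochner_Integration.integral_cong) (auto simp: power2_diff algebra_simps)
  also have "\<dots> = (l2n u)\<^sup>2 + (l2n u)\<^sup>2 - 2 * ?L"
    using i1 i2 e1 L by simp
  finally show ?thesis by linarith
qed

lemma fourier_L1_damped: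
  fixes u :: "'a::euclidean_space \<Rightarrow> real"
  assumes u: "integrable lborel u" "u \<in> L2" and t: "t > 0"
  shows "(\<lambda>\<xi>. complex_of_real (exp (- t * (norm \<xi>)\<^sup>2)) * fourier_L1 u \<xi>) \<in> L2"
    "integrable lborel (\<lambda>\<xi>. exp (- t * (norm \<xi>)\<^sup>2) * (cmod (fourier_L1 u \<xi>))\<^sup>2)"
proof -
  have [measurable]: "u \<in> borel_measurable borel" using u by auto
  define C where "C = (2 * pi) powr (- (real DIM('a) / 2)) * (LINT x|lborel. \<bar>u x\<bar>)"
  have C: "cmod (fourier_L1 u \<xi>) \<le> C" for \<xi> unfolding C_def by (rule fourier_L1_bound[OF u(1)])
  have i: "integrable lborel (\<lambda>\<xi>. exp (- t * (norm \<xi>)\<^sup>2) * (cmod (fourier_L1 u \<xi>))\<^sup>2)" if t: "t > 0" for t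
  proof (rule Bochner_Integration.integrable_bound)
    show "integrable lborel (\<lambda>\<xi>::'a. C\<^sup>2 * exp (- t * (norm \<xi>)\<^sup>2))"
      by (intro integrable_mult_right gaussian_integral t)
    show "AE \<xi> in lborel. norm (exp (- t * (norm \<xi>)\<^sup>2) * (cmod (fourier_L1 u \<xi>))\<^sup>2) \<le> norm (C\<^sup>2 * exp (- t * (norm \<xi>)\<^sup>2))"
      using C by (intro AE_I2) (simp add: mult.commute mult_left_mono power_mono)
  qed measurable
  show "integrable lborel (\<lambda>\<xi>. exp (- t * (norm \<xi>)\<^sup>2) * (cmod (fourier_L1 u \<xi>))\<^sup>2)" by (rule i[OF t])
  show "(\<lambda>\<xi>. complex_of_real (exp (- t * (norm \<xi>)\<^sup>2)) * fourier_L1 u \<xi>) \<in> L2"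
  proof (rule L2_I)
    have "(norm (complex_of_real (exp (- t * (norm \<xi>)\<^sup>2)) * fourier_L1 u \<xi>))\<^sup>2 =
      exp (- (2 * t) * (norm \<xi>)\<^sup>2) * (cmod (fourier_L1 u \<xi>))\<^sup>2" for \<xi> :: 'a
      by (simp add: norm_mult power_mult_distrib flip: exp_double)
    then show "integrable lborel (\<lambda>\<xi>. (norm (complex_of_real (exp (- t * (norm \<xi>)\<^sup>2)) * fourier_L1 u \<xi>))\<^sup>2)"
      using i[of "2 * t"] t by simp
  qed measurable
qed

text \<open>Dropping the defect bounds the damped transforms by the norm of u, and Fatou removes the
  damping.\<close>

lemma fourier_L1_L2:
  fixes u :: "'a::euclidean_space \<Rightarrow> real"
  assumes u: "integrable lborel u" "u \<in> L2"
  shows "fourier_L1 u \<in> L2" "l2n (fourier_L1 u) \<le> l2n u"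
proof -
  have [measurable]: "u \<in> borel_measurable borel" using u by auto
  define f where "f n \<xi> = complex_of_real (exp (- (1 / real (Suc n)) * (norm \<xi>)\<^sup>2)) * fourier_L1 u \<xi>" for n and \<xi> :: 'a
  have fL: "f n \<in> L2" for n unfolding f_def[abs_def] by (rule fourier_L1_damped[OF u]) simp
  have le: "l2n (f n) \<le> l2n u" for n
  proof (rule power2_le_imp_le)
    \<comment> \<open>Squaring doubles the exponent of the damping factor, hence the 2.\<close>
    define t where "t = 2 * (1 / real (Suc n))"
    have t: "t > 0" unfolding t_def by simp
    have "(norm (f n \<xi>))\<^sup>2 = exp (- t * (norm \<xi>)\<^sup>2) * (cmod (fourier_L1 u \<xi>))\<^sup>2" for \<xi> :: 'a
      unfolding f_def t_def by (simp add: norm_mult power_mult_distrib flip: exp_double)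
    then have "(l2n (f n))\<^sup>2 = (LINT \<xi>|lborel. exp (- t * (norm \<xi>)\<^sup>2) * (cmod (fourier_L1 u \<xi>))\<^sup>2)"
      unfolding l2n_sq by simp
    moreover have "0 \<le> (LINT z|(lborel \<Otimes>\<^sub>M lborel). (u (fst z) - u (snd z))\<^sup>2 * heat_kernel t (fst z - snd z))"
      by (intro integral_nonneg_AE AE_I2) (simp add: heat_kernel_nonneg[OF t])
    ultimately show "(l2n (f n))\<^sup>2 \<le> (l2n u)\<^sup>2" using heat_defect[OF u t] by simp
  qed simp
  have lim: "(\<lambda>n. f n \<xi>) \<longlonglongrightarrow> fourier_L1 u \<xi>" for \<xi>
  proof -
    have "(\<lambda>n. complex_of_real (exp (- (1 / real (Suc n)) * (norm \<xi>)\<^sup>2)) * fourier_L1 u \<xi>)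
      \<longlonglongrightarrow> complex_of_real (exp (- 0 * (norm \<xi>)\<^sup>2)) * fourier_L1 u \<xi>"
      using LIMSEQ_inverse_real_of_nat by (intro tendsto_intros) (simp add: inverse_eq_divide)
    then show ?thesis unfolding f_def by simp
  qed
  show "fourier_L1 u \<in> L2" "l2n (fourier_L1 u) \<le> l2n u"
    using L2_Fatou[of f "fourier_L1 u" 0 "l2n u"] fL lim le by auto
qed

text \<open>With a = |z|^2 / (4 t), the product a exp (- a) is at most 2 exp (- a / 2), and exp (- a
  / 2) is the Gaussian at time 2 t; the powers of sqrt 2 compare the normalisations. Since the bound
  is again a heat kernel, mass one remains available.\<close>

lemma heat_kernel_second_moment:
  fixes z :: "'a::euclidean_space"
  assumes t: "t > 0"
  shows "(norm z)\<^sup>2 * heat_kernel t z \<le> (8 * sqrt 2 ^ DIM('a)) * t * heat_kernel (2 * t) z"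
proof -
  define a where "a = (norm z)\<^sup>2 / (4 * t)"
  have "a / 2 \<le> exp (a / 2)" using exp_ge_add_one_self[of "a / 2"] by linarith
  then have "a * exp (- a) \<le> 2 * exp (a / 2) * exp (- a)" by (intro mult_right_mono) auto
  also have "\<dots> = 2 * exp (- (a / 2))" by (simp flip: exp_add)
  finally have 1: "a * exp (- a) \<le> 2 * exp (- (a / 2))" .
  have k: "1 / sqrt (4 * pi * t) = sqrt 2 * (1 / sqrt (4 * pi * (2 * t)))"
  proof -
    have "sqrt (4 * pi * (2 * t)) = sqrt 2 * sqrt (4 * pi * t)"
      unfolding real_sqrt_mult[symmetric] by (simp add: mult_ac)
    then show ?thesis by simp
  qed
  have "(norm z)\<^sup>2 * heat_kernel t z = (1 / sqrt (4 * pi * t)) ^ DIM('a) * (4 * t) * (a * exp (- a))"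
    unfolding heat_kernel_def a_def using t by simp
  also have "\<dots> \<le> (1 / sqrt (4 * pi * t)) ^ DIM('a) * (4 * t) * (2 * exp (- (a / 2)))"
    using t by (intro mult_left_mono 1) auto
  also have "\<dots> = (8 * sqrt 2 ^ DIM('a)) * t * heat_kernel (2 * t) z"
    unfolding heat_kernel_def a_def k power_mult_distrib by simp
  finally show ?thesis .
qed

text \<open>The squared difference is at most C^2 |x - y|^2, and the kernel has second moment of
  order t. Only pairs with at least one point in a ball containing the support count, so the
  majorant is integrable.\<close>

lemma test_function_heat_defect:
  fixes f :: "'a::euclidean_space \<Rightarrow> real"
  assumes f: "f \<in> test_functions W"
  obtains K where "K \<ge> 0" "\<And>t. t > 0 \<Longrightarrow>
    (l2n f)\<^sup>2 - (LINT \<xi>|lborel. exp (- t * (norm \<xi>)\<^sup>2) * (cmod (fourier_L1 f \<xi>))\<^sup>2) \<le> K * t"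
proof -
  obtain C where C: "C \<ge> 0" "\<And>x y. \<bar>f x - f y\<bar> \<le> C * norm (x - y)" using test_functions_Lipschitz[OF f] by blast
  obtain R where R: "\<And>x. f x \<noteq> 0 \<Longrightarrow> norm x \<le> R" using test_functions_bounded_support[OF f] by blast
  define b where "b = (indicator (cball 0 R) :: 'a \<Rightarrow> real)"
  have b: "integrable lborel b" unfolding b_def by (rule integrable_indicator_ball)
  have b0: "0 \<le> b x" for x unfolding b_def by simp
  define A where "A = C\<^sup>2 * (8 * sqrt 2 ^ DIM('a))"
  have A: "A \<ge> 0" unfolding A_def by simp
  define K where "K = A * (LINT x|lborel. b x)"
  have [measurable]: "f \<in> borel_measurable borel" by (rule test_functions_measurable[OF f])
  have "(l2n f)\<^sup>2 - (LINT \<xi>|lborel. exp (- t * (norm \<xi>)\<^sup>2) * (cmod (fourier_L1 f \<xi>))\<^sup>2) \<le> K * t" if t: "t > 0" for t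
  proof -
    have t2: "2 * t > 0" using t by simp
    let ?P = "lborel \<Otimes>\<^sub>M lborel :: ('a \<times> 'a) measure"
    let ?m = "\<lambda>z. A * t * (b (fst z) * heat_kernel (2 * t) (fst z - snd z) + b (snd z) * heat_kernel (2 * t) (fst z - snd z))"
    have le: "(f (fst z) - f (snd z))\<^sup>2 * heat_kernel t (fst z - snd z) \<le> ?m z" for z
    proof (cases "f (fst z) = 0 \<and> f (snd z) = 0")
      case True
      have "0 \<le> ?m z" using t by (intro mult_nonneg_nonneg add_nonneg_nonneg A b0 heat_kernel_nonneg t2) simp_all
      then show ?thesis using True by simp
    next
      case False
      then have b1: "1 \<le> b (fst z) + b (snd z)" using R unfolding b_def by (auto simp: indicator_def)
      have "(f (fst z) - f (snd z))\<^sup>2 \<le> (C * norm (fst z - snd z))\<^sup>2"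
        using power_mono[OF C(2)[of "fst z" "snd z"], of 2] by simp
      then have "(f (fst z) - f (snd z))\<^sup>2 * heat_kernel t (fst z - snd z)
          \<le> C\<^sup>2 * ((norm (fst z - snd z))\<^sup>2 * heat_kernel t (fst z - snd z))"
        using mult_right_mono[OF _ heat_kernel_nonneg[OF t]] by (fastforce simp: power_mult_distrib mult.assoc)
      also have "\<dots> \<le> C\<^sup>2 * ((8 * sqrt 2 ^ DIM('a)) * t * heat_kernel (2 * t) (fst z - snd z))"
        by (intro mult_left_mono heat_kernel_second_moment t) auto
      also have "\<dots> = (A * t * heat_kernel (2 * t) (fst z - snd z)) * 1" unfolding A_def by simp
      also have "\<dots> \<le> (A * t * heat_kernel (2 * t) (fst z - snd z)) * (b (fst z) + b (snd z))"
        using t by (intro mult_left_mono b1 mult_nonneg_nonneg A heat_kernel_nonneg t2) simp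
      finally show ?thesis by (simp add: algebra_simps)
    qed
    note ih = integrable_heat_kernel_tensor[OF b t2]
    have "(LINT z|?P. (f (fst z) - f (snd z))\<^sup>2 * heat_kernel t (fst z - snd z)) \<le> (LINT z|?P. ?m z)"
    proof (rule integral_mono')
      show "integrable ?P ?m" using ih by simp
      show "0 \<le> ?m z" for z using t by (intro mult_nonneg_nonneg add_nonneg_nonneg A b0 heat_kernel_nonneg t2) simp_all
    qed (rule le)
    also have "\<dots> = A * t * (2 * (LINT x|lborel. b x))" using ih by simp
    also have "\<dots> = 2 * (K * t)" unfolding K_def by simp
    finally show ?thesis
      using heat_defect[OF test_functions_L2(2)[OF f] test_functions_L2(1)[OF f] t] by linarith
  qed
  moreover have "K \<ge> 0" unfolding K_def using A b0 by simp
  ultimately show ?thesis using that by blast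
qed

text \<open>Letting t tend to 0 in the defect estimate gives equality of norms. Dividing it by t,
  and using that (1 - exp (- t r)) / t tends to r, gives by Fatou a full derivative in
  \<open>L2\<close>.\<close>

lemma test_function_fourier:
  fixes f :: "'a::euclidean_space \<Rightarrow> real"
  assumes f: "f \<in> test_functions W"
  shows "l2n (fourier_L1 f) = l2n f" "integrable lborel (\<lambda>\<xi>. (norm \<xi>)\<^sup>2 * (cmod (fourier_L1 f \<xi>))\<^sup>2)"
proof -
  obtain K where K: "K \<ge> 0" "\<And>t. t > 0 \<Longrightarrow>
    (l2n f)\<^sup>2 - (LINT \<xi>|lborel. exp (- t * (norm \<xi>)\<^sup>2) * (cmod (fourier_L1 f \<xi>))\<^sup>2) \<le> K * t"
    using test_function_heat_defect[OF f] by blast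
  note fL = test_functions_L2(2)[OF f] test_functions_L2(1)[OF f]
  note F = fourier_L1_L2[OF fL]
  have [measurable]: "f \<in> borel_measurable borel" by (rule test_functions_measurable[OF f])
  note Fi = L2_integrable[OF F(1)]
  have lower: "(l2n f)\<^sup>2 \<le> (l2n (fourier_L1 f))\<^sup>2 + K * t" if t: "t > 0" for t
  proof -
    have "(LINT \<xi>|lborel. exp (- t * (norm \<xi>)\<^sup>2) * (cmod (fourier_L1 f \<xi>))\<^sup>2) \<le> (LINT \<xi>|lborel. (cmod (fourier_L1 f \<xi>))\<^sup>2)"
      by (intro integral_mono fourier_L1_damped[OF fL t] Fi) (use t in \<open>auto intro!: mult_left_le_one_le\<close>)
    then show ?thesis using K(2)[OF t] unfolding l2n_sq[of "fourier_L1 f"] by linarith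
  qed
  have "(l2n f)\<^sup>2 \<le> (l2n (fourier_L1 f))\<^sup>2"
  proof (rule field_le_epsilon)
    fix e :: real assume e: "e > 0"
    have "K * (e / (K + 1)) \<le> e" using K(1) e by (simp add: field_simps)
    then show "(l2n f)\<^sup>2 \<le> (l2n (fourier_L1 f))\<^sup>2 + e" using lower[of "e / (K + 1)"] K(1) e by simp
  qed
  then have "l2n f \<le> l2n (fourier_L1 f)" by (rule power2_le_imp_le) simp
  then show iso: "l2n (fourier_L1 f) = l2n f" using F(2) by simp
  \<comment> \<open>A square root, so that the defect estimate divided by t = 1 / (n + 1) is a bound
    for the \<open>l2n\<close> norm and \<open>L2_Fatou\<close> applies.\<close>
  define g where "g n \<xi> = sqrt (real (Suc n) * (1 - exp (- (1 / real (Suc n)) * (norm \<xi>)\<^sup>2))) * cmod (fourier_L1 f \<xi>)" for n and \<xi> :: 'a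
  have nn: "0 \<le> real (Suc n) * (1 - exp (- (1 / real (Suc n)) * (norm \<xi>)\<^sup>2))" for n and \<xi> :: 'a by simp
  have gsq: "(norm (g n \<xi>))\<^sup>2 = real (Suc n) * (1 - exp (- (1 / real (Suc n)) * (norm \<xi>)\<^sup>2)) * (cmod (fourier_L1 f \<xi>))\<^sup>2" for n \<xi>
    unfolding g_def using nn by (simp add: power_mult_distrib)
  have gi: "integrable lborel (\<lambda>\<xi>. (norm (g n \<xi>))\<^sup>2)" and gle: "(LINT \<xi>|lborel. (norm (g n \<xi>))\<^sup>2) \<le> K" for n
  proof -
    define t where "t = 1 / real (Suc n)"
    have t: "t > 0" unfolding t_def by simp
    have e: "(\<lambda>\<xi>. (norm (g n \<xi>))\<^sup>2) = (\<lambda>\<xi>. real (Suc n) * ((cmod (fourier_L1 f \<xi>))\<^sup>2 - exp (- t * (norm \<xi>)\<^sup>2) * (cmod (fourier_L1 f \<xi>))\<^sup>2))"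
      unfolding gsq t_def by (rule ext) (simp add: algebra_simps)
    show "integrable lborel (\<lambda>\<xi>. (norm (g n \<xi>))\<^sup>2)"
      unfolding e by (intro integrable_mult_right Bochner_Integration.integrable_diff Fi fourier_L1_damped[OF fL t])
    have "(LINT \<xi>|lborel. (norm (g n \<xi>))\<^sup>2) = real (Suc n) * ((l2n (fourier_L1 f))\<^sup>2 - (LINT \<xi>|lborel. exp (- t * (norm \<xi>)\<^sup>2) * (cmod (fourier_L1 f \<xi>))\<^sup>2))"
      unfolding e integral_mult_right_zero l2n_sq
      by (subst Bochner_Integration.integral_diff[OF Fi fourier_L1_damped(2)[OF fL t]]) simp
    also have "\<dots> \<le> real (Suc n) * (K * t)" unfolding iso by (intro mult_left_mono K(2) t) simp
    also have "\<dots> = K" unfolding t_def by simp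
    finally show "(LINT \<xi>|lborel. (norm (g n \<xi>))\<^sup>2) \<le> K" .
  qed
  have gm: "g n \<in> borel_measurable borel" for n unfolding g_def[abs_def] by measurable
  have gL: "g n \<in> L2" for n using gm gi by (rule L2_I)
  have "(\<lambda>\<xi>. norm \<xi> * cmod (fourier_L1 f \<xi>)) \<in> L2"
  proof (rule L2_Fatou(1)[of g _ 0 "sqrt K"])
    show "l2n (g n) \<le> sqrt K" for n unfolding l2n_def using gle by (rule real_sqrt_le_mono)
    have "(\<lambda>n. g n \<xi>) \<longlonglongrightarrow> norm \<xi> * cmod (fourier_L1 f \<xi>)" for \<xi>
    proof -
      have "(\<lambda>n. real (Suc n) * (1 - exp (- (1 / real (Suc n)) * r))) \<longlonglongrightarrow> r" for r by real_asymp
      from tendsto_mult[OF tendsto_real_sqrt[OF this[of "(norm \<xi>)\<^sup>2"]] tendsto_const]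
      show ?thesis unfolding g_def by simp
    qed
    then show "AE \<xi> in lborel. (\<lambda>n. g n \<xi>) \<longlonglongrightarrow> norm \<xi> * cmod (fourier_L1 f \<xi>)" by simp
  qed (use gL in auto)
  from L2_integrable[OF this] show "integrable lborel (\<lambda>\<xi>. (norm \<xi>)\<^sup>2 * (cmod (fourier_L1 f \<xi>))\<^sup>2)"
    by (simp add: norm_mult power_mult_distrib)
qed

section \<open>The Fourier transform of square integrable functions\<close>

definition trunc :: "real \<Rightarrow> ('a::euclidean_space \<Rightarrow> real) \<Rightarrow> 'a \<Rightarrow> real" where
  "trunc R u x = indicator (ball 0 R) x * u x"

lemma trunc_L2:
  assumes u: "u \<in> L2"
  shows "trunc R u \<in> L2"
proof -
  note [measurable] = L2_measurable[OF u]
  show ?thesis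
    by (rule L2_dominated[OF _ u, where C=1]) (auto simp: trunc_def[abs_def] indicator_def)
qed

lemma L2_bounded_support_integrable:
  fixes u :: "'a::euclidean_space \<Rightarrow> real"
  assumes u: "u \<in> L2" and b: "AE x in lborel. x \<notin> cball 0 R \<longrightarrow> u x = 0"
  shows "integrable lborel u"
proof (rule Bochner_Integration.integrable_bound)
  show "integrable lborel (\<lambda>x. (norm (u x))\<^sup>2 + indicator (cball 0 R) x)"
    using L2_integrable[OF u] integrable_indicator_ball by (intro Bochner_Integration.integrable_add)
  show "AE x in lborel. norm (u x) \<le> norm ((norm (u x))\<^sup>2 + indicator (cball 0 R) x :: real)"
    using b
  proof eventually_elim
    case (elim x)
    have "\<bar>u x\<bar> \<le> (u x)\<^sup>2 + 1" using sum_squares_bound[of "\<bar>u x\<bar>" 1] by simp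
    then show ?case using elim by (cases "x \<in> cball 0 R") auto
  qed
  show "u \<in> borel_measurable lborel" using L2_measurable[OF u] by simp
qed

lemma trunc_integrable: "u \<in> L2 \<Longrightarrow> integrable lborel (trunc R u)"
  by (rule L2_bounded_support_integrable[OF trunc_L2, where R=R]) (auto simp: trunc_def indicator_def)

lemma tendsto_0_le:
  fixes f g :: "'x \<Rightarrow> real"
  assumes "\<And>x. 0 \<le> f x" "\<And>x. f x \<le> g x" "(g \<longlongrightarrow> 0) F"
  shows "(f \<longlongrightarrow> 0) F"
  by (rule tendsto_sandwich[OF _ _ tendsto_const assms(3)]) (auto simp: assms(1,2))

lemma trunc_tendsto:
  fixes u :: "'a::euclidean_space \<Rightarrow> real"
  assumes u: "u \<in> L2"
  shows "((\<lambda>R. l2n (\<lambda>x. u x - trunc R u x)) \<longlongrightarrow> 0) at_top"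
proof -
  note [measurable] = L2_measurable[OF u]
  have "((\<lambda>R. LINT x|lborel. (norm (u x - trunc R u x))\<^sup>2) \<longlongrightarrow> integral\<^sup>L lborel (\<lambda>x::'a. 0 :: real)) at_top"
  proof (rule integral_dominated_convergence_at_top[where w="\<lambda>x::'a. (norm (u x))\<^sup>2"])
    show "AE x in lborel. ((\<lambda>R. (norm (u x - trunc R u x))\<^sup>2) \<longlongrightarrow> 0) at_top"
    proof (rule AE_I2, rule tendsto_eventually)
      fix x :: 'a
      show "\<forall>\<^sub>F R in at_top. (norm (u x - trunc R u x))\<^sup>2 = 0"
        using eventually_gt_at_top[of "norm x"] by eventually_elim (simp add: trunc_def)
    qed
    show "\<forall>\<^sub>F R in at_top. AE x in lborel. norm ((norm (u x - trunc R u x))\<^sup>2) \<le> (norm (u x))\<^sup>2"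
      by (auto simp: trunc_def indicator_def)
    show "(\<lambda>x. (norm (u x - trunc R u x))\<^sup>2) \<in> borel_measurable lborel" for R
    proof -
      have [measurable]: "ball (0::'a) R \<in> sets borel" by simp
      show ?thesis unfolding trunc_def by measurable
    qed
  qed (use L2_integrable[OF u] in auto)
  from tendsto_real_sqrt[OF this] show ?thesis unfolding l2n_def by simp
qed

lemma fourier_L1_diff:
  assumes "integrable lborel u" "integrable lborel v"
  shows "fourier_L1 (\<lambda>x. u x - v x) \<xi> = fourier_L1 u \<xi> - fourier_L1 v \<xi>"
  using fourier_L1_lin[OF assms, of 1 "-1"] by simp

lemma l2n_fourier_L1_diff:
  fixes u v :: "'a::euclidean_space \<Rightarrow> real"
  assumes u: "u \<in> L2" "integrable lborel u" and v: "v \<in> L2" "integrable lborel v"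
  shows "l2n (\<lambda>\<xi>. fourier_L1 u \<xi> - fourier_L1 v \<xi>) \<le> l2n (\<lambda>x. u x - v x)"
proof -
  have "l2n (fourier_L1 (\<lambda>x. u x - v x)) \<le> l2n (\<lambda>x. u x - v x)"
    by (intro fourier_L1_L2 L2_diff Bochner_Integration.integrable_diff u v)
  then show ?thesis unfolding l2n_def by (simp add: fourier_L1_diff[OF u(2) v(2)])
qed

text \<open>The predicate inside \<open>fourier_def\<close>, with \<open>l2n\<close> in place of the
  nonnegative integral; it determines \<open>U\<close> up to null sets.\<close>

definition is_fourier :: "('a::euclidean_space \<Rightarrow> real) \<Rightarrow> ('a \<Rightarrow> complex) \<Rightarrow> bool" where
  "is_fourier u U \<longleftrightarrow> U \<in> L2 \<and> ((\<lambda>R. l2n (\<lambda>\<xi>. fourier_L1 (trunc R u) \<xi> - U \<xi>)) \<longlongrightarrow> 0) at_top"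

lemma fourier_L1_trunc_L2: "u \<in> L2 \<Longrightarrow> fourier_L1 (trunc R u) \<in> L2"
  by (intro fourier_L1_L2 trunc_integrable trunc_L2)

lemma fourier_eq:
  fixes u :: "'a::euclidean_space \<Rightarrow> real"
  assumes u: "u \<in> L2"
  shows "fourier u = (SOME U. is_fourier u U)"
proof -
  have "((\<lambda>R. \<integral>\<^sup>+ \<xi>. ennreal ((cmod (fourier_L1 (\<lambda>x. indicator (ball 0 R) x * u x) \<xi> - U \<xi>))\<^sup>2) \<partial>lborel) \<longlongrightarrow> 0) at_top
    \<longleftrightarrow> ((\<lambda>R. l2n (\<lambda>\<xi>. fourier_L1 (trunc R u) \<xi> - U \<xi>)) \<longlongrightarrow> 0) at_top" if U: "U \<in> L2" for U
  proof -
    let ?g = "\<lambda>R. l2n (\<lambda>\<xi>. fourier_L1 (trunc R u) \<xi> - U \<xi>)"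
    have "(\<integral>\<^sup>+ \<xi>. ennreal ((cmod (fourier_L1 (\<lambda>x. indicator (ball 0 R) x * u x) \<xi> - U \<xi>))\<^sup>2) \<partial>lborel) = ennreal ((?g R)\<^sup>2)" for R
      using L2_nn_integral[OF L2_diff[OF fourier_L1_trunc_L2[OF u, of R] U]] unfolding trunc_def .
    then have "((\<lambda>R. \<integral>\<^sup>+ \<xi>. ennreal ((cmod (fourier_L1 (\<lambda>x. indicator (ball 0 R) x * u x) \<xi> - U \<xi>))\<^sup>2) \<partial>lborel) \<longlongrightarrow> 0) at_top
      \<longleftrightarrow> ((\<lambda>R. ennreal ((?g R)\<^sup>2)) \<longlongrightarrow> ennreal 0) at_top" by simp
    also have "\<dots> \<longleftrightarrow> ((\<lambda>R. (?g R)\<^sup>2) \<longlongrightarrow> 0) at_top"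
      by (rule tendsto_ennreal_iff) auto
    also have "\<dots> \<longleftrightarrow> (?g \<longlongrightarrow> 0) at_top"
    proof
      assume "((\<lambda>R. (?g R)\<^sup>2) \<longlongrightarrow> 0) at_top"
      from tendsto_real_sqrt[OF this] show "(?g \<longlongrightarrow> 0) at_top" by simp
    next
      assume "(?g \<longlongrightarrow> 0) at_top"
      from tendsto_power[OF this, of 2] show "((\<lambda>R. (?g R)\<^sup>2) \<longlongrightarrow> 0) at_top" by simp
    qed
    finally show ?thesis .
  qed
  then show ?thesis unfolding fourier_def is_fourier_def by (metis (no_types, lifting))
qed

text \<open>Completeness is applied along integer radii; the estimate by the tails
  \<open>a R\<close> then extends the convergence to all real radii.\<close>

lemma is_fourier_exists:
  fixes u :: "'a::euclidean_space \<Rightarrow> real"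
  assumes u: "u \<in> L2"
  shows "\<exists>U. is_fourier u U"
proof -
  define a where "a R = l2n (\<lambda>x. u x - trunc R u x)" for R
  have a: "(a \<longlongrightarrow> 0) at_top" unfolding a_def[abs_def] by (rule trunc_tendsto[OF u])
  have an: "(\<lambda>n. a (real n)) \<longlonglongrightarrow> 0"
    by (rule filterlim_compose[OF a filterlim_real_sequentially])
  note T = trunc_L2[OF u] trunc_integrable[OF u]
  have d: "l2n (\<lambda>\<xi>. fourier_L1 (trunc R u) \<xi> - fourier_L1 (trunc S u) \<xi>) \<le> a R + a S" for R S
  proof -
    have "l2n (\<lambda>\<xi>. fourier_L1 (trunc R u) \<xi> - fourier_L1 (trunc S u) \<xi>) \<le> l2n (\<lambda>x. trunc R u x - trunc S u x)"
      by (intro l2n_fourier_L1_diff T)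
    also have "\<dots> \<le> l2n (\<lambda>x. trunc R u x - u x) + l2n (\<lambda>x. u x - trunc S u x)"
      by (intro l2n_triangle_diff T u)
    finally show ?thesis unfolding a_def by (simp add: l2n_minus_commute[of u])
  qed
  obtain U where U: "U \<in> L2" "(\<lambda>n. l2n (\<lambda>\<xi>. fourier_L1 (trunc (real n) u) \<xi> - U \<xi>)) \<longlonglongrightarrow> 0"
  proof -
    have "\<exists>l\<in>L2. (\<lambda>n. l2n (\<lambda>\<xi>. fourier_L1 (trunc (real n) u) \<xi> - l \<xi>)) \<longlonglongrightarrow> 0"
    proof (rule L2_complete[OF fourier_L1_trunc_L2[OF u]])
      fix e :: real assume "e > 0"
      then have "\<forall>\<^sub>F n in sequentially. a (real n) < e / 2" using order_tendstoD(2)[OF an, of "e / 2"] by simp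
      then obtain M where M: "\<And>n. n \<ge> M \<Longrightarrow> a (real n) < e / 2" unfolding eventually_sequentially by blast
      show "\<exists>M. \<forall>m\<ge>M. \<forall>n\<ge>M. l2n (\<lambda>x. fourier_L1 (trunc (real m) u) x - fourier_L1 (trunc (real n) u) x) < e"
      proof (intro exI[of _ M] allI impI)
        fix m n assume "m \<ge> M" "n \<ge> M"
        then show "l2n (\<lambda>x. fourier_L1 (trunc (real m) u) x - fourier_L1 (trunc (real n) u) x) < e"
          using d[of "real m" "real n"] M[of m] M[of n] by linarith
      qed
    qed
    then show ?thesis using that by blast
  qed
  have le: "l2n (\<lambda>\<xi>. fourier_L1 (trunc R u) \<xi> - U \<xi>) \<le> a R" for R
  proof (rule LIMSEQ_le[OF tendsto_const])
    show "(\<lambda>n. a R + a (real n) + l2n (\<lambda>\<xi>. fourier_L1 (trunc (real n) u) \<xi> - U \<xi>)) \<longlonglongrightarrow> a R"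
      using tendsto_add[OF tendsto_add[OF tendsto_const an] U(2), of "a R"] by simp
    have "l2n (\<lambda>\<xi>. fourier_L1 (trunc R u) \<xi> - U \<xi>) \<le> a R + a (real n) + l2n (\<lambda>\<xi>. fourier_L1 (trunc (real n) u) \<xi> - U \<xi>)" for n
      using l2n_triangle_diff[OF fourier_L1_trunc_L2[OF u, of R] fourier_L1_trunc_L2[OF u, of "real n"] U(1)] d[of R "real n"]
      by linarith
    then show "\<exists>N. \<forall>n\<ge>N. l2n (\<lambda>\<xi>. fourier_L1 (trunc R u) \<xi> - U \<xi>) \<le> a R + a (real n) + l2n (\<lambda>\<xi>. fourier_L1 (trunc (real n) u) \<xi> - U \<xi>)"
      by blast
  qed
  have "((\<lambda>R. l2n (\<lambda>\<xi>. fourier_L1 (trunc R u) \<xi> - U \<xi>)) \<longlongrightarrow> 0) at_top"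
    by (rule tendsto_sandwich[OF _ _ tendsto_const a]) (use le in auto)
  then show ?thesis using U(1) unfolding is_fourier_def by blast
qed

lemma fourier_is_fourier: "u \<in> L2 \<Longrightarrow> is_fourier u (fourier u)"
  unfolding fourier_eq using is_fourier_exists by (rule someI_ex)

lemma fourier_L2: "u \<in> L2 \<Longrightarrow> fourier u \<in> L2"
  using fourier_is_fourier unfolding is_fourier_def by blast

lemma is_fourier_unique:
  assumes "is_fourier u U" and u: "u \<in> L2"
  shows "AE \<xi> in lborel. fourier u \<xi> = U \<xi>"
proof -
  have U: "U \<in> L2" "((\<lambda>R. l2n (\<lambda>\<xi>. fourier_L1 (trunc R u) \<xi> - U \<xi>)) \<longlongrightarrow> 0) at_top"
    and V: "fourier u \<in> L2" "((\<lambda>R. l2n (\<lambda>\<xi>. fourier_L1 (trunc R u) \<xi> - fourier u \<xi>)) \<longlongrightarrow> 0) at_top"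
    using assms(1) fourier_is_fourier[OF u] unfolding is_fourier_def by auto
  have le: "l2n (\<lambda>\<xi>. fourier u \<xi> - U \<xi>) \<le> l2n (\<lambda>\<xi>. fourier_L1 (trunc R u) \<xi> - fourier u \<xi>) + l2n (\<lambda>\<xi>. fourier_L1 (trunc R u) \<xi> - U \<xi>)" for R
    using l2n_triangle_diff[OF V(1) fourier_L1_trunc_L2[OF u, of R] U(1)] l2n_minus_commute[of "fourier u"] by simp
  have "l2n (\<lambda>\<xi>. fourier u \<xi> - U \<xi>) \<le> 0 + 0"
    by (rule tendsto_lowerbound[OF tendsto_add[OF V(2) U(2)]]) (use le in auto)
  then have "l2n (\<lambda>\<xi>. fourier u \<xi> - U \<xi>) = 0" using l2n_nonneg[of "\<lambda>\<xi>. fourier u \<xi> - U \<xi>"] by linarith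
  from l2n_eq_0[OF L2_diff[OF V(1) U(1)] this] show ?thesis by eventually_elim simp
qed

lemma fourier_lin:
  assumes u: "u \<in> L2" and v: "v \<in> L2"
  shows "AE \<xi> in lborel. fourier (\<lambda>x. a * u x + b * v x) \<xi> = of_real a * fourier u \<xi> + of_real b * fourier v \<xi>"
proof (rule is_fourier_unique[OF _ L2_add[OF L2_cmult[OF u] L2_cmult[OF v]]])
  have U: "fourier u \<in> L2" "((\<lambda>R. l2n (\<lambda>\<xi>. fourier_L1 (trunc R u) \<xi> - fourier u \<xi>)) \<longlongrightarrow> 0) at_top"
    and V: "fourier v \<in> L2" "((\<lambda>R. l2n (\<lambda>\<xi>. fourier_L1 (trunc R v) \<xi> - fourier v \<xi>)) \<longlongrightarrow> 0) at_top"
    using fourier_is_fourier u v unfolding is_fourier_def by auto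
  have e: "fourier_L1 (trunc R (\<lambda>x. a * u x + b * v x)) \<xi> - (of_real a * fourier u \<xi> + of_real b * fourier v \<xi>)
    = a *\<^sub>R (fourier_L1 (trunc R u) \<xi> - fourier u \<xi>) + b *\<^sub>R (fourier_L1 (trunc R v) \<xi> - fourier v \<xi>)" for R \<xi>
  proof -
    have "trunc R (\<lambda>x. a * u x + b * v x) = (\<lambda>x. a * trunc R u x + b * trunc R v x)"
      by (rule ext) (simp add: trunc_def algebra_simps)
    then show ?thesis
      using fourier_L1_lin[OF trunc_integrable[OF u, of R] trunc_integrable[OF v, of R], of a b \<xi>]
      by (simp add: scaleR_conv_of_real algebra_simps)
  qed
  have le: "l2n (\<lambda>\<xi>. fourier_L1 (trunc R (\<lambda>x. a * u x + b * v x)) \<xi> - (of_real a * fourier u \<xi> + of_real b * fourier v \<xi>))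
    \<le> \<bar>a\<bar> * l2n (\<lambda>\<xi>. fourier_L1 (trunc R u) \<xi> - fourier u \<xi>) + \<bar>b\<bar> * l2n (\<lambda>\<xi>. fourier_L1 (trunc R v) \<xi> - fourier v \<xi>)" for R
    unfolding e l2n_scaleR[symmetric]
    by (intro l2n_triangle L2_scaleR L2_diff U V fourier_L1_trunc_L2 u v)
  have "((\<lambda>R. \<bar>a\<bar> * l2n (\<lambda>\<xi>. fourier_L1 (trunc R u) \<xi> - fourier u \<xi>) + \<bar>b\<bar> * l2n (\<lambda>\<xi>. fourier_L1 (trunc R v) \<xi> - fourier v \<xi>)) \<longlongrightarrow> \<bar>a\<bar> * 0 + \<bar>b\<bar> * 0) at_top"
    by (intro tendsto_intros U V)
  then have "((\<lambda>R. \<bar>a\<bar> * l2n (\<lambda>\<xi>. fourier_L1 (trunc R u) \<xi> - fourier u \<xi>) + \<bar>b\<bar> * l2n (\<lambda>\<xi>. fourier_L1 (trunc R v) \<xi> - fourier v \<xi>)) \<longlongrightarrow> 0) at_top"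
    by simp
  with le have "((\<lambda>R. l2n (\<lambda>\<xi>. fourier_L1 (trunc R (\<lambda>x. a * u x + b * v x)) \<xi> - (of_real a * fourier u \<xi> + of_real b * fourier v \<xi>))) \<longlongrightarrow> 0) at_top"
    by (rule tendsto_0_le[OF l2n_nonneg])
  then show "is_fourier (\<lambda>x. a * u x + b * v x) (\<lambda>\<xi>. of_real a * fourier u \<xi> + of_real b * fourier v \<xi>)"
    unfolding is_fourier_def by (intro conjI L2_add L2_cmult U V)
qed

lemma fourier_diff:
  assumes "u \<in> L2" "v \<in> L2"
  shows "AE \<xi> in lborel. fourier (\<lambda>x. u x - v x) \<xi> = fourier u \<xi> - fourier v \<xi>"
  using fourier_lin[OF assms, of 1 "-1"] by simp

lemma fourier_eq_fourier_L1:
  assumes u: "u \<in> L2" "integrable lborel u"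
  shows "AE \<xi> in lborel. fourier u \<xi> = fourier_L1 u \<xi>"
proof (rule is_fourier_unique[OF _ u(1)])
  have "l2n (\<lambda>\<xi>. fourier_L1 (trunc R u) \<xi> - fourier_L1 u \<xi>) \<le> l2n (\<lambda>x. u x - trunc R u x)" for R
    unfolding l2n_minus_commute[of u] by (intro l2n_fourier_L1_diff u trunc_L2 trunc_integrable)
  then have "((\<lambda>R. l2n (\<lambda>\<xi>. fourier_L1 (trunc R u) \<xi> - fourier_L1 u \<xi>)) \<longlongrightarrow> 0) at_top"
    by (intro tendsto_sandwich[OF _ _ tendsto_const trunc_tendsto[OF u(1)]]) auto
  then show "is_fourier u (fourier_L1 u)" unfolding is_fourier_def using fourier_L1_L2 u by blast
qed

text \<open>Equality holds everywhere, not just almost everywhere: the transforms of the truncations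
  agree exactly, so the choice in \<open>fourier_def\<close> is made from the same
  predicate.\<close>

lemma fourier_cong_AE:
  fixes u v :: "'a::euclidean_space \<Rightarrow> real"
  assumes [measurable]: "u \<in> borel_measurable borel" "v \<in> borel_measurable borel"
    and e: "AE x in lborel. u x = v x"
  shows "fourier u = fourier v"
proof -
  have "fourier_L1 (\<lambda>x. indicator (ball 0 R) x * u x) = fourier_L1 (\<lambda>x. indicator (ball 0 R) x * v x)" for R
  proof (rule ext)
    fix \<xi>
    have [measurable]: "ball (0::'a) R \<in> sets borel" by simp
    have "(LINT x|lborel. cis (- (x \<bullet> \<xi>)) * complex_of_real (indicator (ball 0 R) x * u x)) =
      (LINT x|lborel. cis (- (x \<bullet> \<xi>)) * complex_of_real (indicator (ball 0 R) x * v x))"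
    proof (rule integral_cong_AE)
      show "(\<lambda>x. cis (- (x \<bullet> \<xi>)) * complex_of_real (indicator (ball 0 R) x * u x)) \<in> borel_measurable lborel"
        by measurable
      show "(\<lambda>x. cis (- (x \<bullet> \<xi>)) * complex_of_real (indicator (ball 0 R) x * v x)) \<in> borel_measurable lborel"
        by measurable
    qed (use e in auto)
    then show "fourier_L1 (\<lambda>x. indicator (ball 0 R) x * u x) \<xi> = fourier_L1 (\<lambda>x. indicator (ball 0 R) x * v x) \<xi>"
      unfolding fourier_L1_def by simp
  qed
  then show ?thesis unfolding fourier_def by simp
qed

lemma l2n_fourier_le:
  fixes u :: "'a::euclidean_space \<Rightarrow> real"
  assumes u: "u \<in> L2"
  shows "l2n (fourier u) \<le> l2n u"
proof -
  note F = fourier_L2[OF u]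
  have lim: "((\<lambda>R. l2n (\<lambda>\<xi>. fourier_L1 (trunc R u) \<xi> - fourier u \<xi>)) \<longlongrightarrow> 0) at_top"
    using fourier_is_fourier[OF u] unfolding is_fourier_def by blast
  have "l2n (fourier u) \<le> l2n u + l2n (\<lambda>\<xi>. fourier_L1 (trunc R u) \<xi> - fourier u \<xi>)" for R
  proof -
    have "l2n (fourier_L1 (trunc R u)) \<le> l2n (trunc R u)" by (intro fourier_L1_L2 trunc_L2 trunc_integrable u)
    also have "\<dots> \<le> l2n u" by (intro l2n_mono trunc_L2 u) (auto simp: trunc_def indicator_def)
    finally show ?thesis using l2n_diff_le[OF fourier_L1_trunc_L2[OF u, of R] F] by linarith
  qed
  then have "l2n (fourier u) \<le> l2n u + 0"
    by (intro tendsto_lowerbound[OF tendsto_add[OF tendsto_const lim]]) auto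
  then show ?thesis by simp
qed

lemma l2n_fourier_diff_le:
  fixes u v :: "'a::euclidean_space \<Rightarrow> real"
  assumes "u \<in> L2" "v \<in> L2"
  shows "l2n (\<lambda>\<xi>. fourier u \<xi> - fourier v \<xi>) \<le> l2n (\<lambda>x. u x - v x)"
proof -
  have [measurable]: "fourier u \<in> borel_measurable borel" "fourier v \<in> borel_measurable borel"
    "fourier (\<lambda>x. u x - v x) \<in> borel_measurable borel"
    using assms L2_diff[OF assms] fourier_L2 L2_measurable by blast+
  have "l2n (\<lambda>\<xi>. fourier u \<xi> - fourier v \<xi>) = l2n (fourier (\<lambda>x. u x - v x))"
    by (rule l2n_cong_AE) (use fourier_diff[OF assms] in auto)
  then show ?thesis using l2n_fourier_le[OF L2_diff[OF assms]] by simp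
qed

text \<open>Both norms are continuous in \<open>L2\<close>, and they agree on the dense set of test
  functions.\<close>

lemma plancherel:
  fixes u :: "'a::euclidean_space \<Rightarrow> real"
  assumes u: "u \<in> L2"
  shows "l2n (fourier u) = l2n u"
proof -
  have "\<bar>l2n (fourier u) - l2n u\<bar> \<le> 0 + e" if e: "e > 0" for e
  proof -
    have e2: "e / 2 > 0" using e by simp
    obtain f where f: "f \<in> test_functions UNIV" "l2n (\<lambda>x. u x - f x) < e / 2"
      using test_functions_dense[OF u open_UNIV _ e2] by auto
    note fL = test_functions_L2[OF f(1)]
    have [measurable]: "fourier f \<in> borel_measurable borel" "f \<in> borel_measurable borel"
      using fourier_L2[OF fL(1)] L2_measurable fL(1) by blast+
    have "l2n (fourier f) = l2n (fourier_L1 f)"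
      by (intro l2n_cong_AE fourier_eq_fourier_L1 fL) measurable
    then have "l2n (fourier f) = l2n f" using test_function_fourier(1)[OF f(1)] by simp
    moreover have "\<bar>l2n (fourier u) - l2n (fourier f)\<bar> \<le> l2n (\<lambda>x. u x - f x)"
      using l2n_diff_le[OF fourier_L2[OF u] fourier_L2[OF fL(1)]] l2n_fourier_diff_le[OF u fL(1)] by linarith
    moreover have "\<bar>l2n u - l2n f\<bar> \<le> l2n (\<lambda>x. u x - f x)" by (rule l2n_diff_le[OF u fL(1)])
    ultimately show ?thesis using f(2) by linarith
  qed
  then have "\<bar>l2n (fourier u) - l2n u\<bar> \<le> 0" by (rule field_le_epsilon)
  then show ?thesis by simp
qed

lemma cnj_measurable[measurable]: "cnj \<in> borel_measurable borel"
  by (intro borel_measurable_continuous_onI continuous_intros)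

lemma L2_Re_mult_cnj_integrable:
  fixes f g :: "'a::euclidean_space \<Rightarrow> complex"
  assumes "f \<in> L2" "g \<in> L2"
  shows "integrable lborel (\<lambda>\<xi>. Re (f \<xi> * cnj (g \<xi>)))"
proof -
  note [measurable] = assms[THEN L2_measurable]
  have "(\<lambda>\<xi>. cnj (g \<xi>)) \<in> L2"
    by (rule L2_dominated[OF _ assms(2), where C=1]) auto
  then show ?thesis using L2_mult_integrable[OF assms(1)] by (intro integrable_Re)
qed

lemma L2_Re_mult_cnj_le:
  fixes f g :: "'a::euclidean_space \<Rightarrow> complex"
  assumes "f \<in> L2" "g \<in> L2"
  shows "\<bar>LINT \<xi>|lborel. Re (f \<xi> * cnj (g \<xi>))\<bar> \<le> l2n f * l2n g"
proof -
  have "\<bar>LINT \<xi>|lborel. Re (f \<xi> * cnj (g \<xi>))\<bar> \<le> (LINT \<xi>|lborel. \<bar>Re (f \<xi> * cnj (g \<xi>))\<bar>)"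
    by (rule integral_abs_bound)
  also have "\<dots> \<le> (LINT \<xi>|lborel. norm (f \<xi>) * norm (g \<xi>))"
  proof (rule integral_mono)
    show "integrable lborel (\<lambda>\<xi>. norm (f \<xi>) * norm (g \<xi>))"
      by (intro L2_mult_integrable L2_norm assms)
    show "\<bar>Re (f \<xi> * cnj (g \<xi>))\<bar> \<le> norm (f \<xi>) * norm (g \<xi>)" for \<xi>
      using abs_Re_le_cmod[of "f \<xi> * cnj (g \<xi>)"] by (simp add: norm_mult)
  qed (intro integrable_abs L2_Re_mult_cnj_integrable assms)
  also have "\<dots> \<le> l2n f * l2n g" by (rule L2_norm_mult_integral_le[OF assms])
  finally show ?thesis .
qed

lemma l2n_sq_add_complex:
  fixes f g :: "'a::euclidean_space \<Rightarrow> complex"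
  assumes "f \<in> L2" "g \<in> L2"
  shows "(l2n (\<lambda>\<xi>. f \<xi> + g \<xi>))\<^sup>2 = (l2n f)\<^sup>2 + 2 * (LINT \<xi>|lborel. Re (f \<xi> * cnj (g \<xi>))) + (l2n g)\<^sup>2"
proof -
  define h where "h \<xi> = Re (f \<xi> * cnj (g \<xi>))" for \<xi>
  have "(norm (f \<xi> + g \<xi>))\<^sup>2 = (norm (f \<xi>))\<^sup>2 + 2 * h \<xi> + (norm (g \<xi>))\<^sup>2" for \<xi>
    unfolding cmod_power2 h_def by (simp add: power2_eq_square algebra_simps)
  moreover have "integrable lborel h" unfolding h_def[abs_def] by (rule L2_Re_mult_cnj_integrable[OF assms])
  ultimately show ?thesis
    unfolding l2n_sq h_def[symmetric] using L2_integrable[OF assms(1)] L2_integrable[OF assms(2)] by simp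
qed

lemma l2n_sq_lin:
  fixes u v :: "'a::euclidean_space \<Rightarrow> real"
  assumes u: "u \<in> L2" and v: "v \<in> L2"
  shows "(l2n (\<lambda>x. u x + v x))\<^sup>2 = (l2n u)\<^sup>2 + 2 * (LINT x|lborel. u x * v x) + (l2n v)\<^sup>2"
    and "(l2n (\<lambda>x. u x - v x))\<^sup>2 = (l2n u)\<^sup>2 - 2 * (LINT x|lborel. u x * v x) + (l2n v)\<^sup>2"
  using L2.I_square[OF u v, of 1 1] L2.I_square[OF u v, of 1 "-1"]
  unfolding L2.nrm_sq[OF L2_add[OF u v]] L2.nrm_sq[OF L2_diff[OF u v]] L2.nrm_sq[OF u] L2.nrm_sq[OF v]
  by simp_all

text \<open>Polarisation of \<open>plancherel\<close>, by comparing the two expansions of the norm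
  of u + v.\<close>

lemma parseval:
  fixes u v :: "'a::euclidean_space \<Rightarrow> real"
  assumes u: "u \<in> L2" and v: "v \<in> L2"
  shows "(LINT \<xi>|lborel. Re (fourier u \<xi> * cnj (fourier v \<xi>))) = (LINT x|lborel. u x * v x)"
proof -
  note UV = fourier_L2[OF u] fourier_L2[OF v]
  note s = L2_add[OF u v]
  have [measurable]: "fourier u \<in> borel_measurable borel" "fourier v \<in> borel_measurable borel"
    "fourier (\<lambda>x. u x + v x) \<in> borel_measurable borel"
    using UV fourier_L2[OF s] L2_measurable by blast+
  have "l2n (\<lambda>\<xi>. fourier u \<xi> + fourier v \<xi>) = l2n (fourier (\<lambda>x. u x + v x))"
    by (rule l2n_cong_AE) (use fourier_lin[OF u v, of 1 1] in auto)
  then have "(l2n (\<lambda>\<xi>. fourier u \<xi> + fourier v \<xi>))\<^sup>2 = (l2n (\<lambda>x. u x + v x))\<^sup>2" using plancherel[OF s] by simp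
  then show ?thesis
    unfolding l2n_sq_add_complex[OF UV] l2n_sq_lin(1)[OF u v] plancherel[OF u] plancherel[OF v] by linarith
qed

section \<open>Reflection of frequencies and the Hartley transform\<close>

lemma AE_lborel_uminus: "(AE x::'a::euclidean_space in lborel. P x) \<Longrightarrow> AE x in lborel. P (- x)"
proof -
  assume "AE x::'a in lborel. P x"
  then have "AE x::'a in distr lborel borel (\<lambda>y. 0 - y). P x" by (simp only: lborel_reflect)
  then have "AE x::'a in lborel. P (0 - x)" by (rule AE_distrD[rotated]) simp
  then show ?thesis by simp
qed

lemma lborel_integral_uminus:
  fixes f :: "'a::euclidean_space \<Rightarrow> 'b::{banach, second_countable_topology}"
  assumes "f \<in> borel_measurable borel"
  shows "(LINT y|lborel. f (- y)) = (LINT y|lborel. f y)"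
    and "integrable lborel (\<lambda>y. f (- y)) \<longleftrightarrow> integrable lborel f"
  using lborel_integral_reflect[OF assms, of 0] by simp_all

lemma L2_uminus:
  fixes f :: "'a::euclidean_space \<Rightarrow> 'b::{real_normed_vector, second_countable_topology}"
  assumes "f \<in> L2"
  shows "(\<lambda>x. f (- x)) \<in> L2" "l2n (\<lambda>x. f (- x)) = l2n f"
proof -
  note [measurable] = L2_measurable[OF assms]
  have m: "(\<lambda>x. (norm (f x))\<^sup>2) \<in> borel_measurable borel" by measurable
  show "(\<lambda>x. f (- x)) \<in> L2"
    by (rule L2_I) (use lborel_integral_uminus(2)[OF m] L2_integrable[OF assms] in auto)
  show "l2n (\<lambda>x. f (- x)) = l2n f" unfolding l2n_def using lborel_integral_uminus(1)[OF m] by simp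
qed

text \<open>For integrable real functions the symmetry is exact. Hence the reflected and conjugated
  transform is also the limit of the truncated transforms, and uniqueness of the limit
  concludes.\<close>

lemma fourier_uminus:
  fixes u :: "'a::euclidean_space \<Rightarrow> real"
  assumes u: "u \<in> L2"
  shows "AE \<xi> in lborel. fourier u (- \<xi>) = cnj (fourier u \<xi>)"
proof -
  have F: "fourier u \<in> L2" "((\<lambda>R. l2n (\<lambda>\<xi>. fourier_L1 (trunc R u) \<xi> - fourier u \<xi>)) \<longlongrightarrow> 0) at_top"
    using fourier_is_fourier[OF u] unfolding is_fourier_def by auto
  have 1: "fourier_L1 v (- \<xi>) = cnj (fourier_L1 v \<xi>)" for v :: "'a \<Rightarrow> real" and \<xi>
  proof -
    have "cnj (cis (- (x \<bullet> \<xi>)) * complex_of_real (v x)) = cis (x \<bullet> \<xi>) * complex_of_real (v x)" for x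
      by (simp add: cis_cnj)
    then have "cnj (LINT x|lborel. cis (- (x \<bullet> \<xi>)) * complex_of_real (v x)) = (LINT x|lborel. cis (x \<bullet> \<xi>) * complex_of_real (v x))"
      using Bochner_Integration.integral_cnj[of lborel "\<lambda>x. cis (- (x \<bullet> \<xi>)) * complex_of_real (v x)"] by (simp only:)
    then show ?thesis unfolding fourier_L1_def by simp
  qed
  have m: "fourier u \<in> borel_measurable borel" by (rule L2_measurable[OF F(1)])
  have cL: "(\<lambda>\<xi>. cnj (fourier u (- \<xi>))) \<in> L2"
    by (rule L2_dominated[OF _ L2_uminus(1)[OF F(1)], where C=1]) (use m in auto)
  have "l2n (\<lambda>\<xi>. fourier_L1 (trunc R u) \<xi> - cnj (fourier u (- \<xi>))) = l2n (\<lambda>\<xi>. fourier_L1 (trunc R u) \<xi> - fourier u \<xi>)" for R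
  proof -
    have "norm (fourier_L1 (trunc R u) \<xi> - cnj (fourier u (- \<xi>))) = norm (fourier_L1 (trunc R u) (- \<xi>) - fourier u (- \<xi>))" for \<xi>
    proof -
      have "fourier_L1 (trunc R u) \<xi> = cnj (fourier_L1 (trunc R u) (- \<xi>))" using 1[of "trunc R u" \<xi>] by simp
      then show ?thesis by (metis complex_cnj_diff complex_mod_cnj)
    qed
    then have "l2n (\<lambda>\<xi>. fourier_L1 (trunc R u) \<xi> - cnj (fourier u (- \<xi>))) = l2n (\<lambda>\<xi>. fourier_L1 (trunc R u) (- \<xi>) - fourier u (- \<xi>))"
      unfolding l2n_def by simp
    also have "\<dots> = l2n (\<lambda>\<xi>. fourier_L1 (trunc R u) \<xi> - fourier u \<xi>)"
      by (rule L2_uminus(2)[OF L2_diff[OF fourier_L1_trunc_L2[OF u] F(1)]])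
    finally show ?thesis .
  qed
  then have "is_fourier u (\<lambda>\<xi>. cnj (fourier u (- \<xi>)))" unfolding is_fourier_def using F(2) cL by simp
  from is_fourier_unique[OF this u] show ?thesis by eventually_elim simp
qed

text \<open>
  The Hartley transform is a symmetric isometry of the real space \<open>L2\<close>, hence an
  involution. This replaces the Fourier inversion theorem.
\<close>

definition hartley :: "('a::euclidean_space \<Rightarrow> real) \<Rightarrow> 'a \<Rightarrow> real" where
  "hartley u \<xi> = Re (fourier u \<xi>) - Im (fourier u \<xi>)"

lemma hartley_measurable: "u \<in> L2 \<Longrightarrow> hartley u \<in> borel_measurable borel"
  using L2_measurable[OF fourier_L2] unfolding hartley_def[abs_def] by measurable

lemma abs_hartley_le: "\<bar>hartley u \<xi>\<bar> \<le> 2 * cmod (fourier u \<xi>)"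
  unfolding hartley_def using abs_Re_le_cmod[of "fourier u \<xi>"] abs_Im_le_cmod[of "fourier u \<xi>"] by linarith

lemma hartley_L2: "u \<in> L2 \<Longrightarrow> hartley u \<in> L2"
  by (rule L2_dominated[OF hartley_measurable fourier_L2, where C=2]) (auto simp: abs_hartley_le)

text \<open>The square of Re - Im differs from the squared modulus by a multiple of Re times Im,
  which is odd by \<open>fourier_uminus\<close> and therefore has integral 0.\<close>

lemma hartley_isometry:
  fixes u :: "'a::euclidean_space \<Rightarrow> real"
  assumes u: "u \<in> L2"
  shows "l2n (hartley u) = l2n u"
proof -
  note F = fourier_L2[OF u]
  note [measurable] = L2_measurable[OF F]
  define g where "g \<xi> = Re (fourier u \<xi>) * Im (fourier u \<xi>)" for \<xi>
  have gm: "g \<in> borel_measurable borel" unfolding g_def[abs_def] by measurable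
  have gi: "integrable lborel g"
  proof (rule Bochner_Integration.integrable_bound[OF L2_integrable[OF F]])
    show "AE \<xi> in lborel. norm (g \<xi>) \<le> norm ((norm (fourier u \<xi>))\<^sup>2)"
      unfolding g_def power2_eq_square
      by (intro AE_I2) (simp add: abs_mult mult_mono abs_Re_le_cmod abs_Im_le_cmod)
  qed (use gm in simp)
  have "AE \<xi> in lborel. g (- \<xi>) = - g \<xi>"
    using fourier_uminus[OF u] by eventually_elim (simp add: g_def)
  then have "(LINT \<xi>|lborel. g (- \<xi>)) = (LINT \<xi>|lborel. - g \<xi>)"
    using gm by (intro integral_cong_AE) auto
  then have g0: "(LINT \<xi>|lborel. g \<xi>) = 0" using lborel_integral_uminus(1)[OF gm] by simp
  have "(norm (hartley u \<xi>))\<^sup>2 = (norm (fourier u \<xi>))\<^sup>2 - 2 * g \<xi>" for \<xi>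
    unfolding hartley_def g_def by (simp add: cmod_power2 power2_diff)
  then have "(l2n (hartley u))\<^sup>2 = (l2n (fourier u))\<^sup>2"
    unfolding l2n_sq using gi L2_integrable[OF F] g0 by simp
  then show ?thesis using plancherel[OF u] by simp
qed

lemma hartley_diff:
  assumes "u \<in> L2" "v \<in> L2"
  shows "l2n (\<lambda>\<xi>. hartley u \<xi> - hartley v \<xi>) = l2n (\<lambda>x. u x - v x)"
proof -
  have [measurable]: "hartley u \<in> borel_measurable borel" "hartley v \<in> borel_measurable borel"
    "hartley (\<lambda>x. u x - v x) \<in> borel_measurable borel"
    using assms L2_diff[OF assms] hartley_measurable by blast+
  have "l2n (\<lambda>\<xi>. hartley u \<xi> - hartley v \<xi>) = l2n (hartley (\<lambda>x. u x - v x))"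
  proof (rule l2n_cong_AE)
    show "AE \<xi> in lborel. hartley u \<xi> - hartley v \<xi> = hartley (\<lambda>x. u x - v x) \<xi>"
      using fourier_diff[OF assms] by eventually_elim (simp add: hartley_def)
  qed measurable
  then show ?thesis using hartley_isometry[OF L2_diff[OF assms]] by simp
qed

text \<open>Fubini, as the exponential kernel is symmetric in x and \<xi>. This is the source of the
  symmetry of the Hartley transform.\<close>

lemma fourier_L1_multiplication:
  fixes u w :: "'a::euclidean_space \<Rightarrow> real"
  assumes u: "integrable lborel u" and w: "integrable lborel w"
  shows "(LINT \<xi>|lborel. fourier_L1 u \<xi> * complex_of_real (w \<xi>)) = (LINT x|lborel. complex_of_real (u x) * fourier_L1 w x)"
proof -
  have [measurable]: "u \<in> borel_measurable borel" "w \<in> borel_measurable borel" using u w by auto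
  define c where "c = complex_of_real ((2 * pi) powr (- (real DIM('a) / 2)))"
  define k where "k x \<xi> = (c * (cis (- (x \<bullet> \<xi>)) * complex_of_real (u x))) * complex_of_real (w \<xi>)" for x \<xi>
  have "integrable (lborel \<Otimes>\<^sub>M lborel) (case_prod k)"
  proof (rule Bochner_Integration.integrable_bound)
    show "integrable (lborel \<Otimes>\<^sub>M lborel) (\<lambda>z. cmod c * (case z of (x, \<xi>) \<Rightarrow> u x * w \<xi>))"
      by (intro integrable_mult_right integrable_tensor u w)
    show "case_prod k \<in> borel_measurable (lborel \<Otimes>\<^sub>M lborel)" unfolding k_def by measurable
    show "AE z in lborel \<Otimes>\<^sub>M lborel. norm (case_prod k z) \<le> norm (cmod c * (case z of (x, \<xi>) \<Rightarrow> u x * w \<xi>))"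
      by (intro AE_I2) (auto simp: k_def norm_mult)
  qed
  then have "(LINT \<xi>|lborel. LINT x|lborel. k x \<xi>) = (LINT x|lborel. LINT \<xi>|lborel. k x \<xi>)"
    by (rule lborel_pair.Fubini_integral)
  moreover have "(LINT x|lborel. k x \<xi>) = fourier_L1 u \<xi> * complex_of_real (w \<xi>)" for \<xi>
    unfolding fourier_L1_def k_def c_def integral_mult_left_zero integral_mult_right_zero ..
  moreover have "(LINT \<xi>|lborel. k x \<xi>) = complex_of_real (u x) * fourier_L1 w x" for x
  proof -
    have "k x \<xi> = (complex_of_real (u x) * c) * (cis (- (\<xi> \<bullet> x)) * complex_of_real (w \<xi>))" for \<xi>
      unfolding k_def by (simp add: inner_commute mult_ac)
    then show ?thesis unfolding fourier_L1_def c_def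
      by (simp only: integral_mult_right_zero mult.assoc)
  qed
  ultimately show ?thesis by simp
qed

lemma hartley_symmetric_trunc:
  fixes u w :: "'a::euclidean_space \<Rightarrow> real"
  assumes u: "u \<in> L2" "integrable lborel u" and w: "w \<in> L2" "integrable lborel w"
  shows "(LINT \<xi>|lborel. hartley u \<xi> * w \<xi>) = (LINT x|lborel. u x * hartley w x)"
proof -
  have H: "AE \<xi> in lborel. hartley f \<xi> = Re (fourier_L1 f \<xi>) - Im (fourier_L1 f \<xi>)"
    if "f \<in> L2" "integrable lborel f" for f :: "'a \<Rightarrow> real"
    using fourier_eq_fourier_L1[OF that] by eventually_elim (simp add: hartley_def)
  have i: "integrable lborel (\<lambda>\<xi>. fourier_L1 f \<xi> * complex_of_real (h \<xi>))"
    if f: "f \<in> L2" "integrable lborel f" and h: "h \<in> L2" for f h :: "'a \<Rightarrow> real"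
  proof (rule L2_mult_integrable[OF fourier_L1_L2(1)[OF f(2,1)]])
    show "(\<lambda>\<xi>. complex_of_real (h \<xi>)) \<in> L2"
      by (rule L2_dominated[OF _ h, where C=1]) (use L2_measurable[OF h] in auto)
  qed
  have e: "(LINT \<xi>|lborel. hartley f \<xi> * h \<xi>) = Re (LINT \<xi>|lborel. fourier_L1 f \<xi> * complex_of_real (h \<xi>)) - Im (LINT \<xi>|lborel. fourier_L1 f \<xi> * complex_of_real (h \<xi>))"
    if f: "f \<in> L2" "integrable lborel f" and h: "h \<in> L2" for f h :: "'a \<Rightarrow> real"
  proof -
    note [measurable] = hartley_measurable[OF f(1)] L2_measurable[OF h] fourier_L1_measurable[OF L2_measurable[OF f(1)]]
    have "(LINT \<xi>|lborel. hartley f \<xi> * h \<xi>) = (LINT \<xi>|lborel. Re (fourier_L1 f \<xi> * complex_of_real (h \<xi>)) - Im (fourier_L1 f \<xi> * complex_of_real (h \<xi>)))"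
    proof (rule integral_cong_AE)
      show "AE \<xi> in lborel. hartley f \<xi> * h \<xi> = Re (fourier_L1 f \<xi> * complex_of_real (h \<xi>)) - Im (fourier_L1 f \<xi> * complex_of_real (h \<xi>))"
        using H[OF f] by eventually_elim (simp add: left_diff_distrib)
    qed measurable
    also have "\<dots> = (LINT \<xi>|lborel. Re (fourier_L1 f \<xi> * complex_of_real (h \<xi>))) - (LINT \<xi>|lborel. Im (fourier_L1 f \<xi> * complex_of_real (h \<xi>)))"
      by (intro Bochner_Integration.integral_diff integrable_Re integrable_Im i f h)
    finally show ?thesis by (simp only: integral_Re[OF i[OF f h]] integral_Im[OF i[OF f h]])
  qed
  have "(LINT x|lborel. u x * hartley w x) = (LINT x|lborel. hartley w x * u x)" by (simp add: mult.commute)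
  moreover have "(LINT \<xi>|lborel. fourier_L1 u \<xi> * complex_of_real (w \<xi>)) = (LINT x|lborel. fourier_L1 w x * complex_of_real (u x))"
    using fourier_L1_multiplication[OF u(2) w(2)] by (simp add: mult.commute)
  ultimately show ?thesis using e[OF u w(1)] e[OF w u(1)] by simp
qed

lemma hartley_symmetric:
  fixes u w :: "'a::euclidean_space \<Rightarrow> real"
  assumes u: "u \<in> L2" and w: "w \<in> L2"
  shows "(LINT \<xi>|lborel. hartley u \<xi> * w \<xi>) = (LINT x|lborel. u x * hartley w x)"
proof -
  have t: "(\<lambda>n. l2n (\<lambda>x. trunc (real n) f x - f x)) \<longlonglongrightarrow> 0" if f: "f \<in> L2" for f :: "'a \<Rightarrow> real"
    using filterlim_compose[OF trunc_tendsto[OF f] filterlim_real_sequentially] by (simp add: l2n_minus_commute)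
  have th: "(\<lambda>n. l2n (\<lambda>x. hartley (trunc (real n) f) x - hartley f x)) \<longlonglongrightarrow> 0" if f: "f \<in> L2" for f :: "'a \<Rightarrow> real"
    using t[OF f] by (simp add: hartley_diff[OF trunc_L2[OF f] f])
  have "(\<lambda>n. LINT \<xi>|lborel. hartley (trunc (real n) u) \<xi> * trunc (real n) w \<xi>) \<longlonglongrightarrow> (LINT \<xi>|lborel. hartley u \<xi> * w \<xi>)"
    by (intro L2_inner_tendsto t th u w hartley_L2 trunc_L2)
  moreover have "(\<lambda>n. LINT \<xi>|lborel. trunc (real n) u \<xi> * hartley (trunc (real n) w) \<xi>) \<longlonglongrightarrow> (LINT \<xi>|lborel. u \<xi> * hartley w \<xi>)"
    by (intro L2_inner_tendsto t th u w hartley_L2 trunc_L2)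
  ultimately show ?thesis
    using hartley_symmetric_trunc[OF trunc_L2[OF u] trunc_integrable[OF u] trunc_L2[OF w] trunc_integrable[OF w]]
    by (simp add: LIMSEQ_unique)
qed

text \<open>Expanding the squared distance, symmetry and isometry turn the three terms into the
  squared norm of u with coefficients 1, -2 and 1.\<close>

lemma hartley_involution:
  fixes u :: "'a::euclidean_space \<Rightarrow> real"
  assumes u: "u \<in> L2"
  shows "AE x in lborel. hartley (hartley u) x = u x"
proof -
  note H = hartley_L2[OF u] and HH = hartley_L2[OF hartley_L2[OF u]]
  have "(l2n (\<lambda>x. hartley (hartley u) x - u x))\<^sup>2 =
    (l2n (hartley (hartley u)))\<^sup>2 - 2 * (LINT x|lborel. hartley (hartley u) x * u x) + (l2n u)\<^sup>2"
    by (rule l2n_sq_lin(2)[OF HH u])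
  also have "(LINT x|lborel. hartley (hartley u) x * u x) = (LINT x|lborel. hartley u x * hartley u x)"
    by (rule hartley_symmetric[OF H u])
  also have "\<dots> = (l2n u)\<^sup>2" unfolding hartley_isometry[OF u, symmetric] by (rule L2.nrm_sq[OF H, symmetric])
  finally have "l2n (\<lambda>x. hartley (hartley u) x - u x) = 0"
    unfolding hartley_isometry[OF u] hartley_isometry[OF H] by simp
  from l2n_eq_0[OF L2_diff[OF HH u] this] show ?thesis by eventually_elim simp
qed

text \<open>The transform of a real function is Hermitian, so its real part is the even part of the
  Hartley transform and its imaginary part is minus the odd part.\<close>

lemma fourier_eq_hartley:
  fixes u :: "'a::euclidean_space \<Rightarrow> real"
  assumes u: "u \<in> L2"
  shows "AE \<xi> in lborel. fourier u \<xi> = Complex ((hartley u \<xi> + hartley u (- \<xi>)) / 2) ((hartley u (- \<xi>) - hartley u \<xi>) / 2)"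
  using fourier_uminus[OF u] by eventually_elim (simp add: hartley_def complex_eq_iff)

text \<open>The witness is the Hartley transform of \<open>w * hartley u\<close>, which is real by
  construction. As \<open>w\<close> is real and even, multiplying by it respects the even and odd
  parts from which the Fourier transform is rebuilt.\<close>

lemma fourier_multiplier_exists:
  fixes u :: "'a::euclidean_space \<Rightarrow> real"
  assumes u: "u \<in> L2" and [measurable]: "w \<in> borel_measurable borel" and even: "\<And>\<xi>. w (- \<xi>) = (w \<xi> :: real)"
    and L: "(\<lambda>\<xi>. of_real (w \<xi>) * fourier u \<xi>) \<in> L2"
  shows "\<exists>v\<in>L2. AE \<xi> in lborel. fourier v \<xi> = of_real (w \<xi>) * fourier u \<xi>"
proof -
  note [measurable] = hartley_measurable[OF u]
  define g where "g \<xi> = w \<xi> * hartley u \<xi>" for \<xi>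
  have g: "g \<in> L2"
  proof (rule L2_dominated[OF _ L, where C=2])
    show "AE x in lborel. norm (g x) \<le> 2 * norm (complex_of_real (w x) * fourier u x)"
    proof (rule AE_I2)
      fix x
      have "\<bar>w x\<bar> * \<bar>hartley u x\<bar> \<le> \<bar>w x\<bar> * (2 * cmod (fourier u x))" by (intro mult_left_mono abs_hartley_le) simp
      then show "norm (g x) \<le> 2 * norm (complex_of_real (w x) * fourier u x)" by (simp add: g_def abs_mult norm_mult)
    qed
  qed (simp add: g_def[abs_def])
  note v = hartley_L2[OF g]
  have "AE \<xi> in lborel. fourier (hartley g) \<xi> = of_real (w \<xi>) * fourier u \<xi>"
    using fourier_eq_hartley[OF v] fourier_eq_hartley[OF u] hartley_involution[OF g] AE_lborel_uminus[OF hartley_involution[OF g]]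
  proof eventually_elim
    case (elim \<xi>)
    show ?case unfolding elim(1)[unfolded elim(3,4)] elim(2) g_def even
      by (simp add: complex_eq_iff ring_distribs add_divide_distrib diff_divide_distrib)
  qed
  then show ?thesis using v by blast
qed

lemma fractional_laplacian:
  fixes u :: "'a::euclidean_space \<Rightarrow> real"
  assumes u: "u \<in> L2" and L: "(\<lambda>\<xi>. of_real (norm \<xi> powr (2 * \<sigma>)) * fourier u \<xi>) \<in> L2"
  shows "fractional_laplacian \<sigma> u \<in> L2"
    "AE \<xi> in lborel. fourier (fractional_laplacian \<sigma> u) \<xi> = of_real (norm \<xi> powr (2 * \<sigma>)) * fourier u \<xi>"
proof -
  have "\<exists>v. v \<in> L2 \<and> (AE \<xi> in lborel. fourier v \<xi> = complex_of_real (norm \<xi> powr (2 * \<sigma>)) * fourier u \<xi>)"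
    using fourier_multiplier_exists[OF u _ _ L] by auto
  then have "fractional_laplacian \<sigma> u \<in> L2 \<and>
      (AE \<xi> in lborel. fourier (fractional_laplacian \<sigma> u) \<xi> = complex_of_real (norm \<xi> powr (2 * \<sigma>)) * fourier u \<xi>)"
    unfolding fractional_laplacian_def by (rule someI_ex)
  then show "fractional_laplacian \<sigma> u \<in> L2"
    "AE \<xi> in lborel. fourier (fractional_laplacian \<sigma> u) \<xi> = of_real (norm \<xi> powr (2 * \<sigma>)) * fourier u \<xi>" by auto
qed

section \<open>Sobolev spaces\<close>

text \<open>The weight is the square root of the one in \<open>Hs_norm\<close>, so that the Sobolev
  norm becomes an \<open>l2n\<close> norm.\<close>

definition bessel :: "real \<Rightarrow> ('a::euclidean_space \<Rightarrow> real) \<Rightarrow> 'a \<Rightarrow> complex" where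
  "bessel s u \<xi> = of_real ((1 + (norm \<xi>)\<^sup>2) powr (s / 2)) * fourier u \<xi>"

text \<open>The Fourier side of the Laplacian to the power s / 2; the product of two of these is the
  leading part of the bilinear form.\<close>

definition riesz :: "real \<Rightarrow> ('a::euclidean_space \<Rightarrow> real) \<Rightarrow> 'a \<Rightarrow> complex" where
  "riesz s u \<xi> = of_real (norm \<xi> powr s) * fourier u \<xi>"

definition Hs_inner :: "real \<Rightarrow> ('a::euclidean_space \<Rightarrow> real) \<Rightarrow> ('a \<Rightarrow> real) \<Rightarrow> real" where
  "Hs_inner s u v = (LINT \<xi>|lborel. Re (bessel s u \<xi> * cnj (bessel s v \<xi>)))"

definition energy :: "real \<Rightarrow> ('a::euclidean_space \<Rightarrow> real) \<Rightarrow> ('a \<Rightarrow> real) \<Rightarrow> real" where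
  "energy s u v = (LINT \<xi>|lborel. Re (riesz s u \<xi> * cnj (riesz s v \<xi>)))"

lemma norm_bessel_sq: "(norm (bessel s u \<xi>))\<^sup>2 = (1 + (norm \<xi>)\<^sup>2) powr s * (cmod (fourier u \<xi>))\<^sup>2"
proof -
  have "((1 + (norm \<xi>)\<^sup>2) powr (s / 2))\<^sup>2 = (1 + (norm \<xi>)\<^sup>2) powr s"
    by (simp add: power2_eq_square flip: powr_add)
  then show ?thesis unfolding bessel_def by (simp add: norm_mult power_mult_distrib)
qed

lemma bessel_measurable:
  fixes u :: "'a::euclidean_space \<Rightarrow> real"
  assumes u: "u \<in> L2" shows "bessel s u \<in> borel_measurable borel"
proof -
  note [measurable] = L2_measurable[OF fourier_L2[OF u]]
  show ?thesis unfolding bessel_def[abs_def] by measurable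
qed

lemma riesz_measurable:
  fixes u :: "'a::euclidean_space \<Rightarrow> real"
  assumes u: "u \<in> L2" shows "riesz s u \<in> borel_measurable borel"
proof -
  note [measurable] = L2_measurable[OF fourier_L2[OF u]]
  show ?thesis unfolding riesz_def[abs_def] by measurable
qed

lemma Hs_norm_eq: "Hs_norm s u = l2n (bessel s u)"
  unfolding Hs_norm_def l2n_def norm_bessel_sq ..

lemma Hs_iff: "u \<in> Hs s \<longleftrightarrow> u \<in> L2 \<and> bessel s u \<in> L2"
proof -
  have "bessel s u \<in> L2 \<longleftrightarrow> integrable lborel (\<lambda>\<xi>. (1 + (norm \<xi>)\<^sup>2) powr s * (cmod (fourier u \<xi>))\<^sup>2)" if "u \<in> L2"
    unfolding norm_bessel_sq[symmetric] using L2_integrable L2_I[OF bessel_measurable[OF that]] by blast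
  then show ?thesis unfolding Hs_def by auto
qed

lemma Hs_L2: "u \<in> Hs s \<Longrightarrow> u \<in> L2" and Hs_bessel: "u \<in> Hs s \<Longrightarrow> bessel s u \<in> L2"
  unfolding Hs_iff by auto

lemma bessel_lin:
  assumes "u \<in> L2" "v \<in> L2"
  shows "AE \<xi> in lborel. bessel s (\<lambda>x. a * u x + b * v x) \<xi> = of_real a * bessel s u \<xi> + of_real b * bessel s v \<xi>"
  using fourier_lin[OF assms, of a b] by eventually_elim (simp add: bessel_def algebra_simps)

lemma riesz_lin:
  assumes "u \<in> L2" "v \<in> L2"
  shows "AE \<xi> in lborel. riesz s (\<lambda>x. a * u x + b * v x) \<xi> = of_real a * riesz s u \<xi> + of_real b * riesz s v \<xi>"
  using fourier_lin[OF assms, of a b] by eventually_elim (simp add: riesz_def algebra_simps)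

lemma Hs_lin:
  assumes u: "u \<in> Hs s" and v: "v \<in> Hs s"
  shows "(\<lambda>x. a * u x + b * v x) \<in> Hs s"
proof -
  note L = Hs_L2[OF u] Hs_L2[OF v]
  have 1: "(\<lambda>x. a * u x + b * v x) \<in> L2" by (intro L2_add L2_cmult L)
  moreover have "(\<lambda>\<xi>. of_real a * bessel s u \<xi> + of_real b * bessel s v \<xi>) \<in> L2"
    by (intro L2_add L2_cmult Hs_bessel u v)
  ultimately show ?thesis unfolding Hs_iff
    using L2_cong_AE[OF bessel_measurable[OF 1] _ bessel_lin[OF L]] by blast
qed

text \<open>Common source of the linearity of \<open>Hs_inner\<close> and of \<open>energy\<close>.
  The transforms are linear only almost everywhere, whence the separate function
  \<open>k\<close>.\<close>

lemma Re_cnj_lin: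
  fixes f g h k :: "'a::euclidean_space \<Rightarrow> complex"
  assumes L: "f \<in> L2" "g \<in> L2" "h \<in> L2" and k: "k \<in> borel_measurable borel"
    and e: "AE \<xi> in lborel. k \<xi> = of_real a * f \<xi> + of_real b * g \<xi>"
  shows "(LINT \<xi>|lborel. Re (k \<xi> * cnj (h \<xi>))) =
    a * (LINT \<xi>|lborel. Re (f \<xi> * cnj (h \<xi>))) + b * (LINT \<xi>|lborel. Re (g \<xi> * cnj (h \<xi>)))"
proof -
  note [measurable] = L[THEN L2_measurable] k
  define A B where "A \<xi> = Re (f \<xi> * cnj (h \<xi>))" and "B \<xi> = Re (g \<xi> * cnj (h \<xi>))" for \<xi>
  have AB: "integrable lborel A" "integrable lborel B"
    unfolding A_def[abs_def] B_def[abs_def] by (intro L2_Re_mult_cnj_integrable L)+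
  have "(LINT \<xi>|lborel. Re (k \<xi> * cnj (h \<xi>))) = (LINT \<xi>|lborel. a * A \<xi> + b * B \<xi>)"
  proof (rule integral_cong_AE)
    show "AE \<xi> in lborel. Re (k \<xi> * cnj (h \<xi>)) = a * A \<xi> + b * B \<xi>"
      using e by eventually_elim (simp add: A_def B_def algebra_simps)
    show "(\<lambda>\<xi>. a * A \<xi> + b * B \<xi>) \<in> borel_measurable lborel" using AB by auto
    show "(\<lambda>\<xi>. Re (k \<xi> * cnj (h \<xi>))) \<in> borel_measurable lborel" by measurable
  qed
  also have "\<dots> = a * (LINT \<xi>|lborel. A \<xi>) + b * (LINT \<xi>|lborel. B \<xi>)" using AB by simp
  finally show ?thesis unfolding A_def B_def .
qed

lemma Re_cnj_sym: "(LINT \<xi>|lborel. Re (f \<xi> * cnj (h \<xi>))) = (LINT \<xi>|lborel. Re (h \<xi> * cnj (f \<xi>)))"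
  by (simp add: mult.commute)

lemma Re_cnj_self: "(LINT \<xi>|lborel. Re (f \<xi> * cnj (f \<xi>))) = (l2n f)\<^sup>2"
proof -
  have "Re (z * cnj z) = (norm z)\<^sup>2" for z unfolding cmod_power2 by (simp add: power2_eq_square)
  then show ?thesis unfolding l2n_sq by presburger
qed

text \<open>Both the functions and their weighted transforms are Cauchy in \<open>L2\<close>. The
  two limits are matched pointwise along a common subsequence, because the weighted transform is a
  pointwise multiple of the transform.\<close>

lemma Hs_complete:
  fixes f :: "nat \<Rightarrow> 'a::euclidean_space \<Rightarrow> real"
  assumes s: "0 \<le> s" and f: "\<And>n. f n \<in> Hs s"
    and cauchy: "\<And>e. e > 0 \<Longrightarrow> \<exists>M. \<forall>m\<ge>M. \<forall>n\<ge>M. Hs_norm s (\<lambda>x. f m x - f n x) < e"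
  shows "\<exists>l\<in>Hs s. (\<lambda>n. Hs_norm s (\<lambda>x. f n x - l x)) \<longlonglongrightarrow> 0"
proof -
  note fL = Hs_L2[OF f] and fB = Hs_bessel[OF f]
  note meas = bessel_measurable
  have d: "l2n (\<lambda>\<xi>. bessel s u \<xi> - bessel s v \<xi>) = Hs_norm s (\<lambda>x. u x - v x)" if "u \<in> L2" "v \<in> L2" for u v :: "'a \<Rightarrow> real"
  proof -
    note [measurable] = bessel_measurable[OF that(1), of s] bessel_measurable[OF that(2), of s] bessel_measurable[OF L2_diff[OF that], of s]
    show ?thesis unfolding Hs_norm_eq by (rule l2n_cong_AE) (use bessel_lin[OF that, of s 1 "-1"] in auto)
  qed
  have le: "l2n u \<le> Hs_norm s u" if u: "u \<in> Hs s" for u :: "'a \<Rightarrow> real"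
  proof -
    have "l2n (fourier u) \<le> l2n (bessel s u)"
    proof (intro l2n_mono fourier_L2 Hs_L2[OF u] Hs_bessel u AE_I2)
      fix \<xi> :: 'a
      have "1 \<le> (1 + (norm \<xi>)\<^sup>2) powr (s / 2)" using s by (intro ge_one_powr_ge_zero) auto
      then have "1 * norm (fourier u \<xi>) \<le> (1 + (norm \<xi>)\<^sup>2) powr (s / 2) * norm (fourier u \<xi>)" by (intro mult_right_mono) auto
      then show "norm (fourier u \<xi>) \<le> norm (bessel s u \<xi>)" by (simp add: bessel_def norm_mult)
    qed
    then show ?thesis using plancherel[OF Hs_L2[OF u]] unfolding Hs_norm_eq by simp
  qed
  have "\<exists>M. \<forall>m\<ge>M. \<forall>n\<ge>M. l2n (\<lambda>x. f m x - f n x) < e" if "e > 0" for e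
  proof -
    have "(\<lambda>x. f m x - f n x) \<in> Hs s" for m n using Hs_lin[OF f[of m] f[of n], of 1 "-1"] by simp
    then show ?thesis using cauchy[OF that] le by (meson le_less_trans)
  qed
  from L2_complete[OF fL this] obtain l where l: "l \<in> L2" "(\<lambda>n. l2n (\<lambda>x. f n x - l x)) \<longlonglongrightarrow> 0" by blast
  have "\<exists>M. \<forall>m\<ge>M. \<forall>n\<ge>M. l2n (\<lambda>x. bessel s (f m) x - bessel s (f n) x) < e" if "e > 0" for e
    unfolding d[OF fL fL] using cauchy[OF that] .
  from L2_complete[OF fB this] obtain V where V: "V \<in> L2" "(\<lambda>n. l2n (\<lambda>x. bessel s (f n) x - V x)) \<longlonglongrightarrow> 0" by blast
  have FL: "(\<lambda>n. l2n (\<lambda>x. fourier (f n) x - fourier l x)) \<longlonglongrightarrow> 0"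
    by (rule tendsto_0_le[OF l2n_nonneg _ l(2)]) (rule l2n_fourier_diff_le[OF fL l(1)])
  obtain r where r: "strict_mono r" "AE \<xi> in lborel. (\<lambda>n. bessel s (f (r n)) \<xi>) \<longlonglongrightarrow> V \<xi>"
    using L2_subseq_AE[OF fB V] by blast
  have FLr: "(\<lambda>n. l2n (\<lambda>x. fourier (f (r n)) x - fourier l x)) \<longlonglongrightarrow> 0"
    using LIMSEQ_subseq_LIMSEQ[OF FL r(1)] by (simp add: o_def)
  obtain r' where r': "strict_mono r'" "AE \<xi> in lborel. (\<lambda>n. fourier (f (r (r' n))) \<xi>) \<longlonglongrightarrow> fourier l \<xi>"
    using L2_subseq_AE[OF fourier_L2[OF fL] fourier_L2[OF l(1)] FLr] by blast
  have Vl: "AE \<xi> in lborel. bessel s l \<xi> = V \<xi>"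
    using r(2) r'(2)
  proof eventually_elim
    case (elim \<xi>)
    have "(\<lambda>n. bessel s (f (r (r' n))) \<xi>) \<longlonglongrightarrow> V \<xi>"
      using LIMSEQ_subseq_LIMSEQ[OF elim(1) r'(1)] by (simp add: o_def)
    moreover have "(\<lambda>n. bessel s (f (r (r' n))) \<xi>) \<longlonglongrightarrow> bessel s l \<xi>"
      unfolding bessel_def by (intro tendsto_intros elim(2))
    ultimately show ?case by (rule LIMSEQ_unique[rotated])
  qed
  have lB: "bessel s l \<in> L2" by (rule L2_cong_AE[OF bessel_measurable[OF l(1)] V(1) Vl])
  then have "l \<in> Hs s" using l(1) unfolding Hs_iff by blast
  moreover have "Hs_norm s (\<lambda>x. f n x - l x) = l2n (\<lambda>x. bessel s (f n) x - V x)" for n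
  proof -
    note [measurable] = L2_measurable[OF fB] L2_measurable[OF lB] L2_measurable[OF V(1)]
    show ?thesis unfolding d[OF fL l(1), symmetric] by (rule l2n_cong_AE) (use Vl in auto)
  qed
  ultimately show ?thesis using V(2) by (intro bexI[of _ l]) simp_all
qed

lemma Hs_inner_lin:
  assumes "u \<in> Hs s" "v \<in> Hs s" "w \<in> Hs s"
  shows "Hs_inner s (\<lambda>x. a * u x + b * v x) w = a * Hs_inner s u w + b * Hs_inner s v w"
  unfolding Hs_inner_def
  by (intro Re_cnj_lin Hs_bessel bessel_lin bessel_measurable L2_add L2_cmult Hs_L2[OF assms(1)] Hs_L2[OF assms(2)] assms)

lemma Hs_inner_self: "Hs_inner s u u = (Hs_norm s u)\<^sup>2"
  unfolding Hs_inner_def Hs_norm_eq by (rule Re_cnj_self)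

lemma Hs_inner_sym: "Hs_inner s u v = Hs_inner s v u"
  unfolding Hs_inner_def by (rule Re_cnj_sym)

lemma Hs_norm_nonneg[simp]: "0 \<le> Hs_norm s u"
  unfolding Hs_norm_eq by simp

lemma Hs_zero: "(\<lambda>x. 0) \<in> Hs s"
proof -
  have "AE \<xi> in lborel. bessel s (\<lambda>x::'a. 0 * 0 + 0 * 0) \<xi> = of_real 0 * bessel s (\<lambda>x. 0) \<xi> + of_real 0 * bessel s (\<lambda>x. 0) \<xi>"
    using bessel_lin[OF L2_zero L2_zero, of s 0 0] .
  then have "AE \<xi> in lborel. bessel s (\<lambda>x::'a. 0) \<xi> = 0" by simp
  then show ?thesis unfolding Hs_iff
    using L2_cong_AE[OF bessel_measurable[OF L2_zero] L2_zero, of s] L2_zero by blast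
qed

lemma semi_inner_nrm_Hs:
  fixes V :: "('a::euclidean_space \<Rightarrow> real) set"
  assumes "semi_inner V (Hs_inner s)"
  shows "semi_inner.nrm (Hs_inner s :: ('a \<Rightarrow> real) \<Rightarrow> _) = Hs_norm s"
  by (rule ext) (simp add: semi_inner.nrm_def[OF assms] Hs_inner_self)

lemma semi_inner_Hs:
  assumes "V \<subseteq> Hs s" "(\<lambda>x. 0) \<in> V" "\<And>u v a b. u \<in> V \<Longrightarrow> v \<in> V \<Longrightarrow> (\<lambda>x. a * u x + b * v x) \<in> V"
  shows "semi_inner V (Hs_inner s)"
proof
  fix u v w a b assume "u \<in> V" "v \<in> V" "w \<in> V"
  then show "Hs_inner s (\<lambda>x. a * u x + b * v x) w = a * Hs_inner s u w + b * Hs_inner s v w"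
    using assms(1) by (intro Hs_inner_lin) auto
qed (use assms in \<open>auto simp: Hs_inner_self intro: Hs_inner_sym\<close>)

interpretation Hs: semi_inner "Hs s :: ('a::euclidean_space \<Rightarrow> real) set" "Hs_inner s"
  rewrites "semi_inner.nrm (Hs_inner s :: ('a \<Rightarrow> real) \<Rightarrow> _) = Hs_norm s"
proof -
  show "semi_inner (Hs s :: ('a \<Rightarrow> real) set) (Hs_inner s)" by (rule semi_inner_Hs) (auto intro: Hs_zero Hs_lin)
  then show "semi_inner.nrm (Hs_inner s :: ('a \<Rightarrow> real) \<Rightarrow> _) = Hs_norm s" by (rule semi_inner_nrm_Hs)
qed

lemma power2_powr_half: "0 \<le> x \<Longrightarrow> (x\<^sup>2) powr (r / 2) = x powr r" for x :: real
proof (cases "x = 0")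
  case False
  assume "0 \<le> x"
  then have "x\<^sup>2 = x powr 2" using False by simp
  then show ?thesis by (simp only: powr_powr) simp
qed simp

lemma powr_norm_le_bessel_weight: 
  assumes "0 \<le> s" shows "norm \<xi> powr s \<le> (1 + (norm \<xi>)\<^sup>2) powr (s / 2)"
proof -
  have "norm \<xi> powr s = ((norm \<xi>)\<^sup>2) powr (s / 2)" by (simp add: power2_powr_half)
  also have "\<dots> \<le> (1 + (norm \<xi>)\<^sup>2) powr (s / 2)" using assms by (intro powr_mono2) auto
  finally show ?thesis .
qed

text \<open>A number in [0, 1] is at most its s-th power; apply this to 1 / (1 + r) and r / (1 + r),
  which add up to 1.\<close>

lemma powr_add_le:
  fixes r :: real
  assumes "0 \<le> r" "0 < s" "s \<le> 1"
  shows "(1 + r) powr s \<le> 1 + r powr s"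
proof -
  have a: "1 / (1 + r) \<le> (1 / (1 + r)) powr s"
    using powr_mono'[of s 1 "1 / (1 + r)"] assms by simp
  have b: "r / (1 + r) \<le> (r / (1 + r)) powr s"
    using powr_mono'[of s 1 "r / (1 + r)"] assms by simp
  have "1 = 1 / (1 + r) + r / (1 + r)" using assms by (simp add: field_simps)
  also have "\<dots> \<le> (1 / (1 + r)) powr s + (r / (1 + r)) powr s" using a b by simp
  also have "\<dots> = (1 + r powr s) / (1 + r) powr s" using assms by (simp add: powr_divide add_divide_distrib)
  finally show ?thesis using assms by (simp add: field_simps)
qed

context
  fixes s :: real
  assumes s: "0 < s" "s < 1"
begin

section \<open>Comparison of the norms with the energy\<close>

lemma l2n_le_Hs_norm: "u \<in> Hs s \<Longrightarrow> l2n u \<le> Hs_norm s u"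
proof -
  assume u: "u \<in> Hs s"
  have "l2n (fourier u) \<le> l2n (bessel s u)"
  proof (intro l2n_mono fourier_L2 Hs_L2[OF u] Hs_bessel u AE_I2)
    fix \<xi> :: 'a
    have "1 \<le> (1 + (norm \<xi>)\<^sup>2) powr (s / 2)" using s by (intro ge_one_powr_ge_zero) auto
    then have "1 * norm (fourier u \<xi>) \<le> (1 + (norm \<xi>)\<^sup>2) powr (s / 2) * norm (fourier u \<xi>)" by (intro mult_right_mono) auto
    then show "norm (fourier u \<xi>) \<le> norm (bessel s u \<xi>)" by (simp add: bessel_def norm_mult)
  qed
  then show ?thesis using plancherel[OF Hs_L2[OF u]] unfolding Hs_norm_eq by simp
qed

lemma Hs_riesz: "u \<in> Hs s \<Longrightarrow> riesz s u \<in> L2" and l2n_riesz_le: "u \<in> Hs s \<Longrightarrow> l2n (riesz s u) \<le> Hs_norm s u"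
proof -
  assume u: "u \<in> Hs s"
  have le: "norm (riesz s u \<xi>) \<le> norm (bessel s u \<xi>)" for \<xi>
    using mult_right_mono[OF powr_norm_le_bessel_weight[of s \<xi>], of "norm (fourier u \<xi>)"] s
    unfolding riesz_def bessel_def by (simp add: norm_mult)
  show r: "riesz s u \<in> L2"
    by (rule L2_dominated[OF riesz_measurable[OF Hs_L2[OF u]] Hs_bessel[OF u], where C=1]) (use le in simp)
  show "l2n (riesz s u) \<le> Hs_norm s u" unfolding Hs_norm_eq
    by (intro l2n_mono r Hs_bessel[OF u]) (use le in simp)
qed

lemma energy_lin:
  assumes "u \<in> Hs s" "v \<in> Hs s" "w \<in> Hs s"
  shows "energy s (\<lambda>x. a * u x + b * v x) w = a * energy s u w + b * energy s v w"
  unfolding energy_def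
  by (intro Re_cnj_lin Hs_riesz riesz_lin riesz_measurable L2_add L2_cmult Hs_L2[OF assms(1)] Hs_L2[OF assms(2)] assms)

lemma energy_sym: "energy s u v = energy s v u"
  unfolding energy_def by (rule Re_cnj_sym)

lemma energy_lin_right:
  assumes "u \<in> Hs s" "v \<in> Hs s" "w \<in> Hs s"
  shows "energy s w (\<lambda>x. a * u x + b * v x) = a * energy s w u + b * energy s w v"
  using energy_lin[OF assms, of a b] by (simp add: energy_sym)

lemma energy_self: "energy s u u = (l2n (riesz s u))\<^sup>2"
  unfolding energy_def by (rule Re_cnj_self)

lemma energy_le: "u \<in> Hs s \<Longrightarrow> v \<in> Hs s \<Longrightarrow> \<bar>energy s u v\<bar> \<le> Hs_norm s u * Hs_norm s v"
  unfolding energy_def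
  by (rule order_trans[OF L2_Re_mult_cnj_le mult_mono]) (auto intro: Hs_riesz l2n_riesz_le)

text \<open>From (1 + |\<xi>|^2)^s \<le> 1 + |\<xi>|^(2 s), valid for exponents below 1: the energy
  controls the Sobolev norm up to the \<open>L2\<close> norm. All coercivity estimates start
  here.\<close>

lemma Hs_norm_sq_le:
  assumes u: "u \<in> Hs s"
  shows "(Hs_norm s u)\<^sup>2 \<le> (l2n u)\<^sup>2 + energy s u u"
proof -
  note L = L2_integrable[OF fourier_L2[OF Hs_L2[OF u]]] L2_integrable[OF Hs_riesz[OF u]]
  have "(Hs_norm s u)\<^sup>2 \<le> (LINT \<xi>|lborel. (norm (fourier u \<xi>))\<^sup>2 + (norm (riesz s u \<xi>))\<^sup>2)"
    unfolding Hs_norm_eq l2n_sq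
  proof (intro integral_mono L2_integrable Hs_bessel u Bochner_Integration.integrable_add fourier_L2 Hs_L2[OF u] Hs_riesz)
    fix \<xi> :: 'a
    have "(1 + (norm \<xi>)\<^sup>2) powr s \<le> 1 + ((norm \<xi>)\<^sup>2) powr s" using s by (intro powr_add_le) auto
    also have "((norm \<xi>)\<^sup>2) powr s = (norm \<xi> powr s)\<^sup>2"
      using power2_powr_half[of "norm \<xi>" "2 * s"] by (simp add: power2_eq_square flip: powr_add)
    finally have "(1 + (norm \<xi>)\<^sup>2) powr s * (cmod (fourier u \<xi>))\<^sup>2 \<le> (1 + (norm \<xi> powr s)\<^sup>2) * (cmod (fourier u \<xi>))\<^sup>2"
      by (rule mult_right_mono) simp
    then show "(norm (bessel s u \<xi>))\<^sup>2 \<le> (norm (fourier u \<xi>))\<^sup>2 + (norm (riesz s u \<xi>))\<^sup>2"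
      unfolding norm_bessel_sq riesz_def by (simp add: norm_mult power_mult_distrib algebra_simps)
  qed
  also have "\<dots> = (l2n (fourier u))\<^sup>2 + (l2n (riesz s u))\<^sup>2" unfolding l2n_sq using L by simp
  finally show ?thesis unfolding energy_self plancherel[OF Hs_L2[OF u]] .
qed

text \<open>Test functions have a full derivative in \<open>L2\<close> by
  \<open>test_function_fourier\<close>, and s < 1.\<close>

lemma test_functions_Hs: "test_functions W \<subseteq> Hs s"
proof
  fix f :: "'a \<Rightarrow> real" assume f: "f \<in> test_functions W"
  note fL = test_functions_L2[OF f]
  note F = fourier_L1_L2[OF fL(2,1)]
  have [measurable]: "f \<in> borel_measurable borel" by (rule test_functions_measurable[OF f])
  define g where "g \<xi> = of_real ((1 + (norm \<xi>)\<^sup>2) powr (s / 2)) * fourier_L1 f \<xi>" for \<xi>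
  have [measurable]: "g \<in> borel_measurable borel" unfolding g_def[abs_def] by measurable
  have "g \<in> L2"
  proof (rule L2_I)
    show "integrable lborel (\<lambda>\<xi>. (norm (g \<xi>))\<^sup>2)"
    proof (rule Bochner_Integration.integrable_bound)
      show "integrable lborel (\<lambda>\<xi>. (cmod (fourier_L1 f \<xi>))\<^sup>2 + (norm \<xi>)\<^sup>2 * (cmod (fourier_L1 f \<xi>))\<^sup>2)"
        by (intro Bochner_Integration.integrable_add test_function_fourier(2)[OF f] L2_integrable F)
      show "AE \<xi> in lborel. norm ((norm (g \<xi>))\<^sup>2) \<le> norm ((cmod (fourier_L1 f \<xi>))\<^sup>2 + (norm \<xi>)\<^sup>2 * (cmod (fourier_L1 f \<xi>))\<^sup>2)"
      proof (rule AE_I2)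
        fix \<xi> :: 'a
        have "((1 + (norm \<xi>)\<^sup>2) powr (s / 2))\<^sup>2 = (1 + (norm \<xi>)\<^sup>2) powr s"
          by (simp add: power2_eq_square flip: powr_add)
        also have "\<dots> \<le> (1 + (norm \<xi>)\<^sup>2) powr 1" using s by (intro powr_mono) auto
        also have "\<dots> = 1 + (norm \<xi>)\<^sup>2" by (simp add: add_nonneg_nonneg)
        finally have "((1 + (norm \<xi>)\<^sup>2) powr (s / 2))\<^sup>2 * (cmod (fourier_L1 f \<xi>))\<^sup>2 \<le> (1 + (norm \<xi>)\<^sup>2) * (cmod (fourier_L1 f \<xi>))\<^sup>2"
          by (rule mult_right_mono) simp
        then show "norm ((norm (g \<xi>))\<^sup>2) \<le> norm ((cmod (fourier_L1 f \<xi>))\<^sup>2 + (norm \<xi>)\<^sup>2 * (cmod (fourier_L1 f \<xi>))\<^sup>2)"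
          unfolding g_def by (simp add: norm_mult power_mult_distrib algebra_simps)
      qed
    qed measurable
  qed measurable
  moreover have "AE \<xi> in lborel. bessel s f \<xi> = g \<xi>"
    using fourier_eq_fourier_L1[OF fL] by eventually_elim (simp add: bessel_def g_def)
  ultimately show "f \<in> Hs s" unfolding Hs_iff
    using fL(1) L2_cong_AE[OF bessel_measurable[OF fL(1)]] by blast
qed

lemma Hs_cong_AE:
  assumes u: "u \<in> Hs s" and v: "v \<in> borel_measurable borel" and e: "AE x in lborel. u x = v x"
  shows "v \<in> Hs s" "fourier v = fourier u"
proof -
  have uL: "u \<in> L2" by (rule Hs_L2[OF u])
  have e': "AE x in lborel. v x = u x" using e by eventually_elim simp
  have vL: "v \<in> L2" by (rule L2_cong_AE[OF v uL e'])
  show F: "fourier v = fourier u" by (rule fourier_cong_AE[OF v L2_measurable[OF uL] e'])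
  have "bessel s v = bessel s u" unfolding bessel_def[abs_def] F ..
  then show "v \<in> Hs s" using vL Hs_bessel[OF u] unfolding Hs_iff by simp
qed

section \<open>Closures of the test functions in the Sobolev space\<close>

lemma Hs_tilde_Hs: "u \<in> Hs_tilde s W \<Longrightarrow> u \<in> Hs s"
  unfolding Hs_tilde_def by blast

lemma Hs_tilde_limit:
  assumes z: "z \<in> Hs s" and lim: "\<And>e. e > 0 \<Longrightarrow> \<exists>u\<in>Hs_tilde s W. Hs_norm s (\<lambda>x. u x - z x) < e"
  shows "z \<in> Hs_tilde s W"
  unfolding Hs_tilde_def
proof (intro CollectI conjI allI impI z)
  fix e :: real assume e: "e > 0"
  then have e2: "e / 2 > 0" by simp
  obtain u where u: "u \<in> Hs_tilde s W" "Hs_norm s (\<lambda>x. u x - z x) < e / 2" using lim[OF e2] by blast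
  obtain f where f: "f \<in> test_functions W" "Hs_norm s (\<lambda>x. u x - f x) < e / 2"
    using u(1) e2 unfolding Hs_tilde_def by blast
  have fH: "f \<in> Hs s" using f(1) test_functions_Hs by blast
  note uH = Hs_tilde_Hs[OF u(1)]
  have "Hs_norm s (\<lambda>x. z x - f x) \<le> Hs_norm s (\<lambda>x. z x - u x) + Hs_norm s (\<lambda>x. u x - f x)"
    by (rule Hs.nrm_triangle_diff[OF z uH fH])
  also have "Hs_norm s (\<lambda>x. z x - u x) = Hs_norm s (\<lambda>x. u x - z x)" by (rule Hs.nrm_minus_commute[OF z uH])
  finally show "\<exists>\<phi>\<in>test_functions W. Hs_norm s (\<lambda>x. z x - \<phi> x) < e"
    using u(2) f by (intro bexI[OF _ f(1)]) linarith
qed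

lemma Hs_norm_zero: "Hs_norm s (\<lambda>x. 0) = 0"
  using Hs.nrm_scale[OF Hs_zero, of s 0] by simp

lemma test_functions_Hs_tilde: "test_functions W \<subseteq> Hs_tilde s W"
proof
  fix f :: "'a \<Rightarrow> real" assume f: "f \<in> test_functions W"
  then have "\<exists>\<phi>\<in>test_functions W. Hs_norm s (\<lambda>x. f x - \<phi> x) < e" if "e > 0" for e
    using that by (intro bexI[of _ f]) (simp_all add: Hs_norm_zero)
  then show "f \<in> Hs_tilde s W" unfolding Hs_tilde_def using f test_functions_Hs by blast
qed

lemma Hs_tilde_zero: "(\<lambda>x. 0) \<in> Hs_tilde s W"
  using test_functions_Hs_tilde test_functions_zero by blast

lemma Hs_tilde_lin:
  assumes u: "u \<in> Hs_tilde s W" and v: "v \<in> Hs_tilde s W"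
  shows "(\<lambda>x. a * u x + b * v x) \<in> Hs_tilde s W"
  unfolding Hs_tilde_def
proof (intro CollectI conjI allI impI)
  note H = Hs_tilde_Hs[OF u] Hs_tilde_Hs[OF v]
  show "(\<lambda>x. a * u x + b * v x) \<in> Hs s" by (rule Hs_lin[OF H])
  fix e :: real assume e: "e > 0"
  define d where "d = e / (\<bar>a\<bar> + \<bar>b\<bar> + 1)"
  have d: "d > 0" "(\<bar>a\<bar> + \<bar>b\<bar>) * d < e" unfolding d_def using e by (auto simp: field_simps add_pos_nonneg)
  obtain f g where f: "f \<in> test_functions W" "Hs_norm s (\<lambda>x. u x - f x) < d"
    and g: "g \<in> test_functions W" "Hs_norm s (\<lambda>x. v x - g x) < d"
    using u v d(1) unfolding Hs_tilde_def by blast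
  have FH: "f \<in> Hs s" "g \<in> Hs s" using f(1) g(1) test_functions_Hs by blast+
  note D = Hs.diff[OF H(1) FH(1)] Hs.diff[OF H(2) FH(2)]
  have "Hs_norm s (\<lambda>x. (a * u x + b * v x) - (a * f x + b * g x)) = Hs_norm s (\<lambda>x. a * (u x - f x) + b * (v x - g x))"
    by (simp add: algebra_simps)
  also have "\<dots> \<le> Hs_norm s (\<lambda>x. a * (u x - f x)) + Hs_norm s (\<lambda>x. b * (v x - g x))"
    by (intro Hs.nrm_triangle Hs.scale D)
  also have "\<dots> = \<bar>a\<bar> * Hs_norm s (\<lambda>x. u x - f x) + \<bar>b\<bar> * Hs_norm s (\<lambda>x. v x - g x)"
    by (simp only: Hs.nrm_scale[OF D(1)] Hs.nrm_scale[OF D(2)])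
  also have "\<dots> \<le> \<bar>a\<bar> * d + \<bar>b\<bar> * d" using f(2) g(2) by (intro add_mono mult_left_mono) auto
  also have "\<dots> < e" using d(2) by (simp add: algebra_simps)
  finally show "\<exists>\<phi>\<in>test_functions W. Hs_norm s (\<lambda>x. a * u x + b * v x - \<phi> x) < e"
    using test_functions_lin[OF f(1) g(1), of a b] by (intro bexI[of _ "\<lambda>x. a * f x + b * g x"])
qed

lemma Hs_tilde_zero_outside:
  assumes u: "u \<in> Hs_tilde s W" and W: "W \<in> sets borel"
  shows "AE x in lborel. x \<notin> W \<longrightarrow> u x = 0"
proof (rule l2n_AE_zero_outside_limit[OF Hs_L2[OF Hs_tilde_Hs[OF u]] _ W])
  fix e :: real assume e: "e > 0"
  then obtain f where f: "f \<in> test_functions W" "Hs_norm s (\<lambda>x. u x - f x) < e"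
    using u unfolding Hs_tilde_def by blast
  have fH: "f \<in> Hs s" using f(1) test_functions_Hs by blast
  have "l2n (\<lambda>x. f x - u x) \<le> Hs_norm s (\<lambda>x. u x - f x)"
    using l2n_le_Hs_norm[OF Hs.diff[OF Hs_tilde_Hs[OF u] fH]] l2n_minus_commute[of f u] by simp
  then show "\<exists>f\<in>L2. (AE x in lborel. x \<notin> W \<longrightarrow> f x = 0) \<and> l2n (\<lambda>x. f x - u x) < e"
    using f Hs_L2[OF fH] test_functions_zero_outside[OF f(1)] by (intro bexI[of _ f]) auto
qed

text \<open>Serves twice: for \<open>Hs_tilde\<close> and for the annihilator of finitely many
  exterior data inside it.\<close>

lemma semi_hilbert_Hs_subspace:
  assumes V: "V \<subseteq> Hs s" "(\<lambda>x. 0) \<in> V" "\<And>u v a b. u \<in> V \<Longrightarrow> v \<in> V \<Longrightarrow> (\<lambda>x. a * u x + b * v x) \<in> V"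
    and closed: "\<And>z. z \<in> Hs s \<Longrightarrow> (\<And>e. e > 0 \<Longrightarrow> \<exists>u\<in>V. Hs_norm s (\<lambda>x. u x - z x) < e) \<Longrightarrow> z \<in> V"
  shows "semi_hilbert V (Hs_inner s)"
proof -
  have si: "semi_inner V (Hs_inner s)" by (rule semi_inner_Hs[OF V])
  show ?thesis
  proof (intro semi_hilbert.intro si semi_hilbert_axioms.intro, unfold semi_inner_nrm_Hs[OF si])
    fix f :: "nat \<Rightarrow> 'a \<Rightarrow> real"
    assume f: "\<And>n. f n \<in> V"
      and c: "\<And>e. e > 0 \<Longrightarrow> \<exists>M. \<forall>m\<ge>M. \<forall>n\<ge>M. Hs_norm s (\<lambda>x. f m x - f n x) < e"
    have "f n \<in> Hs s" for n using f V(1) by blast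
    then obtain l where l: "l \<in> Hs s" "(\<lambda>n. Hs_norm s (\<lambda>x. f n x - l x)) \<longlonglongrightarrow> 0"
      using Hs_complete[of s f] s(1) c by auto
    have "l \<in> V"
    proof (rule closed[OF l(1)])
      fix e :: real assume "e > 0"
      then have "\<forall>\<^sub>F n in sequentially. Hs_norm s (\<lambda>x. f n x - l x) < e" using order_tendstoD(2)[OF l(2)] by blast
      then obtain n where "Hs_norm s (\<lambda>x. f n x - l x) < e" by (auto dest: eventually_happens)
      then show "\<exists>u\<in>V. Hs_norm s (\<lambda>x. u x - l x) < e" using f[of n] by blast
    qed
    then show "\<exists>l\<in>V. (\<lambda>n. Hs_norm s (\<lambda>x. f n x - l x)) \<longlonglongrightarrow> 0" using l(2) by blast
  qed
qed

lemma semi_hilbert_Hs_tilde: "semi_hilbert (Hs_tilde s W) (Hs_inner s)"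
  by (rule semi_hilbert_Hs_subspace)
    (auto intro: Hs_tilde_Hs Hs_tilde_zero Hs_tilde_lin Hs_tilde_limit)

lemma nrm_Hs: "semi_inner.nrm (Hs_inner s :: ('a::euclidean_space \<Rightarrow> real) \<Rightarrow> _) = Hs_norm s"
  by (rule semi_inner_nrm_Hs[OF Hs.semi_inner_axioms])

text \<open>Parseval applied to the functions chosen by \<open>fractional_laplacian\<close>;
  connects the bilinear form of the problem with the Fourier side.\<close>

lemma fractional_laplacian_energy:
  assumes u: "u \<in> Hs s" and v: "v \<in> Hs s"
  shows "(LINT x|lborel. fractional_laplacian (s / 2) u x * fractional_laplacian (s / 2) v x) = energy s u v"
proof -
  have F: "fractional_laplacian (s / 2) u \<in> L2" "AE \<xi> in lborel. fourier (fractional_laplacian (s / 2) u) \<xi> = riesz s u \<xi>"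
    if "u \<in> Hs s" for u :: "'a \<Rightarrow> real"
    using fractional_laplacian[OF Hs_L2[OF that], of "s / 2"] Hs_riesz[OF that] unfolding riesz_def[abs_def] by auto
  note m [measurable] = L2_measurable[OF fourier_L2[OF F(1)[OF u]]] L2_measurable[OF fourier_L2[OF F(1)[OF v]]]
    L2_measurable[OF Hs_riesz[OF u]] L2_measurable[OF Hs_riesz[OF v]]
  have "(LINT x|lborel. fractional_laplacian (s / 2) u x * fractional_laplacian (s / 2) v x) =
    (LINT \<xi>|lborel. Re (fourier (fractional_laplacian (s / 2) u) \<xi> * cnj (fourier (fractional_laplacian (s / 2) v) \<xi>)))"
    by (rule parseval[OF F(1)[OF u] F(1)[OF v], symmetric])
  also have "\<dots> = energy s u v" unfolding energy_def
  proof (rule integral_cong_AE)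
    show "AE \<xi> in lborel. Re (fourier (fractional_laplacian (s / 2) u) \<xi> * cnj (fourier (fractional_laplacian (s / 2) v) \<xi>)) =
      Re (riesz s u \<xi> * cnj (riesz s v \<xi>))"
      using F(2)[OF u] F(2)[OF v] by eventually_elim simp
  qed measurable
  finally show ?thesis .
qed

end

section \<open>Unique continuation for Riesz potentials\<close>

text \<open>The difference quotients at 0 have integral 0, and the mean value theorem dominates them
  by the bound for the derivative. The bounds are required on \<open>K\<close>, off which \<phi>
  vanishes.\<close>

lemma integral_param_derivative_zero:
  fixes \<phi> :: "'a::euclidean_space \<Rightarrow> real" and h h' :: "real \<Rightarrow> 'a \<Rightarrow> real"
  assumes \<phi>: "integrable lborel \<phi>" and supp: "AE y in lborel. y \<notin> K \<longrightarrow> \<phi> y = 0" and \<delta>: "\<delta> > 0"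
    and m: "\<And>t. h t \<in> borel_measurable borel" and m': "h' 0 \<in> borel_measurable borel"
    and der: "\<And>t y. \<bar>t\<bar> < \<delta> \<Longrightarrow> y \<in> K \<Longrightarrow> ((\<lambda>t. h t y) has_real_derivative h' t y) (at t)"
    and bound': "\<And>t y. \<bar>t\<bar> < \<delta> \<Longrightarrow> y \<in> K \<Longrightarrow> \<bar>h' t y\<bar> \<le> C"
    and bound: "\<And>t y. \<bar>t\<bar> < \<delta> \<Longrightarrow> y \<in> K \<Longrightarrow> \<bar>h t y\<bar> \<le> D"
    and zero: "\<And>t. \<bar>t\<bar> < \<delta> \<Longrightarrow> (LINT y|lborel. \<phi> y * h t y) = 0"
  shows "(LINT y|lborel. \<phi> y * h' 0 y) = 0"
proof -
  have [measurable]: "\<phi> \<in> borel_measurable borel" using \<phi> by auto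
  note [measurable] = m m'
  \<comment> \<open>The offset 2 keeps every \<open>t n\<close> strictly below \<delta>, the first
    one included.\<close>
  define t where "t n = \<delta> / real (n + 2)" for n :: nat
  have t: "0 < t n" "t n < \<delta>" for n
    using \<delta> mult_nonneg_nonneg[of \<delta> "real n"] unfolding t_def by (auto simp: field_simps intro: add_pos_nonneg)
  have t0: "t \<longlonglongrightarrow> 0" unfolding t_def by real_asymp
  have tat: "filterlim t (at 0) sequentially" using t0 t(1) by (auto simp: filterlim_at intro!: always_eventually) (metis less_irrefl)
  define q where "q n y = \<phi> y * ((h (t n) y - h 0 y) / t n)" for n y
  have int: "integrable lborel (\<lambda>y. \<phi> y * h s y)" if "\<bar>s\<bar> < \<delta>" for s
  proof (rule Bochner_Integration.integrable_bound)
    show "integrable lborel (\<lambda>y. D * \<phi> y)" using \<phi> by simp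
    show "AE y in lborel. norm (\<phi> y * h s y) \<le> norm (D * \<phi> y)"
      using supp
    proof eventually_elim
      case (elim y)
      have "\<bar>h s y\<bar> \<le> \<bar>D\<bar>" if "y \<in> K" using bound[OF \<open>\<bar>s\<bar> < \<delta>\<close> that] by linarith
      then have "\<bar>h s y\<bar> * \<bar>\<phi> y\<bar> \<le> \<bar>D\<bar> * \<bar>\<phi> y\<bar>"
        using elim by (cases "y \<in> K") (auto intro: mult_right_mono)
      then show ?case by (simp add: abs_mult mult.commute)
    qed
  qed measurable
  have q0: "(LINT y|lborel. q n y) = 0" for n
  proof -
    have tn: "\<bar>t n\<bar> < \<delta>" "\<bar>0\<bar> < \<delta>" using t[of n] \<delta> by auto
    have "(LINT y|lborel. q n y) = (LINT y|lborel. (\<phi> y * h (t n) y - \<phi> y * h 0 y) / t n)"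
      unfolding q_def by (intro Bochner_Integration.integral_cong) (auto simp: algebra_simps diff_divide_distrib)
    also have "\<dots> = ((LINT y|lborel. \<phi> y * h (t n) y) - (LINT y|lborel. \<phi> y * h 0 y)) / t n"
      using int[OF tn(1)] int[OF tn(2)] by simp
    also have "\<dots> = 0" using zero[OF tn(1)] zero[OF tn(2)] by simp
    finally show ?thesis .
  qed
  have "(\<lambda>n. LINT y|lborel. q n y) \<longlonglongrightarrow> (LINT y|lborel. \<phi> y * h' 0 y)"
  proof (rule integral_dominated_convergence)
    show "integrable lborel (\<lambda>y. \<bar>C * \<phi> y\<bar>)" using \<phi> by (intro integrable_abs integrable_mult_right)
    show "AE y in lborel. (\<lambda>n. q n y) \<longlonglongrightarrow> \<phi> y * h' 0 y"
      using supp
    proof eventually_elim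
      case (elim y)
      show ?case
      proof (cases "y \<in> K")
        case True
        have "((\<lambda>s. (h (0 + s) y - h 0 y) / s) \<longlongrightarrow> h' 0 y) (at 0)"
          using der[of 0 y] \<delta> True unfolding DERIV_def by simp
        from filterlim_compose[OF this tat] show ?thesis
          unfolding q_def by (intro tendsto_mult tendsto_const) simp
      next
        case False
        then show ?thesis using elim by (simp add: q_def)
      qed
    qed
    show "AE y in lborel. norm (q n y) \<le> \<bar>C * \<phi> y\<bar>" for n
      using supp
    proof eventually_elim
      case (elim y)
      show ?case
      proof (cases "y \<in> K")
        case True
        have "\<exists>z. 0 < z \<and> z < t n \<and> h (t n) y - h 0 y = (t n - 0) * h' z y"
          using t[of n] True by (intro MVT2 der) auto
        then obtain z where z: "0 < z" "z < t n" "h (t n) y - h 0 y = t n * h' z y" by auto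
        have "\<bar>h' z y\<bar> \<le> C" using z t[of n] by (intro bound' True) auto
        then have "\<bar>(h (t n) y - h 0 y) / t n\<bar> \<le> \<bar>C\<bar>" using z(3) t(1)[of n] by simp
        then have "\<bar>\<phi> y\<bar> * \<bar>(h (t n) y - h 0 y) / t n\<bar> \<le> \<bar>\<phi> y\<bar> * \<bar>C\<bar>" by (intro mult_left_mono) auto
        then show ?thesis by (simp add: q_def abs_mult mult.commute)
      next
        case False
        then show ?thesis using elim by (simp add: q_def)
      qed
    qed
  qed (auto simp: q_def[abs_def])
  then show ?thesis unfolding q0 by (simp add: LIMSEQ_const_iff)
qed

text \<open>A power of the squared distance, so \<open>p\<close> is half the exponent and one
  application of the Laplacian lowers it by 1.\<close>

definition npow :: "real \<Rightarrow> 'a::euclidean_space \<Rightarrow> 'a \<Rightarrow> real" where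
  "npow p x y = ((norm (x - y))\<^sup>2) powr p"

lemma npow_measurable[measurable]: "npow p x \<in> borel_measurable borel"
  unfolding npow_def[abs_def] by measurable

lemma norm_shift_sq:
  fixes i :: "'a::euclidean_space"
  assumes "i \<in> Basis"
  shows "(norm (x + t *\<^sub>R i - y))\<^sup>2 = (norm (x - y))\<^sup>2 + 2 * t * ((x - y) \<bullet> i) + t\<^sup>2"
proof -
  have 1: "x + t *\<^sub>R i - y = (x - y) + t *\<^sub>R i" by simp
  have "(norm (v + t *\<^sub>R i))\<^sup>2 = (norm v)\<^sup>2 + 2 * t * (v \<bullet> i) + t\<^sup>2" for v
    unfolding power2_norm_eq_inner inner_add_left inner_add_right inner_scaleR_left inner_scaleR_right
    using inner_commute[of i v] inner_same_Basis[OF assms] by (simp add: power2_eq_square distrib_left)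
  then show ?thesis unfolding 1 .
qed

text \<open>
  Apart from a constant the Laplacian of \<open>npow p\<close> is \<open>npow (p - 1)\<close>; the sign condition makes
  that constant nonzero.
\<close>

lemma npow_laplacian_step:
  fixes \<phi> :: "'a::euclidean_space \<Rightarrow> real"
  assumes \<phi>: "integrable lborel \<phi>" and supp: "AE y in lborel. y \<notin> K \<longrightarrow> \<phi> y = 0"
    and B: "open B" and d: "d > 0"
    and dist: "\<And>x y. x \<in> B \<Longrightarrow> y \<in> K \<Longrightarrow> d \<le> norm (x - y) \<and> norm (x - y) \<le> D"
    and p: "p < 0" "real DIM('a) + 2 * (p - 1) < 0"
    and zero: "\<And>x. x \<in> B \<Longrightarrow> (LINT y|lborel. \<phi> y * npow p x y) = 0"
    and x: "x \<in> B"
  shows "(LINT y|lborel. \<phi> y * npow (p - 1) x y) = 0"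
proof -
  have [measurable]: "\<phi> \<in> borel_measurable borel" using \<phi> by auto
  define M where "M q = (d\<^sup>2) powr q" for q :: real
  have M: "0 \<le> npow q x y" "npow q x y \<le> M q" if "q < 0" "x \<in> B" "y \<in> K" for q x y
    using dist[OF that(2,3)] d that(1) unfolding npow_def M_def by (auto intro!: powr_mono2' power_mono)
  have inn: "\<bar>(x - y) \<bullet> i\<bar> \<le> D" if "x \<in> B" "y \<in> K" "i \<in> Basis" for x y i
    using Basis_le_norm[OF that(3), of "x - y"] dist[OF that(1,2)] by linarith
  have pos: "(norm (x - y))\<^sup>2 > 0" if "x \<in> B" "y \<in> K" for x y
  proof -
    have "norm (x - y) > 0" using dist[OF that] d by linarith
    then show ?thesis by simp
  qed
  have D: "0 \<le> D" if "y \<in> K" for y using dist[OF x that] d by linarith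
  have nb: "\<exists>\<delta>>0. \<forall>t. \<bar>t\<bar> < \<delta> \<longrightarrow> x + t *\<^sub>R i \<in> B" if xB: "x \<in> B" and "i \<in> Basis" for x i
  proof -
    obtain e where "e > 0" "ball x e \<subseteq> B" by (rule openE[OF B xB])
    moreover have "x + t *\<^sub>R i \<in> ball x e" if "\<bar>t\<bar> < e" for t
      using that \<open>i \<in> Basis\<close> by (simp add: dist_norm)
    ultimately show ?thesis by (intro exI[of _ e]) blast
  qed
  have npow_der: "((\<lambda>t. npow q (x + t *\<^sub>R i) y) has_real_derivative
      q * npow (q - 1) (x + t *\<^sub>R i) y * (2 * ((x - y) \<bullet> i + t))) (at t)"
    if "x + t *\<^sub>R i \<in> B" "y \<in> K" "i \<in> Basis" for q t y i x
  proof -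
    have ps: "(norm (x - y))\<^sup>2 + 2 * t * ((x - y) \<bullet> i) + t\<^sup>2 > 0"
      using pos[OF that(1,2)] unfolding norm_shift_sq[OF that(3)] .
    have g: "((\<lambda>t. (norm (x - y))\<^sup>2 + 2 * t * ((x - y) \<bullet> i) + t\<^sup>2) has_real_derivative 2 * ((x - y) \<bullet> i + t)) (at t)"
      by (auto intro!: derivative_eq_intros)
    show ?thesis unfolding npow_def norm_shift_sq[OF that(3)]
      by (rule DERIV_chain2[OF has_real_derivative_powr[OF ps, of q] g])
  qed
  \<comment> \<open>The first derivative in direction i, up to the factor 2 p. It is obtained for
    every point of \<open>B\<close>, so that it can be differentiated once more.\<close>
  have first: "(LINT y|lborel. \<phi> y * (((x - y) \<bullet> i) * npow (p - 1) x y)) = 0" if x: "x \<in> B" and i: "i \<in> Basis" for x i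
  proof -
    obtain \<delta> where \<delta>: "\<delta> > 0" "\<And>t. \<bar>t\<bar> < \<delta> \<Longrightarrow> x + t *\<^sub>R i \<in> B" using nb[OF x i] by blast
    have "(LINT y|lborel. \<phi> y * (p * npow (p - 1) (x + 0 *\<^sub>R i) y * (2 * ((x - y) \<bullet> i + 0)))) = 0"
    proof (rule integral_param_derivative_zero[OF \<phi> supp \<delta>(1), where h="\<lambda>t. npow p (x + t *\<^sub>R i)"
          and h'="\<lambda>t y. p * npow (p - 1) (x + t *\<^sub>R i) y * (2 * ((x - y) \<bullet> i + t))"])
      fix t y assume t: "\<bar>t\<bar> < \<delta>" and y: "y \<in> K"
      show "((\<lambda>t. npow p (x + t *\<^sub>R i) y) has_real_derivative
         p * npow (p - 1) (x + t *\<^sub>R i) y * (2 * ((x - y) \<bullet> i + t))) (at t)"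
        by (rule npow_der[OF \<delta>(2)[OF t] y i])
      show "\<bar>npow p (x + t *\<^sub>R i) y\<bar> \<le> M p" using M[OF p(1) \<delta>(2)[OF t] y] by simp
      have "(x - y) \<bullet> i + t = (x + t *\<^sub>R i - y) \<bullet> i" using i by (simp add: inner_diff_left inner_add_left)
      then have "\<bar>(x - y) \<bullet> i + t\<bar> \<le> D" using inn[OF \<delta>(2)[OF t] y i] by simp
      moreover have "\<bar>npow (p - 1) (x + t *\<^sub>R i) y\<bar> \<le> M (p - 1)" using M[of "p - 1", OF _ \<delta>(2)[OF t] y] p(1) by simp
      ultimately have "\<bar>p\<bar> * \<bar>npow (p - 1) (x + t *\<^sub>R i) y\<bar> * (2 * \<bar>(x - y) \<bullet> i + t\<bar>) \<le> \<bar>p\<bar> * M (p - 1) * (2 * D)"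
        using D[OF y] unfolding M_def by (intro mult_mono) auto
      then show "\<bar>p * npow (p - 1) (x + t *\<^sub>R i) y * (2 * ((x - y) \<bullet> i + t))\<bar> \<le> \<bar>p\<bar> * M (p - 1) * (2 * D)"
        unfolding abs_mult abs_numeral .
    next
      fix t assume "\<bar>t\<bar> < \<delta>"
      then show "(LINT y|lborel. \<phi> y * npow p (x + t *\<^sub>R i) y) = 0" by (intro zero \<delta>(2))
    qed measurable
    moreover have "\<phi> y * (p * npow (p - 1) (x + 0 *\<^sub>R i) y * (2 * ((x - y) \<bullet> i + 0))) = (2 * p) * (\<phi> y * (((x - y) \<bullet> i) * npow (p - 1) x y))" for y
      by simp
    ultimately show ?thesis using p(1) by (simp only: integral_mult_right_zero) simp
  qed
  \<comment> \<open>The second derivative in direction i, divided by 2 p, by the product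
    rule.\<close>
  define g where "g i y = \<phi> y * (npow (p - 1) x y + 2 * (p - 1) * (((x - y) \<bullet> i)\<^sup>2 * npow (p - 2) x y))" for i y
  have second: "(LINT y|lborel. g i y) = 0" if i: "i \<in> Basis" for i
  proof -
    obtain \<delta> where \<delta>: "\<delta> > 0" "\<And>t. \<bar>t\<bar> < \<delta> \<Longrightarrow> x + t *\<^sub>R i \<in> B" using nb[OF x i] by blast
    have s: "(x - y) \<bullet> i + t = (x + t *\<^sub>R i - y) \<bullet> i" for t y using i by (simp add: inner_diff_left inner_add_left)
    let ?h = "\<lambda>t y. ((x - y) \<bullet> i + t) * npow (p - 1) (x + t *\<^sub>R i) y"
    let ?h' = "\<lambda>t y. npow (p - 1) (x + t *\<^sub>R i) y + ((x - y) \<bullet> i + t) * ((p - 1) * npow (p - 1 - 1) (x + t *\<^sub>R i) y * (2 * ((x - y) \<bullet> i + t)))"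
    have "(LINT y|lborel. \<phi> y * ?h' 0 y) = 0"
    proof (rule integral_param_derivative_zero[OF \<phi> supp \<delta>(1), where h="?h" and h'="?h'"])
      fix t y assume t: "\<bar>t\<bar> < \<delta>" and y: "y \<in> K"
      have "((\<lambda>t. (x - y) \<bullet> i + t) has_real_derivative 1) (at t)" by (auto intro!: derivative_eq_intros)
      from DERIV_mult[OF this npow_der[OF \<delta>(2)[OF t] y i, of "p - 1"]]
      show "((\<lambda>t. ?h t y) has_real_derivative ?h' t y) (at t)" by (simp add: algebra_simps)
      have a: "\<bar>(x - y) \<bullet> i + t\<bar> \<le> D" using inn[OF \<delta>(2)[OF t] y i] unfolding s .
      have b: "\<bar>npow (p - 1) (x + t *\<^sub>R i) y\<bar> \<le> M (p - 1)" using M[of "p - 1", OF _ \<delta>(2)[OF t] y] p(1) by simp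
      have c: "\<bar>npow (p - 1 - 1) (x + t *\<^sub>R i) y\<bar> \<le> M (p - 1 - 1)" using M[of "p - 1 - 1", OF _ \<delta>(2)[OF t] y] p(1) by simp
      show "\<bar>?h t y\<bar> \<le> D * M (p - 1)" unfolding abs_mult using a b D[OF y] by (intro mult_mono) auto
      have "\<bar>?h' t y\<bar> \<le> \<bar>npow (p - 1) (x + t *\<^sub>R i) y\<bar> + \<bar>(x - y) \<bullet> i + t\<bar> * (\<bar>p - 1\<bar> * \<bar>npow (p - 1 - 1) (x + t *\<^sub>R i) y\<bar> * (2 * \<bar>(x - y) \<bullet> i + t\<bar>))"
        using abs_triangle_ineq by (metis (no_types, opaque_lifting) abs_mult abs_numeral)
      also have "\<dots> \<le> M (p - 1) + D * (\<bar>p - 1\<bar> * M (p - 1 - 1) * (2 * D))"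
        using a b c D[OF y] unfolding M_def by (intro add_mono mult_mono) auto
      finally show "\<bar>?h' t y\<bar> \<le> M (p - 1) + D * (\<bar>p - 1\<bar> * M (p - 1 - 1) * (2 * D))" .
    next
      fix t assume "\<bar>t\<bar> < \<delta>"
      from first[OF \<delta>(2)[OF this] i] show "(LINT y|lborel. \<phi> y * ?h t y) = 0" unfolding s .
    qed measurable
    moreover have "\<phi> y * ?h' 0 y = g i y" for y unfolding g_def by (simp add: power2_eq_square algebra_simps)
    ultimately show ?thesis by (simp only:)
  qed
  have g_int: "integrable lborel (g i)" if i: "i \<in> Basis" for i
  proof (rule Bochner_Integration.integrable_bound)
    show "integrable lborel (\<lambda>y. (M (p - 1) + 2 * \<bar>p - 1\<bar> * (D\<^sup>2 * M (p - 2))) * \<phi> y)" using \<phi> by simp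
    show "AE y in lborel. norm (g i y) \<le> norm ((M (p - 1) + 2 * \<bar>p - 1\<bar> * (D\<^sup>2 * M (p - 2))) * \<phi> y)"
      using supp
    proof eventually_elim
      case (elim y)
      show ?case
      proof (cases "y \<in> K")
        case True
        have a: "((x - y) \<bullet> i)\<^sup>2 \<le> D\<^sup>2" using inn[OF x True i] D[OF True] abs_le_square_iff[of "(x - y) \<bullet> i" D] by simp
        have b: "\<bar>npow (p - 1) x y\<bar> \<le> M (p - 1)" "\<bar>npow (p - 2) x y\<bar> \<le> M (p - 2)"
          using M[of "p - 1", OF _ x True] M[of "p - 2", OF _ x True] p(1) by simp_all
        have "\<bar>npow (p - 1) x y + 2 * (p - 1) * (((x - y) \<bullet> i)\<^sup>2 * npow (p - 2) x y)\<bar>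
          \<le> \<bar>npow (p - 1) x y\<bar> + \<bar>2 * (p - 1) * (((x - y) \<bullet> i)\<^sup>2 * npow (p - 2) x y)\<bar>" by (rule abs_triangle_ineq)
        also have "\<bar>2 * (p - 1) * (((x - y) \<bullet> i)\<^sup>2 * npow (p - 2) x y)\<bar> = 2 * \<bar>p - 1\<bar> * (((x - y) \<bullet> i)\<^sup>2 * \<bar>npow (p - 2) x y\<bar>)"
          by (simp only: abs_mult abs_numeral abs_power2 mult.assoc)
        also have "\<bar>npow (p - 1) x y\<bar> + \<dots> \<le> M (p - 1) + 2 * \<bar>p - 1\<bar> * (D\<^sup>2 * M (p - 2))"
          using a b unfolding M_def by (intro add_mono mult_mono) auto
        also have "\<dots> \<le> \<bar>M (p - 1) + 2 * \<bar>p - 1\<bar> * (D\<^sup>2 * M (p - 2))\<bar>" by simp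
        finally have "\<bar>npow (p - 1) x y + 2 * (p - 1) * (((x - y) \<bullet> i)\<^sup>2 * npow (p - 2) x y)\<bar> \<le> \<bar>M (p - 1) + 2 * \<bar>p - 1\<bar> * (D\<^sup>2 * M (p - 2))\<bar>" .
        from mult_left_mono[OF this abs_ge_zero[of "\<phi> y"]] show ?thesis
          unfolding g_def real_norm_def abs_mult[of "\<phi> y"] abs_mult[of "M (p - 1) + 2 * \<bar>p - 1\<bar> * (D\<^sup>2 * M (p - 2))" "\<phi> y"]
          by (simp only: mult.commute)
      qed (use elim in \<open>simp add: g_def\<close>)
    qed
  qed (simp add: g_def[abs_def])
  \<comment> \<open>Summing over the basis turns the squared components into |x - y|^2, which raises
    the exponent p - 2 to p - 1 and leaves the factor n + 2 (p - 1).\<close>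
  have "0 = (LINT y|lborel. (\<Sum>i\<in>Basis. g i y))" using second g_int by simp
  also have "\<dots> = (LINT y|lborel. (real DIM('a) + 2 * (p - 1)) * (\<phi> y * npow (p - 1) x y))"
  proof (rule integral_cong_AE)
    show "AE y in lborel. (\<Sum>i\<in>Basis. g i y) = (real DIM('a) + 2 * (p - 1)) * (\<phi> y * npow (p - 1) x y)"
      using supp
    proof eventually_elim
      case (elim y)
      show ?case
      proof (cases "y \<in> K")
        case True
        have "(norm (x - y))\<^sup>2 * npow (p - 2) x y = npow (p - 1) x y"
          using pos[OF x True] unfolding npow_def by (simp add: powr_mult_base)
        then have "(\<Sum>i\<in>Basis. ((x - y) \<bullet> i)\<^sup>2) * npow (p - 2) x y = npow (p - 1) x y"
          by (simp add: norm_sq_eq_sum_Basis)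
        moreover have "(\<Sum>i\<in>Basis. g i y) = \<phi> y * (real DIM('a) * npow (p - 1) x y + 2 * (p - 1) * ((\<Sum>i\<in>Basis. ((x - y) \<bullet> i)\<^sup>2) * npow (p - 2) x y))"
          unfolding g_def by (simp add: sum.distrib sum_distrib_left[symmetric] sum_distrib_right[symmetric])
        ultimately show ?thesis by (simp add: algebra_simps)
      qed (use elim in \<open>simp add: g_def\<close>)
    qed
  qed (auto simp: g_def[abs_def])
  finally show ?thesis using p(2) by simp
qed

section \<open>The algebra generated by Gaussians with centres in a convex set\<close>

text \<open>The value \<open>\<kappa> = 0\<close> is allowed so that constants belong to the family,
  as the Stone-Weierstrass theorem requires.\<close>

inductive gauss_comb :: "'a::euclidean_space set \<Rightarrow> ('a \<Rightarrow> real) \<Rightarrow> bool" for B where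
  base: "\<kappa> \<ge> 0 \<Longrightarrow> x \<in> B \<Longrightarrow> gauss_comb B (\<lambda>y. c * exp (- \<kappa> * (norm (x - y))\<^sup>2))"
| sum: "gauss_comb B f \<Longrightarrow> gauss_comb B g \<Longrightarrow> gauss_comb B (\<lambda>y. f y + g y)"

text \<open>Completing the square: the product is a multiple of a Gaussian centred at the weighted
  mean of the two centres, which convexity keeps in \<open>B\<close>.\<close>

lemma gauss_product:
  fixes x z :: "'a::euclidean_space"
  assumes "\<kappa> \<ge> 0" "\<mu> \<ge> 0" "x \<in> B" "z \<in> B" "convex B"
  shows "\<exists>w\<in>B. \<exists>c. \<forall>y. exp (- \<kappa> * (norm (x - y))\<^sup>2) * exp (- \<mu> * (norm (z - y))\<^sup>2)
    = c * exp (- (\<kappa> + \<mu>) * (norm (w - y))\<^sup>2)"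
proof (cases "\<kappa> + \<mu> = 0")
  case True
  then show ?thesis using assms by (intro bexI[of _ x] exI[of _ 1]) (auto simp: add_nonneg_eq_0_iff)
next
  case False
  define a where "a = \<kappa> + \<mu>"
  have a: "a > 0" using False assms unfolding a_def by linarith
  define w where "w = (\<kappa> / a) *\<^sub>R x + (\<mu> / a) *\<^sub>R z"
  have w: "w \<in> B" unfolding w_def using assms a by (intro convexD[OF assms(5)]) (auto simp: a_def add_divide_distrib[symmetric])
  have aw: "a *\<^sub>R w = \<kappa> *\<^sub>R x + \<mu> *\<^sub>R z" unfolding w_def using a by (simp add: scaleR_add_right)
  define K where "K = \<kappa> * (x \<bullet> x) + \<mu> * (z \<bullet> z) - a * (w \<bullet> w)"
  have E: "- \<kappa> * (norm (x - y))\<^sup>2 + - \<mu> * (norm (z - y))\<^sup>2 = - K + - a * (norm (w - y))\<^sup>2" for y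
  proof -
    have "a * (w \<bullet> y) = \<kappa> * (x \<bullet> y) + \<mu> * (z \<bullet> y)"
      using arg_cong[OF aw, of "\<lambda>v. v \<bullet> y"] by (simp add: inner_add_left)
    moreover have "a * (y \<bullet> y) = \<kappa> * (y \<bullet> y) + \<mu> * (y \<bullet> y)" unfolding a_def by (rule distrib_right)
    moreover have n: "(norm (v - y))\<^sup>2 = v \<bullet> v - 2 * (v \<bullet> y) + y \<bullet> y" for v
      unfolding power2_norm_eq_inner inner_diff_left inner_diff_right using inner_commute[of v y] by simp
    ultimately show ?thesis unfolding K_def n by (simp add: algebra_simps)
  qed
  have "exp (- \<kappa> * (norm (x - y))\<^sup>2) * exp (- \<mu> * (norm (z - y))\<^sup>2) = exp (- K) * exp (- a * (norm (w - y))\<^sup>2)" for y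
  proof -
    have "exp (- \<kappa> * (norm (x - y))\<^sup>2) * exp (- \<mu> * (norm (z - y))\<^sup>2) = exp (- \<kappa> * (norm (x - y))\<^sup>2 + - \<mu> * (norm (z - y))\<^sup>2)"
      by (rule exp_add[symmetric])
    also have "\<dots> = exp (- K + - a * (norm (w - y))\<^sup>2)" by (rule arg_cong[OF E])
    also have "\<dots> = exp (- K) * exp (- a * (norm (w - y))\<^sup>2)" by (rule exp_add)
    finally show ?thesis .
  qed
  then show ?thesis unfolding a_def by (intro bexI[OF _ w] exI[of _ "exp (- K)"] allI)
qed

lemma gauss_comb_mult:
  assumes f: "gauss_comb B f" and g: "gauss_comb B g" and B: "convex B"
  shows "gauss_comb B (\<lambda>y. f y * g y)"
  using f
proof induction
  case (base \<kappa> x c)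
  note f = base
  show ?case using g
  proof induction
    case (base \<mu> z k)
    obtain w C where w: "w \<in> B" "\<And>y. exp (- \<kappa> * (norm (x - y))\<^sup>2) * exp (- \<mu> * (norm (z - y))\<^sup>2) = C * exp (- (\<kappa> + \<mu>) * (norm (w - y))\<^sup>2)"
      using gauss_product[OF f(1) base(1) f(2) base(2) B] by blast
    have "(\<lambda>y. c * exp (- \<kappa> * (norm (x - y))\<^sup>2) * (k * exp (- \<mu> * (norm (z - y))\<^sup>2))) = (\<lambda>y. (c * k * C) * exp (- (\<kappa> + \<mu>) * (norm (w - y))\<^sup>2))"
    proof
      fix y
      have "c * exp (- \<kappa> * (norm (x - y))\<^sup>2) * (k * exp (- \<mu> * (norm (z - y))\<^sup>2)) = c * k * (exp (- \<kappa> * (norm (x - y))\<^sup>2) * exp (- \<mu> * (norm (z - y))\<^sup>2))"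
        by (simp only: mult_ac)
      also have "\<dots> = c * k * (C * exp (- (\<kappa> + \<mu>) * (norm (w - y))\<^sup>2))" by (simp only: w(2))
      finally show "c * exp (- \<kappa> * (norm (x - y))\<^sup>2) * (k * exp (- \<mu> * (norm (z - y))\<^sup>2)) = (c * k * C) * exp (- (\<kappa> + \<mu>) * (norm (w - y))\<^sup>2)"
        by (simp only: mult.assoc)
    qed
    then show ?case using gauss_comb.base[OF _ w(1), of "\<kappa> + \<mu>" "c * k * C"] f(1) base(1) by simp
  next
    case (sum f1 g1)
    then show ?case using gauss_comb.sum[OF sum.IH] by (simp only: distrib_left)
  qed
next
  case (sum f1 g1)
  then show ?case using gauss_comb.sum[OF sum.IH] by (simp only: distrib_right)
qed

lemma gauss_comb_continuous: "gauss_comb B f \<Longrightarrow> continuous_on S f"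
  by (induction rule: gauss_comb.induct) (auto intro!: continuous_intros)

lemma riesz_potential_unique_continuation:
  fixes \<phi> :: "'a::euclidean_space \<Rightarrow> real"
  assumes \<phi>: "integrable lborel \<phi>" "\<phi> \<in> L2" and supp: "AE y in lborel. y \<notin> K \<longrightarrow> \<phi> y = 0" and K: "compact K"
    and B: "open B" "convex B" "B \<noteq> {}" and d: "d > 0"
    and dist: "\<And>x y. x \<in> B \<Longrightarrow> y \<in> K \<Longrightarrow> d \<le> norm (x - y) \<and> norm (x - y) \<le> D"
    and p: "2 * p < - real DIM('a)"
    and zero: "\<And>x. x \<in> B \<Longrightarrow> (LINT y|lborel. \<phi> y * npow p x y) = 0"
  shows "AE y in lborel. \<phi> y = 0"
proof -
  have [measurable]: "\<phi> \<in> borel_measurable borel" using \<phi> by auto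
  have Kb: "K \<in> sets borel" using K by (simp add: compact_imp_closed)
  \<comment> \<open>Pairing with \<phi> is continuous for uniform convergence on \<open>K\<close>;
    both approximation arguments below rest on this bound.\<close>
  have int: "integrable lborel (\<lambda>y. \<phi> y * h y)" and bnd: "\<bar>(LINT y|lborel. \<phi> y * h y)\<bar> \<le> C * (LINT y|lborel. \<bar>\<phi> y\<bar>)"
    if [measurable]: "h \<in> borel_measurable borel" and h: "\<And>y. y \<in> K \<Longrightarrow> \<bar>h y\<bar> \<le> C" and C: "C \<ge> 0" for h C
  proof -
    have le: "AE y in lborel. \<bar>\<phi> y * h y\<bar> \<le> C * \<bar>\<phi> y\<bar>"
      using supp
    proof eventually_elim
      case (elim y)
      show ?case
      proof (cases "y \<in> K")
        case True
        then show ?thesis using mult_right_mono[OF h[OF True], of "\<bar>\<phi> y\<bar>"] by (simp add: abs_mult mult.commute)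
      qed (use elim in simp)
    qed
    show i: "integrable lborel (\<lambda>y. \<phi> y * h y)"
      by (rule Bochner_Integration.integrable_bound[of _ "\<lambda>y. C * \<bar>\<phi> y\<bar>"]) (use \<phi> le C in \<open>auto simp: abs_mult\<close>)
    have "\<bar>(LINT y|lborel. \<phi> y * h y)\<bar> \<le> (LINT y|lborel. \<bar>\<phi> y * h y\<bar>)" by (rule integral_abs_bound)
    also have "\<dots> \<le> (LINT y|lborel. C * \<bar>\<phi> y\<bar>)" using i \<phi> le by (intro integral_mono_AE) auto
    finally show "\<bar>(LINT y|lborel. \<phi> y * h y)\<bar> \<le> C * (LINT y|lborel. \<bar>\<phi> y\<bar>)" by simp
  qed
  define L where "L = (LINT y|lborel. \<bar>\<phi> y\<bar>)"
  have L: "L \<ge> 0" unfolding L_def by simp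
  have small: "I = 0" if "\<And>e. e > 0 \<Longrightarrow> \<bar>I\<bar> \<le> e * c" "c \<ge> 0" for I c :: real
  proof -
    have "\<bar>I\<bar> \<le> 0 + e" if "e > 0" for e
    proof -
      have "\<bar>I\<bar> \<le> e / (c + 1) * c" using \<open>e > 0\<close> \<open>c \<ge> 0\<close> by (intro \<open>\<And>e. e > 0 \<Longrightarrow> \<bar>I\<bar> \<le> e * c\<close>) simp
      also have "\<dots> \<le> e" using \<open>e > 0\<close> \<open>c \<ge> 0\<close> by (simp add: field_simps)
      finally show ?thesis by simp
    qed
    then have "\<bar>I\<bar> \<le> 0" by (rule field_le_epsilon)
    then show ?thesis by simp
  qed
  have N: "real DIM('a) > 0" by simp
  have powers: "\<forall>x\<in>B. (LINT y|lborel. \<phi> y * npow (p - real k) x y) = 0" for k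
  proof (induction k)
    case 0
    then show ?case using zero by simp
  next
    case (Suc k)
    show ?case
    proof
      fix x assume x: "x \<in> B"
      have "(LINT y|lborel. \<phi> y * npow ((p - real k) - 1) x y) = 0"
        by (rule npow_laplacian_step[OF \<phi>(1) supp B(1) d dist _ _ _ x]) (use p N Suc in auto)
      then show "(LINT y|lborel. \<phi> y * npow (p - real (Suc k)) x y) = 0" by (simp add: algebra_simps)
    qed
  qed
  have gauss: "(LINT y|lborel. \<phi> y * exp (- \<kappa> * (norm (x - y))\<^sup>2)) = 0" if x: "x \<in> B" and l: "\<kappa> \<ge> 0" for \<kappa> x
  proof (rule small)
    fix e :: real assume e: "e > 0"
    \<comment> \<open>In the variable \<tau> = 1 / |x - y|^2 the factor \<open>\<tau> powr p\<close>
      cancels the prefactor \<open>npow p x y\<close>. Approximating G by a polynomial thus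
      approximates the Gaussian by a combination of the kernels \<open>npow (p - i)\<close>. The
      interval \<open>S\<close> stays away from 0, where G can be singular.\<close>
    define G where "G \<tau> = \<tau> powr p * exp (- \<kappa> * (1 / \<tau>))" for \<tau> :: real
    define S where "S = {1 / D\<^sup>2 .. 1 / d\<^sup>2}"
    have tau: "1 / (norm (x - y))\<^sup>2 \<in> S" "(norm (x - y))\<^sup>2 > 0" "D > 0" if "y \<in> K" for y
    proof -
      have n: "norm (x - y) > 0" "d \<le> norm (x - y)" "norm (x - y) \<le> D" using dist[OF x that] d by auto
      then show "(norm (x - y))\<^sup>2 > 0" "D > 0" by (simp, linarith)
      show "1 / (norm (x - y))\<^sup>2 \<in> S" unfolding S_def using n d by (auto intro!: divide_left_mono power_mono mult_pos_pos)
    qed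
    have Spos: "\<tau> > 0" if "\<tau> \<in> S" "D > 0" for \<tau>
    proof -
      have "0 < 1 / D\<^sup>2" using that by simp
      moreover have "1 / D\<^sup>2 \<le> \<tau>" using that unfolding S_def by simp
      ultimately show ?thesis by linarith
    qed
    show "\<bar>(LINT y|lborel. \<phi> y * exp (- \<kappa> * (norm (x - y))\<^sup>2))\<bar> \<le> e * ((d\<^sup>2) powr p * L)"
    proof (cases "D > 0")
      case True
      have "continuous_on S G" unfolding G_def using Spos[OF _ True] by (intro continuous_intros) fastforce+
      then obtain P where P: "real_polynomial_function P" "\<And>\<tau>. \<tau> \<in> S \<Longrightarrow> \<bar>G \<tau> - P \<tau>\<bar> < e"
        using Stone_Weierstrass_real_polynomial_function[of S G e] e unfolding S_def by auto
      obtain c n where c: "P = (\<lambda>\<tau>. \<Sum>i\<le>n. c i * \<tau> ^ i)" using P(1) unfolding real_polynomial_function_iff_sum by blast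
      define h where "h y = (\<Sum>i\<le>n. c i * npow (p - real i) x y)" for y
      have hm [measurable]: "h \<in> borel_measurable borel" unfolding h_def[abs_def] by measurable
      have heq: "h y = npow p x y * P (1 / (norm (x - y))\<^sup>2)" if "y \<in> K" for y
      proof -
        have "npow (p - real i) x y = npow p x y * (1 / (norm (x - y))\<^sup>2) ^ i" for i
          using tau(2)[OF that] unfolding npow_def
          by (simp only: powr_diff powr_realpow power_one_over) (simp add: field_simps)
        then show ?thesis unfolding h_def c by (simp add: sum_distrib_left mult_ac)
      qed
      have Geq: "exp (- \<kappa> * (norm (x - y))\<^sup>2) = npow p x y * G (1 / (norm (x - y))\<^sup>2)" if "y \<in> K" for y
        using tau(2)[OF that] unfolding npow_def G_def by (simp add: powr_divide)
      have npb: "0 \<le> npow p x y" "npow p x y \<le> (d\<^sup>2) powr p" if "y \<in> K" for y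
        using dist[OF x that] d p N unfolding npow_def by (auto intro!: powr_mono2' power_mono)
      have diff: "\<bar>exp (- \<kappa> * (norm (x - y))\<^sup>2) - h y\<bar> \<le> e * (d\<^sup>2) powr p" if y: "y \<in> K" for y
      proof -
        have "\<bar>exp (- \<kappa> * (norm (x - y))\<^sup>2) - h y\<bar> = npow p x y * \<bar>G (1 / (norm (x - y))\<^sup>2) - P (1 / (norm (x - y))\<^sup>2)\<bar>"
          unfolding heq[OF y] Geq[OF y] using npb(1)[OF y] by (simp add: abs_mult flip: right_diff_distrib)
        also have "\<dots> \<le> (d\<^sup>2) powr p * e" using P(2)[OF tau(1)[OF y]] npb[OF y] by (intro mult_mono) auto
        finally show ?thesis by (simp add: mult.commute)
      qed
      have ih: "integrable lborel (\<lambda>y. \<phi> y * npow (p - real i) x y)" for i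
        by (rule int[where C="(d\<^sup>2) powr (p - real i)"])
          (use dist[OF x] d p N in \<open>auto simp: npow_def[abs_def] intro!: powr_mono2' power_mono\<close>)
      have ih': "integrable lborel (\<lambda>y. \<phi> y * h y)"
        unfolding h_def sum_distrib_left by (intro Bochner_Integration.integrable_sum, subst mult.left_commute, intro integrable_mult_right ih)
      have "(LINT y|lborel. \<phi> y * h y) = (LINT y|lborel. (\<Sum>i\<le>n. c i * (\<phi> y * npow (p - real i) x y)))"
        unfolding h_def by (simp add: sum_distrib_left mult.left_commute)
      also have "\<dots> = (\<Sum>i\<le>n. c i * (LINT y|lborel. \<phi> y * npow (p - real i) x y))" using ih by simp
      also have "\<dots> = 0" using powers x by simp
      finally have h0: "(LINT y|lborel. \<phi> y * h y) = 0" .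
      have ie: "integrable lborel (\<lambda>y. \<phi> y * exp (- \<kappa> * (norm (x - y))\<^sup>2))"
        by (rule int[where C=1]) (use l in auto)
      have "(LINT y|lborel. \<phi> y * exp (- \<kappa> * (norm (x - y))\<^sup>2)) = (LINT y|lborel. \<phi> y * exp (- \<kappa> * (norm (x - y))\<^sup>2)) - (LINT y|lborel. \<phi> y * h y)"
        using h0 by simp
      also have "\<dots> = (LINT y|lborel. \<phi> y * (exp (- \<kappa> * (norm (x - y))\<^sup>2) - h y))"
        unfolding right_diff_distrib using ie ih' by (rule Bochner_Integration.integral_diff[symmetric])
      finally have eq: "(LINT y|lborel. \<phi> y * exp (- \<kappa> * (norm (x - y))\<^sup>2)) = (LINT y|lborel. \<phi> y * (exp (- \<kappa> * (norm (x - y))\<^sup>2) - h y))" .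
      have "\<bar>(LINT y|lborel. \<phi> y * (exp (- \<kappa> * (norm (x - y))\<^sup>2) - h y))\<bar> \<le> (e * (d\<^sup>2) powr p) * L"
        unfolding L_def by (rule bnd) (use diff e in auto)
      then show ?thesis unfolding eq by (simp add: mult_ac)
    next
      \<comment> \<open>Without a positive upper bound for the distances \<open>K\<close> is empty,
        so \<phi> vanishes.\<close>
      case False
      then have "K = {}" using tau(3) by blast
      then have "AE y in lborel. \<phi> y * exp (- \<kappa> * (norm (x - y))\<^sup>2) = 0" using supp by auto
      then have "(LINT y|lborel. \<phi> y * exp (- \<kappa> * (norm (x - y))\<^sup>2)) = integral\<^sup>L lborel (\<lambda>y::'a. 0)"
        by (intro integral_cong_AE) auto
      then show ?thesis using e L by simp
    qed
  qed (use L in simp)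
  have comb: "integrable lborel (\<lambda>y. \<phi> y * f y) \<and> (LINT y|lborel. \<phi> y * f y) = 0" if "gauss_comb B f" for f
    using that
  proof induction
    case (base \<kappa> x c)
    have "integrable lborel (\<lambda>y. \<phi> y * exp (- \<kappa> * (norm (x - y))\<^sup>2))"
      by (rule int[where C=1]) (use base in auto)
    moreover have "\<phi> y * (c * exp (- \<kappa> * (norm (x - y))\<^sup>2)) = c * (\<phi> y * exp (- \<kappa> * (norm (x - y))\<^sup>2))" for y by simp
    ultimately show ?case using gauss[OF base(2,1)] by (simp only: integrable_mult_right integral_mult_right_zero) simp
  next
    case (sum f g)
    then show ?case by (simp add: distrib_left)
  qed
  have "(LINT y|lborel. \<phi> y * f y) = 0" if f: "f \<in> test_functions UNIV" for f
  proof (rule small)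
    fix e :: real assume e: "e > 0"
    have "\<exists>g. gauss_comb B g \<and> (\<forall>y\<in>K. \<bar>f y - g y\<bar> < e)"
    proof (rule Stone_Weierstrass_HOL[OF K _ _ _ _ _ _ e])
      obtain x where x: "x \<in> B" using B by blast
      show "gauss_comb B (\<lambda>y. c)" for c using gauss_comb.base[of 0 x B c] x by simp
      show "continuous_on K g" if "gauss_comb B g" for g using gauss_comb_continuous[OF that] .
      show "gauss_comb B (\<lambda>y. g y + h y)" if "gauss_comb B g \<and> gauss_comb B h" for g h using that gauss_comb.sum by blast
      show "gauss_comb B (\<lambda>y. g y * h y)" if "gauss_comb B g \<and> gauss_comb B h" for g h using that gauss_comb_mult B(2) by blast
      show "continuous_on K f" using test_functions_continuous[OF f] continuous_on_subset by blast
      fix y z :: 'a assume yz: "y \<in> K \<and> z \<in> K \<and> y \<noteq> z"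
      obtain r where r: "r > 0" "ball x r \<subseteq> B" by (rule openE[OF B(1) x])
      \<comment> \<open>If y and z are equidistant from x, moving the centre in the direction y - z
        breaks the tie. This length moves it by half the radius r, so it stays in the ball.\<close>
      define \<epsilon> where "\<epsilon> = r / (2 * norm (y - z))"
      have \<epsilon>: "\<epsilon> > 0" unfolding \<epsilon>_def using r yz by simp
      define x' where "x' = x + \<epsilon> *\<^sub>R (y - z)"
      have "norm (\<epsilon> *\<^sub>R (y - z)) = r / 2" unfolding \<epsilon>_def using yz r(1) by simp
      then have x': "x' \<in> B" using r unfolding x'_def by (intro subsetD[OF r(2)]) (simp add: dist_norm)
      have key: "(norm (x' - z))\<^sup>2 - (norm (x' - y))\<^sup>2 = (norm (x - z))\<^sup>2 - (norm (x - y))\<^sup>2 + 2 * \<epsilon> * (norm (y - z))\<^sup>2"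
        unfolding x'_def power2_norm_eq_inner
        by (simp add: inner_diff_left inner_diff_right inner_add_left inner_add_right inner_commute algebra_simps)
      have "2 * \<epsilon> * (norm (y - z))\<^sup>2 > 0" using \<epsilon> yz by simp
      then have "(norm (x - z))\<^sup>2 \<noteq> (norm (x - y))\<^sup>2 \<or> (norm (x' - z))\<^sup>2 \<noteq> (norm (x' - y))\<^sup>2" using key by linarith
      then obtain w where w: "w \<in> B" "(norm (w - z))\<^sup>2 \<noteq> (norm (w - y))\<^sup>2" using x x' by blast
      show "\<exists>g. gauss_comb B g \<and> g y \<noteq> g z"
        using gauss_comb.base[of 1 w B 1] w by (intro exI[of _ "\<lambda>y. 1 * exp (- 1 * (norm (w - y))\<^sup>2)"]) auto
    qed
    then obtain g where g: "gauss_comb B g" "\<And>y. y \<in> K \<Longrightarrow> \<bar>f y - g y\<bar> < e" by blast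
    have [measurable]: "f \<in> borel_measurable borel" by (rule test_functions_measurable[OF f])
    have [measurable]: "g \<in> borel_measurable borel" by (rule borel_measurable_continuous_onI[OF gauss_comb_continuous[OF g(1)]])
    obtain C where C: "C \<ge> 0" "\<And>y. \<bar>f y\<bar> \<le> C" using test_functions_bounded[OF f] by blast
    have if': "integrable lborel (\<lambda>y. \<phi> y * f y)" by (rule int[where C=C]) (use C in auto)
    have "(LINT y|lborel. \<phi> y * (f y - g y)) = (LINT y|lborel. \<phi> y * f y) - (LINT y|lborel. \<phi> y * g y)"
      unfolding right_diff_distrib using if' comb[OF g(1)] by (intro Bochner_Integration.integral_diff) auto
    moreover have "\<bar>(LINT y|lborel. \<phi> y * (f y - g y))\<bar> \<le> e * L"
      unfolding L_def by (rule bnd) (use g(2) e in \<open>auto intro: less_imp_le\<close>)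
    ultimately show "\<bar>(LINT y|lborel. \<phi> y * f y)\<bar> \<le> e * L" using comb[OF g(1)] by simp
  qed (rule L)
  from AE_zero_if_orthogonal_test_functions[OF \<phi>(2) open_UNIV this] show ?thesis by simp
qed

section \<open>The fractional energy as a singular integral\<close>

lemma lborel_integral_scale:
  fixes f :: "real \<Rightarrow> real"
  assumes "c > 0"
  shows "integrable lborel (\<lambda>t. f (c * t)) \<longleftrightarrow> integrable lborel f"
    "(LINT t|lborel. f (c * t)) = (LINT t|lborel. f t) / c"
  using lborel_integrable_real_affine_iff[of c f 0] lborel_integral_real_affine[of c f 0] assms by auto

lemma integrable_powr_0_1:
  assumes "a > -1"
  shows "integrable lborel (\<lambda>t::real. indicator {0..1} t * t powr a)"
proof (rule integrableI_bounded)
  have "((\<lambda>x. x powr a) has_integral (1 powr (a+1) / (a+1))) {0..1}"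
    by (rule has_integral_powr_from_0) (use assms in auto)
  from nn_integral_has_integral_lebesgue[OF _ this]
  show "(\<integral>\<^sup>+t. ennreal (norm (indicator {0..1} t * t powr a)) \<partial>lborel) < \<infinity>" by simp
qed measurable

lemma integrable_powr_1_inf:
  assumes "a < -1"
  shows "integrable lborel (\<lambda>t::real. indicator {1..} t * t powr a)"
proof (rule integrableI_bounded)
  have "((\<lambda>x. x powr a) has_integral (- (1 powr (a+1)) / (a+1))) {1..}"
    by (rule has_integral_powr_to_inf) (use assms in auto)
  from nn_integral_has_integral_lebesgue[OF _ this]
  show "(\<integral>\<^sup>+t. ennreal (norm (indicator {1..} t * t powr a)) \<partial>lborel) < \<infinity>" by simp
qed measurable

section \<open>Subordination of fractional powers to the heat semigroup\<close>

text \<open>The density of Bochner's subordination: r^s is, up to a constant, the integral of 1 -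
  exp (- t r) against it. It is 0 for t \<le> 0 so that integrals run over the whole line.\<close>

definition subord :: "real \<Rightarrow> real \<Rightarrow> real" where
  "subord s t = (if t > 0 then t powr (- 1 - s) else 0)"

lemma subord_measurable[measurable]: "subord s \<in> borel_measurable borel"
  unfolding subord_def[abs_def] by measurable

lemma subord_scale: "c > 0 \<Longrightarrow> subord s (c * t) = c powr (- 1 - s) * subord s t"
  unfolding subord_def by (simp add: powr_mult zero_less_mult_iff)

context
  fixes s :: real
  assumes s: "0 < s" "s < 1"
begin

text \<open>The normalising constant of the subordination formula, Gamma (1 - s) / s.\<close>

definition subord_const :: real where
  "subord_const = (LINT t|lborel. (1 - exp (- t)) * subord s t)"

text \<open>Near 0 the factor 1 - exp (- t) \<le> t lifts the exponent to -s > -1; at infinity the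
  exponent -1 - s < -1 suffices.\<close>

lemma subord_integrable: "integrable lborel (\<lambda>t. (1 - exp (- t)) * subord s t)"
proof (rule Bochner_Integration.integrable_bound)
  show "integrable lborel (\<lambda>t::real. indicator {0..1} t * t powr (- s) + indicator {1..} t * t powr (- 1 - s))"
    using s by (intro Bochner_Integration.integrable_add integrable_powr_0_1 integrable_powr_1_inf) auto
  show "AE t in lborel. norm ((1 - exp (- t)) * subord s t) \<le> norm (indicator {0..1} t * t powr (- s) + indicator {1..} t * t powr (- 1 - s))"
  proof (rule AE_I2)
    fix t :: real
    consider "t \<le> 0" | "0 < t" "t < 1" | "1 \<le> t" by linarith
    then show "norm ((1 - exp (- t)) * subord s t) \<le> norm (indicator {0..1} t * t powr (- s) + indicator {1..} t * t powr (- 1 - s))"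
    proof cases
      case 2
      have "1 - exp (- t) \<le> t" using exp_ge_add_one_self[of "- t"] by linarith
      then have "(1 - exp (- t)) * t powr (- 1 - s) \<le> t * t powr (- 1 - s)" by (intro mult_right_mono) auto
      also have "\<dots> = t powr (- s)" using 2 by (simp add: powr_mult_base)
      finally show ?thesis using 2 by (simp add: subord_def abs_mult)
    next
      case 3
      have "(1 - exp (- t)) * t powr (- 1 - s) \<le> 1 * t powr (- 1 - s)" by (intro mult_right_mono) auto
      then have "(1 - exp (- t)) * t powr (- 1 - s) \<le> indicator {0..1} t * t powr (- s) + t powr (- 1 - s)"
        by (smt (verit) indicator_pos_le mult_nonneg_nonneg powr_ge_zero)
      then show ?thesis using 3 by (simp add: subord_def abs_mult)
    qed (simp add: subord_def)
  qed
qed measurable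

text \<open>The density is homogeneous, so the substitution of r t for t reduces to r = 1.\<close>

lemma subord_integral:
  assumes r: "r \<ge> 0"
  shows "integrable lborel (\<lambda>t. (1 - exp (- t * r)) * subord s t)"
    "(LINT t|lborel. (1 - exp (- t * r)) * subord s t) = r powr s * subord_const"
proof -
  define f where "f t = (1 - exp (- t)) * subord s t" for t
  have "integrable lborel (\<lambda>t. (1 - exp (- t * r)) * subord s t) \<and>
    (LINT t|lborel. (1 - exp (- t * r)) * subord s t) = r powr s * subord_const"
  proof (cases "r = 0")
    case False
    then have r: "r > 0" using assms by simp
    have e: "(1 - exp (- t * r)) * subord s t = r powr (1 + s) * f (r * t)" for t
    proof -
      have "r powr (1 + s) * r powr (- 1 - s) = 1" using r by (simp flip: powr_add)
      then have k: "r powr (1 + s) * (r powr (- 1 - s) * subord s t) = subord s t" by (simp only: mult.assoc[symmetric])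
      have "r powr (1 + s) * f (r * t) = (1 - exp (- (r * t))) * (r powr (1 + s) * (r powr (- 1 - s) * subord s t))"
        unfolding f_def subord_scale[OF r] by (simp only: mult_ac)
      then show ?thesis unfolding k by (simp add: mult.commute)
    qed
    have "integrable lborel f" unfolding f_def[abs_def] by (rule subord_integrable)
    then have "integrable lborel (\<lambda>t. f (r * t))" by (simp only: lborel_integral_scale(1)[OF r])
    moreover have "r powr (1 + s) * (subord_const / r) = r powr s * subord_const" using r by (simp add: powr_add)
    moreover have "(LINT t|lborel. f t) = subord_const" unfolding subord_const_def f_def ..
    ultimately show ?thesis unfolding e integral_mult_right_zero lborel_integral_scale(2)[OF r] by simp
  qed simp
  then show "integrable lborel (\<lambda>t. (1 - exp (- t * r)) * subord s t)"
    "(LINT t|lborel. (1 - exp (- t * r)) * subord s t) = r powr s * subord_const" by auto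
qed

text \<open>The integrand of the subordinated heat kernel at distance 1; by homogeneity its integral
  is the constant in front of the singular kernel.\<close>

definition kernel_profile :: "nat \<Rightarrow> real \<Rightarrow> real" where
  "kernel_profile N t = subord s t * ((1 / sqrt (4 * pi * t)) ^ N * exp (- 1 / (4 * t)))"

definition kernel_const :: "nat \<Rightarrow> real" where
  "kernel_const N = (LINT t|lborel. kernel_profile N t)"

lemma kernel_profile_measurable[measurable]: "kernel_profile N \<in> borel_measurable borel"
  unfolding kernel_profile_def[abs_def] by measurable

lemma kernel_profile_pos: "t > 0 \<Longrightarrow> kernel_profile N t > 0"
  unfolding kernel_profile_def subord_def by simp

lemma kernel_profile_zero: "t \<le> 0 \<Longrightarrow> kernel_profile N t = 0"
  unfolding kernel_profile_def subord_def by simp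

text \<open>A single term of the exponential series.\<close>

lemma exp_minus_le_power:
  fixes y :: real assumes "y > 0" shows "exp (- y) \<le> fact M / y ^ M"
proof -
  have "y ^ M / fact M \<le> exp y"
  proof -
    have "(\<Sum>n\<in>{M}. inverse (fact n) * y ^ n) \<le> (\<Sum>n. inverse (fact n) * y ^ n)"
      using assms by (intro sum_le_suminf summable_exp) auto
    then show ?thesis unfolding exp_def by (simp add: divide_inverse mult.commute scaleR_conv_of_real)
  qed
  then have "exp (- y) * (y ^ M / fact M) \<le> exp (- y) * exp y" by (intro mult_left_mono) auto
  then have "exp (- y) * (y ^ M / fact M) \<le> 1" by (simp flip: exp_add)
  then show ?thesis using assms by (simp add: field_simps)
qed

lemma kernel_profile_integrable: "integrable lborel (kernel_profile N)"
proof (rule Bochner_Integration.integrable_bound)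
  \<comment> \<open>The decay of exp (- 1 / (4 t)) at 0 is traded for the power t^M. This choice
    makes the resulting exponent M - 1 - s - N / 2 nonnegative, so the profile is bounded on (0,
    1).\<close>
  define M where "M = N + 2"
  define C :: real where "C = fact M * 4 ^ M"
  have C: "C \<ge> 0" unfolding C_def by simp
  show "integrable lborel (\<lambda>t::real. C * (indicator {0..1} t * t powr 0) + indicator {1..} t * t powr (- 1 - s))"
    using s by (intro Bochner_Integration.integrable_add integrable_mult_right integrable_powr_0_1 integrable_powr_1_inf) auto
  have sq: "(1 / sqrt (4 * pi * t)) ^ N \<le> t powr (- real N / 2)" if t: "t > 0" for t
  proof -
    have "1 / sqrt (4 * pi * t) \<le> 1 / sqrt t"
      using t pi_ge_two by (intro divide_left_mono real_sqrt_le_mono) (auto intro!: mult_pos_pos)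
    then have "(1 / sqrt (4 * pi * t)) ^ N \<le> (1 / sqrt t) ^ N" using t by (intro power_mono) auto
    also have "\<dots> = t powr (- real N / 2)"
      using t by (simp add: powr_half_sqrt[symmetric] powr_minus_divide[symmetric] powr_realpow[symmetric] powr_powr)
    finally show ?thesis .
  qed
  show "AE t in lborel. norm (kernel_profile N t) \<le> norm (C * (indicator {0..1} t * t powr 0) + indicator {1..} t * t powr (- 1 - s))"
  proof (rule AE_I2)
    fix t :: real
    consider "t \<le> 0" | "0 < t" "t < 1" | "1 \<le> t" by linarith
    then show "norm (kernel_profile N t) \<le> norm (C * (indicator {0..1} t * t powr 0) + indicator {1..} t * t powr (- 1 - s))"
    proof cases
      case 1 then show ?thesis by (simp add: kernel_profile_zero)
    next
      case 2
      have "exp (- 1 / (4 * t)) \<le> fact M / (1 / (4 * t)) ^ M" using exp_minus_le_power[of "1 / (4 * t)" M] 2 by simp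
      also have "\<dots> = C * t powr (real M)" unfolding C_def using 2 by (simp add: powr_realpow field_simps)
      finally have e: "exp (- 1 / (4 * t)) \<le> C * t powr (real M)" .
      have "kernel_profile N t \<le> t powr (- 1 - s) * (t powr (- real N / 2) * (C * t powr (real M)))"
        unfolding kernel_profile_def subord_def using 2 sq e C by (auto intro!: mult_mono mult_left_mono)
      also have "\<dots> = C * t powr (real M - 1 - s - real N / 2)"
        by (simp add: mult_ac flip: powr_add) (simp add: algebra_simps)
      also have "\<dots> \<le> C * 1" using 2 s C by (intro mult_left_mono powr_le1) (auto simp: M_def)
      finally show ?thesis using 2 kernel_profile_pos[of t N] C by simp
    next
      case 3
      have a: "(1 / sqrt (4 * pi * t)) ^ N \<le> 1"
      proof -
        have "1 * 1 \<le> (4 * pi) * t" using 3 pi_ge_two by (intro mult_mono) auto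
        then show ?thesis using 3 by (intro power_le_one) auto
      qed
      have "kernel_profile N t \<le> t powr (- 1 - s) * (1 * 1)"
        unfolding kernel_profile_def subord_def using 3 a by (auto intro!: mult_mono mult_left_mono mult_le_one)
      moreover have "0 \<le> C * (indicator {0..1} t * t powr 0)" using C by simp
      ultimately show ?thesis using 3 kernel_profile_pos[of t N] by simp
    qed
  qed
qed measurable

lemma AE_open_ex:
  fixes U :: "'a::euclidean_space set"
  assumes "open U" "U \<noteq> {}" "AE z in lborel. P z"
  shows "\<exists>z\<in>U. P z"
proof (rule ccontr)
  assume "\<not> ?thesis"
  then have "AE z in lborel. z \<notin> U" using assms(3) by (auto elim: eventually_mono)
  then have "U \<in> null_sets lborel" using AE_iff_null_sets[of U lborel] assms(1) by simp
  then have "negligible U" by (simp add: negligible_iff_null_sets null_sets_completionI)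
  then show False using open_not_negligible assms(1,2) by blast
qed

lemma kernel_const_nonzero: "kernel_const N \<noteq> 0"
proof
  assume "kernel_const N = 0"
  moreover have "0 \<le> kernel_profile N t" for t
    using kernel_profile_pos[of t N] kernel_profile_zero[of t N] by (cases "t > 0") auto
  ultimately have "AE t in lborel. kernel_profile N t = 0"
    unfolding kernel_const_def using integral_nonneg_eq_0_iff_AE[OF kernel_profile_integrable] by simp
  then have "\<exists>t\<in>{0<..}. kernel_profile N t = 0" by (rule AE_open_ex[rotated 2]) auto
  then obtain t where "t \<in> {0<..}" "kernel_profile N t = 0" by blast
  then show False using kernel_profile_pos[of t N] by simp
qed

text \<open>Substituting |x - y|^2 t for t reduces to distance 1 and produces |x - y|^(-n - 2 s),
  the kernel of the fractional Laplacian off the diagonal.\<close>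

lemma subord_heat_kernel:
  fixes x y :: "'a::euclidean_space"
  assumes "x \<noteq> y"
  shows "integrable lborel (\<lambda>t. subord s t * heat_kernel t (x - y))"
    "(LINT t|lborel. subord s t * heat_kernel t (x - y)) = kernel_const DIM('a) * npow (- s - real DIM('a) / 2) x y"
proof -
  let ?N = "DIM('a)"
  define R where "R = (norm (x - y))\<^sup>2"
  have R: "R > 0" unfolding R_def using assms by simp
  have iR: "1 / R > 0" using R by simp
  define c where "c = R powr (- 1 - s) * R powr (- real ?N / 2)"
  have e: "subord s t * heat_kernel t (x - y) = c * kernel_profile ?N ((1 / R) * t)" for t
  proof (cases "t > 0")
    case True
    have a: "subord s ((1 / R) * t) = R powr (1 + s) * subord s t"
      unfolding subord_scale[OF iR] using R by (simp add: powr_divide powr_minus_divide[symmetric] add.commute)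
    have b: "(1 / sqrt (4 * pi * ((1 / R) * t))) ^ ?N = R powr (real ?N / 2) * (1 / sqrt (4 * pi * t)) ^ ?N"
    proof -
      have "1 / sqrt (4 * pi * ((1 / R) * t)) = sqrt R * (1 / sqrt (4 * pi * t))"
        using R True by (simp add: real_sqrt_mult real_sqrt_divide)
      moreover have "sqrt R ^ ?N = R powr (real ?N / 2)"
        using R by (simp add: powr_half_sqrt[symmetric] powr_realpow[symmetric] powr_powr)
      ultimately show ?thesis by (simp only: power_mult_distrib)
    qed
    have d: "c * (R powr (1 + s) * R powr (real ?N / 2)) = 1"
      unfolding c_def using R by (simp flip: powr_add)
    have "c * kernel_profile ?N ((1 / R) * t) = (c * (R powr (1 + s) * R powr (real ?N / 2))) * (subord s t * ((1 / sqrt (4 * pi * t)) ^ ?N * exp (- R / (4 * t))))"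
      unfolding kernel_profile_def a b using R by (simp add: mult_ac)
    also have "\<dots> = subord s t * ((1 / sqrt (4 * pi * t)) ^ ?N * exp (- R / (4 * t)))" unfolding d by simp
    also have "\<dots> = subord s t * heat_kernel t (x - y)" unfolding heat_kernel_def R_def ..
    finally show ?thesis by (rule sym)
  next
    case False
    have "subord s ((1 / R) * t) = 0" "subord s t = 0" using False R unfolding subord_def by (auto simp: zero_less_divide_iff)
    then show ?thesis unfolding kernel_profile_def by simp
  qed
  have "c * R = R powr (- s - real ?N / 2)"
    unfolding c_def using R by (simp add: powr_mult_base mult_ac flip: powr_add)
  then have "c * (kernel_const ?N / (1 / R)) = kernel_const ?N * npow (- s - real ?N / 2) x y"
    unfolding npow_def R_def[symmetric] by (simp add: mult_ac)
  then show "(LINT t|lborel. subord s t * heat_kernel t (x - y)) = kernel_const ?N * npow (- s - real ?N / 2) x y"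
    unfolding e integral_mult_right_zero lborel_integral_scale(2)[OF iR] kernel_const_def .
  show "integrable lborel (\<lambda>t. subord s t * heat_kernel t (x - y))"
    unfolding e using lborel_integral_scale(1)[OF iR, of "kernel_profile ?N"] kernel_profile_integrable
    by (intro integrable_mult_right) simp
qed

section \<open>The energy of functions with separated supports\<close>

lemma powr_sq: "(norm \<xi> powr s)\<^sup>2 = ((norm \<xi>)\<^sup>2) powr s"
  using power2_powr_half[of "norm \<xi>" "2 * s"] by (simp add: power2_eq_square flip: powr_add)

text \<open>Subordination writes |\<xi>|^(2 s) as an integral over 1 - exp (- t |\<xi>|^2). The part
  with 1 is the \<open>L2\<close> product by Parseval and vanishes by \<open>orth\<close>; the
  damped part is \<open>heat_pairing\<close>.\<close>

lemma energy_heat: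
  fixes u v :: "'a::euclidean_space \<Rightarrow> real"
  assumes u: "u \<in> Hs s" "integrable lborel u" and v: "v \<in> Hs s" "integrable lborel v"
    and orth: "(LINT x|lborel. u x * v x) = 0"
  shows "subord_const * energy s u v =
    - (LINT t|lborel. subord s t * (LINT z|(lborel \<Otimes>\<^sub>M lborel). u (fst z) * v (snd z) * heat_kernel t (fst z - snd z)))"
proof -
  note L = Hs_L2[OF u(1)] Hs_L2[OF v(1)]
  note F = fourier_L2[OF L(1)] fourier_L2[OF L(2)]
  define P where "P \<xi> = Re (fourier u \<xi> * cnj (fourier v \<xi>))" for \<xi>
  have P: "integrable lborel P" unfolding P_def[abs_def] by (rule L2_Re_mult_cnj_integrable[OF F])
  have [measurable]: "P \<in> borel_measurable borel" using P by auto
  have RP: "Re (riesz s u \<xi> * cnj (riesz s v \<xi>)) = ((norm \<xi>)\<^sup>2) powr s * P \<xi>" for \<xi>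
  proof -
    have "riesz s u \<xi> * cnj (riesz s v \<xi>) = complex_of_real ((norm \<xi> powr s)\<^sup>2) * (fourier u \<xi> * cnj (fourier v \<xi>))"
      unfolding riesz_def by (simp add: power2_eq_square)
    then show ?thesis unfolding P_def powr_sq by simp
  qed
  have RPi: "integrable lborel (\<lambda>\<xi>. ((norm \<xi>)\<^sup>2) powr s * P \<xi>)"
    unfolding RP[symmetric] by (intro L2_Re_mult_cnj_integrable Hs_riesz[OF s] u v)
  define J where "J \<xi> t = P \<xi> * ((1 - exp (- t * (norm \<xi>)\<^sup>2)) * subord s t)" for \<xi> t
  have nn: "0 \<le> (1 - exp (- t * (norm (\<xi>::'a))\<^sup>2)) * subord s t" for \<xi> t
    by (cases "t > 0") (auto simp: subord_def)
  have Ji: "integrable lborel (J \<xi>)" "(LINT t|lborel. J \<xi> t) = (((norm \<xi>)\<^sup>2) powr s * P \<xi>) * subord_const" for \<xi>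
    unfolding J_def[abs_def] using subord_integral[of "(norm \<xi>)\<^sup>2"] by simp_all
  \<comment> \<open>The time integral of the nonnegative factor reproduces |\<xi>|^(2 s), which is
    integrable against |P| because both functions have finite energy.\<close>
  have "integrable (lborel \<Otimes>\<^sub>M lborel) (case_prod J)"
  proof (rule lborel_pair.Fubini_integrable)
    show "case_prod J \<in> borel_measurable (lborel \<Otimes>\<^sub>M lborel)" unfolding J_def by measurable
    have "\<bar>J \<xi> t\<bar> = \<bar>P \<xi>\<bar> * ((1 - exp (- t * (norm \<xi>)\<^sup>2)) * subord s t)" for \<xi> t
      unfolding J_def abs_mult[of "P \<xi>"] abs_of_nonneg[OF nn] ..
    then have "(LINT t|lborel. norm (case (\<xi>, t) of (\<xi>, t) \<Rightarrow> J \<xi> t)) = \<bar>((norm \<xi>)\<^sup>2) powr s * P \<xi>\<bar> * subord_const" for \<xi>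
      using subord_integral[of "(norm \<xi>)\<^sup>2"] by (simp add: abs_mult)
    then show "integrable lborel (\<lambda>\<xi>. LINT t|lborel. norm (case (\<xi>, t) of (\<xi>, t) \<Rightarrow> J \<xi> t))"
      using RPi by simp
    show "AE \<xi> in lborel. integrable lborel (\<lambda>t. case (\<xi>, t) of (\<xi>, t) \<Rightarrow> J \<xi> t)" using Ji by simp
  qed
  then have fub: "(LINT t|lborel. LINT \<xi>|lborel. J \<xi> t) = (LINT \<xi>|lborel. LINT t|lborel. J \<xi> t)"
    by (rule lborel_pair.Fubini_integral)
  have "subord_const * energy s u v = (LINT \<xi>|lborel. LINT t|lborel. J \<xi> t)"
    unfolding energy_def RP Ji(2) by simp
  also have "\<dots> = (LINT t|lborel. - (subord s t * (LINT z|(lborel \<Otimes>\<^sub>M lborel). u (fst z) * v (snd z) * heat_kernel t (fst z - snd z))))"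
    unfolding fub[symmetric]
  proof (intro Bochner_Integration.integral_cong refl)
    fix t
    show "(LINT \<xi>|lborel. J \<xi> t) = - (subord s t * (LINT z|(lborel \<Otimes>\<^sub>M lborel). u (fst z) * v (snd z) * heat_kernel t (fst z - snd z)))"
    proof (cases "t > 0")
      case t: True
      define E where "E \<xi> = complex_of_real (exp (- t * (norm \<xi>)\<^sup>2)) * (fourier_L1 u \<xi> * cnj (fourier_L1 v \<xi>))" for \<xi>
      have [measurable]: "fourier_L1 u \<in> borel_measurable borel" "fourier_L1 v \<in> borel_measurable borel"
        using fourier_L1_measurable L2_measurable L by blast+
      have Em [measurable]: "E \<in> borel_measurable borel" unfolding E_def[abs_def] by measurable
      have AEP: "AE \<xi> in lborel. exp (- t * (norm \<xi>)\<^sup>2) * P \<xi> = Re (E \<xi>)"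
        using fourier_eq_fourier_L1[OF L(1) u(2)] fourier_eq_fourier_L1[OF L(2) v(2)]
        by eventually_elim (simp add: P_def E_def)
      have eP: "integrable lborel (\<lambda>\<xi>. exp (- t * (norm \<xi>)\<^sup>2) * P \<xi>)"
        by (rule Bochner_Integration.integrable_bound[OF P]) (use t in \<open>auto simp: abs_mult intro!: AE_I2 mult_left_le_one_le\<close>)
      have Eint: "integrable lborel E"
      proof (rule Bochner_Integration.integrable_bound)
        note G = fourier_L1_L2(1)[OF u(2) L(1)] fourier_L1_L2(1)[OF v(2) L(2)]
        show "integrable lborel (\<lambda>\<xi>. norm (fourier_L1 u \<xi>) * norm (fourier_L1 v \<xi>))"
          by (intro L2_mult_integrable L2_norm G)
        show "AE \<xi> in lborel. norm (E \<xi>) \<le> norm (norm (fourier_L1 u \<xi>) * norm (fourier_L1 v \<xi>))"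
          using t by (intro AE_I2) (auto simp: E_def norm_mult intro!: mult_left_le_one_le)
      qed simp
      have "(LINT \<xi>|lborel. exp (- t * (norm \<xi>)\<^sup>2) * P \<xi>) = (LINT \<xi>|lborel. Re (E \<xi>))"
        by (rule integral_cong_AE) (use AEP in auto)
      also have "\<dots> = Re (LINT \<xi>|lborel. E \<xi>)" by (rule integral_Re[OF Eint])
      also have "\<dots> = (LINT z|(lborel \<Otimes>\<^sub>M lborel). u (fst z) * v (snd z) * heat_kernel t (fst z - snd z))"
        unfolding E_def heat_pairing[OF u(2) v(2) t] by simp
      finally have H: "(LINT \<xi>|lborel. exp (- t * (norm \<xi>)\<^sup>2) * P \<xi>) = (LINT z|(lborel \<Otimes>\<^sub>M lborel). u (fst z) * v (snd z) * heat_kernel t (fst z - snd z))" .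
      have P0: "(LINT \<xi>|lborel. P \<xi>) = 0" unfolding P_def using parseval[OF L] orth by simp
      have "(LINT \<xi>|lborel. J \<xi> t) = (LINT \<xi>|lborel. subord s t * (P \<xi> - exp (- t * (norm \<xi>)\<^sup>2) * P \<xi>))"
        unfolding J_def by (intro Bochner_Integration.integral_cong) (auto simp: algebra_simps)
      also have "\<dots> = subord s t * ((LINT \<xi>|lborel. P \<xi>) - (LINT \<xi>|lborel. exp (- t * (norm \<xi>)\<^sup>2) * P \<xi>))"
        using P eP by simp
      finally show ?thesis unfolding P0 H by simp
    qed (simp add: J_def subord_def)
  qed
  finally show ?thesis by simp
qed

text \<open>Integrating the heat kernels in time gives the singular kernel. It is bounded on the two
  supports because they have positive distance, so Fubini applies. The minus sign is that of the
  damped part in \<open>energy_heat\<close>.\<close>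

lemma energy_kernel:
  fixes u v :: "'a::euclidean_space \<Rightarrow> real"
  assumes u: "u \<in> Hs s" "integrable lborel u" "\<And>x. x \<notin> K \<Longrightarrow> u x = 0"
    and v: "v \<in> Hs s" "integrable lborel v" "\<And>x. x \<notin> B \<Longrightarrow> v x = 0"
    and d: "d > 0" "\<And>x y. x \<in> B \<Longrightarrow> y \<in> K \<Longrightarrow> d \<le> norm (x - y)"
  shows "subord_const * energy s u v = - kernel_const DIM('a) *
    (LINT y|lborel. v y * (LINT x|lborel. u x * npow (- s - real DIM('a) / 2) y x))"
proof -
  define p where "p = - s - real DIM('a) / 2"
  have p: "p < 0" unfolding p_def using s DIM_positive[where 'a='a] by (simp add: add_pos_pos minus_less_iff)
  note [measurable] = L2_measurable[OF Hs_L2[OF u(1)]] L2_measurable[OF Hs_L2[OF v(1)]]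
  have sep: "x \<noteq> y \<and> d \<le> norm (x - y)" if "u x * v y \<noteq> 0" for x y
  proof -
    have "x \<in> K" "y \<in> B" using that u(3) v(3) by (metis mult_zero_left, metis mult_zero_right)
    then show ?thesis using d(2)[of y x] d(1) by (auto simp: norm_minus_commute)
  qed
  have orth: "(LINT x|lborel. u x * v x) = 0"
  proof -
    have "u x * v x = 0" for x using sep[of x x] by blast
    then show ?thesis by (simp only: integral_zero)
  qed
  define w where "w z = u (fst z) * v (snd z)" for z
  have w_int: "integrable lborel w"
    using integrable_tensor[OF u(2) v(2)] unfolding w_def by (simp add: case_prod_beta' lborel_prod)
  have [measurable]: "w \<in> borel_measurable borel" using w_int by auto
  have fs [measurable]: "(fst :: 'a \<times> 'a \<Rightarrow> 'a) \<in> borel \<rightarrow>\<^sub>M borel" "(snd :: 'a \<times> 'a \<Rightarrow> 'a) \<in> borel \<rightarrow>\<^sub>M borel"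
    by (intro borel_measurable_continuous_onI continuous_intros)+
  define H where "H z t = w z * (subord s t * heat_kernel t (fst z - snd z))" for z t
  have Hin: "integrable lborel (H z)" "(LINT t|lborel. H z t) = w z * (kernel_const DIM('a) * npow p (fst z) (snd z))"
    "(LINT t|lborel. norm (H z t)) = \<bar>w z\<bar> * (kernel_const DIM('a) * npow p (fst z) (snd z))" for z
  proof -
    have nn: "0 \<le> subord s t * heat_kernel t (fst z - snd z)" for t
      by (cases "t > 0") (auto simp: subord_def heat_kernel_nonneg)
    have "norm (H z t) = \<bar>w z\<bar> * (subord s t * heat_kernel t (fst z - snd z))" for t
      unfolding H_def real_norm_def abs_mult[of "w z"] abs_of_nonneg[OF nn] ..
    moreover have "w z = 0 \<or> fst z \<noteq> snd z" using sep[of "fst z" "snd z"] unfolding w_def by blast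
    ultimately show "integrable lborel (H z)" "(LINT t|lborel. H z t) = w z * (kernel_const DIM('a) * npow p (fst z) (snd z))"
      "(LINT t|lborel. norm (H z t)) = \<bar>w z\<bar> * (kernel_const DIM('a) * npow p (fst z) (snd z))"
      using subord_heat_kernel[of "fst z" "snd z"] unfolding H_def[abs_def] p_def[symmetric] by auto
  qed
  have npm: "(\<lambda>z. npow p (fst z) (snd z)) \<in> borel_measurable (borel :: ('a \<times> 'a) measure)"
    unfolding npow_def by measurable
  have wn: "integrable lborel (\<lambda>z. w z * npow p (fst z) (snd z))"
  proof (rule Bochner_Integration.integrable_bound)
    show "integrable lborel (\<lambda>z. (d\<^sup>2) powr p * w z)" using w_int by simp
    show "AE z in lborel. norm (w z * npow p (fst z) (snd z)) \<le> norm ((d\<^sup>2) powr p * w z)"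
    proof (rule AE_I2)
      fix z
      show "norm (w z * npow p (fst z) (snd z)) \<le> norm ((d\<^sup>2) powr p * w z)"
      proof (cases "w z = 0")
        case False
        then have "d \<le> norm (fst z - snd z)" using sep[of "fst z" "snd z"] unfolding w_def by blast
        then have "npow p (fst z) (snd z) \<le> (d\<^sup>2) powr p" unfolding npow_def using d(1) p by (intro powr_mono2') auto
        moreover have "0 \<le> npow p (fst z) (snd z)" unfolding npow_def by simp
        ultimately show ?thesis by (simp add: abs_mult mult.commute mult_left_mono)
      qed simp
    qed
  qed (use npm in measurable)
  have "integrable (lborel \<Otimes>\<^sub>M lborel) (case_prod H)"
  proof (rule lborel_pair.Fubini_integrable)
    have [measurable]: "(fst :: ('a \<times> 'a) \<times> real \<Rightarrow> 'a \<times> 'a) \<in> borel \<rightarrow>\<^sub>M borel" "(snd :: ('a \<times> 'a) \<times> real \<Rightarrow> real) \<in> borel \<rightarrow>\<^sub>M borel"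
      by (intro borel_measurable_continuous_onI continuous_intros)+
    have "(\<lambda>x. H (fst x) (snd x)) \<in> borel_measurable borel" unfolding H_def heat_kernel_def by measurable
    then show "case_prod H \<in> borel_measurable (lborel \<Otimes>\<^sub>M lborel)" by (simp add: lborel_prod case_prod_beta')
    show "AE z in lborel. integrable lborel (\<lambda>t. case (z, t) of (z, t) \<Rightarrow> H z t)" using Hin by simp
    have "(LINT t|lborel. norm (case (z, t) of (z, t) \<Rightarrow> H z t)) = kernel_const DIM('a) * (\<bar>w z * npow p (fst z) (snd z)\<bar>)" for z
      using Hin(3)[of z] by (simp add: abs_mult npow_def)
    then show "integrable lborel (\<lambda>z. LINT t|lborel. norm (case (z, t) of (z, t) \<Rightarrow> H z t))"
      using wn by simp
  qed
  then have fub: "(LINT t|lborel. LINT z|lborel. H z t) = (LINT z|lborel. LINT t|lborel. H z t)"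
    by (rule lborel_pair.Fubini_integral)
  have "subord_const * energy s u v = - (LINT t|lborel. LINT z|lborel. H z t)"
    unfolding energy_heat[OF u(1,2) v(1,2) orth] lborel_prod
  proof (intro arg_cong[where f=uminus] Bochner_Integration.integral_cong refl)
    fix t
    have "(LINT z|lborel. H z t) = (LINT z|lborel. subord s t * (u (fst z) * v (snd z) * heat_kernel t (fst z - snd z)))"
      unfolding H_def w_def by (intro Bochner_Integration.integral_cong) auto
    then show "subord s t * (LINT z|lborel. u (fst z) * v (snd z) * heat_kernel t (fst z - snd z)) = (LINT z|lborel. H z t)"
      by simp
  qed
  also have "(LINT t|lborel. LINT z|lborel. H z t) = (LINT z|lborel. kernel_const DIM('a) * (w z * npow p (fst z) (snd z)))"
    unfolding fub Hin(2) by (simp add: mult.left_commute)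
  also have "\<dots> = kernel_const DIM('a) * (LINT z|(lborel \<Otimes>\<^sub>M lborel). w z * npow p (fst z) (snd z))" by (simp add: lborel_prod)
  also have "(LINT z|(lborel \<Otimes>\<^sub>M lborel). w z * npow p (fst z) (snd z)) = (LINT y|lborel. LINT x|lborel. w (x, y) * npow p x y)"
    using lborel_pair.integral_snd[of "\<lambda>x y. w (x, y) * npow p x y"] wn by (simp add: lborel_prod case_prod_beta')
  also have "\<dots> = (LINT y|lborel. v y * (LINT x|lborel. u x * npow p y x))"
  proof (intro Bochner_Integration.integral_cong refl)
    fix y
    have "(LINT x|lborel. w (x, y) * npow p x y) = (LINT x|lborel. v y * (u x * npow p y x))"
      unfolding w_def npow_def by (intro Bochner_Integration.integral_cong) (auto simp: norm_minus_commute)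
    then show "(LINT x|lborel. w (x, y) * npow p x y) = v y * (LINT x|lborel. u x * npow p y x)" by simp
  qed
  finally show ?thesis unfolding p_def by simp
qed

text \<open>The vanishing energies become the pointwise vanishing of a Riesz potential on a ball:
  \<open>energy_kernel\<close> gives it against test functions, hence almost everywhere, and
  continuity gives it everywhere, as the descent in the exponent requires.\<close>

lemma fractional_unique_continuation:
  fixes u :: "'a::euclidean_space \<Rightarrow> real"
  assumes u: "u \<in> Hs s" "AE x in lborel. x \<notin> K \<longrightarrow> u x = 0" and K: "compact K"
    and W: "open W" "W \<noteq> {}" "W \<inter> K = {}"
    and zero: "\<And>f. f \<in> test_functions W \<Longrightarrow> energy s u f = 0"
  shows "AE x in lborel. u x = 0"
proof -
  define p where "p = - s - real DIM('a) / 2"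
  have p: "2 * p < - real DIM('a)" "p < 0" unfolding p_def using s DIM_positive[where 'a='a] by (auto simp: add_pos_pos minus_less_iff)
  have [measurable]: "K \<in> sets borel" using K by (simp add: compact_imp_closed)
  \<comment> \<open>A representative that vanishes everywhere off \<open>K\<close>; its Fourier
    transform is literally the same function, so the energies do not change.\<close>
  define \<phi> where "\<phi> x = indicator K x * u x" for x
  note [measurable] = L2_measurable[OF Hs_L2[OF u(1)]]
  have \<phi>m [measurable]: "\<phi> \<in> borel_measurable borel" unfolding \<phi>_def[abs_def] by measurable
  have ae: "AE x in lborel. u x = \<phi> x" using u(2) by eventually_elim (auto simp: \<phi>_def indicator_def)
  note \<phi>H = Hs_cong_AE[OF s u(1) \<phi>m ae]
  note \<phi>L = Hs_L2[OF \<phi>H(1)]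
  have \<phi>0: "x \<notin> K \<Longrightarrow> \<phi> x = 0" for x unfolding \<phi>_def by simp
  obtain R where R: "\<And>y. y \<in> K \<Longrightarrow> norm y \<le> R" using compact_imp_bounded[OF K] by (auto simp: bounded_iff)
  have \<phi>i: "integrable lborel \<phi>"
    by (rule L2_bounded_support_integrable[OF \<phi>L, where R=R]) (use R \<phi>0 in \<open>auto intro!: AE_I2\<close>)
  obtain x0 where x0: "x0 \<in> W" using W by blast
  obtain e where e: "e > 0" "ball x0 e \<subseteq> W" by (rule openE[OF W(1) x0])
  \<comment> \<open>The ball of radius e lies in \<open>W\<close> and misses \<open>K\<close>; with
    half the radius, every point of \<open>B\<close> has distance at least e / 2 from
    \<open>K\<close>.\<close>
  define B where "B = ball x0 (e / 2)"
  define d where "d = e / 2"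
  define D where "D = norm x0 + e + R"
  have d: "d > 0" unfolding d_def using e by simp
  have B: "open B" "convex B" "B \<noteq> {}" "B \<subseteq> W" unfolding B_def using e by (auto simp: subset_iff)
  have dist: "d \<le> norm (x - y) \<and> norm (x - y) \<le> D" if "x \<in> B" "y \<in> K" for x y
  proof -
    have "y \<notin> ball x0 e" using that W(3) e(2) by blast
    then have "e \<le> dist x0 y" by simp
    moreover have "dist x0 x < e / 2" using that unfolding B_def by simp
    moreover have "dist x0 y \<le> dist x0 x + dist x y" by (rule dist_triangle)
    ultimately have "e / 2 \<le> dist x y" by linarith
    moreover have "norm (x - y) \<le> D"
    proof -
      have "norm (x - y) \<le> norm x + norm y" by (rule norm_triangle_ineq4)
      moreover have "norm x \<le> norm x0 + norm (x - x0)" using norm_triangle_ineq[of x0 "x - x0"] by simp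
      moreover have "norm (x - x0) < e / 2" using that unfolding B_def by (simp add: dist_norm norm_minus_commute)
      ultimately show ?thesis unfolding D_def using R[OF that(2)] e(1) by linarith
    qed
    ultimately show ?thesis unfolding d_def by (simp add: dist_norm)
  qed
  define \<Phi> where "\<Phi> x = (LINT y|lborel. \<phi> y * npow p x y)" for x
  have [measurable]: "\<Phi> \<in> borel_measurable borel"
    unfolding \<Phi>_def[abs_def] npow_def by (intro lborel.borel_measurable_lebesgue_integral) measurable
  define C where "C = (d\<^sup>2) powr p"
  have npb: "\<bar>\<phi> y * npow p x y\<bar> \<le> C * \<bar>\<phi> y\<bar>" if "x \<in> B" for x y
  proof (cases "y \<in> K")
    case True
    have "npow p x y \<le> C" unfolding npow_def C_def using dist[OF that True] d p by (intro powr_mono2') auto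
    moreover have "0 \<le> npow p x y" unfolding npow_def by simp
    ultimately show ?thesis using mult_right_mono[of "npow p x y" C "\<bar>\<phi> y\<bar>"] by (simp add: abs_mult mult.commute)
  qed (simp add: \<phi>0)
  have \<Phi>i: "integrable lborel (\<lambda>y. \<phi> y * npow p x y)" if "x \<in> B" for x
    by (rule Bochner_Integration.integrable_bound[of _ "\<lambda>y. C * \<bar>\<phi> y\<bar>"]) (use \<phi>i npb[OF that] in \<open>auto intro!: AE_I2 simp: abs_mult C_def\<close>)
  have \<Phi>b: "\<bar>\<Phi> x\<bar> \<le> C * (LINT y|lborel. \<bar>\<phi> y\<bar>)" if "x \<in> B" for x
  proof -
    have "\<bar>\<Phi> x\<bar> \<le> (LINT y|lborel. \<bar>\<phi> y * npow p x y\<bar>)" unfolding \<Phi>_def by (rule integral_abs_bound)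
    also have "\<dots> \<le> (LINT y|lborel. C * \<bar>\<phi> y\<bar>)" using \<Phi>i[OF that] \<phi>i npb[OF that] by (intro integral_mono) auto
    finally show ?thesis by simp
  qed
  \<comment> \<open>Cut off to \<open>B\<close>, where the potential is bounded, so that the
    orthogonality criterion for square integrable functions applies.\<close>
  define v where "v x = indicator B x * \<Phi> x" for x
  have Bb: "B \<in> sets borel" using B(1) by simp
  have vm: "v \<in> borel_measurable borel" unfolding v_def[abs_def] using Bb by measurable
  have vL: "v \<in> L2"
  proof (rule L2_I[OF vm])
    show "integrable lborel (\<lambda>x. (norm (v x))\<^sup>2)"
    proof (rule Bochner_Integration.integrable_bound)
      have "emeasure lborel B < \<infinity>" unfolding B_def by (rule emeasure_bounded_finite) simp
      then show "integrable lborel (\<lambda>x. (C * (LINT y|lborel. \<bar>\<phi> y\<bar>))\<^sup>2 * indicator B x)"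
        using Bb by (intro integrable_mult_right integrable_real_indicator) auto
      show "AE x in lborel. norm ((norm (v x))\<^sup>2) \<le> norm ((C * (LINT y|lborel. \<bar>\<phi> y\<bar>))\<^sup>2 * indicator B x)"
      proof (rule AE_I2)
        fix x show "norm ((norm (v x))\<^sup>2) \<le> norm ((C * (LINT y|lborel. \<bar>\<phi> y\<bar>))\<^sup>2 * indicator B x)"
          using power_mono[OF \<Phi>b[of x], of 2] by (cases "x \<in> B") (auto simp: v_def)
      qed
    qed (use vm in simp)
  qed
  have "AE x in lborel. x \<in> B \<longrightarrow> v x = 0"
  proof (rule AE_zero_if_orthogonal_test_functions[OF vL B(1)])
    fix f assume f: "f \<in> test_functions B"
    have fH: "f \<in> Hs s" using test_functions_Hs[OF s] f by blast
    have "subord_const * energy s \<phi> f = - kernel_const DIM('a) * (LINT y|lborel. f y * (LINT x|lborel. \<phi> x * npow (- s - real DIM('a) / 2) y x))"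
    proof (rule energy_kernel[OF \<phi>H(1) \<phi>i \<phi>0 fH test_functions_L2(2)[OF f] test_functions_zero_outside[OF f] d])
      show "d \<le> norm (x - y)" if "x \<in> B" "y \<in> K" for x y using dist[OF that] by blast
    qed
    moreover have "energy s \<phi> f = 0"
    proof -
      have "energy s \<phi> f = energy s u f" unfolding energy_def riesz_def \<phi>H(2) ..
      then show ?thesis using zero test_functions_mono[OF B(4)] f by auto
    qed
    ultimately have z: "(LINT y|lborel. f y * \<Phi> y) = 0" using kernel_const_nonzero unfolding \<Phi>_def p_def by simp
    have vf: "v y * f y = f y * \<Phi> y" for y using test_functions_zero_outside[OF f, of y] unfolding v_def by (cases "y \<in> B") auto
    show "(LINT y|lborel. v y * f y) = 0" unfolding vf by (rule z)
  qed
  then have \<Phi>0: "AE x in lborel. x \<in> B \<longrightarrow> \<Phi> x = 0" by eventually_elim (simp add: v_def)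
  \<comment> \<open>A set of full measure in \<open>B\<close> is dense there, and dominated
    convergence makes the potential continuous.\<close>
  have "\<Phi> x = 0" if x: "x \<in> B" for x
  proof -
    have "\<exists>z. z \<in> B \<and> dist z x < 1 / real (Suc n) \<and> \<Phi> z = 0" for n
    proof -
      have "\<exists>z\<in>B \<inter> ball x (1 / real (Suc n)). z \<in> B \<longrightarrow> \<Phi> z = 0"
        using x by (intro AE_open_ex \<Phi>0 open_Int B(1)) (auto simp: disjoint_iff intro: centre_in_ball[THEN iffD2])
      then show ?thesis by (auto simp: dist_commute)
    qed
    then obtain z where z: "\<And>n. z n \<in> B" "\<And>n. dist (z n) x < 1 / real (Suc n)" "\<And>n. \<Phi> (z n) = 0" by metis
    have zx: "z \<longlonglongrightarrow> x"
    proof (rule metric_tendsto_imp_tendsto[of "\<lambda>n. 1 / real (Suc n)" 0])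
      show "(\<lambda>n. 1 / real (Suc n)) \<longlonglongrightarrow> 0" by real_asymp
      show "\<forall>\<^sub>F n in sequentially. dist (z n) x \<le> dist (1 / real (Suc n)) 0"
        using z(2) by (intro always_eventually allI) (simp add: less_imp_le)
    qed
    have "(\<lambda>n. LINT y|lborel. \<phi> y * npow p (z n) y) \<longlonglongrightarrow> (LINT y|lborel. \<phi> y * npow p x y)"
    proof (rule integral_dominated_convergence)
      show "integrable lborel (\<lambda>y. C * \<bar>\<phi> y\<bar>)" using \<phi>i by simp
      show "AE y in lborel. norm (\<phi> y * npow p (z n) y) \<le> C * \<bar>\<phi> y\<bar>" for n using npb[OF z(1)] by simp
      show "AE y in lborel. (\<lambda>n. \<phi> y * npow p (z n) y) \<longlonglongrightarrow> \<phi> y * npow p x y"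
      proof (rule AE_I2)
        fix y
        show "(\<lambda>n. \<phi> y * npow p (z n) y) \<longlonglongrightarrow> \<phi> y * npow p x y"
        proof (cases "y \<in> K")
          case True
          have "norm (x - y) \<noteq> 0" using dist[OF x True] d by auto
          then show ?thesis unfolding npow_def by (intro tendsto_intros zx) simp
        qed (simp add: \<phi>0)
      qed
    qed measurable
    then have "(\<lambda>n. \<Phi> (z n)) \<longlonglongrightarrow> \<Phi> x" unfolding \<Phi>_def .
    then show ?thesis unfolding z(3) by (simp add: LIMSEQ_const_iff)
  qed
  then have "AE y in lborel. \<phi> y = 0"
    using riesz_potential_unique_continuation[OF \<phi>i \<phi>L _ K B(1-3) d dist p(1)] \<phi>0 unfolding \<Phi>_def by simp
  then show ?thesis using ae by eventually_elim simp
qed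

end

section \<open>The Dirichlet problem modulo finitely many exterior data\<close>

lemma cmod_cis_diff_le: "cmod (cis a - cis b) \<le> \<bar>a - b\<bar>"
proof -
  have "cis a - cis b = cis b * (cis (a - b) - 1)" by (simp add: right_diff_distrib cis_mult)
  then have "cmod (cis a - cis b) = cmod (iexp (a - b) - (\<Sum>k\<le>0. (\<i> * of_real (a - b)) ^ k / fact k))"
    by (simp add: norm_mult cis_conv_exp)
  also have "\<dots> \<le> \<bar>a - b\<bar> ^ Suc 0 / fact (Suc 0)" by (rule iexp_approx1)
  finally show ?thesis by simp
qed

lemma indicator_L2:
  fixes S :: "'a::euclidean_space set"
  assumes "S \<in> sets borel" "bounded S"
  shows "indicator S \<in> (L2 :: ('a \<Rightarrow> real) set)"
proof (rule L2_I)
  have "(norm (indicator S x :: real))\<^sup>2 = indicator S x" for x by (auto simp: indicator_def)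
  moreover have "integrable lborel (indicator S :: 'a \<Rightarrow> real)"
    using assms emeasure_bounded_finite[OF assms(2)] by (intro integrable_real_indicator) auto
  ultimately show "integrable lborel (\<lambda>x. (norm (indicator S x :: real))\<^sup>2)" by simp
qed (use assms(1) in simp)

text \<open>Formulated for one exterior set. The estimate uses an instance for each of the two sets;
  notions that do not involve \<open>W\<close>, such as \<open>form\<close> and
  \<open>nonresonant\<close>, coincide in both.\<close>

locale fractional_exterior =
  fixes s :: real and \<Omega> W :: "'a::euclidean_space set"
  assumes s: "0 < s" "s < 1"
    and \<Omega>: "open \<Omega>" "bounded \<Omega>"
    and W: "open W" "W \<noteq> {}" "W \<inter> closure \<Omega> = {}"
begin

abbreviation "X \<equiv> Hs_tilde s \<Omega>"
abbreviation "Y \<equiv> Hs_tilde s W"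

sublocale X: semi_hilbert "Hs_tilde s \<Omega>" "Hs_inner s"
  rewrites "semi_inner.nrm (Hs_inner s :: ('a \<Rightarrow> real) \<Rightarrow> _) = Hs_norm s"
  by (rule semi_hilbert_Hs_tilde[OF s]) (rule nrm_Hs[OF s])

lemma X_Hs: "u \<in> X \<Longrightarrow> u \<in> Hs s" and Y_Hs: "f \<in> Y \<Longrightarrow> f \<in> Hs s"
  using Hs_tilde_Hs[OF s] by blast+

lemma X_L2: "u \<in> X \<Longrightarrow> u \<in> L2"
  using X_Hs Hs_L2 by blast

lemma X_l2n_le: "u \<in> X \<Longrightarrow> l2n u \<le> Hs_norm s u"
  using l2n_le_Hs_norm[OF s] X_Hs by blast

lemma X_zero_outside: "u \<in> X \<Longrightarrow> AE x in lborel. x \<notin> \<Omega> \<longrightarrow> u x = 0"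
  by (rule Hs_tilde_zero_outside[OF s]) (simp_all add: borel_open \<Omega>(1))

lemma \<Omega>_radius: obtains R where "R \<ge> 0" "\<Omega> \<subseteq> cball 0 R"
proof -
  obtain R where "\<forall>x\<in>\<Omega>. norm x \<le> R" using \<Omega>(2) unfolding bounded_iff by blast
  then have R: "\<Omega> \<subseteq> cball 0 R" by (auto simp: mem_cball_0)
  have "cball 0 R \<subseteq> cball (0::'a) (max R 0)" by (rule subset_cball) simp
  then show ?thesis using that[of "max R 0"] R by auto
qed

lemma X_integrable: "u \<in> X \<Longrightarrow> integrable lborel u"
proof -
  assume u: "u \<in> X"
  obtain R where R: "\<Omega> \<subseteq> cball 0 R" using \<Omega>_radius by blast
  show ?thesis
  proof (rule L2_bounded_support_integrable[OF X_L2[OF u], where R=R])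
    show "AE x in lborel. x \<notin> cball 0 R \<longrightarrow> u x = 0"
      using X_zero_outside[OF u] by eventually_elim (use R in blast)
  qed
qed

lemma X_L1_le: "u \<in> X \<Longrightarrow> (LINT x|lborel. \<bar>u x\<bar>) \<le> l2n (indicator \<Omega> :: 'a \<Rightarrow> real) * l2n u"
proof -
  assume u: "u \<in> X"
  have ind: "indicator \<Omega> \<in> (L2 :: ('a \<Rightarrow> real) set)" using \<Omega> by (intro indicator_L2) auto
  have [measurable]: "\<Omega> \<in> sets borel" using \<Omega>(1) by simp
  note [measurable] = L2_measurable[OF X_L2[OF u]]
  have "(LINT x|lborel. \<bar>u x\<bar>) = (LINT x|lborel. norm (indicator \<Omega> x :: real) * norm (u x))"
    by (rule integral_cong_AE) (use X_zero_outside[OF u] in \<open>auto elim!: eventually_mono\<close>)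
  also have "\<dots> \<le> l2n (indicator \<Omega> :: 'a \<Rightarrow> real) * l2n u" by (rule L2_norm_mult_integral_le[OF ind X_L2[OF u]])
  finally show ?thesis .
qed

lemma energy_bdd: "f \<in> Hs s \<Longrightarrow> X.bdd_lin (energy s f)"
  by (rule X.bdd_linI[where K="Hs_norm s f"])
    (auto intro!: energy_lin_right[OF s] energy_le[OF s] X_Hs)

lemma Hs_norm_AE_zero: "(u :: 'a \<Rightarrow> real) \<in> Hs s \<Longrightarrow> AE x in lborel. u x = 0 \<Longrightarrow> Hs_norm s u = 0"
proof -
  assume u: "u \<in> Hs s" "AE x in lborel. u x = 0"
  have um: "u \<in> borel_measurable borel" using L2_measurable[OF Hs_L2[OF u(1)]] by simp
  have "AE x in lborel. (\<lambda>x::'a. 0) x = u x" using u(2) by eventually_elim simp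
  then have "fourier u = fourier (\<lambda>x::'a. 0)" by (rule Hs_cong_AE(2)[OF s Hs_zero um])
  then have "Hs_norm s u = Hs_norm s (\<lambda>x::'a. 0)" unfolding Hs_norm_def by simp
  then show ?thesis using Hs_norm_zero[OF s] by simp
qed

text \<open>By \<open>separating_functionals_dense\<close> it is enough that an element of
  \<open>X\<close> on which all exterior energies vanish is null, which is unique
  continuation.\<close>

lemma exterior_energy_dense:
  assumes G: "X.bdd_lin G" and e: "e > 0"
  shows "\<exists>f\<in>Y. \<forall>w\<in>X. \<bar>G w - energy s f w\<bar> \<le> e * Hs_norm s w"
proof -
  \<comment> \<open>Agreement with an exterior energy is demanded on \<open>X\<close> only, so that
    pointwise linear combinations of the functionals stay in the set.\<close>
  define LL where "LL = {L. X.bdd_lin L \<and> (\<exists>f\<in>Y. \<forall>w\<in>X. L w = energy s f w)}"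
  have "\<exists>L\<in>LL. \<forall>w\<in>X. \<bar>G w - L w\<bar> \<le> e * Hs_norm s w"
  proof (rule X.separating_functionals_dense[OF _ _ _ _ G e])
    show "X.bdd_lin L" if "L \<in> LL" for L using that unfolding LL_def by blast
    have "energy s (\<lambda>x. 0) \<in> LL" unfolding LL_def using energy_bdd[OF Hs_zero] Hs_tilde_zero[OF s] by blast
    then show "LL \<noteq> {}" by blast
    show "(\<lambda>w. a * L w + b * L' w) \<in> LL" if LL: "L \<in> LL" "L' \<in> LL" for L L' a b
    proof -
      obtain f f' where f: "f \<in> Y" "\<forall>w\<in>X. L w = energy s f w" and f': "f' \<in> Y" "\<forall>w\<in>X. L' w = energy s f' w"
        using LL unfolding LL_def by blast
      have "\<forall>w\<in>X. a * L w + b * L' w = energy s (\<lambda>x. a * f x + b * f' x) w"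
        using f f' by (simp add: energy_lin[OF s Y_Hs Y_Hs X_Hs])
      moreover have "X.bdd_lin (\<lambda>w. a * L w + b * L' w)" using LL unfolding LL_def by (intro X.bdd_lin_combination) auto
      ultimately show ?thesis unfolding LL_def using Hs_tilde_lin[OF s f(1) f'(1), of a b] by blast
    qed
    fix y assume y: "y \<in> X" and z: "\<And>L. L \<in> LL \<Longrightarrow> L y = 0"
    have "AE x in lborel. y x = 0"
    proof (rule fractional_unique_continuation[OF s X_Hs[OF y] _ _ W])
      show "AE x in lborel. x \<notin> closure \<Omega> \<longrightarrow> y x = 0"
        using X_zero_outside[OF y] by eventually_elim (use closure_subset in blast)
      show "compact (closure \<Omega>)" using \<Omega>(2) by simp
      fix f assume "f \<in> test_functions W"
      then have f: "f \<in> Y" using test_functions_Hs_tilde[OF s] by blast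
      then have "energy s f \<in> LL" unfolding LL_def using energy_bdd[OF Y_Hs] by blast
      then show "energy s y f = 0" using z energy_sym[OF s, of f y] by metis
    qed
    then show "Hs_inner s y y = 0" unfolding Hs_inner_self using Hs_norm_AE_zero[OF X_Hs[OF y]] by simp
  qed
  then show ?thesis unfolding LL_def by fastforce
qed

section \<open>Coercivity on the annihilator of finitely many exterior data\<close>

text \<open>Evaluating the transform at a frequency is bounded because \<Omega> is bounded: the
  \<open>L1\<close> norm is controlled by \<open>l2n\<close>. Real and imaginary part are separated
  since functionals are real valued.\<close>

lemma fourier_functional_bdd:
  "X.bdd_lin (\<lambda>u. Re (fourier_L1 u \<eta>))" "X.bdd_lin (\<lambda>u. Im (fourier_L1 u \<eta>))"
proof -
  define c where "c = (2 * pi) powr (- (real DIM('a) / 2))"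
  have "cmod (fourier_L1 u \<eta>) \<le> (c * l2n (indicator \<Omega> :: 'a \<Rightarrow> real)) * Hs_norm s u" if u: "u \<in> X" for u
  proof -
    have "cmod (fourier_L1 u \<eta>) \<le> c * (LINT x|lborel. \<bar>u x\<bar>)" unfolding c_def by (rule fourier_L1_bound[OF X_integrable[OF u]])
    also have "\<dots> \<le> c * (l2n (indicator \<Omega> :: 'a \<Rightarrow> real) * Hs_norm s u)"
    proof (rule mult_left_mono)
      show "(LINT x|lborel. \<bar>u x\<bar>) \<le> l2n (indicator \<Omega> :: 'a \<Rightarrow> real) * Hs_norm s u"
        by (rule order_trans[OF X_L1_le[OF u] mult_left_mono[OF X_l2n_le[OF u]]]) simp
    qed (simp add: c_def)
    finally show ?thesis by (simp add: mult.assoc)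
  qed
  then have "\<bar>Re (fourier_L1 u \<eta>)\<bar> \<le> (c * l2n (indicator \<Omega> :: 'a \<Rightarrow> real)) * Hs_norm s u"
    "\<bar>Im (fourier_L1 u \<eta>)\<bar> \<le> (c * l2n (indicator \<Omega> :: 'a \<Rightarrow> real)) * Hs_norm s u" if "u \<in> X" for u
    using that abs_Re_le_cmod abs_Im_le_cmod order_trans by blast+
  then show "X.bdd_lin (\<lambda>u. Re (fourier_L1 u \<eta>))" "X.bdd_lin (\<lambda>u. Im (fourier_L1 u \<eta>))"
    by (auto intro!: X.bdd_linI simp: fourier_L1_lin[OF X_integrable X_integrable])
qed

text \<open>On a set contained in a ball of radius R the phases at two frequencies differ by at most
  R |\<xi> - \<eta>|.\<close>

lemma fourier_L1_Lipschitz: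
  obtains C where "C \<ge> 0" "\<And>u \<xi> \<eta>. u \<in> X \<Longrightarrow> cmod (fourier_L1 u \<xi> - fourier_L1 u \<eta>) \<le> C * norm (\<xi> - \<eta>) * l2n u"
proof -
  define c where "c = (2 * pi) powr (- (real DIM('a) / 2))"
  have c: "c \<ge> 0" unfolding c_def by simp
  obtain R where R: "R \<ge> 0" "\<Omega> \<subseteq> cball 0 R" using \<Omega>_radius by blast
  define C where "C = c * (R * l2n (indicator \<Omega> :: 'a \<Rightarrow> real))"
  have "cmod (fourier_L1 u \<xi> - fourier_L1 u \<eta>) \<le> C * norm (\<xi> - \<eta>) * l2n u" if u: "u \<in> X" for u \<xi> \<eta>
  proof -
    note ui = X_integrable[OF u]
    have [measurable]: "u \<in> borel_measurable borel" using ui by auto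
    define D where "D x = cis (- (x \<bullet> \<xi>)) * complex_of_real (u x) - cis (- (x \<bullet> \<eta>)) * complex_of_real (u x)" for x
    have m: "(\<lambda>x. - (x \<bullet> \<zeta>)) \<in> borel_measurable borel" for \<zeta> :: 'a by measurable
    have Di: "integrable lborel D" unfolding D_def
      by (intro Bochner_Integration.integrable_diff integrable_cis_mult[OF ui m])
    have "fourier_L1 u \<xi> - fourier_L1 u \<eta> = complex_of_real c * (LINT x|lborel. D x)"
      unfolding fourier_L1_def D_def c_def
      by (subst Bochner_Integration.integral_diff[OF integrable_cis_mult[OF ui m] integrable_cis_mult[OF ui m]])
        (simp add: right_diff_distrib)
    then have "cmod (fourier_L1 u \<xi> - fourier_L1 u \<eta>) = c * cmod (LINT x|lborel. D x)" using c by (simp add: norm_mult)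
    also have "\<dots> \<le> c * (LINT x|lborel. (R * norm (\<xi> - \<eta>)) * \<bar>u x\<bar>)"
    proof (intro mult_left_mono c)
      have "cmod (LINT x|lborel. D x) \<le> (LINT x|lborel. cmod (D x))" by (rule integral_norm_bound)
      also have "\<dots> \<le> (LINT x|lborel. (R * norm (\<xi> - \<eta>)) * \<bar>u x\<bar>)"
      proof (rule integral_mono_AE)
        show "AE x in lborel. cmod (D x) \<le> (R * norm (\<xi> - \<eta>)) * \<bar>u x\<bar>"
          using X_zero_outside[OF u]
        proof eventually_elim
          case (elim x)
          show ?case
          proof (cases "x \<in> \<Omega>")
            case True
            have "D x = (cis (- (x \<bullet> \<xi>)) - cis (- (x \<bullet> \<eta>))) * complex_of_real (u x)" unfolding D_def by (simp add: left_diff_distrib)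
            then have "cmod (D x) \<le> \<bar>- (x \<bullet> \<xi>) - - (x \<bullet> \<eta>)\<bar> * \<bar>u x\<bar>"
              by (simp only: norm_mult norm_of_real) (intro mult_right_mono cmod_cis_diff_le abs_ge_zero)
            also have "\<bar>- (x \<bullet> \<xi>) - - (x \<bullet> \<eta>)\<bar> = \<bar>x \<bullet> (\<xi> - \<eta>)\<bar>" by (simp add: inner_diff_right)
            also have "\<dots> * \<bar>u x\<bar> \<le> (R * norm (\<xi> - \<eta>)) * \<bar>u x\<bar>"
            proof (rule mult_right_mono)
              have "\<bar>x \<bullet> (\<xi> - \<eta>)\<bar> \<le> norm x * norm (\<xi> - \<eta>)" by (rule Cauchy_Schwarz_ineq2)
              also have "\<dots> \<le> R * norm (\<xi> - \<eta>)" using R(2) True by (intro mult_right_mono) auto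
              finally show "\<bar>x \<bullet> (\<xi> - \<eta>)\<bar> \<le> R * norm (\<xi> - \<eta>)" .
            qed simp
            finally show ?thesis .
          qed (use elim in \<open>simp add: D_def\<close>)
        qed
      qed (use Di ui in auto)
      finally show "cmod (LINT x|lborel. D x) \<le> (LINT x|lborel. (R * norm (\<xi> - \<eta>)) * \<bar>u x\<bar>)" .
    qed
    also have "\<dots> = c * (R * norm (\<xi> - \<eta>)) * (LINT x|lborel. \<bar>u x\<bar>)" by simp
    also have "\<dots> \<le> c * (R * norm (\<xi> - \<eta>)) * (l2n (indicator \<Omega> :: 'a \<Rightarrow> real) * l2n u)"
      using c R(1) by (intro mult_left_mono X_L1_le u) auto
    finally show ?thesis unfolding C_def by (simp add: mult_ac)
  qed
  moreover have "C \<ge> 0" unfolding C_def using c R(1) by simp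
  ultimately show ?thesis using that by blast
qed

text \<open>
  On the low frequencies the transform of a function supported in \<open>\<Omega>\<close> is controlled by its
  values on a finite net; these are bounded functionals, hence limits of energies against
  exterior data.
\<close>

lemma exterior_coercivity:
  assumes \<epsilon>: "\<epsilon> > 0"
  shows "\<exists>T\<subseteq>Y. finite T \<and> (\<forall>u\<in>X. (\<forall>f\<in>T. energy s f u = 0) \<longrightarrow> (l2n u)\<^sup>2 \<le> \<epsilon> * energy s u u)"
proof -
  obtain C where C: "C \<ge> 0" "\<And>u \<xi> \<eta>. u \<in> X \<Longrightarrow> cmod (fourier_L1 u \<xi> - fourier_L1 u \<eta>) \<le> C * norm (\<xi> - \<eta>) * l2n u"
    using fourier_L1_Lipschitz by blast
  \<comment> \<open>Beyond this radius |\<xi>|^(2 s) is at least 8 / \<epsilon>, so the high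
    frequencies contribute at most \<epsilon> / 8 times the energy.\<close>
  define R where "R = (8 / \<epsilon>) powr (1 / (2 * s))"
  have R: "R > 0" unfolding R_def using \<epsilon> by simp
  have R2: "R powr (2 * s) = 8 / \<epsilon>" unfolding R_def using \<epsilon> s by (simp add: powr_powr)
  define S where "S = cball (0::'a) R"
  have Sm [measurable]: "S \<in> sets borel" unfolding S_def by simp
  define V where "V = measure lborel S"
  have V: "V \<ge> 0" unfolding V_def by simp
  have iS: "integrable lborel (indicator S :: 'a \<Rightarrow> real)" "(LINT \<xi>|lborel. indicator S \<xi>) = V"
    unfolding V_def S_def by (rule integrable_indicator_ball) simp
  \<comment> \<open>Mesh of the net: integrated over a ball of volume V, the oscillation between a
    frequency and its net point costs at most a quarter of the squared \<open>l2n\<close>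
    norm.\<close>
  define \<delta> where "\<delta> = 1 / sqrt (8 * V * C\<^sup>2 + 1)"
  have VC: "8 * V * C\<^sup>2 + 1 > 0" using V by (simp add: add_nonneg_pos)
  have \<delta>: "\<delta> > 0" "V * (2 * C\<^sup>2 * \<delta>\<^sup>2) \<le> 1 / 4"
    unfolding \<delta>_def using VC by (auto simp: power_divide field_simps)
  \<comment> \<open>Accuracy of the approximating energies. The error is measured in the Sobolev
    norm, which is bounded by \<open>l2n\<close> norm plus energy, and must be absorbed in both;
    whence the minimum of 1 / 4 and \<epsilon> / 8.\<close>
  define \<tau> where "\<tau> = sqrt (min (1 / 4) (\<epsilon> / 8) / (4 * V + 1))"
  have m0: "0 < min (1 / 4) (\<epsilon> / 8)" using \<epsilon> by simp
  have \<tau>: "\<tau> > 0" "4 * V * \<tau>\<^sup>2 \<le> 1 / 4" "4 * V * \<tau>\<^sup>2 \<le> \<epsilon> / 8"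
  proof -
    show "\<tau> > 0" unfolding \<tau>_def using m0 V by (simp add: add_nonneg_pos)
    have "\<tau>\<^sup>2 = min (1 / 4) (\<epsilon> / 8) / (4 * V + 1)" unfolding \<tau>_def using m0 V by simp
    then have "4 * V * \<tau>\<^sup>2 = (4 * V / (4 * V + 1)) * min (1 / 4) (\<epsilon> / 8)" by simp
    also have "\<dots> \<le> 1 * min (1 / 4) (\<epsilon> / 8)" using V m0 by (intro mult_right_mono) auto
    finally show "4 * V * \<tau>\<^sup>2 \<le> 1 / 4" "4 * V * \<tau>\<^sup>2 \<le> \<epsilon> / 8" by auto
  qed
  have "compact S" unfolding S_def by simp
  then obtain N where N: "finite N" "S \<subseteq> (\<Union>\<eta>\<in>N. ball \<eta> \<delta>)"
    using \<delta>(1) unfolding compact_eq_totally_bounded by blast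
  obtain a where a: "\<And>\<eta>. a \<eta> \<in> Y" "\<And>\<eta> w. w \<in> X \<Longrightarrow> \<bar>Re (fourier_L1 w \<eta>) - energy s (a \<eta>) w\<bar> \<le> \<tau> * Hs_norm s w"
    using exterior_energy_dense[OF fourier_functional_bdd(1) \<tau>(1)] by metis
  obtain b where b: "\<And>\<eta>. b \<eta> \<in> Y" "\<And>\<eta> w. w \<in> X \<Longrightarrow> \<bar>Im (fourier_L1 w \<eta>) - energy s (b \<eta>) w\<bar> \<le> \<tau> * Hs_norm s w"
    using exterior_energy_dense[OF fourier_functional_bdd(2) \<tau>(1)] by metis
  define T where "T = a ` N \<union> b ` N"
  have "(l2n u)\<^sup>2 \<le> \<epsilon> * energy s u u" if u: "u \<in> X" and z: "\<forall>f\<in>T. energy s f u = 0" for u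
  proof -
    note uH = X_Hs[OF u] and uL = X_L2[OF u] and ui = X_integrable[OF u]
    define l n E where "l = l2n u" and "n = Hs_norm s u" and "E = energy s u u"
    have nle: "n\<^sup>2 \<le> l\<^sup>2 + E" unfolding n_def l_def E_def by (rule Hs_norm_sq_le[OF s uH])
    have E0: "E \<ge> 0" unfolding E_def energy_self[OF s] by simp
    have n0: "n \<ge> 0" unfolding n_def by simp
    have low: "(cmod (fourier_L1 u \<xi>))\<^sup>2 \<le> 2 * C\<^sup>2 * \<delta>\<^sup>2 * l\<^sup>2 + 4 * \<tau>\<^sup>2 * n\<^sup>2" if "\<xi> \<in> S" for \<xi>
    proof -
      obtain \<eta> where \<eta>: "\<eta> \<in> N" "\<xi> \<in> ball \<eta> \<delta>" using subsetD[OF N(2) \<open>\<xi> \<in> S\<close>] by (elim UN_E)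
      have "\<bar>Re (fourier_L1 u \<eta>)\<bar> \<le> \<tau> * n" "\<bar>Im (fourier_L1 u \<eta>)\<bar> \<le> \<tau> * n"
        using a(2)[OF u, of \<eta>] b(2)[OF u, of \<eta>] z \<eta>(1) unfolding n_def T_def by auto
      then have "(Re (fourier_L1 u \<eta>))\<^sup>2 \<le> (\<tau> * n)\<^sup>2" "(Im (fourier_L1 u \<eta>))\<^sup>2 \<le> (\<tau> * n)\<^sup>2"
        using abs_le_square_iff[of _ "\<tau> * n"] \<tau>(1) n0 by auto
      then have 1: "(cmod (fourier_L1 u \<eta>))\<^sup>2 \<le> 2 * (\<tau>\<^sup>2 * n\<^sup>2)" unfolding cmod_power2 by (simp add: power_mult_distrib)
      have "cmod (fourier_L1 u \<xi> - fourier_L1 u \<eta>) \<le> C * norm (\<xi> - \<eta>) * l" unfolding l_def by (rule C(2)[OF u])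
      also have "\<dots> \<le> C * \<delta> * l" using \<eta>(2) C(1) unfolding l_def
        by (intro mult_right_mono mult_left_mono) (auto simp: dist_norm norm_minus_commute)
      finally have "(cmod (fourier_L1 u \<xi> - fourier_L1 u \<eta>))\<^sup>2 \<le> (C * \<delta> * l)\<^sup>2" by (intro power_mono) auto
      then have 2: "(cmod (fourier_L1 u \<xi> - fourier_L1 u \<eta>))\<^sup>2 \<le> C\<^sup>2 * \<delta>\<^sup>2 * l\<^sup>2" by (simp add: power_mult_distrib)
      have "cmod (fourier_L1 u \<xi>) \<le> cmod (fourier_L1 u \<xi> - fourier_L1 u \<eta>) + cmod (fourier_L1 u \<eta>)"
        using norm_triangle_ineq[of "fourier_L1 u \<xi> - fourier_L1 u \<eta>" "fourier_L1 u \<eta>"] by simp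
      then have "(cmod (fourier_L1 u \<xi>))\<^sup>2 \<le> (cmod (fourier_L1 u \<xi> - fourier_L1 u \<eta>) + cmod (fourier_L1 u \<eta>))\<^sup>2"
        by (intro power_mono) auto
      also have "\<dots> \<le> 2 * (cmod (fourier_L1 u \<xi> - fourier_L1 u \<eta>))\<^sup>2 + 2 * (cmod (fourier_L1 u \<eta>))\<^sup>2"
        using sum_squares_bound[of "cmod (fourier_L1 u \<xi> - fourier_L1 u \<eta>)" "cmod (fourier_L1 u \<eta>)"] by (simp add: power2_sum)
      finally show ?thesis using 1 2 by linarith
    qed
    have high: "(cmod (fourier_L1 u \<xi>))\<^sup>2 \<le> (\<epsilon> / 8) * ((norm \<xi> powr s)\<^sup>2 * (cmod (fourier_L1 u \<xi>))\<^sup>2)" if "\<xi> \<notin> S" for \<xi>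
    proof -
      have "R < norm \<xi>" using that unfolding S_def by simp
      then have "R powr (2 * s) \<le> norm \<xi> powr (2 * s)" using R s by (intro powr_mono2) auto
      moreover have "norm \<xi> powr (2 * s) = (norm \<xi> powr s)\<^sup>2" by (simp add: power2_eq_square flip: powr_add)
      ultimately have "8 / \<epsilon> \<le> (norm \<xi> powr s)\<^sup>2" unfolding R2 by simp
      then have "1 \<le> (\<epsilon> / 8) * (norm \<xi> powr s)\<^sup>2" using \<epsilon> by (simp add: field_simps)
      then have "1 * (cmod (fourier_L1 u \<xi>))\<^sup>2 \<le> ((\<epsilon> / 8) * (norm \<xi> powr s)\<^sup>2) * (cmod (fourier_L1 u \<xi>))\<^sup>2"
        by (rule mult_right_mono) simp
      then show ?thesis by (simp add: mult_ac)
    qed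
    define g where "g \<xi> = (2 * C\<^sup>2 * \<delta>\<^sup>2 * l\<^sup>2 + 4 * \<tau>\<^sup>2 * n\<^sup>2) * indicator S \<xi> + (\<epsilon> / 8) * (norm (riesz s u \<xi>))\<^sup>2" for \<xi>
    have ri: "integrable lborel (\<lambda>\<xi>. (norm (riesz s u \<xi>))\<^sup>2)" by (intro L2_integrable Hs_riesz[OF s] uH)
    have "l\<^sup>2 = (LINT \<xi>|lborel. (norm (fourier u \<xi>))\<^sup>2)" unfolding l_def plancherel[OF uL, symmetric] l2n_sq ..
    also have "\<dots> \<le> (LINT \<xi>|lborel. g \<xi>)"
    proof (rule integral_mono_AE)
      show "integrable lborel (\<lambda>\<xi>. (norm (fourier u \<xi>))\<^sup>2)" by (intro L2_integrable fourier_L2 uL)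
      show "integrable lborel g" unfolding g_def[abs_def]
        by (intro Bochner_Integration.integrable_add integrable_mult_right ri iS)
      show "AE \<xi> in lborel. (norm (fourier u \<xi>))\<^sup>2 \<le> g \<xi>"
        using fourier_eq_fourier_L1[OF uL ui]
      proof eventually_elim
        case (elim \<xi>)
        have rz: "(norm (riesz s u \<xi>))\<^sup>2 = (norm \<xi> powr s)\<^sup>2 * (cmod (fourier_L1 u \<xi>))\<^sup>2"
          unfolding riesz_def elim by (simp add: norm_mult power_mult_distrib)
        show ?case
        proof (cases "\<xi> \<in> S")
          case True
          then show ?thesis using low[OF True] \<epsilon> unfolding g_def elim by (simp add: add_increasing2)
        next
          case False
          then show ?thesis using high[OF False] unfolding g_def rz elim by simp
        qed
      qed
    qed
    also have "\<dots> = (2 * C\<^sup>2 * \<delta>\<^sup>2 * l\<^sup>2 + 4 * \<tau>\<^sup>2 * n\<^sup>2) * V + (\<epsilon> / 8) * E"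
      unfolding g_def E_def energy_self[OF s] l2n_sq using ri iS by simp
    also have "\<dots> = (V * (2 * C\<^sup>2 * \<delta>\<^sup>2)) * l\<^sup>2 + (4 * V * \<tau>\<^sup>2) * n\<^sup>2 + (\<epsilon> / 8) * E" by (simp add: algebra_simps)
    also have "\<dots> \<le> (1 / 4) * l\<^sup>2 + (4 * V * \<tau>\<^sup>2) * (l\<^sup>2 + E) + (\<epsilon> / 8) * E"
      using \<delta>(2) nle V E0 by (intro add_mono mult_right_mono mult_left_mono) auto
    also have "\<dots> = (1 / 4) * l\<^sup>2 + ((4 * V * \<tau>\<^sup>2) * l\<^sup>2 + (4 * V * \<tau>\<^sup>2) * E) + (\<epsilon> / 8) * E" by (simp add: distrib_left)
    also have "\<dots> \<le> (1 / 4) * l\<^sup>2 + ((1 / 4) * l\<^sup>2 + (\<epsilon> / 8) * E) + (\<epsilon> / 8) * E"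
      using \<tau>(2,3) E0 by (intro add_mono mult_right_mono order_refl) auto
    finally have "l\<^sup>2 \<le> (1 / 4) * l\<^sup>2 + ((1 / 4) * l\<^sup>2 + (\<epsilon> / 8) * E) + (\<epsilon> / 8) * E" .
    \<comment> \<open>Two quarters are absorbed on the left, and the two energy terms add up to
      \<epsilon> / 4.\<close>
    then have "l\<^sup>2 / 2 \<le> (\<epsilon> * E) / 4" by (simp add: field_simps)
    moreover have "0 \<le> \<epsilon> * E" using \<epsilon> E0 by simp
    ultimately show ?thesis unfolding l_def E_def by linarith
  qed
  moreover have "T \<subseteq> Y" "finite T" unfolding T_def using a(1) b(1) N(1) by auto
  ultimately show ?thesis by blast
qed

section \<open>Forms with bounded potentials\<close>

definition pot :: "real \<Rightarrow> ('a \<Rightarrow> real) \<Rightarrow> bool" where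
  "pot C q \<longleftrightarrow> q \<in> borel_measurable borel \<and> (AE x in lborel. \<bar>q x\<bar> \<le> C)"

text \<open>Potentials live on the whole space here; those of the Dirichlet problem enter extended
  by zero.\<close>

definition form :: "('a \<Rightarrow> real) \<Rightarrow> ('a \<Rightarrow> real) \<Rightarrow> ('a \<Rightarrow> real) \<Rightarrow> real" where
  "form q u v = energy s u v + (LINT x|lborel. q x * u x * v x)"

lemma pot_mult_L2:
  fixes u :: "'a \<Rightarrow> real"
  assumes q: "pot C q" and u: "u \<in> L2"
  shows "(\<lambda>x. q x * u x) \<in> L2"
proof -
  have [measurable]: "q \<in> borel_measurable borel" using q unfolding pot_def by blast
  note [measurable] = L2_measurable[OF u]
  show ?thesis
  proof (rule L2_dominated[OF _ u, where C=C])
    have "AE x in lborel. \<bar>q x\<bar> \<le> C" using q unfolding pot_def by blast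
    then show "AE x in lborel. norm (q x * u x) \<le> C * norm (u x)"
      by eventually_elim (simp add: abs_mult mult_right_mono)
  qed measurable
qed

lemma pot_integrable:
  fixes u v :: "'a \<Rightarrow> real"
  assumes "pot C q" "u \<in> L2" "v \<in> L2"
  shows "integrable lborel (\<lambda>x. q x * u x * v x)"
  by (rule L2_mult_integrable[OF pot_mult_L2[OF assms(1,2)] assms(3)])

lemma pot_integral_le:
  fixes u v :: "'a \<Rightarrow> real"
  assumes q: "pot C q" and C: "C \<ge> 0" and u: "u \<in> L2" and v: "v \<in> L2"
  shows "\<bar>(LINT x|lborel. q x * u x * v x)\<bar> \<le> C * (l2n u * l2n v)"
proof -
  have "AE x in lborel. \<bar>q x\<bar> \<le> C" using q unfolding pot_def by blast
  then have le: "AE x in lborel. \<bar>q x * u x * v x\<bar> \<le> C * (norm (u x) * norm (v x))"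
    by eventually_elim (simp add: abs_mult mult.assoc mult_right_mono)
  have "\<bar>(LINT x|lborel. q x * u x * v x)\<bar> \<le> (LINT x|lborel. \<bar>q x * u x * v x\<bar>)" by (rule integral_abs_bound)
  also have "\<dots> \<le> (LINT x|lborel. C * (norm (u x) * norm (v x)))"
    by (intro integral_mono_AE le integrable_abs pot_integrable[OF q u v] integrable_mult_right L2_mult_integrable L2_norm u v)
  also have "\<dots> \<le> C * (l2n u * l2n v)" using C L2_norm_mult_integral_le[OF u v] by (simp add: mult_left_mono)
  finally show ?thesis .
qed

lemma form_lin:
  assumes q: "pot C q" and u: "u \<in> Hs s" "v \<in> Hs s" "w \<in> Hs s"
  shows "form q (\<lambda>x. a * u x + b * v x) w = a * form q u w + b * form q v w"
proof -
  have "q x * (a * u x + b * v x) * w x = a * (q x * u x * w x) + b * (q x * v x * w x)" for x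
    by (simp add: algebra_simps)
  then have "(LINT x|lborel. q x * (a * u x + b * v x) * w x) = a * (LINT x|lborel. q x * u x * w x) + b * (LINT x|lborel. q x * v x * w x)"
    using pot_integrable[OF q Hs_L2[OF u(1)] Hs_L2[OF u(3)]] pot_integrable[OF q Hs_L2[OF u(2)] Hs_L2[OF u(3)]] by simp
  then show ?thesis unfolding form_def energy_lin[OF s u] by (simp add: algebra_simps)
qed

lemma form_sym: "form q u v = form q v u"
  unfolding form_def by (simp add: energy_sym[OF s, of u v] mult.commute mult.left_commute)

lemma form_lin_right:
  assumes q: "pot C q" and u: "u \<in> Hs s" "v \<in> Hs s" "w \<in> Hs s"
  shows "form q w (\<lambda>x. a * u x + b * v x) = a * form q w u + b * form q w v"
  using form_lin[OF q u, of a b] by (simp add: form_sym)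

lemma form_le:
  assumes q: "pot C q" and C: "C \<ge> 0" and u: "u \<in> Hs s" "v \<in> Hs s"
  shows "\<bar>form q u v\<bar> \<le> (1 + C) * (Hs_norm s u * Hs_norm s v)"
proof -
  have "\<bar>form q u v\<bar> \<le> \<bar>energy s u v\<bar> + \<bar>(LINT x|lborel. q x * u x * v x)\<bar>" unfolding form_def by (rule abs_triangle_ineq)
  also have "\<dots> \<le> Hs_norm s u * Hs_norm s v + C * (l2n u * l2n v)"
    by (intro add_mono energy_le[OF s] u pot_integral_le[OF q C] Hs_L2[OF u(1)] Hs_L2[OF u(2)])
  also have "\<dots> \<le> Hs_norm s u * Hs_norm s v + C * (Hs_norm s u * Hs_norm s v)"
    using C by (intro add_mono mult_left_mono mult_mono l2n_le_Hs_norm[OF s] u) auto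
  finally show ?thesis by (simp add: algebra_simps)
qed

lemma form_bdd: "pot C q \<Longrightarrow> C \<ge> 0 \<Longrightarrow> u \<in> Hs s \<Longrightarrow> X.bdd_lin (form q u)"
proof (rule X.bdd_linI[where K="(1 + C) * Hs_norm s u"])
  assume q: "pot C q" "C \<ge> 0" and u: "u \<in> Hs s"
  show "\<bar>form q u w\<bar> \<le> (1 + C) * Hs_norm s u * Hs_norm s w" if "w \<in> X" for w
    using form_le[OF q u X_Hs[OF that]] by (simp add: mult.assoc)
qed (auto intro!: form_lin_right X_Hs)

text \<open>Where the energy is at least 2 C + 1 times the squared \<open>L2\<close> norm, a
  potential bounded by C takes away at most half of it. The finite set depends on C and not on the
  potential.\<close>

lemma form_coercive_on_subspace:
  assumes C: "C \<ge> 0"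
  obtains T where "T \<subseteq> Y" "finite T"
    "\<And>q u. pot C q \<Longrightarrow> u \<in> X \<Longrightarrow> (\<forall>f\<in>T. energy s f u = 0) \<Longrightarrow> (Hs_norm s u)\<^sup>2 \<le> 4 * form q u u"
proof -
  \<comment> \<open>The form keeps half of the energy, and \<epsilon> \<le> 1 bounds the squared
    Sobolev norm by twice the energy; together this is the factor 4.\<close>
  define \<epsilon> where "\<epsilon> = 1 / (2 * C + 1)"
  have \<epsilon>: "\<epsilon> > 0" "\<epsilon> \<le> 1" "C * \<epsilon> \<le> 1 / 2" unfolding \<epsilon>_def using C by (auto simp: field_simps)
  obtain T where T: "T \<subseteq> Y" "finite T" "\<forall>u\<in>X. (\<forall>f\<in>T. energy s f u = 0) \<longrightarrow> (l2n u)\<^sup>2 \<le> \<epsilon> * energy s u u"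
    using exterior_coercivity[OF \<epsilon>(1)] by blast
  have "(Hs_norm s u)\<^sup>2 \<le> 4 * form q u u" if q: "pot C q" and u: "u \<in> X" and z: "\<forall>f\<in>T. energy s f u = 0" for q u
  proof -
    define E where "E = energy s u u"
    have E: "E \<ge> 0" unfolding E_def energy_self[OF s] by simp
    have l: "(l2n u)\<^sup>2 \<le> \<epsilon> * E" using T(3) u z unfolding E_def by blast
    also have "\<dots> \<le> 1 * E" using \<epsilon>(2) E by (intro mult_right_mono) auto
    finally have 1: "(Hs_norm s u)\<^sup>2 \<le> 2 * E" using Hs_norm_sq_le[OF s X_Hs[OF u]] unfolding E_def by linarith
    have "\<bar>(LINT x|lborel. q x * u x * u x)\<bar> \<le> C * (l2n u)\<^sup>2"
      using pot_integral_le[OF q C X_L2[OF u] X_L2[OF u]] by (simp add: power2_eq_square)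
    also have "\<dots> \<le> C * (\<epsilon> * E)" using l C by (rule mult_left_mono)
    also have "\<dots> = (C * \<epsilon>) * E" by simp
    also have "\<dots> \<le> (1 / 2) * E" using \<epsilon>(3) E by (rule mult_right_mono)
    finally have "- ((1 / 2) * E) \<le> (LINT x|lborel. q x * u x * u x)" by (simp add: abs_le_iff)
    then have "(1 / 2) * E \<le> form q u u" unfolding form_def E_def by linarith
    then show ?thesis using 1 by linarith
  qed
  then show ?thesis using that T(1,2) by blast
qed

lemma Hs_subspace_sum:
  assumes V: "(\<lambda>x. 0) \<in> V" "\<And>u v a b. u \<in> V \<Longrightarrow> v \<in> V \<Longrightarrow> (\<lambda>x. a * u x + b * v x) \<in> V" "V \<subseteq> Hs s"
    and A: "finite A" "\<And>i. i \<in> A \<Longrightarrow> (f i :: 'a \<Rightarrow> real) \<in> V"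
  shows "(\<lambda>x. \<Sum>i\<in>A. c i * f i x) \<in> V \<and> (\<forall>w\<in>Hs s. energy s (\<lambda>x. \<Sum>i\<in>A. c i * f i x) w = (\<Sum>i\<in>A. c i * energy s (f i) w))
    \<and> Hs_norm s (\<lambda>x. \<Sum>i\<in>A. c i * f i x) \<le> (\<Sum>i\<in>A. \<bar>c i\<bar> * Hs_norm s (f i))"
  using A
proof (induction A rule: finite_induct)
  case empty
  have "energy s (\<lambda>x::'a. 0) w = 0" if "w \<in> Hs s" for w
    using energy_lin[OF s Hs_zero Hs_zero that, of 0 0] by simp
  then have "\<forall>w\<in>Hs s. energy s (\<lambda>x::'a. 0) w = 0" by blast
  then show ?case using V(1) Hs_norm_zero[OF s, where 'a='a] by simp
next
  case (insert i A)
  let ?g = "\<lambda>x. \<Sum>i\<in>A. c i * f i x"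
  have fi: "f i \<in> V" and g: "?g \<in> V" using insert by auto
  have e: "(\<lambda>x. \<Sum>i\<in>insert i A. c i * f i x) = (\<lambda>x. c i * f i x + 1 * ?g x)" using insert(1,2) by auto
  have H: "f i \<in> Hs s" "?g \<in> Hs s" using fi g V(3) by auto
  have "Hs_norm s (\<lambda>x. c i * f i x + ?g x) \<le> Hs_norm s (\<lambda>x. c i * f i x) + Hs_norm s ?g"
    by (rule Hs.nrm_triangle[OF Hs.scale[OF H(1)] H(2)])
  also have "Hs_norm s (\<lambda>x. c i * f i x) = \<bar>c i\<bar> * Hs_norm s (f i)" by (rule Hs.nrm_scale[OF H(1)])
  finally show ?case
    unfolding e using V(2)[OF fi g, of "c i" 1] energy_lin[OF s H, of _ "c i" 1] insert by auto
qed

lemma Y_sum: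
  assumes "finite A" "\<And>i. i \<in> A \<Longrightarrow> f i \<in> Y"
  shows "(\<lambda>x. \<Sum>i\<in>A. c i * f i x) \<in> Y"
    "w \<in> Hs s \<Longrightarrow> energy s (\<lambda>x. \<Sum>i\<in>A. c i * f i x) w = (\<Sum>i\<in>A. c i * energy s (f i) w)"
    "Hs_norm s (\<lambda>x. \<Sum>i\<in>A. c i * f i x) \<le> (\<Sum>i\<in>A. \<bar>c i\<bar> * Hs_norm s (f i))"
proof -
  have Y: "Y \<subseteq> Hs s" using Y_Hs by blast
  have lin: "\<And>u v a b. u \<in> Y \<Longrightarrow> v \<in> Y \<Longrightarrow> (\<lambda>x. a * u x + b * v x) \<in> Y" by (rule Hs_tilde_lin[OF s])
  have "(\<lambda>x. \<Sum>i\<in>A. c i * f i x) \<in> Y \<and> (\<forall>w\<in>Hs s. energy s (\<lambda>x. \<Sum>i\<in>A. c i * f i x) w = (\<Sum>i\<in>A. c i * energy s (f i) w))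
    \<and> Hs_norm s (\<lambda>x. \<Sum>i\<in>A. c i * f i x) \<le> (\<Sum>i\<in>A. \<bar>c i\<bar> * Hs_norm s (f i))"
    by (rule Hs_subspace_sum[OF Hs_tilde_zero[OF s] lin Y assms])
  then show "(\<lambda>x. \<Sum>i\<in>A. c i * f i x) \<in> Y"
    "w \<in> Hs s \<Longrightarrow> energy s (\<lambda>x. \<Sum>i\<in>A. c i * f i x) w = (\<Sum>i\<in>A. c i * energy s (f i) w)"
    "Hs_norm s (\<lambda>x. \<Sum>i\<in>A. c i * f i x) \<le> (\<Sum>i\<in>A. \<bar>c i\<bar> * Hs_norm s (f i))" by simp_all
qed

text \<open>On the annihilator \<open>V\<close> of the finite set the form is an inner product
  equivalent to the Sobolev one, so Riesz solves the equation there. The remaining functional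
  vanishes on \<open>V\<close>, hence is a combination of the fixed energies with controlled
  coefficients by \<open>functional_in_span\<close>. Neither the energies nor the constant depend on
  q.\<close>

lemma uniform_solvability:
  assumes C: "C \<ge> 0"
  obtains N :: nat and y :: "nat \<Rightarrow> 'a \<Rightarrow> real" and M where "\<And>i. y i \<in> Y" "M \<ge> 0"
    "\<forall>q F \<delta>. pot C q \<longrightarrow> X.bdd_lin F \<longrightarrow> 0 \<le> \<delta> \<longrightarrow> (\<forall>w\<in>X. \<bar>F w\<bar> \<le> \<delta> * Hs_norm s w) \<longrightarrow>
      (\<exists>z\<in>X. \<exists>c. Hs_norm s z \<le> M * \<delta> \<and> (\<forall>i<N. \<bar>c i\<bar> \<le> M * \<delta>) \<and>
        (\<forall>w\<in>X. F w = form q z w + (\<Sum>i<N. c i * energy s (y i) w)))"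
proof -
  obtain T where T: "T \<subseteq> Y" "finite T"
    "\<And>q u. pot C q \<Longrightarrow> u \<in> X \<Longrightarrow> (\<forall>f\<in>T. energy s f u = 0) \<Longrightarrow> (Hs_norm s u)\<^sup>2 \<le> 4 * form q u u"
    using form_coercive_on_subspace[OF C] by blast
  obtain xs where xs: "set xs = T" using finite_list[OF T(2)] by blast
  define N where "N = length xs"
  \<comment> \<open>The zero function beyond the list makes every \<open>y i\<close> an element of
    \<open>Y\<close>, without a condition on i.\<close>
  define y where "y i = (if i < N then xs ! i else (\<lambda>x. 0))" for i
  have yY: "y i \<in> Y" for i using xs T(1) Hs_tilde_zero[OF s] unfolding y_def N_def by (auto simp: subset_iff)
  have yT: "(\<forall>f\<in>T. energy s f u = 0) \<longleftrightarrow> (\<forall>i<N. energy s (y i) u = 0)" for u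
    unfolding xs[symmetric] y_def N_def by (simp add: all_set_conv_all_nth)
  have yb: "\<forall>i<N. X.bdd_lin (energy s (y i))" using energy_bdd[OF Y_Hs[OF yY]] by simp
  obtain M0 where M0: "M0 \<ge> 0" "\<forall>F \<delta>. X.bdd_lin F \<longrightarrow> 0 \<le> \<delta> \<longrightarrow> (\<forall>w\<in>X. \<bar>F w\<bar> \<le> \<delta> * Hs_norm s w) \<longrightarrow>
     (\<forall>w\<in>X. (\<forall>i<N. energy s (y i) w = 0) \<longrightarrow> F w = 0) \<longrightarrow>
     (\<exists>c. (\<forall>i<N. \<bar>c i\<bar> \<le> M0 * \<delta>) \<and> (\<forall>w\<in>X. F w = (\<Sum>i<N. c i * energy s (y i) w)))"
    using X.functional_in_span[OF yb] by (elim exE conjE) (rule that)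
  define V where "V = {u \<in> X. \<forall>f\<in>T. energy s f u = 0}"
  have VX: "V \<subseteq> X" unfolding V_def by blast
  have V0: "(\<lambda>x. 0) \<in> V"
  proof -
    have "energy s f (\<lambda>x. 0) = 0" if "f \<in> T" for f
      using energy_lin_right[OF s Hs_zero Hs_zero Y_Hs, of f 0 0] that T(1) by auto
    then show ?thesis unfolding V_def using Hs_tilde_zero[OF s] by blast
  qed
  have Vlin: "(\<lambda>x. a * u x + b * v x) \<in> V" if "u \<in> V" "v \<in> V" for u v a b
  proof -
    have "energy s f (\<lambda>x. a * u x + b * v x) = 0" if f: "f \<in> T" for f
      using energy_lin_right[OF s X_Hs X_Hs Y_Hs, of u v f a b] \<open>u \<in> V\<close> \<open>v \<in> V\<close> f T(1) unfolding V_def by auto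
    then show ?thesis using Hs_tilde_lin[OF s, of u \<Omega> v a b] that unfolding V_def by blast
  qed
  have hil: "semi_hilbert V (Hs_inner s)"
  proof (rule semi_hilbert_Hs_subspace[OF s _ V0 Vlin])
    show "V \<subseteq> Hs s" using VX X_Hs by blast
    fix z assume z: "z \<in> Hs s" and lim: "\<And>e. e > 0 \<Longrightarrow> \<exists>u\<in>V. Hs_norm s (\<lambda>x. u x - z x) < e"
    have zX: "z \<in> X" using Hs_tilde_limit[OF s z] lim VX by (meson subsetD)
    have "energy s f z = 0" if f: "f \<in> T" for f
    proof -
      have fH: "f \<in> Hs s" using f T(1) Y_Hs by blast
      have "\<bar>energy s f z\<bar> \<le> 0 + e" if e: "e > 0" for e
      proof -
        have e': "e / (Hs_norm s f + 1) > 0" using e by (simp add: add_nonneg_pos)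
        obtain u where u: "u \<in> V" "Hs_norm s (\<lambda>x. u x - z x) < e / (Hs_norm s f + 1)" using lim[OF e'] by blast
        have uH: "u \<in> Hs s" using u(1) VX X_Hs by blast
        have "energy s f u = 0" using u(1) f unfolding V_def by blast
        moreover have "energy s f (\<lambda>x. u x - z x) = energy s f u - energy s f z"
          using energy_lin_right[OF s uH z fH, of 1 "-1"] by simp
        moreover have "\<bar>energy s f (\<lambda>x. u x - z x)\<bar> \<le> Hs_norm s f * Hs_norm s (\<lambda>x. u x - z x)"
          by (rule energy_le[OF s fH Hs.diff[OF uH z]])
        moreover have "Hs_norm s f * Hs_norm s (\<lambda>x. u x - z x) \<le> Hs_norm s f * (e / (Hs_norm s f + 1))"
          using u(2) by (intro mult_left_mono) auto
        moreover have "Hs_norm s f * (e / (Hs_norm s f + 1)) \<le> e"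
        proof -
          have "Hs_norm s f * e \<le> e * (Hs_norm s f + 1)" using e by (simp add: algebra_simps)
          then show ?thesis by (simp add: pos_divide_le_eq add_nonneg_pos)
        qed
        ultimately show ?thesis by linarith
      qed
      then have "\<bar>energy s f z\<bar> \<le> 0" by (rule field_le_epsilon)
      then show ?thesis by simp
    qed
    then show "z \<in> V" unfolding V_def using zX by blast
  qed
  \<comment> \<open>4 \<delta> bounds the solution, and (1 + (1 + C) * 4) \<delta> the functional
    that is left over, whose coefficients cost a further factor \<open>M0\<close>.\<close>
  define M where "M = 4 + M0 * (1 + (1 + C) * 4)"
  have M: "M \<ge> 0" unfolding M_def using M0(1) C by simp
  have main: "\<exists>z\<in>X. \<exists>c. Hs_norm s z \<le> M * \<delta> \<and> (\<forall>i<N. \<bar>c i\<bar> \<le> M * \<delta>) \<and>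
        (\<forall>w\<in>X. F w = form q z w + (\<Sum>i<N. c i * energy s (y i) w))"
    if q: "pot C q" and F: "X.bdd_lin F" and \<delta>: "0 \<le> \<delta>" and Fb: "\<forall>w\<in>X. \<bar>F w\<bar> \<le> \<delta> * Hs_norm s w" for q F \<delta>
  proof -
    have co: "(Hs_norm s u)\<^sup>2 \<le> 4 * form q u u" if "u \<in> V" for u
      using T(3)[OF q, of u] that unfolding V_def by blast
    have VH: "u \<in> V \<Longrightarrow> u \<in> Hs s" for u using VX X_Hs by blast
    have si: "semi_inner V (form q)"
    proof
      show "0 \<le> form q u u" if "u \<in> V" for u using order_trans[OF zero_le_power2 co[OF that]] by simp
    qed (use Vlin V0 VH form_lin[OF q] form_sym in auto)
    interpret B: semi_inner V "form q" by (rule si)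
    have n1: "Hs_norm s u \<le> 2 * B.nrm u" if "u \<in> V" for u
    proof (rule power2_le_imp_le)
      show "(Hs_norm s u)\<^sup>2 \<le> (2 * B.nrm u)\<^sup>2" using co[OF that] B.nrm_sq[OF that] by (simp add: power_mult_distrib)
    qed (use that in simp)
    have n2: "B.nrm u \<le> sqrt (1 + C) * Hs_norm s u" if "u \<in> V" for u
    proof (rule power2_le_imp_le)
      have "form q u u \<le> (1 + C) * (Hs_norm s u)\<^sup>2"
        using form_le[OF q C VH[OF that] VH[OF that]] by (simp add: power2_eq_square)
      then show "(B.nrm u)\<^sup>2 \<le> (sqrt (1 + C) * Hs_norm s u)\<^sup>2" using B.nrm_sq[OF that] C by (simp add: power_mult_distrib)
    qed (use C in simp)
    interpret B: semi_hilbert V "form q"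
    proof
      fix f :: "nat \<Rightarrow> 'a \<Rightarrow> real"
      assume f: "\<And>n. f n \<in> V" and c: "\<And>e. e > 0 \<Longrightarrow> \<exists>M. \<forall>m\<ge>M. \<forall>n\<ge>M. B.nrm (\<lambda>x. f m x - f n x) < e"
      have "\<exists>M. \<forall>m\<ge>M. \<forall>n\<ge>M. Hs_norm s (\<lambda>x. f m x - f n x) < e" if e: "e > 0" for e
      proof -
        obtain M where M: "\<forall>m\<ge>M. \<forall>n\<ge>M. B.nrm (\<lambda>x. f m x - f n x) < e / 2" using c[of "e / 2"] e by auto
        have "Hs_norm s (\<lambda>x. f m x - f n x) < e" if "m \<ge> M" "n \<ge> M" for m n
          using M that n1[OF B.diff[OF f f], of m n] by fastforce
        then show ?thesis by blast
      qed
      then have "\<exists>l\<in>V. (\<lambda>n. Hs_norm s (\<lambda>x. f n x - l x)) \<longlonglongrightarrow> 0"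
        by (rule semi_hilbert.complete[OF hil f, unfolded nrm_Hs[OF s]])
      then obtain l where l: "l \<in> V" "(\<lambda>n. Hs_norm s (\<lambda>x. f n x - l x)) \<longlonglongrightarrow> 0" by (elim bexE)
      have "(\<lambda>n. B.nrm (\<lambda>x. f n x - l x)) \<longlonglongrightarrow> 0"
      proof (rule tendsto_0_le)
        show "0 \<le> B.nrm (\<lambda>x. f n x - l x)" for n by (intro B.nrm_nonneg B.diff f l)
        show "B.nrm (\<lambda>x. f n x - l x) \<le> sqrt (1 + C) * Hs_norm s (\<lambda>x. f n x - l x)" for n by (intro n2 B.diff f l)
        show "(\<lambda>n. sqrt (1 + C) * Hs_norm s (\<lambda>x. f n x - l x)) \<longlonglongrightarrow> 0" using tendsto_mult_left[OF l(2), of "sqrt (1 + C)"] by simp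
      qed
      then show "\<exists>l\<in>V. (\<lambda>n. B.nrm (\<lambda>x. f n x - l x)) \<longlonglongrightarrow> 0" using l(1) by blast
    qed
    have FB: "B.bdd_lin F"
    proof (rule B.bdd_linI[where K="2 * \<delta>"])
      fix u v a b assume "u \<in> V" "v \<in> V"
      then show "F (\<lambda>x. a * u x + b * v x) = a * F u + b * F v" using X.bdd_linD[OF F] VX by blast
    next
      fix u assume u: "u \<in> V"
      have "\<bar>F u\<bar> \<le> \<delta> * Hs_norm s u" using Fb u VX by blast
      also have "\<dots> \<le> \<delta> * (2 * B.nrm u)" using n1[OF u] \<delta> by (rule mult_left_mono)
      finally show "\<bar>F u\<bar> \<le> 2 * \<delta> * B.nrm u" by simp
    qed
    obtain z where z: "z \<in> V" "\<forall>w\<in>V. form q z w = F w" using B.riesz[OF FB] by blast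
    have zX: "z \<in> X" using z(1) VX by blast
    have zn: "Hs_norm s z \<le> 4 * \<delta>"
    proof (cases "Hs_norm s z = 0")
      case False
      have "(Hs_norm s z)\<^sup>2 \<le> 4 * F z" using co[OF z(1)] z by simp
      also have "\<dots> \<le> 4 * (\<delta> * Hs_norm s z)" using Fb zX by fastforce
      finally have "Hs_norm s z * Hs_norm s z \<le> (4 * \<delta>) * Hs_norm s z" by (simp add: power2_eq_square)
      moreover have "0 < Hs_norm s z" using False Hs_norm_nonneg[of s z] by linarith
      ultimately show ?thesis by (rule mult_right_le_imp_le)
    qed (use \<delta> in simp)
    \<comment> \<open>What the solution found on \<open>V\<close> fails to represent on all of
      \<open>X\<close>.\<close>
    define G where "G = (\<lambda>w. 1 * F w + (- 1) * form q z w)"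
    have G1: "X.bdd_lin G" unfolding G_def by (rule X.bdd_lin_combination[OF F form_bdd[OF q C X_Hs[OF zX]]])
    define \<gamma> where "\<gamma> = \<delta> * (1 + (1 + C) * 4)"
    have G2: "0 \<le> \<gamma>" unfolding \<gamma>_def using \<delta> C by simp
    have G3: "\<forall>w\<in>X. \<bar>G w\<bar> \<le> \<gamma> * Hs_norm s w"
    proof
      fix w assume w: "w \<in> X"
      have "\<bar>G w\<bar> \<le> \<bar>F w\<bar> + \<bar>form q z w\<bar>" unfolding G_def using abs_triangle_ineq4[of "F w" "form q z w"] by simp
      also have "\<dots> \<le> \<delta> * Hs_norm s w + (1 + C) * (Hs_norm s z * Hs_norm s w)"
        using Fb w by (intro add_mono form_le[OF q C] X_Hs zX) auto
      also have "\<dots> \<le> \<delta> * Hs_norm s w + (1 + C) * ((4 * \<delta>) * Hs_norm s w)"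
        using zn C by (intro add_mono mult_left_mono mult_right_mono) auto
      finally show "\<bar>G w\<bar> \<le> \<gamma> * Hs_norm s w" unfolding \<gamma>_def by (simp add: algebra_simps)
    qed
    have G4: "\<forall>w\<in>X. (\<forall>i<N. energy s (y i) w = 0) \<longrightarrow> G w = 0"
      using z(2) unfolding G_def V_def yT by simp
    obtain c where c: "\<forall>i<N. \<bar>c i\<bar> \<le> M0 * \<gamma>" "\<forall>w\<in>X. G w = (\<Sum>i<N. c i * energy s (y i) w)"
      using M0(2)[THEN spec, THEN spec, THEN mp, OF G1, THEN mp, OF G2, THEN mp, OF G3, THEN mp, OF G4] by blast
    have k: "4 * \<delta> \<le> M * \<delta>" "M0 * \<gamma> \<le> M * \<delta>"
      unfolding M_def \<gamma>_def using M0(1) C \<delta> by (auto simp: algebra_simps)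
    show ?thesis
    proof (intro bexI[OF _ zX] exI[of _ c] conjI allI impI ballI)
      show "Hs_norm s z \<le> M * \<delta>" using zn k(1) by linarith
      show "\<bar>c i\<bar> \<le> M * \<delta>" if "i < N" for i using c(1) that k(2) by fastforce
      show "F w = form q z w + (\<Sum>i<N. c i * energy s (y i) w)" if "w \<in> X" for w
        using c(2) that unfolding G_def by fastforce
    qed
  qed
  show ?thesis by (rule that[where N=N and y=y, OF yY M]) (intro allI impI main)
qed

end

context fractional_exterior
begin

section \<open>Solvability for nonresonant potentials\<close>

text \<open>Uniqueness for zero data, phrased with the seminorm because elements are functions and
  not classes.\<close>

definition nonresonant :: "('a \<Rightarrow> real) \<Rightarrow> bool" where
  "nonresonant q \<longleftrightarrow> (\<forall>z\<in>X. (\<forall>w\<in>X. form q z w = 0) \<longrightarrow> Hs_norm s z = 0)"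

text \<open>
  The exterior energies that \<open>uniform_solvability\<close> needs are discarded one at a time: by
  nonresonance and symmetry the last one is nearly represented by the form, and the
  remainder, expanded with a coefficient at most one half on the same energy, lets one solve
  for it.
\<close>

lemma nonresonant_solvable:
  assumes q: "pot C q" and C: "C \<ge> 0" and nr: "nonresonant q" and F: "X.bdd_lin F"
  shows "\<exists>z\<in>X. \<forall>w\<in>X. form q z w = F w"
proof -
  obtain N0 :: nat and y :: "nat \<Rightarrow> 'a \<Rightarrow> real" and M0 where y: "\<And>i. y i \<in> Y" and M0: "M0 \<ge> 0"
    and U: "\<forall>q F \<delta>. pot C q \<longrightarrow> X.bdd_lin F \<longrightarrow> 0 \<le> \<delta> \<longrightarrow> (\<forall>w\<in>X. \<bar>F w\<bar> \<le> \<delta> * Hs_norm s w) \<longrightarrow>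
      (\<exists>z\<in>X. \<exists>c. Hs_norm s z \<le> M0 * \<delta> \<and> (\<forall>i<N0. \<bar>c i\<bar> \<le> M0 * \<delta>) \<and>
        (\<forall>w\<in>X. F w = form q z w + (\<Sum>i<N0. c i * energy s (y i) w)))"
    by (rule uniform_solvability[OF C]) (rule that; assumption)
  define S where "S N M F \<delta> \<longleftrightarrow> (\<exists>z\<in>X. \<exists>c. (\<forall>i<N. \<bar>c i\<bar> \<le> M * \<delta>) \<and>
        (\<forall>w\<in>X. F w = form q z w + (\<Sum>i<N. c i * energy s (y i) w)))" for N :: nat and M F and \<delta> :: real
  \<comment> \<open>\<open>P N\<close>: every bounded functional is represented up to the first N
    energies, with coefficients controlled by its norm. The control is carried along because the
    elimination step needs a small coefficient.\<close>
  define P where "P N \<longleftrightarrow> (\<exists>M\<ge>0. \<forall>F \<delta>. X.bdd_lin F \<longrightarrow> 0 \<le> \<delta> \<longrightarrow> (\<forall>w\<in>X. \<bar>F w\<bar> \<le> \<delta> * Hs_norm s w) \<longrightarrow> S N M F \<delta>)" for N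
  have step: "P N" if PN: "P (Suc N)" for N
  proof -
    obtain M where M: "M \<ge> 0" and PM: "\<And>F \<delta>. X.bdd_lin F \<Longrightarrow> 0 \<le> \<delta> \<Longrightarrow> (\<forall>w\<in>X. \<bar>F w\<bar> \<le> \<delta> * Hs_norm s w) \<Longrightarrow> S (Suc N) M F \<delta>"
      using PN unfolding P_def by blast
    \<comment> \<open>So small that the coefficient of the energy of \<open>y N\<close> in the
      expansion of the remainder is at most 1 / 2.\<close>
    define e where "e = 1 / (2 * (M + 1))"
    have e: "e > 0" "M * e \<le> 1 / 2" unfolding e_def using M by (auto simp: field_simps)
    define LL where "LL = {L. X.bdd_lin L \<and> (\<exists>z\<in>X. \<forall>w\<in>X. L w = form q z w)}"
    have in_LL: "form q z \<in> LL" if "z \<in> X" for z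
      unfolding LL_def using form_bdd[OF q C X_Hs[OF that]] that by blast
    have "\<exists>L\<in>LL. \<forall>w\<in>X. \<bar>energy s (y N) w - L w\<bar> \<le> e * Hs_norm s w"
    proof (rule X.separating_functionals_dense[OF _ _ _ _ energy_bdd[OF Y_Hs[OF y]] e(1)])
      show "X.bdd_lin L" if "L \<in> LL" for L using that unfolding LL_def by blast
      show "LL \<noteq> {}" using in_LL[OF X.zero] by blast
      show "(\<lambda>w. a * L w + b * L' w) \<in> LL" if LL: "L \<in> LL" "L' \<in> LL" for L L' a b
      proof -
        obtain f f' where f: "f \<in> X" "\<forall>w\<in>X. L w = form q f w" and f': "f' \<in> X" "\<forall>w\<in>X. L' w = form q f' w"
          using LL unfolding LL_def by blast
        have "\<forall>w\<in>X. a * L w + b * L' w = form q (\<lambda>x. a * f x + b * f' x) w"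
          using f f' by (simp add: form_lin[OF q X_Hs X_Hs X_Hs])
        moreover have "X.bdd_lin (\<lambda>w. a * L w + b * L' w)" using LL unfolding LL_def by (intro X.bdd_lin_combination) auto
        ultimately show ?thesis unfolding LL_def using X.lin[OF f(1) f'(1), of a b] by blast
      qed
      fix v assume v: "v \<in> X" and z: "\<And>L. L \<in> LL \<Longrightarrow> L v = 0"
      have "form q v w = 0" if "w \<in> X" for w using z[OF in_LL[OF that]] form_sym[of q w v] by simp
      then have "Hs_norm s v = 0" using nr v unfolding nonresonant_def by blast
      then show "Hs_inner s v v = 0" by (simp add: Hs_inner_self)
    qed
    then obtain zL where zL: "zL \<in> X" "\<And>w. w \<in> X \<Longrightarrow> \<bar>energy s (y N) w - form q zL w\<bar> \<le> e * Hs_norm s w"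
      unfolding LL_def by fastforce
    define G where "G = (\<lambda>w. 1 * energy s (y N) w + (- 1) * form q zL w)"
    have G1: "X.bdd_lin G" unfolding G_def
      by (rule X.bdd_lin_combination[OF energy_bdd[OF Y_Hs[OF y]] form_bdd[OF q C X_Hs[OF zL(1)]]])
    have "S (Suc N) M G e" by (rule PM[OF G1]) (use e zL in \<open>auto simp: G_def\<close>)
    then obtain z1 c where z1: "z1 \<in> X" and c: "\<forall>i<Suc N. \<bar>c i\<bar> \<le> M * e"
      and Ge: "\<forall>w\<in>X. G w = form q z1 w + (\<Sum>i<Suc N. c i * energy s (y i) w)"
      unfolding S_def by (elim bexE exE conjE)
    \<comment> \<open>The energy of \<open>y N\<close> occurs on both sides of its own expansion;
      solving for it means dividing by this number, which is at least 1 / 2.\<close>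
    define d where "d = 1 - c N"
    have d: "d \<noteq> 0" using c[rule_format, of N] e(2) unfolding d_def by auto
    define z0 where "z0 = (\<lambda>x. (1 / d) * zL x + (1 / d) * z1 x)"
    have z0: "z0 \<in> X" unfolding z0_def by (rule X.lin[OF zL(1) z1])
    have yN: "energy s (y N) w = form q z0 w + (\<Sum>i<N. (c i / d) * energy s (y i) w)" if w: "w \<in> X" for w
    proof -
      have f0: "form q z0 w = (1 / d) * form q zL w + (1 / d) * form q z1 w"
        unfolding z0_def by (rule form_lin[OF q X_Hs[OF zL(1)] X_Hs[OF z1] X_Hs[OF w]])
      have "energy s (y N) w - form q zL w = form q z1 w + ((\<Sum>i<N. c i * energy s (y i) w) + c N * energy s (y N) w)"
        using Ge w unfolding G_def by simp
      then have "d * energy s (y N) w = form q zL w + form q z1 w + (\<Sum>i<N. c i * energy s (y i) w)"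
        unfolding d_def by (simp add: algebra_simps)
      then have "energy s (y N) w = (form q zL w + form q z1 w + (\<Sum>i<N. c i * energy s (y i) w)) / d"
        using d by (simp add: field_simps)
      then show ?thesis unfolding f0 by (simp add: add_divide_distrib sum_divide_distrib)
    qed
    define K where "K = 1 + (\<Sum>i<N. \<bar>c i / d\<bar>)"
    have K: "K \<ge> 0" unfolding K_def by (simp add: sum_nonneg add_nonneg_nonneg)
    show ?thesis unfolding P_def
    proof (intro exI[of _ "M * K"] conjI allI impI)
      show "0 \<le> M * K" using M K by simp
      fix F \<delta> assume F: "X.bdd_lin F" "0 \<le> \<delta>" "\<forall>w\<in>X. \<bar>F w\<bar> \<le> \<delta> * Hs_norm s w"
      obtain z a where z: "z \<in> X" and a: "\<forall>i<Suc N. \<bar>a i\<bar> \<le> M * \<delta>"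
        and Fe: "\<forall>w\<in>X. F w = form q z w + (\<Sum>i<Suc N. a i * energy s (y i) w)"
        using PM[OF F] unfolding S_def by (elim bexE exE conjE)
      have aN: "\<bar>a N\<bar> \<le> M * \<delta>" using a by simp
      show "S N (M * K) F \<delta>" unfolding S_def
      proof (intro bexI[of _ "\<lambda>x. 1 * z x + a N * z0 x"] exI[of _ "\<lambda>i. a i + a N * (c i / d)"] conjI allI impI ballI)
        show "(\<lambda>x. 1 * z x + a N * z0 x) \<in> X" by (rule X.lin[OF z z0])
        fix i assume i: "i < N"
        have "\<bar>a i + a N * (c i / d)\<bar> \<le> \<bar>a i\<bar> + \<bar>a N\<bar> * \<bar>c i / d\<bar>" by (metis abs_triangle_ineq abs_mult)
        also have "\<dots> \<le> M * \<delta> + (M * \<delta>) * (\<Sum>i<N. \<bar>c i / d\<bar>)"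
        proof (intro add_mono mult_mono)
          show "\<bar>a i\<bar> \<le> M * \<delta>" using a i by simp
          show "\<bar>c i / d\<bar> \<le> (\<Sum>i<N. \<bar>c i / d\<bar>)" using i by (intro member_le_sum) auto
        qed (use aN M F(2) in auto)
        finally show "\<bar>a i + a N * (c i / d)\<bar> \<le> M * K * \<delta>" unfolding K_def by (simp add: algebra_simps)
      next
        fix w assume w: "w \<in> X"
        have "F w = form q z w + ((\<Sum>i<N. a i * energy s (y i) w) + a N * energy s (y N) w)" using Fe w by simp
        also have "a N * energy s (y N) w = a N * form q z0 w + (\<Sum>i<N. (a N * (c i / d)) * energy s (y i) w)"
          unfolding yN[OF w] by (simp add: distrib_left sum_distrib_left mult.assoc)
        finally show "F w = form q (\<lambda>x. 1 * z x + a N * z0 x) w + (\<Sum>i<N. (a i + a N * (c i / d)) * energy s (y i) w)"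
          unfolding form_lin[OF q X_Hs[OF z] X_Hs[OF z0] X_Hs[OF w]] by (simp add: distrib_right sum.distrib)
      qed
    qed
  qed
  have "P N0" unfolding P_def S_def 
  proof (intro exI[of _ M0] conjI allI impI M0)
    fix F \<delta> assume "X.bdd_lin F" "0 \<le> \<delta>" "\<forall>w\<in>X. \<bar>F w\<bar> \<le> \<delta> * Hs_norm s w"
    from U[THEN spec, THEN spec, THEN spec, THEN mp, OF q, THEN mp, OF this(1), THEN mp, OF this(2), THEN mp, OF this(3)]
    show "\<exists>z\<in>X. \<exists>c. (\<forall>i<N0. \<bar>c i\<bar> \<le> M0 * \<delta>) \<and> (\<forall>w\<in>X. F w = form q z w + (\<Sum>i<N0. c i * energy s (y i) w))"
      by (elim bexE exE conjE) (intro bexI exI conjI)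
  qed
  moreover have "P N \<Longrightarrow> P 0" for N by (induction N) (use step in blast)+
  ultimately have "P 0" by blast
  then obtain M where PM: "\<And>F \<delta>. X.bdd_lin F \<Longrightarrow> 0 \<le> \<delta> \<Longrightarrow> (\<forall>w\<in>X. \<bar>F w\<bar> \<le> \<delta> * Hs_norm s w) \<Longrightarrow> S 0 M F \<delta>"
    unfolding P_def by blast
  obtain K where K: "K \<ge> 0" "\<forall>w\<in>X. \<bar>F w\<bar> \<le> K * Hs_norm s w" using F unfolding X.bdd_lin_def by blast
  show ?thesis using PM[OF F K] unfolding S_def by auto
qed

section \<open>Runge approximation with uniform bounds\<close>

lemma pot_functional_bdd:
  assumes q: "pot C q" "C \<ge> 0" and u: "u \<in> Hs s"
  shows "X.bdd_lin (\<lambda>w. LINT x|lborel. q x * u x * w x)"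
proof -
  have "X.bdd_lin (\<lambda>w. 1 * form q u w + (- 1) * energy s u w)"
    by (rule X.bdd_lin_combination[OF form_bdd[OF q u] energy_bdd[OF u]])
  then show ?thesis by (simp add: form_def)
qed

text \<open>For a target \<open>a\<close> one seeks a datum whose energy is minus
  \<open>form q a\<close>. This functional is affine in the coefficients of q, so
  \<open>energy s a\<close> and the functionals given by \<open>g j * a\<close> are approximated by
  exterior energies once and for all. The small error is solved for by
  \<open>uniform_solvability\<close>: its solution corrects the target, and its energies go into the
  datum.\<close>

lemma uniform_runge:
  assumes C: "C \<ge> 0" and a: "a \<in> X" and \<epsilon>: "\<epsilon> > 0" and g: "\<And>j. j \<in> J \<Longrightarrow> pot G (g j)" and J: "finite J"
    and G: "G \<ge> 0" and A: "A \<ge> 0"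
  obtains M where "M \<ge> 0"
    "\<And>q c. pot C q \<Longrightarrow> (AE x in lborel. q x = (\<Sum>j\<in>J. c j * g j x)) \<Longrightarrow> (\<And>j. j \<in> J \<Longrightarrow> \<bar>c j\<bar> \<le> A) \<Longrightarrow>
      \<exists>f\<in>Y. \<exists>z\<in>X. (\<forall>w\<in>X. form q z w + energy s f w = 0) \<and> Hs_norm s f \<le> M \<and> Hs_norm s (\<lambda>x. z x - a x) \<le> \<epsilon>"
proof -
  obtain N :: nat and y :: "nat \<Rightarrow> 'a \<Rightarrow> real" and M where y: "\<And>i. y i \<in> Y" and M: "M \<ge> 0"
    and U: "\<forall>q F \<delta>. pot C q \<longrightarrow> X.bdd_lin F \<longrightarrow> 0 \<le> \<delta> \<longrightarrow> (\<forall>w\<in>X. \<bar>F w\<bar> \<le> \<delta> * Hs_norm s w) \<longrightarrow>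
      (\<exists>z\<in>X. \<exists>c. Hs_norm s z \<le> M * \<delta> \<and> (\<forall>i<N. \<bar>c i\<bar> \<le> M * \<delta>) \<and>
        (\<forall>w\<in>X. F w = form q z w + (\<Sum>i<N. c i * energy s (y i) w)))"
    by (rule uniform_solvability[OF C]) (rule that; assumption)
  note aH = X_Hs[OF a] and aL = X_L2[OF a]
  define \<delta> where "\<delta> = \<epsilon> / (M + 1)"
  have \<delta>: "\<delta> > 0" "M * \<delta> \<le> \<epsilon>" unfolding \<delta>_def using M \<epsilon> by (auto simp: field_simps)
  \<comment> \<open>Distributes the admissible error \<delta> over one energy and
    \<open>card J\<close> functionals, the latter weighted by coefficients of size up to A.\<close>
  define \<delta>' where "\<delta>' = \<delta> / (1 + real (card J) * A)"
  have p: "1 + real (card J) * A > 0" using A by (simp add: add_pos_nonneg)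
  have \<delta>': "\<delta>' > 0" "\<delta>' * (1 + real (card J) * A) = \<delta>" unfolding \<delta>'_def using p \<delta>(1) by auto
  define \<Phi> where "\<Phi> j w = (LINT x|lborel. g j x * a x * w x)" for j w
  obtain h0 where h0: "h0 \<in> Y" "\<And>w. w \<in> X \<Longrightarrow> \<bar>energy s a w - energy s h0 w\<bar> \<le> \<delta>' * Hs_norm s w"
    using exterior_energy_dense[OF energy_bdd[OF aH] \<delta>'(1)] by blast
  have "\<exists>h. h \<in> Y \<and> (\<forall>w\<in>X. \<bar>\<Phi> j w - energy s h w\<bar> \<le> \<delta>' * Hs_norm s w)" if "j \<in> J" for j
  proof -
    have "X.bdd_lin (\<Phi> j)" unfolding \<Phi>_def by (rule pot_functional_bdd[OF g[OF that] G aH])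
    from exterior_energy_dense[OF this \<delta>'(1)] show ?thesis by blast
  qed
  then obtain h where h: "\<And>j. j \<in> J \<Longrightarrow> h j \<in> Y"
      "\<And>j w. j \<in> J \<Longrightarrow> w \<in> X \<Longrightarrow> \<bar>\<Phi> j w - energy s (h j) w\<bar> \<le> \<delta>' * Hs_norm s w" by metis
  \<comment> \<open>Bound for the datum, one term for each of its parts; q and its coefficients do
    not occur in it.\<close>
  define B where "B = Hs_norm s h0 + (\<Sum>j\<in>J. A * Hs_norm s (h j)) + (\<Sum>i<N. (M * \<delta>) * Hs_norm s (y i))"
  have B: "B \<ge> 0" unfolding B_def using A M \<delta>(1) by (intro add_nonneg_nonneg sum_nonneg) auto
  have main: "\<exists>f\<in>Y. \<exists>z\<in>X. (\<forall>w\<in>X. form q z w + energy s f w = 0) \<and> Hs_norm s f \<le> B \<and> Hs_norm s (\<lambda>x. z x - a x) \<le> \<epsilon>"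
    if q: "pot C q" and qe: "AE x in lborel. q x = (\<Sum>j\<in>J. c j * g j x)" and cA: "\<And>j. j \<in> J \<Longrightarrow> \<bar>c j\<bar> \<le> A" for q c
  proof -
    define S1 where "S1 = (\<lambda>x. \<Sum>j\<in>J. c j * h j x)"
    have S1: "S1 \<in> Y" "\<And>w. w \<in> Hs s \<Longrightarrow> energy s S1 w = (\<Sum>j\<in>J. c j * energy s (h j) w)"
      "Hs_norm s S1 \<le> (\<Sum>j\<in>J. \<bar>c j\<bar> * Hs_norm s (h j))"
      unfolding S1_def by (rule Y_sum[OF J h(1)]; assumption)+
    define H where "H = (\<lambda>x. 1 * h0 x + 1 * S1 x)"
    have HY: "H \<in> Y" unfolding H_def by (rule Hs_tilde_lin[OF s h0(1) S1(1)])
    have He: "energy s H w = energy s h0 w + (\<Sum>j\<in>J. c j * energy s (h j) w)" if "w \<in> X" for w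
      unfolding H_def energy_lin[OF s Y_Hs[OF h0(1)] Y_Hs[OF S1(1)] X_Hs[OF that]] S1(2)[OF X_Hs[OF that]] by simp
    have fa: "form q a w = energy s a w + (\<Sum>j\<in>J. c j * \<Phi> j w)" if w: "w \<in> X" for w
    proof -
      have gm: "g j \<in> borel_measurable borel" if "j \<in> J" for j using g[OF that] unfolding pot_def by blast
      have qm [measurable]: "q \<in> borel_measurable borel" using q unfolding pot_def by blast
      note [measurable] = L2_measurable[OF aL] L2_measurable[OF X_L2[OF w]]
      have gi: "integrable lborel (\<lambda>x. c j * (g j x * a x * w x))" if "j \<in> J" for j
        by (rule integrable_mult_right[OF pot_integrable[OF g[OF that] aL X_L2[OF w]]])
      have "(LINT x|lborel. q x * a x * w x) = (LINT x|lborel. (\<Sum>j\<in>J. c j * (g j x * a x * w x)))"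
      proof (rule integral_cong_AE)
        show "AE x in lborel. q x * a x * w x = (\<Sum>j\<in>J. c j * (g j x * a x * w x))"
          using qe by eventually_elim (simp add: sum_distrib_right mult.assoc)
        show "(\<lambda>x. \<Sum>j\<in>J. c j * (g j x * a x * w x)) \<in> borel_measurable lborel"
          by (rule borel_measurable_integrable[OF Bochner_Integration.integrable_sum[OF gi]])
      qed measurable
      also have "\<dots> = (\<Sum>j\<in>J. (LINT x|lborel. c j * (g j x * a x * w x)))" by (rule Bochner_Integration.integral_sum[OF gi])
      also have "\<dots> = (\<Sum>j\<in>J. c j * \<Phi> j w)" unfolding \<Phi>_def by simp
      finally show ?thesis unfolding form_def by simp
    qed
    define F where "F = (\<lambda>w. 1 * form q a w + (- 1) * energy s H w)"
    have F1: "X.bdd_lin F" unfolding F_def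
      by (rule X.bdd_lin_combination[OF form_bdd[OF q C aH] energy_bdd[OF Y_Hs[OF HY]]])
    have F2: "\<bar>F w\<bar> \<le> \<delta> * Hs_norm s w" if w: "w \<in> X" for w
    proof -
      have "F w = (energy s a w - energy s h0 w) + (\<Sum>j\<in>J. c j * (\<Phi> j w - energy s (h j) w))"
        unfolding F_def fa[OF w] He[OF w] by (simp add: right_diff_distrib sum_subtractf)
      also have "\<bar>\<dots>\<bar> \<le> \<bar>energy s a w - energy s h0 w\<bar> + (\<Sum>j\<in>J. \<bar>c j * (\<Phi> j w - energy s (h j) w)\<bar>)"
        by (rule order_trans[OF abs_triangle_ineq add_left_mono[OF sum_abs]])
      also have "\<dots> \<le> \<delta>' * Hs_norm s w + (\<Sum>j\<in>J. A * (\<delta>' * Hs_norm s w))"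
      proof (intro add_mono sum_mono)
        show "\<bar>energy s a w - energy s h0 w\<bar> \<le> \<delta>' * Hs_norm s w" by (rule h0(2)[OF w])
        show "\<bar>c j * (\<Phi> j w - energy s (h j) w)\<bar> \<le> A * (\<delta>' * Hs_norm s w)" if j: "j \<in> J" for j
          unfolding abs_mult by (rule mult_mono[OF cA[OF j] h(2)[OF j w] A abs_ge_zero])
      qed
      also have "\<dots> = (\<delta>' * (1 + real (card J) * A)) * Hs_norm s w" by (simp add: algebra_simps)
      finally show ?thesis unfolding \<delta>'(2) .
    qed
    obtain z' c' where z': "z' \<in> X" "Hs_norm s z' \<le> M * \<delta>" and c': "\<forall>i<N. \<bar>c' i\<bar> \<le> M * \<delta>"
      and Fe: "\<forall>w\<in>X. F w = form q z' w + (\<Sum>i<N. c' i * energy s (y i) w)"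
      using U[THEN spec, THEN spec, THEN spec, THEN mp, OF q, THEN mp, OF F1, THEN mp, OF less_imp_le[OF \<delta>(1)]] F2
      by (elim impE[OF _ ballI] bexE exE conjE)
    define S2 where "S2 = (\<lambda>x. \<Sum>i<N. c' i * y i x)"
    have S2: "S2 \<in> Y" "\<And>w. w \<in> Hs s \<Longrightarrow> energy s S2 w = (\<Sum>i<N. c' i * energy s (y i) w)"
      "Hs_norm s S2 \<le> (\<Sum>i<N. \<bar>c' i\<bar> * Hs_norm s (y i))"
      unfolding S2_def by (rule Y_sum[OF finite_lessThan y]; assumption)+
    define T where "T = (\<lambda>x. 1 * H x + 1 * S2 x)"
    have TY: "T \<in> Y" unfolding T_def by (rule Hs_tilde_lin[OF s HY S2(1)])
    define f where "f = (\<lambda>x. (- 1) * T x)"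
    have fY: "f \<in> Y" using Hs_tilde_lin[OF s TY TY, of "-1" 0] unfolding f_def by simp
    define z where "z = (\<lambda>x. 1 * a x + (- 1) * z' x)"
    have zX: "z \<in> X" unfolding z_def by (rule X.lin[OF a z'(1)])
    have "form q z w + energy s f w = 0" if w: "w \<in> X" for w
    proof -
      have "energy s f w = - energy s T w"
        using energy_lin[OF s Y_Hs[OF TY] Y_Hs[OF TY] X_Hs[OF w], of "-1" 0] unfolding f_def by simp
      also have "energy s T w = energy s H w + (\<Sum>i<N. c' i * energy s (y i) w)"
        unfolding T_def energy_lin[OF s Y_Hs[OF HY] Y_Hs[OF S2(1)] X_Hs[OF w]] S2(2)[OF X_Hs[OF w]] by simp
      finally have 1: "energy s f w = - (energy s H w + (\<Sum>i<N. c' i * energy s (y i) w))" .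
      have 2: "form q z w = form q a w - form q z' w"
        unfolding z_def form_lin[OF q aH X_Hs[OF z'(1)] X_Hs[OF w]] by simp
      have "form q a w - energy s H w = form q z' w + (\<Sum>i<N. c' i * energy s (y i) w)"
        using Fe w unfolding F_def by simp
      then show ?thesis unfolding 1 2 by linarith
    qed
    moreover have "Hs_norm s f \<le> B"
    proof -
      have "Hs_norm s f = Hs_norm s T" unfolding f_def Hs.nrm_scale[OF Y_Hs[OF TY]] by simp
      also have "\<dots> \<le> Hs_norm s H + Hs_norm s S2"
        unfolding T_def using Hs.nrm_triangle[OF Y_Hs[OF HY] Y_Hs[OF S2(1)]] by simp
      also have "Hs_norm s H \<le> Hs_norm s h0 + Hs_norm s S1"
        unfolding H_def using Hs.nrm_triangle[OF Y_Hs[OF h0(1)] Y_Hs[OF S1(1)]] by simp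
      also have "Hs_norm s S1 \<le> (\<Sum>j\<in>J. A * Hs_norm s (h j))"
        using S1(3) by (rule order_trans) (intro sum_mono mult_right_mono cA, auto)
      also have "Hs_norm s S2 \<le> (\<Sum>i<N. (M * \<delta>) * Hs_norm s (y i))"
        using S2(3) by (rule order_trans) (intro sum_mono mult_right_mono, use c' in auto)
      finally show ?thesis unfolding B_def by simp
    qed
    moreover have "Hs_norm s (\<lambda>x. z x - a x) \<le> \<epsilon>"
    proof -
      have "(\<lambda>x. z x - a x) = (\<lambda>x. (- 1) * z' x)" unfolding z_def by auto
      then have "Hs_norm s (\<lambda>x. z x - a x) = Hs_norm s z'" using Hs.nrm_scale[OF X_Hs[OF z'(1)], of "-1"] by simp
      then show ?thesis using z'(2) \<delta>(2) by linarith
    qed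
    ultimately show ?thesis using fY zX by blast
  qed
  show ?thesis by (rule that[OF B main])
qed

text \<open>Datum and solution are divided by the norm \<tau> of the datum, and \<tau> is recorded
  so that \<open>\<tau> * z\<close> still approximates the target. If \<tau> were 0, nonresonance
  would make the solution null, against \<open>\<epsilon> < l2n a\<close>. Only the upper bound for
  \<tau> is quantitative.\<close>

lemma uniform_normalised_runge:
  assumes C: "C \<ge> 0" and a: "a \<in> X" and \<epsilon>: "\<epsilon> > 0" "\<epsilon> < l2n a" and g: "\<And>j. j \<in> J \<Longrightarrow> pot G (g j)" and J: "finite J"
    and G: "G \<ge> 0" and A: "A \<ge> 0"
  shows "\<exists>M>0. \<forall>q. pot C q \<longrightarrow> nonresonant q \<longrightarrow>
      (\<exists>c. (AE x in lborel. q x = (\<Sum>j\<in>J. c j * g j x)) \<and> (\<forall>j\<in>J. \<bar>c j\<bar> \<le> A)) \<longrightarrow>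
      (\<exists>f\<in>Y. \<exists>z\<in>X. \<exists>\<tau>. 0 < \<tau> \<and> \<tau> \<le> M \<and> Hs_norm s f = 1 \<and> (\<forall>w\<in>X. form q z w + energy s f w = 0) \<and>
        l2n (\<lambda>x. \<tau> * z x - a x) \<le> \<epsilon>)"
proof -
  obtain M where M: "M \<ge> 0" and R: "\<And>q c. pot C q \<Longrightarrow> (AE x in lborel. q x = (\<Sum>j\<in>J. c j * g j x)) \<Longrightarrow> (\<And>j. j \<in> J \<Longrightarrow> \<bar>c j\<bar> \<le> A) \<Longrightarrow>
      \<exists>f\<in>Y. \<exists>z\<in>X. (\<forall>w\<in>X. form q z w + energy s f w = 0) \<and> Hs_norm s f \<le> M \<and> Hs_norm s (\<lambda>x. z x - a x) \<le> \<epsilon>"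
    by (rule uniform_runge[OF C a \<epsilon>(1) g J G A]) (assumption, rule that, assumption, blast)
  have main: "\<exists>f\<in>Y. \<exists>z\<in>X. \<exists>\<tau>. 0 < \<tau> \<and> \<tau> \<le> M + 1 \<and> Hs_norm s f = 1 \<and> (\<forall>w\<in>X. form q z w + energy s f w = 0) \<and>
        l2n (\<lambda>x. \<tau> * z x - a x) \<le> \<epsilon>"
    if q: "pot C q" and nr: "nonresonant q" and qe: "AE x in lborel. q x = (\<Sum>j\<in>J. c j * g j x)" and cA: "\<And>j. j \<in> J \<Longrightarrow> \<bar>c j\<bar> \<le> A" for q c
  proof -
    obtain f z where f: "f \<in> Y" and z: "z \<in> X" and fz: "\<forall>w\<in>X. form q z w + energy s f w = 0"
      and fM: "Hs_norm s f \<le> M" and za: "Hs_norm s (\<lambda>x. z x - a x) \<le> \<epsilon>"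
    proof -
      have "\<exists>f\<in>Y. \<exists>z\<in>X. (\<forall>w\<in>X. form q z w + energy s f w = 0) \<and> Hs_norm s f \<le> M \<and> Hs_norm s (\<lambda>x. z x - a x) \<le> \<epsilon>"
        by (rule R[OF q qe]) (rule cA)
      then show ?thesis using that by (elim bexE conjE)
    qed
    note fH = Y_Hs[OF f] and zH = X_Hs[OF z]
    define \<tau> where "\<tau> = Hs_norm s f"
    have l: "l2n (\<lambda>x. z x - a x) \<le> \<epsilon>" by (rule order_trans[OF X_l2n_le[OF X.diff[OF z a]] za])
    have \<tau>: "\<tau> > 0"
    proof (rule ccontr)
      assume "\<not> \<tau> > 0"
      then have f0: "Hs_norm s f = 0" using Hs_norm_nonneg[of s f] unfolding \<tau>_def by linarith
      have "form q z w = 0" if w: "w \<in> X" for w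
      proof -
        have "\<bar>energy s f w\<bar> \<le> 0" using energy_le[OF s fH X_Hs[OF w]] f0 by simp
        then show ?thesis using fz w by fastforce
      qed
      then have "Hs_norm s z = 0" using nr z unfolding nonresonant_def by blast
      then have "l2n z \<le> 0" using X_l2n_le[OF z] by simp
      moreover have "l2n a \<le> l2n z + l2n (\<lambda>x. z x - a x)"
        using l2n_triangle[OF X_L2[OF z] X_L2[OF X.diff[OF a z]]] l2n_minus_commute[of a z] by simp
      ultimately show False using l \<epsilon>(2) by linarith
    qed
    define f' z' where "f' = (\<lambda>x. (1 / \<tau>) * f x)" and "z' = (\<lambda>x. (1 / \<tau>) * z x)"
    have f'Y: "f' \<in> Y" using Hs_tilde_lin[OF s f f, of "1 / \<tau>" 0] unfolding f'_def by simp
    have z'X: "z' \<in> X" using X.lin[OF z z, of "1 / \<tau>" 0] unfolding z'_def by simp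
    have "Hs_norm s f' = 1" unfolding f'_def Hs.nrm_scale[OF fH] using \<tau> unfolding \<tau>_def by simp
    moreover have "form q z' w + energy s f' w = 0" if w: "w \<in> X" for w
    proof -
      have "form q z' w = (1 / \<tau>) * form q z w"
        using form_lin[OF q zH zH X_Hs[OF w], of "1 / \<tau>" 0] unfolding z'_def by simp
      moreover have "energy s f' w = (1 / \<tau>) * energy s f w"
        using energy_lin[OF s fH fH X_Hs[OF w], of "1 / \<tau>" 0] unfolding f'_def by simp
      moreover have "(1 / \<tau>) * (form q z w + energy s f w) = 0" using fz w by simp
      ultimately show ?thesis by (simp add: distrib_left)
    qed
    moreover have "(\<lambda>x. \<tau> * z' x - a x) = (\<lambda>x. z x - a x)" unfolding z'_def using \<tau> by simp
    moreover have "\<tau> \<le> M + 1" using fM unfolding \<tau>_def by simp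
    ultimately show ?thesis using f'Y z'X \<tau> l by (intro bexI[of _ f'] bexI[of _ z'] exI[of _ \<tau>]) auto
  qed
  have "M + 1 > 0" using M by simp
  then show ?thesis by (intro exI[of _ "M + 1"] conjI allI impI, assumption, elim exE conjE) (rule main, auto)
qed

end

section \<open>The Dirichlet-to-Neumann map and the stability estimate\<close>

text \<open>The maximum with 0 makes the bound valid outside \<Omega> as well, where the extension
  is 0.\<close>

lemma Linf_extension:
  fixes \<Omega> :: "'a::euclidean_space set"
  assumes \<Omega>: "open \<Omega>" and q: "q \<in> Linf \<Omega>"
  shows "(\<lambda>x. indicator \<Omega> x * q x) \<in> borel_measurable borel"
    "AE x in lborel. \<bar>indicator \<Omega> x * q x\<bar> \<le> max 0 (Linf_norm \<Omega> q)"
proof -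
  have \<Omega>s: "\<Omega> \<inter> space lborel \<in> sets lborel" using \<Omega> by simp
  have qm: "q \<in> borel_measurable (restrict_space lborel \<Omega>)"
    and fin: "esssup (restrict_space lborel \<Omega>) (\<lambda>x. ereal \<bar>q x\<bar>) < \<infinity>"
    using q unfolding Linf_def by auto
  show "(\<lambda>x. indicator \<Omega> x * q x) \<in> borel_measurable borel"
    using qm by (simp add: borel_measurable_restrict_space_iff[OF \<Omega>s])
  have "AE x in restrict_space lborel \<Omega>. ereal \<bar>q x\<bar> \<le> esssup (restrict_space lborel \<Omega>) (\<lambda>x. ereal \<bar>q x\<bar>)"
    by (rule esssup_AE)
  then have "AE x in lborel. x \<in> \<Omega> \<longrightarrow> ereal \<bar>q x\<bar> \<le> esssup (restrict_space lborel \<Omega>) (\<lambda>x. ereal \<bar>q x\<bar>)"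
    by (simp only: AE_restrict_space_iff[OF \<Omega>s])
  then show "AE x in lborel. \<bar>indicator \<Omega> x * q x\<bar> \<le> max 0 (Linf_norm \<Omega> q)"
  proof eventually_elim
    case (elim x)
    show ?case
    proof (cases "x \<in> \<Omega>")
      case True
      show ?thesis
        using elim True fin unfolding Linf_norm_def
        by (cases "esssup (restrict_space lborel \<Omega>) (\<lambda>x. ereal \<bar>q x\<bar>)") auto
    qed simp
  qed
qed

lemma Linf_norm_le:
  fixes \<Omega> :: "'a::euclidean_space set"
  assumes \<Omega>: "open \<Omega>" and q: "q \<in> borel_measurable (restrict_space lborel \<Omega>)" and B: "B \<ge> 0"
    and le: "AE x in lborel. x \<in> \<Omega> \<longrightarrow> \<bar>q x\<bar> \<le> B"
  shows "Linf_norm \<Omega> q \<le> B"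
proof -
  have \<Omega>s: "\<Omega> \<inter> space lborel \<in> sets lborel" using \<Omega> by simp
  have "AE x in restrict_space lborel \<Omega>. ereal \<bar>q x\<bar> \<le> ereal B"
    using le by (simp add: AE_restrict_space_iff[OF \<Omega>s])
  then have "esssup (restrict_space lborel \<Omega>) (\<lambda>x. ereal \<bar>q x\<bar>) \<le> ereal B"
    by (intro esssup_I) (use q in simp_all)
  then show ?thesis unfolding Linf_norm_def
    using B by (cases "esssup (restrict_space lborel \<Omega>) (\<lambda>x. ereal \<bar>q x\<bar>)") auto
qed

section \<open>Weak solutions and the Dirichlet-to-Neumann map in terms of the form\<close>

context fractional_exterior
begin

abbreviation ext :: "('a \<Rightarrow> real) \<Rightarrow> 'a \<Rightarrow> real" where
  "ext q \<equiv> \<lambda>x. indicator \<Omega> x * q x"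

lemma pot_mono: "pot C q \<Longrightarrow> C \<le> C' \<Longrightarrow> pot C' q"
  unfolding pot_def by (elim conjE, intro conjI, assumption, erule eventually_mono) linarith

lemma pot_ext: "q \<in> Linf \<Omega> \<Longrightarrow> Linf_norm \<Omega> q \<le> C \<Longrightarrow> 0 \<le> C \<Longrightarrow> pot C (ext q)"
  by (rule pot_mono[of "max 0 (Linf_norm \<Omega> q)"])
    (simp_all only: pot_def Linf_extension[OF \<Omega>(1)] max.bounded_iff simp_thms)

lemma bilinear_form_eq: "u \<in> Hs s \<Longrightarrow> v \<in> Hs s \<Longrightarrow> bilinear_form s \<Omega> q u v = form (ext q) u v"
  unfolding bilinear_form_def form_def fractional_laplacian_energy[OF s] set_lebesgue_integral_def
  by (simp add: mult.assoc)

lemma weak_solution_iff: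
  "weak_solution s \<Omega> q f u \<longleftrightarrow> u \<in> Hs s \<and> (\<lambda>x. u x - f x) \<in> X \<and> (\<forall>w\<in>X. form (ext q) u w = 0)"
proof -
  have "bilinear_form s \<Omega> q u w = form (ext q) u w" if "u \<in> Hs s" "w \<in> X" for w
    by (rule bilinear_form_eq[OF that(1) X_Hs[OF that(2)]])
  then show ?thesis unfolding weak_solution_def by (metis (no_types))
qed

lemma nonresonant_ext: "zero_not_dirichlet_eigenvalue s \<Omega> q \<Longrightarrow> nonresonant (ext q)"
  unfolding nonresonant_def zero_not_dirichlet_eigenvalue_def weak_solution_iff
  by (auto intro!: Hs_norm_AE_zero X_Hs)

text \<open>The unknown is the difference of solution and datum, which solves an equation in
  \<open>X\<close> with minus the form of the datum as right-hand side.\<close>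

lemma weak_solution_exists:
  assumes q: "pot C (ext q)" and C: "C \<ge> 0" and nr: "nonresonant (ext q)" and f: "f \<in> Hs s"
  shows "\<exists>u. weak_solution s \<Omega> q f u"
proof -
  have "X.bdd_lin (\<lambda>w. (- 1) * form (ext q) f w + 0 * form (ext q) f w)"
    by (rule X.bdd_lin_combination[OF form_bdd[OF q C f] form_bdd[OF q C f]])
  from nonresonant_solvable[OF q C nr this]
  obtain z where z: "z \<in> X" "\<And>w. w \<in> X \<Longrightarrow> form (ext q) z w = - form (ext q) f w" by auto
  have "form (ext q) (\<lambda>x. 1 * f x + 1 * z x) w = 0" if w: "w \<in> X" for w
    unfolding form_lin[OF q f X_Hs[OF z(1)] X_Hs[OF w]] using z(2)[OF w] by simp
  then have "weak_solution s \<Omega> q f (\<lambda>x. 1 * f x + 1 * z x)"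
    unfolding weak_solution_iff using z(1) Hs.lin[OF f X_Hs[OF z(1)], of 1 1] by simp
  then show ?thesis by blast
qed

lemma weak_solution_unique:
  assumes q: "pot C (ext q)" and nr: "nonresonant (ext q)" and f: "f \<in> Hs s"
    and u: "weak_solution s \<Omega> q f u" and v: "weak_solution s \<Omega> q f v"
  shows "Hs_norm s (\<lambda>x. u x - v x) = 0"
proof -
  have uH: "u \<in> Hs s" and vH: "v \<in> Hs s" using u v unfolding weak_solution_iff by auto
  have "(\<lambda>x. u x - f x) \<in> X" "(\<lambda>x. v x - f x) \<in> X" using u v unfolding weak_solution_iff by auto
  from X.diff[OF this] have "(\<lambda>x. (u x - f x) - (v x - f x)) \<in> X" .
  then have X: "(\<lambda>x. u x - v x) \<in> X" by simp
  have "form (ext q) (\<lambda>x. u x - v x) w = 0" if w: "w \<in> X" for w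
    using form_lin[OF q uH vH X_Hs[OF w], of 1 "-1"] u v w unfolding weak_solution_iff by simp
  then show ?thesis using nr X unfolding nonresonant_def by blast
qed

text \<open>The choice made in \<open>solution\<close> is harmless: two solutions differ by an
  element of seminorm 0, which the form does not see. Hence any convenient solution computes the
  map.\<close>

lemma DN_map_eq:
  assumes q: "pot C (ext q)" and C: "C \<ge> 0" and nr: "nonresonant (ext q)" and f: "f \<in> Hs s"
    and u: "weak_solution s \<Omega> q f u" and h: "h \<in> Hs s"
  shows "DN_map s \<Omega> q f h = form (ext q) u h"
proof -
  define v where "v = solution s \<Omega> q f"
  have v: "weak_solution s \<Omega> q f v" unfolding v_def solution_def by (rule someI[of "weak_solution s \<Omega> q f", OF u])
  have uH: "u \<in> Hs s" and vH: "v \<in> Hs s" using u v unfolding weak_solution_iff by auto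
  have "\<bar>form (ext q) (\<lambda>x. v x - u x) h\<bar> \<le> 0"
    using form_le[OF q C Hs.diff[OF vH uH] h] weak_solution_unique[OF q nr f v u] by simp
  then have "form (ext q) v h = form (ext q) u h" using form_lin[OF q vH uH h, of 1 "-1"] by simp
  then show ?thesis unfolding DN_map_def v_def[symmetric] bilinear_form_eq[OF vH h] .
qed

text \<open>The potential term vanishes because the two supports are disjoint. So an exterior datum
  enters the equation through its energy alone, the quantity that the density results
  control.\<close>

lemma form_outside:
  assumes q: "pot C q" and f: "f \<in> Y" and w: "w \<in> X"
  shows "form q f w = energy s f w"
proof -
  have "AE x in lborel. x \<notin> W \<longrightarrow> f x = 0" by (rule Hs_tilde_zero_outside[OF s f]) (simp add: W(1))
  with X_zero_outside[OF w] have "AE x in lborel. q x * f x * w x = 0"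
  proof eventually_elim
    case (elim x)
    then show ?case using W(3) closure_subset[of \<Omega>] by (cases "x \<in> W") auto
  qed
  then have "(LINT x|lborel. q x * f x * w x) = 0" by (rule integral_eq_zero_AE)
  then show ?thesis unfolding form_def by simp
qed

lemma weak_solution_exterior:
  assumes q: "pot C (ext q)" and f: "f \<in> Y" and z: "z \<in> X" and e: "\<forall>w\<in>X. form (ext q) z w + energy s f w = 0"
  shows "weak_solution s \<Omega> q f (\<lambda>x. f x + z x)"
proof -
  have "form (ext q) (\<lambda>x. 1 * f x + 1 * z x) w = 0" if w: "w \<in> X" for w
    unfolding form_lin[OF q Y_Hs[OF f] X_Hs[OF z] X_Hs[OF w]] form_outside[OF q f w] using e w by (simp add: add.commute)
  then show ?thesis
    unfolding weak_solution_iff using z Hs.add[OF Y_Hs[OF f] X_Hs[OF z]] by simp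
qed

text \<open>Alessandrini's identity. The solution v for q2 with data f links the two maps: replacing
  h by u2 changes nothing, since their difference lies in \<open>X\<close>, and by symmetry v can be
  exchanged for u1, which has the same exterior data.\<close>

lemma DN_map_difference:
  assumes q1: "pot C (ext q1)" "nonresonant (ext q1)" and q2: "pot C (ext q2)" "nonresonant (ext q2)" and C: "C \<ge> 0"
    and f: "f \<in> Hs s" and h: "h \<in> Hs s"
    and u1: "weak_solution s \<Omega> q1 f u1" and u2: "weak_solution s \<Omega> q2 h u2"
  shows "DN_map s \<Omega> q1 f h - DN_map s \<Omega> q2 f h = (LINT x|lborel. (ext q1 x - ext q2 x) * u1 x * u2 x)"
proof -
  obtain v where v: "weak_solution s \<Omega> q2 f v" using weak_solution_exists[OF q2(1) C q2(2) f] by blast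
  have H: "u1 \<in> Hs s" "u2 \<in> Hs s" "v \<in> Hs s" using u1 u2 v unfolding weak_solution_iff by auto
  have X1: "(\<lambda>x. u2 x - h x) \<in> X" "(\<lambda>x. u1 x - f x) \<in> X" "(\<lambda>x. v x - f x) \<in> X"
    using u1 u2 v unfolding weak_solution_iff by auto
  have "form (ext q1) u1 (\<lambda>x. u2 x - h x) = 0" "form (ext q2) v (\<lambda>x. u2 x - h x) = 0"
    "form (ext q2) u2 (\<lambda>x. u1 x - f x) = 0" "form (ext q2) u2 (\<lambda>x. v x - f x) = 0"
    using X1 u1 u2 v unfolding weak_solution_iff by blast+
  then have e: "form (ext q1) u1 u2 = form (ext q1) u1 h" "form (ext q2) v u2 = form (ext q2) v h"
    "form (ext q2) u2 u1 = form (ext q2) u2 f" "form (ext q2) u2 v = form (ext q2) u2 f"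
    using form_lin_right[OF q1(1) H(2) h H(1), of 1 "-1"] form_lin_right[OF q2(1) H(2) h H(3), of 1 "-1"]
      form_lin_right[OF q2(1) H(1) f H(2), of 1 "-1"] form_lin_right[OF q2(1) H(3) f H(2), of 1 "-1"] by auto
  have "DN_map s \<Omega> q1 f h - DN_map s \<Omega> q2 f h = form (ext q1) u1 h - form (ext q2) v h"
    unfolding DN_map_eq[OF q1(1) C q1(2) f u1 h] DN_map_eq[OF q2(1) C q2(2) f v h] ..
  also have "form (ext q2) v h = form (ext q2) u1 u2"
    using e(2,3,4) form_sym[of "ext q2" v u2] form_sym[of "ext q2" u1 u2] by linarith
  also have "form (ext q1) u1 h - form (ext q2) u1 u2 =
      (LINT x|lborel. ext q1 x * u1 x * u2 x) - (LINT x|lborel. ext q2 x * u1 x * u2 x)"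
    by (simp only: e(1)[symmetric]) (simp add: form_def)
  also have "\<dots> = (LINT x|lborel. ext q1 x * u1 x * u2 x - ext q2 x * u1 x * u2 x)"
    by (rule Bochner_Integration.integral_diff[symmetric])
      (rule pot_integrable[OF q1(1) Hs_L2[OF H(1)] Hs_L2[OF H(2)]] pot_integrable[OF q2(1) Hs_L2[OF H(1)] Hs_L2[OF H(2)]])+
  finally show ?thesis by (simp add: left_diff_distrib)
qed

text \<open>A supremum of reals bounds its members only if the set is bounded above; the bound K
  comes from continuity of the forms, with the two solutions for the datum fixed.\<close>

lemma DN_map_difference_dual:
  assumes q1: "pot C (ext q1)" "nonresonant (ext q1)" and q2: "pot C (ext q2)" "nonresonant (ext q2)" and C: "C \<ge> 0"
    and f: "f \<in> Hs s" and h: "h \<in> Hs_tilde s U" "Hs_norm s h \<le> 1"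
  shows "\<bar>DN_map s \<Omega> q1 f h - DN_map s \<Omega> q2 f h\<bar> \<le> Hs_dual_norm s U (\<lambda>h. DN_map s \<Omega> q1 f h - DN_map s \<Omega> q2 f h)"
proof -
  obtain u where u: "weak_solution s \<Omega> q1 f u" using weak_solution_exists[OF q1(1) C q1(2) f] by blast
  obtain v where v: "weak_solution s \<Omega> q2 f v" using weak_solution_exists[OF q2(1) C q2(2) f] by blast
  have uH: "u \<in> Hs s" and vH: "v \<in> Hs s" using u v unfolding weak_solution_iff by auto
  define K where "K = (1 + C) * Hs_norm s u + (1 + C) * Hs_norm s v"
  have le: "\<bar>DN_map s \<Omega> q1 f k - DN_map s \<Omega> q2 f k\<bar> \<le> K" if k: "k \<in> Hs_tilde s U" "Hs_norm s k \<le> 1" for k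
  proof -
    have kH: "k \<in> Hs s" by (rule Hs_tilde_Hs[OF s k(1)])
    have b: "(1 + C) * (Hs_norm s z * Hs_norm s k) \<le> (1 + C) * Hs_norm s z" for z :: "'a \<Rightarrow> real"
      using C k(2) by (intro mult_left_mono mult_left_le) auto
    have "\<bar>DN_map s \<Omega> q1 f k - DN_map s \<Omega> q2 f k\<bar> = \<bar>form (ext q1) u k - form (ext q2) v k\<bar>"
      unfolding DN_map_eq[OF q1(1) C q1(2) f u kH] DN_map_eq[OF q2(1) C q2(2) f v kH] ..
    also have "\<dots> \<le> \<bar>form (ext q1) u k\<bar> + \<bar>form (ext q2) v k\<bar>" by (rule abs_triangle_ineq4)
    also have "\<dots> \<le> K" unfolding K_def
      by (intro add_mono order_trans[OF form_le[OF q1(1) C uH kH] b] order_trans[OF form_le[OF q2(1) C vH kH] b])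
    finally show ?thesis .
  qed
  show ?thesis unfolding Hs_dual_norm_def
  proof (rule cSUP_upper)
    show "bdd_above ((\<lambda>h. \<bar>DN_map s \<Omega> q1 f h - DN_map s \<Omega> q2 f h\<bar>) ` {h \<in> Hs_tilde s U. Hs_norm s h \<le> 1})"
      using le by (intro bdd_aboveI[where M=K]) auto
  qed (use h in simp)
qed

text \<open>The factors are replaced one at a time; the norm of v is in turn bounded through its
  target \<open>o'\<close>.\<close>

lemma form_integral_perturbation:
  fixes u v p o' :: "'a \<Rightarrow> real"
  assumes D: "pot K D" and K: "K \<ge> 0" and L: "u \<in> L2" "v \<in> L2" "p \<in> L2" "o' \<in> L2"
    and e: "l2n (\<lambda>x. u x - p x) \<le> \<epsilon>" "l2n (\<lambda>x. v x - o' x) \<le> \<epsilon>"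
  shows "\<bar>(LINT x|lborel. D x * u x * v x) - (LINT x|lborel. D x * p x * o' x)\<bar> \<le> K * (\<epsilon> * (l2n o' + \<epsilon> + l2n p))"
proof -
  have \<epsilon>: "\<epsilon> \<ge> 0" using order_trans[OF _ e(1)] by simp
  note Lu = L2_diff[OF L(1,3)] and Lv = L2_diff[OF L(2,4)]
  have "(LINT x|lborel. D x * u x * v x) - (LINT x|lborel. D x * p x * o' x) = (LINT x|lborel. D x * u x * v x - D x * p x * o' x)"
    by (rule Bochner_Integration.integral_diff[symmetric]) (intro pot_integrable[OF D] L)+
  also have "\<dots> = (LINT x|lborel. D x * (u x - p x) * v x + D x * p x * (v x - o' x))"
    by (simp add: algebra_simps)
  also have "\<dots> = (LINT x|lborel. D x * (u x - p x) * v x) + (LINT x|lborel. D x * p x * (v x - o' x))"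
    by (rule Bochner_Integration.integral_add[OF pot_integrable[OF D Lu L(2)] pot_integrable[OF D L(3) Lv]])
  also have "\<bar>\<dots>\<bar> \<le> K * (l2n (\<lambda>x. u x - p x) * l2n v) + K * (l2n p * l2n (\<lambda>x. v x - o' x))"
    by (rule order_trans[OF abs_triangle_ineq add_mono[OF pot_integral_le[OF D K Lu L(2)] pot_integral_le[OF D K L(3) Lv]]])
  also have "\<dots> \<le> K * (\<epsilon> * (l2n o' + \<epsilon>)) + K * (l2n p * \<epsilon>)"
  proof (intro add_mono mult_left_mono mult_mono K e)
    show "l2n v \<le> l2n o' + \<epsilon>" using l2n_triangle[OF L(4) Lv] e(2) by simp
  qed (use \<epsilon> in simp_all)
  finally show ?thesis by (simp add: algebra_simps)
qed

end

section \<open>The stability estimate\<close>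

text \<open>The Runge constants for data in \<open>W\<close> with targets \<open>g j\<close>, and in
  \<open>W'\<close> with target 1, are fixed before the potentials are given. For a pair of
  potentials the index of the largest coefficient selects the target, and pairing the two data
  isolates that coefficient. The nonnegativity in the conclusion allows the constant to be enlarged
  later.\<close>

lemma one_sided_stability:
  fixes \<Omega> W W' :: "'a::euclidean_space set" and g :: "nat \<Rightarrow> 'a \<Rightarrow> real"
  assumes "fractional_exterior s \<Omega> W" "fractional_exterior s \<Omega> W'" and m: "1 \<le> m"
    and gL: "\<forall>j\<in>{1..m}. g j \<in> Linf \<Omega>" and on: "L2_orthonormal \<Omega> m g" and C: "0 < C"
  shows "\<exists>K>0. \<forall>q1 q2. q1 \<in> Linf_span \<Omega> m g \<longrightarrow> q2 \<in> Linf_span \<Omega> m g \<longrightarrow>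
    Linf_norm \<Omega> q1 \<le> C \<longrightarrow> Linf_norm \<Omega> q2 \<le> C \<longrightarrow>
    zero_not_dirichlet_eigenvalue s \<Omega> q1 \<longrightarrow> zero_not_dirichlet_eigenvalue s \<Omega> q2 \<longrightarrow>
    (\<exists>f\<in>Hs_tilde s W. Hs_norm s f = 1 \<and> 0 \<le> DN_difference_norm s \<Omega> W' m q1 q2 (\<lambda>j. f) \<and>
      Linf_norm \<Omega> (\<lambda>x. q1 x - q2 x) \<le> K * DN_difference_norm s \<Omega> W' m q1 q2 (\<lambda>j. f))"
proof -
  interpret A: fractional_exterior s \<Omega> W by fact
  interpret B: fractional_exterior s \<Omega> W' by fact
  note g = bspec[OF gL]
  define J where "J = {1..m}"
  have J: "finite J" "J \<noteq> {}" unfolding J_def using m by auto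
  define o' :: "'a \<Rightarrow> real" where "o' = indicator \<Omega>"
  define p where "p j = (\<lambda>x. indicator \<Omega> x * g j x)" for j
  \<comment> \<open>A common bound for the \<open>g j\<close>; the summand 1 makes it
    positive.\<close>
  define G where "G = (\<Sum>j\<in>J. \<bar>Linf_norm \<Omega> (g j)\<bar>) + 1"
  have G: "G > 0" unfolding G_def by (simp add: add_nonneg_pos sum_nonneg)
  have pG: "A.pot G (p j)" if j: "j \<in> J" for j
  proof -
    have "\<bar>Linf_norm \<Omega> (g j)\<bar> \<le> (\<Sum>j\<in>J. \<bar>Linf_norm \<Omega> (g j)\<bar>)"
      by (rule member_le_sum[OF j]) (use J in auto)
    then show ?thesis unfolding p_def by (intro A.pot_ext g) (use j G in \<open>auto simp: G_def J_def\<close>)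
  qed
  have oL: "o' \<in> L2" unfolding o'_def using A.\<Omega> by (intro indicator_L2) auto
  have po: "p j x * o' x = p j x" for j x unfolding p_def o'_def by (simp add: indicator_def)
  have pL: "p j \<in> L2" if "j \<in> J" for j using A.pot_mult_L2[OF pG[OF that] oL] unfolding po .
  have pp: "(LINT x|lborel. p i x * p j x) = (if i = j then 1 else 0)" if "i \<in> J" "j \<in> J" for i j
  proof -
    have "(LINT x:\<Omega>|lborel. g i x * g j x) = (LINT x|lborel. p i x * p j x)"
      unfolding set_lebesgue_integral_def p_def by (rule Bochner_Integration.integral_cong) (auto simp: indicator_def)
    then show ?thesis using on that unfolding L2_orthonormal_def J_def by simp
  qed
  have lp: "l2n (p j) = 1" if "j \<in> J" for j
  proof -
    have "(l2n (p j))\<^sup>2 = 1" unfolding l2n_sq using pp[OF that that] by (simp add: power2_eq_square)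
    then show ?thesis by (simp add: power2_eq_1_iff l2n_def)
  qed
  \<comment> \<open>The square root of the volume of \<Omega>, positive because \<Omega> carries a
    bounded function of norm 1.\<close>
  define lo where "lo = l2n o'"
  have lo: "lo > 0"
  proof -
    obtain j where j: "j \<in> J" using J(2) by blast
    have "\<bar>(LINT x|lborel. p j x * p j x * o' x)\<bar> \<le> G * (l2n (p j) * l2n o')"
      by (rule A.pot_integral_le[OF pG[OF j] less_imp_le[OF G] pL[OF j] oL])
    then have "1 \<le> G * lo" using pp[OF j j] po lp[OF j] unfolding lo_def by (simp add: mult.assoc)
    then show ?thesis using G by (smt (verit) mult_nonneg_nonpos)
  qed
  \<comment> \<open>The supremum norm of the difference is at most H times its largest
    coefficient.\<close>
  define H where "H = real m * G"
  have H: "H > 0" unfolding H_def using G m by simp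
  \<comment> \<open>The first two bounds keep the targets larger than the error, as
    \<open>uniform_normalised_runge\<close> requires. The third makes the total error, with 2 \<eta>
    in each factor, at most half of the largest coefficient.\<close>
  define \<eta> where "\<eta> = min (1 / 8) (min (lo / 8) (1 / (4 * (H * (lo + 3)))))"
  have Hl: "H * (lo + 3) > 0" using H lo by simp
  have \<eta>: "\<eta> > 0" "\<eta> \<le> 1 / 8" "\<eta> \<le> lo / 8" "2 * (H * (\<eta> * (lo + 3))) \<le> 1 / 2"
  proof -
    show "\<eta> > 0" unfolding \<eta>_def using lo Hl by simp
    show "\<eta> \<le> 1 / 8" "\<eta> \<le> lo / 8" unfolding \<eta>_def by auto
    have "\<eta> \<le> 1 / (4 * (H * (lo + 3)))" unfolding \<eta>_def by simp
    then have "\<eta> * (4 * (H * (lo + 3))) \<le> 1" using Hl by (simp add: pos_le_divide_eq)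
    then show "2 * (H * (\<eta> * (lo + 3))) \<le> 1 / 2" by (simp add: mult_ac)
  qed
  \<comment> \<open>The functions \<open>g j\<close> and 1, cut off to \<Omega>, need not lie in
    \<open>X\<close>; test functions replace them as targets at the cost of a further
    \<eta>.\<close>
  have approx: "\<exists>a\<in>Hs_tilde s \<Omega>. l2n (\<lambda>x. p x - a x) < \<eta>" if pL: "p \<in> L2" and p0: "\<And>x. x \<notin> \<Omega> \<Longrightarrow> p x = 0" for p
  proof -
    have "AE x in lborel. x \<notin> \<Omega> \<longrightarrow> p x = 0" using p0 by simp
    from test_functions_dense[OF pL A.\<Omega>(1) this \<eta>(1)]
    show ?thesis using test_functions_Hs_tilde[OF A.s, of \<Omega>] by blast
  qed
  have "\<exists>a. a \<in> Hs_tilde s \<Omega> \<and> l2n (\<lambda>x. p j x - a x) < \<eta>" if "j \<in> J" for j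
    using approx[OF pL[OF that]] unfolding p_def by fastforce
  then obtain a where a: "\<And>j. j \<in> J \<Longrightarrow> a j \<in> Hs_tilde s \<Omega>" "\<And>j. j \<in> J \<Longrightarrow> l2n (\<lambda>x. p j x - a j x) < \<eta>" by metis
  obtain b where b: "b \<in> Hs_tilde s \<Omega>" "l2n (\<lambda>x. o' x - b x) < \<eta>"
    using approx[OF oL] unfolding o'_def by fastforce
  have tri: "l2n p \<le> l2n a + l2n (\<lambda>x. p x - a x)" if "p \<in> L2" "a \<in> L2" for p a :: "'a \<Rightarrow> real"
    using l2n_triangle[OF that(2) L2_diff[OF that]] by simp
  have \<eta>a: "\<eta> < l2n (a j)" if j: "j \<in> J" for j
    using tri[OF pL[OF j] A.X_L2[OF a(1)[OF j]]] lp[OF j] a(2)[OF j] \<eta>(2) by linarith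
  have \<eta>b: "\<eta> < l2n b"
    using tri[OF oL A.X_L2[OF b(1)]] b(2) \<eta>(3) lo unfolding lo_def by linarith
  have Cl: "C * lo \<ge> 0" and C0: "C \<ge> 0" using C lo by auto
  \<comment> \<open>The bound C lo for the coefficients comes from pairing the potential with an
    orthonormal function, by Cauchy-Schwarz.\<close>
  define good where "good q \<longleftrightarrow> A.pot C q \<and> A.nonresonant q \<and>
      (\<exists>c. (AE x in lborel. q x = (\<Sum>j\<in>J. c j * p j x)) \<and> (\<forall>j\<in>J. \<bar>c j\<bar> \<le> C * lo))" for q
  define R where "R U t M q \<longleftrightarrow> (\<exists>f\<in>Hs_tilde s U. \<exists>z\<in>Hs_tilde s \<Omega>. \<exists>\<tau>. 0 < \<tau> \<and> \<tau> \<le> M \<and> Hs_norm s f = 1 \<and>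
        (\<forall>w\<in>Hs_tilde s \<Omega>. A.form q z w + energy s f w = 0) \<and> l2n (\<lambda>x. \<tau> * z x - t x) \<le> \<eta>)" for U t M q
  have "\<forall>j\<in>J. \<exists>M. M > 0 \<and> (\<forall>q. good q \<longrightarrow> R W (a j) M q)"
  proof
    fix j assume j: "j \<in> J"
    show "\<exists>M. M > 0 \<and> (\<forall>q. good q \<longrightarrow> R W (a j) M q)"
      using A.uniform_normalised_runge[OF C0 a(1)[OF j] \<eta>(1) \<eta>a[OF j] pG J(1) less_imp_le[OF G] Cl]
      unfolding good_def R_def imp_conjL by assumption
  qed
  from bchoice[OF this] obtain MA where MA: "\<forall>j\<in>J. MA j > 0 \<and> (\<forall>q. good q \<longrightarrow> R W (a j) (MA j) q)" by (rule exE)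
  have "\<exists>M. M > 0 \<and> (\<forall>q. good q \<longrightarrow> R W' b M q)"
    using B.uniform_normalised_runge[OF C0 b(1) \<eta>(1) \<eta>b pG J(1) less_imp_le[OF G] Cl]
    unfolding good_def R_def imp_conjL by assumption
  then obtain MB where MB: "MB > 0" "\<forall>q. good q \<longrightarrow> R W' b MB q" by (elim exE conjE)
  \<comment> \<open>A bound valid for whichever index is selected later.\<close>
  define MS where "MS = (\<Sum>j\<in>J. MA j)"
  have MS: "MS > 0" unfolding MS_def using MA J by (intro sum_pos) auto
  define K where "K = H * (2 * (MS * MB))"
  have K: "K > 0" unfolding K_def using H MS MB(1) by simp
  have coeff: "(LINT x|lborel. q x * p k x) = c k" if q: "AE x in lborel. q x = (\<Sum>j\<in>J. c j * p j x)"
    and qm: "q \<in> borel_measurable borel" and k: "k \<in> J" for q c k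
  proof -
    note pm = L2_measurable[OF pL]
    have pi: "integrable lborel (\<lambda>x. c j * (p j x * p k x))" if "j \<in> J" for j
      by (rule integrable_mult_right[OF L2_mult_integrable[OF pL[OF that] pL[OF k]]])
    have "(LINT x|lborel. q x * p k x) = (LINT x|lborel. (\<Sum>j\<in>J. c j * (p j x * p k x)))"
    proof (rule integral_cong_AE)
      show "AE x in lborel. q x * p k x = (\<Sum>j\<in>J. c j * (p j x * p k x))"
        using q by eventually_elim (simp add: sum_distrib_right mult.assoc)
      show "(\<lambda>x. q x * p k x) \<in> borel_measurable lborel" using qm pm[OF k] by simp
      show "(\<lambda>x. \<Sum>j\<in>J. c j * (p j x * p k x)) \<in> borel_measurable lborel"
        by (rule borel_measurable_integrable[OF Bochner_Integration.integrable_sum[OF pi]])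
    qed
    also have "\<dots> = (\<Sum>j\<in>J. (LINT x|lborel. c j * (p j x * p k x)))" by (rule Bochner_Integration.integral_sum[OF pi])
    also have "\<dots> = (\<Sum>j\<in>J. if j = k then c j else 0)" using pp[OF _ k] by (intro sum.cong) auto
    also have "\<dots> = c k" using J(1) k by simp
    finally show ?thesis .
  qed
  have span: "A.pot C (A.ext q) \<and> (\<exists>c. (AE x in lborel. A.ext q x = (\<Sum>j\<in>J. c j * p j x)) \<and> (\<forall>j\<in>J. \<bar>c j\<bar> \<le> C * lo))"
    if q: "q \<in> Linf_span \<Omega> m g" "Linf_norm \<Omega> q \<le> C" for q
  proof -
    have \<Omega>s: "\<Omega> \<inter> space lborel \<in> sets lborel" using A.\<Omega>(1) by simp
    obtain c where c: "AE x in restrict_space lborel \<Omega>. q x = (\<Sum>j=1..m. c j * g j x)" and qL: "q \<in> Linf \<Omega>"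
      using q(1) unfolding Linf_span_def by blast
    have qp: "A.pot C (A.ext q)" by (rule A.pot_ext[OF qL q(2) C0])
    have "AE x in lborel. x \<in> \<Omega> \<longrightarrow> q x = (\<Sum>j=1..m. c j * g j x)" using c by (simp add: AE_restrict_space_iff[OF \<Omega>s])
    then have e: "AE x in lborel. A.ext q x = (\<Sum>j\<in>J. c j * p j x)"
      by eventually_elim (simp add: p_def J_def indicator_def)
    have "\<bar>c k\<bar> \<le> C * lo" if k: "k \<in> J" for k
    proof -
      have "c k = (LINT x|lborel. A.ext q x * p k x)"
        by (rule coeff[OF e _ k, symmetric]) (use qp in \<open>simp add: A.pot_def\<close>)
      also have "\<dots> = (LINT x|lborel. A.ext q x * p k x * o' x)" by (simp add: mult.assoc po)
      finally show ?thesis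
        using A.pot_integral_le[OF qp C0 pL[OF k] oL] lp[OF k] unfolding lo_def by simp
    qed
    then show ?thesis using qp e by blast
  qed
  show ?thesis
  proof (intro exI[of _ K] conjI K allI impI)
    fix q1 q2
    assume q: "q1 \<in> Linf_span \<Omega> m g" "q2 \<in> Linf_span \<Omega> m g" "Linf_norm \<Omega> q1 \<le> C" "Linf_norm \<Omega> q2 \<le> C"
      and nd: "zero_not_dirichlet_eigenvalue s \<Omega> q1" "zero_not_dirichlet_eigenvalue s \<Omega> q2"
    show "\<exists>f\<in>Hs_tilde s W. Hs_norm s f = 1 \<and> 0 \<le> DN_difference_norm s \<Omega> W' m q1 q2 (\<lambda>j. f) \<and>
      Linf_norm \<Omega> (\<lambda>x. q1 x - q2 x) \<le> K * DN_difference_norm s \<Omega> W' m q1 q2 (\<lambda>j. f)"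
    proof -
      have qL: "q1 \<in> Linf \<Omega>" "q2 \<in> Linf \<Omega>" using q(1,2) unfolding Linf_span_def by auto
      define Q1 Q2 where "Q1 = A.ext q1" and "Q2 = A.ext q2"
      have p1: "A.pot C Q1" and p2: "A.pot C Q2" and nr: "A.nonresonant Q1" "A.nonresonant Q2"
        unfolding Q1_def Q2_def using span q A.nonresonant_ext nd by auto
      obtain c1 where c1: "AE x in lborel. Q1 x = (\<Sum>j\<in>J. c1 j * p j x)" "\<forall>j\<in>J. \<bar>c1 j\<bar> \<le> C * lo"
        using span[OF q(1,3)] unfolding Q1_def by (elim exE conjE)
      obtain c2 where c2: "AE x in lborel. Q2 x = (\<Sum>j\<in>J. c2 j * p j x)" "\<forall>j\<in>J. \<bar>c2 j\<bar> \<le> C * lo"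
        using span[OF q(2,4)] unfolding Q2_def by (elim exE conjE)
      have good: "good Q1" "good Q2" unfolding good_def using p1 p2 nr c1 c2 by blast+
      define d where "d j = c1 j - c2 j" for j
      have "Max ((\<lambda>j. \<bar>d j\<bar>) ` J) \<in> (\<lambda>j. \<bar>d j\<bar>) ` J" using J by (intro Max_in) auto
      then obtain k where k: "k \<in> J" "Max ((\<lambda>j. \<bar>d j\<bar>) ` J) = \<bar>d k\<bar>" by (elim imageE)
      have dk: "\<bar>d j\<bar> \<le> \<bar>d k\<bar>" if "j \<in> J" for j
        unfolding k(2)[symmetric] using J(1) that by (intro Max_ge) auto
      define D where "D = (\<lambda>x. Q1 x - Q2 x)"
      have Dm: "D \<in> borel_measurable borel" using p1 p2 unfolding D_def A.pot_def by (intro borel_measurable_diff) auto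
      have De: "AE x in lborel. D x = (\<Sum>j\<in>J. d j * p j x)"
        using c1(1) c2(1) by eventually_elim (simp add: D_def d_def left_diff_distrib sum_subtractf)
      have "AE x in lborel. \<forall>j\<in>J. \<bar>p j x\<bar> \<le> G"
        using J(1) pG unfolding A.pot_def by (simp add: AE_finite_all)
      with De have DH: "AE x in lborel. \<bar>D x\<bar> \<le> H * \<bar>d k\<bar>"
      proof eventually_elim
        case (elim x)
        have "\<bar>D x\<bar> \<le> (\<Sum>j\<in>J. \<bar>d j * p j x\<bar>)" unfolding elim(1) by (rule sum_abs)
        also have "\<dots> \<le> (\<Sum>j\<in>J. \<bar>d k\<bar> * G)"
        proof (rule sum_mono)
          fix j assume j: "j \<in> J"
          show "\<bar>d j * p j x\<bar> \<le> \<bar>d k\<bar> * G"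
            unfolding abs_mult by (rule mult_mono[OF dk[OF j] elim(2)[rule_format, OF j] abs_ge_zero abs_ge_zero])
        qed
        also have "\<dots> = H * \<bar>d k\<bar>" unfolding H_def J_def by simp
        finally show ?case .
      qed
      have Dp: "A.pot (H * \<bar>d k\<bar>) D" unfolding A.pot_def using Dm DH by blast
      have Hd: "H * \<bar>d k\<bar> \<ge> 0" using H by simp
      have norm: "Linf_norm \<Omega> (\<lambda>x. q1 x - q2 x) \<le> H * \<bar>d k\<bar>"
      proof (rule Linf_norm_le[OF A.\<Omega>(1) _ Hd])
        show "(\<lambda>x. q1 x - q2 x) \<in> borel_measurable (restrict_space lborel \<Omega>)"
          using qL unfolding Linf_def by (intro borel_measurable_diff) auto
        show "AE x in lborel. x \<in> \<Omega> \<longrightarrow> \<bar>q1 x - q2 x\<bar> \<le> H * \<bar>d k\<bar>"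
          using DH by eventually_elim (auto simp: D_def Q1_def Q2_def)
      qed
      obtain f z1 t1 where f: "f \<in> Hs_tilde s W" "Hs_norm s f = 1" and z1: "z1 \<in> Hs_tilde s \<Omega>"
        and t1: "0 < t1" "t1 \<le> MA k" and e1: "\<forall>w\<in>Hs_tilde s \<Omega>. A.form Q1 z1 w + energy s f w = 0"
        and l1: "l2n (\<lambda>x. t1 * z1 x - a k x) \<le> \<eta>"
        using MA[rule_format, OF k(1)] good(1) unfolding R_def by (elim conjE impE allE[of _ Q1] bexE exE)
      have "R W' b MB Q2" using MB(2) good(2) by blast
      then obtain h z2 t2 where h: "h \<in> Hs_tilde s W'" "Hs_norm s h = 1" and z2: "z2 \<in> Hs_tilde s \<Omega>"
        and t2: "0 < t2" "t2 \<le> MB" and e2: "\<forall>w\<in>Hs_tilde s \<Omega>. A.form Q2 z2 w + energy s h w = 0"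
        and l2: "l2n (\<lambda>x. t2 * z2 x - b x) \<le> \<eta>"
        unfolding R_def by (elim conjE bexE exE)
      have fH: "f \<in> Hs s" and hH: "h \<in> Hs s" using A.Y_Hs[OF f(1)] B.Y_Hs[OF h(1)] .
      have z1L: "z1 \<in> L2" and z2L: "z2 \<in> L2" using A.X_L2 z1 z2 by auto
      have w1: "weak_solution s \<Omega> q1 f (\<lambda>x. f x + z1 x)"
        by (rule A.weak_solution_exterior[OF p1[unfolded Q1_def] f(1) z1 e1[unfolded Q1_def]])
      have w2: "weak_solution s \<Omega> q2 h (\<lambda>x. h x + z2 x)"
        by (rule B.weak_solution_exterior[OF p2[unfolded Q2_def] h(1) z2 e2[unfolded Q2_def]])
      define S where "S = DN_map s \<Omega> q1 f h - DN_map s \<Omega> q2 f h"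
      define N where "N = DN_difference_norm s \<Omega> W' m q1 q2 (\<lambda>j. f)"
      have "S = (LINT x|lborel. (A.ext q1 x - A.ext q2 x) * (f x + z1 x) * (h x + z2 x))"
        unfolding S_def
        by (rule A.DN_map_difference[OF p1[unfolded Q1_def] nr(1)[unfolded Q1_def] p2[unfolded Q2_def] nr(2)[unfolded Q2_def] C0 fH hH w1 w2])
      \<comment> \<open>On \<Omega> the exterior data vanish and only \<open>z1\<close>,
        \<open>z2\<close> remain; outside \<Omega> the difference of the potentials is 0.\<close>
      also have "\<dots> = (LINT x|lborel. D x * z1 x * z2 x)"
      proof (rule integral_cong_AE)
        have fm: "f \<in> borel_measurable borel" "h \<in> borel_measurable borel" "z1 \<in> borel_measurable borel" "z2 \<in> borel_measurable borel"
          using L2_measurable[OF Hs_L2[OF fH]] L2_measurable[OF Hs_L2[OF hH]] L2_measurable[OF z1L] L2_measurable[OF z2L] by simp_all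
        have De': "(\<lambda>x. A.ext q1 x - A.ext q2 x) = D" unfolding D_def Q1_def Q2_def ..
        have "(\<lambda>x. D x * (f x + z1 x) * (h x + z2 x)) \<in> borel_measurable lborel" using fm Dm by simp
        then show "(\<lambda>x. (A.ext q1 x - A.ext q2 x) * (f x + z1 x) * (h x + z2 x)) \<in> borel_measurable lborel"
          unfolding De'[symmetric] .
        show "(\<lambda>x. D x * z1 x * z2 x) \<in> borel_measurable lborel" using fm Dm by simp
        have "AE x in lborel. x \<notin> W \<longrightarrow> f x = 0" by (rule Hs_tilde_zero_outside[OF A.s f(1)]) (simp add: A.W(1))
        moreover have "AE x in lborel. x \<notin> W' \<longrightarrow> h x = 0" by (rule Hs_tilde_zero_outside[OF A.s h(1)]) (simp add: B.W(1))
        ultimately show "AE x in lborel. (A.ext q1 x - A.ext q2 x) * (f x + z1 x) * (h x + z2 x) = D x * z1 x * z2 x"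
        proof eventually_elim
          case (elim x)
          show ?case
          proof (cases "x \<in> \<Omega>")
            case True
            then have "x \<notin> W" "x \<notin> W'" using A.W(3) B.W(3) closure_subset[of \<Omega>] by auto
            then show ?thesis using elim unfolding D_def Q1_def Q2_def by simp
          qed (simp add: D_def Q1_def Q2_def)
        qed
      qed
      finally have S: "S = (LINT x|lborel. D x * z1 x * z2 x)" .
      have u1L: "(\<lambda>x. t1 * z1 x) \<in> L2" and u2L: "(\<lambda>x. t2 * z2 x) \<in> L2"
        using L2_scaleR[OF z1L, of t1] L2_scaleR[OF z2L, of t2] by simp_all
      have "l2n (\<lambda>x. t1 * z1 x - p k x) \<le> l2n (\<lambda>x. t1 * z1 x - a k x) + l2n (\<lambda>x. a k x - p k x)"
        by (rule l2n_triangle_diff[OF u1L A.X_L2[OF a(1)[OF k(1)]] pL[OF k(1)]])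
      then have l1': "l2n (\<lambda>x. t1 * z1 x - p k x) \<le> 2 * \<eta>"
        using l1 a(2)[OF k(1)] l2n_minus_commute[of "a k" "p k"] by linarith
      have "l2n (\<lambda>x. t2 * z2 x - o' x) \<le> l2n (\<lambda>x. t2 * z2 x - b x) + l2n (\<lambda>x. b x - o' x)"
        by (rule l2n_triangle_diff[OF u2L A.X_L2[OF b(1)] oL])
      then have l2': "l2n (\<lambda>x. t2 * z2 x - o' x) \<le> 2 * \<eta>"
        using l2 b(2) l2n_minus_commute[of b o'] by linarith
      have "\<bar>(LINT x|lborel. D x * (t1 * z1 x) * (t2 * z2 x)) - (LINT x|lborel. D x * p k x * o' x)\<bar>
          \<le> (H * \<bar>d k\<bar>) * ((2 * \<eta>) * (l2n o' + 2 * \<eta> + l2n (p k)))"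
        by (rule A.form_integral_perturbation[OF Dp Hd u1L u2L pL[OF k(1)] oL l1' l2'])
      also have "(LINT x|lborel. D x * (t1 * z1 x) * (t2 * z2 x)) = (LINT x|lborel. (t1 * t2) * (D x * z1 x * z2 x))"
        by (rule Bochner_Integration.integral_cong) simp_all
      also have "\<dots> = t1 * t2 * S" unfolding S by simp
      also have "(LINT x|lborel. D x * p k x * o' x) = d k"
        using coeff[OF De Dm k(1)] by (simp add: mult.assoc po)
      also have "(H * \<bar>d k\<bar>) * ((2 * \<eta>) * (l2n o' + 2 * \<eta> + l2n (p k))) \<le> (H * \<bar>d k\<bar>) * ((2 * \<eta>) * (lo + 3))"
        using Hd \<eta>(1,2) lp[OF k(1)] unfolding lo_def by (intro mult_left_mono) auto
      also have "\<dots> = (2 * (H * (\<eta> * (lo + 3)))) * \<bar>d k\<bar>" by simp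
      also have "\<dots> \<le> (1 / 2) * \<bar>d k\<bar>" by (rule mult_right_mono[OF \<eta>(4) abs_ge_zero])
      \<comment> \<open>The rescaled integral differs from \<open>d k\<close> by at most half of its
        absolute value.\<close>
      finally have "\<bar>d k\<bar> \<le> 2 * \<bar>t1 * t2 * S\<bar>" by linarith
      also have "\<bar>t1 * t2 * S\<bar> = (t1 * t2) * \<bar>S\<bar>" using t1(1) t2(1) by (simp add: abs_mult)
      also have "(t1 * t2) * \<bar>S\<bar> \<le> (MS * MB) * \<bar>S\<bar>"
      proof (intro mult_right_mono mult_mono)
        have "MA k \<le> MS" unfolding MS_def by (rule member_le_sum[OF k(1)]) (use MA J in \<open>auto simp: less_imp_le\<close>)
        then show "t1 \<le> MS" using t1(2) by linarith
        show "t2 \<le> MB" by (rule t2(2))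
      qed (use MS t2 in auto)
      finally have dS: "\<bar>d k\<bar> \<le> 2 * ((MS * MB) * \<bar>S\<bar>)" by simp
      have "N = Hs_dual_norm s W' (\<lambda>h. DN_map s \<Omega> q1 f h - DN_map s \<Omega> q2 f h)"
      proof -
        \<comment> \<open>With one datum for all indices the maximum runs over a single value; the
          range is nonempty because m is at least 1.\<close>
        have "(\<lambda>j. x) ` {1..m} = {x}" for x :: real using m by auto
        then show ?thesis unfolding N_def DN_difference_norm_def by simp
      qed
      then have SN: "\<bar>S\<bar> \<le> N"
        unfolding S_def
        using A.DN_map_difference_dual[OF p1[unfolded Q1_def] nr(1)[unfolded Q1_def] p2[unfolded Q2_def] nr(2)[unfolded Q2_def] C0 fH h(1)] h(2)
        by simp
      have "Linf_norm \<Omega> (\<lambda>x. q1 x - q2 x) \<le> H * (2 * ((MS * MB) * \<bar>S\<bar>))"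
        by (rule order_trans[OF norm mult_left_mono[OF dS less_imp_le[OF H]]])
      also have "\<dots> = K * \<bar>S\<bar>" unfolding K_def by simp
      also have "\<dots> \<le> K * N" by (rule mult_left_mono[OF SN less_imp_le[OF K]])
      finally have "Linf_norm \<Omega> (\<lambda>x. q1 x - q2 x) \<le> K * N" .
      moreover have "0 \<le> N" using SN abs_ge_zero order_trans by blast
      ultimately show ?thesis using f unfolding N_def by blast
    qed
  qed
qed

theorem theorem1:
  fixes s C\<^sub>0 :: real and m :: nat
    and \<Omega> W\<^sub>1 W\<^sub>2 :: "(real ^ 'n) set"
    and g :: "nat \<Rightarrow> real ^ 'n \<Rightarrow> real"
  assumes "0 < s" "s < 1" and "1 \<le> m"
    and "bounded \<Omega>" "smooth_domain \<Omega>"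
    and "lipschitz_domain W\<^sub>1" "W\<^sub>1 \<noteq> {}" "W\<^sub>1 \<subseteq> - closure \<Omega>" "closure W\<^sub>1 \<inter> closure \<Omega> = {}"
    and "lipschitz_domain W\<^sub>2" "W\<^sub>2 \<noteq> {}" "W\<^sub>2 \<subseteq> - closure \<Omega>" "closure W\<^sub>2 \<inter> closure \<Omega> = {}"
    and "\<And>j. j \<in> {1..m} \<Longrightarrow> g j \<in> Linf \<Omega>"
    and "L2_orthonormal \<Omega> m g"
    and "0 < C\<^sub>0"
  shows "\<exists>C\<^sub>1>0. \<forall>q\<^sub>1 q\<^sub>2.
    q\<^sub>1 \<in> Linf_span \<Omega> m g \<longrightarrow> q\<^sub>2 \<in> Linf_span \<Omega> m g \<longrightarrow>
    Linf_norm \<Omega> q\<^sub>1 \<le> C\<^sub>0 \<longrightarrow> Linf_norm \<Omega> q\<^sub>2 \<le> C\<^sub>0 \<longrightarrow>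
    zero_not_dirichlet_eigenvalue s \<Omega> q\<^sub>1 \<longrightarrow> zero_not_dirichlet_eigenvalue s \<Omega> q\<^sub>2 \<longrightarrow>
    (\<exists>f\<^sub>1 f\<^sub>2.
      (\<forall>j\<in>{1..m}. f\<^sub>1 j \<in> Hs_tilde s W\<^sub>1 \<and> Hs_norm s (f\<^sub>1 j) = 1) \<and>
      (\<forall>j\<in>{1..m}. f\<^sub>2 j \<in> Hs_tilde s W\<^sub>2 \<and> Hs_norm s (f\<^sub>2 j) = 1) \<and>
      Linf_norm \<Omega> (\<lambda>x. q\<^sub>1 x - q\<^sub>2 x) \<le>
        C\<^sub>1 * min (DN_difference_norm s \<Omega> W\<^sub>2 m q\<^sub>1 q\<^sub>2 f\<^sub>1)
                 (DN_difference_norm s \<Omega> W\<^sub>1 m q\<^sub>1 q\<^sub>2 f\<^sub>2))"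
proof -
  have \<Omega>: "open \<Omega>" using assms(5) unfolding smooth_domain_def by blast
  have fe: "fractional_exterior s \<Omega> W" if "lipschitz_domain W" "W \<noteq> {}" "W \<subseteq> - closure \<Omega>" for W
    by unfold_locales (use assms(1,2,4) \<Omega> that in \<open>auto simp: lipschitz_domain_def\<close>)
  note A = fe[OF assms(6-8)] and B = fe[OF assms(10-12)]
  have gL: "\<forall>j\<in>{1..m}. g j \<in> Linf \<Omega>" using assms(14) by blast
  obtain K1 where K1: "K1 > 0" "\<forall>q1 q2. q1 \<in> Linf_span \<Omega> m g \<longrightarrow> q2 \<in> Linf_span \<Omega> m g \<longrightarrow>
    Linf_norm \<Omega> q1 \<le> C\<^sub>0 \<longrightarrow> Linf_norm \<Omega> q2 \<le> C\<^sub>0 \<longrightarrow>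
    zero_not_dirichlet_eigenvalue s \<Omega> q1 \<longrightarrow> zero_not_dirichlet_eigenvalue s \<Omega> q2 \<longrightarrow>
    (\<exists>f\<in>Hs_tilde s W\<^sub>1. Hs_norm s f = 1 \<and> 0 \<le> DN_difference_norm s \<Omega> W\<^sub>2 m q1 q2 (\<lambda>j. f) \<and>
      Linf_norm \<Omega> (\<lambda>x. q1 x - q2 x) \<le> K1 * DN_difference_norm s \<Omega> W\<^sub>2 m q1 q2 (\<lambda>j. f))"
    using one_sided_stability[OF A B assms(3) gL assms(15,16)] by (elim exE conjE)
  obtain K2 where K2: "K2 > 0" "\<forall>q1 q2. q1 \<in> Linf_span \<Omega> m g \<longrightarrow> q2 \<in> Linf_span \<Omega> m g \<longrightarrow>
    Linf_norm \<Omega> q1 \<le> C\<^sub>0 \<longrightarrow> Linf_norm \<Omega> q2 \<le> C\<^sub>0 \<longrightarrow>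
    zero_not_dirichlet_eigenvalue s \<Omega> q1 \<longrightarrow> zero_not_dirichlet_eigenvalue s \<Omega> q2 \<longrightarrow>
    (\<exists>f\<in>Hs_tilde s W\<^sub>2. Hs_norm s f = 1 \<and> 0 \<le> DN_difference_norm s \<Omega> W\<^sub>1 m q1 q2 (\<lambda>j. f) \<and>
      Linf_norm \<Omega> (\<lambda>x. q1 x - q2 x) \<le> K2 * DN_difference_norm s \<Omega> W\<^sub>1 m q1 q2 (\<lambda>j. f))"
    using one_sided_stability[OF B A assms(3) gL assms(15,16)] by (elim exE conjE)
  \<comment> \<open>Both one-sided constants are enlarged to their sum, which is legitimate since
    the norms of the differences are nonnegative; the estimate then holds for the smaller of the two
    norms.\<close>
  define K where "K = K1 + K2"
  show ?thesis
  proof (intro exI[of _ K] conjI allI impI)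
    show "0 < K" unfolding K_def using K1(1) K2(1) by simp
    fix q1 q2
    assume q: "q1 \<in> Linf_span \<Omega> m g" "q2 \<in> Linf_span \<Omega> m g" "Linf_norm \<Omega> q1 \<le> C\<^sub>0" "Linf_norm \<Omega> q2 \<le> C\<^sub>0"
      "zero_not_dirichlet_eigenvalue s \<Omega> q1" "zero_not_dirichlet_eigenvalue s \<Omega> q2"
    obtain f1 where f1: "f1 \<in> Hs_tilde s W\<^sub>1" "Hs_norm s f1 = 1" "0 \<le> DN_difference_norm s \<Omega> W\<^sub>2 m q1 q2 (\<lambda>j. f1)"
      "Linf_norm \<Omega> (\<lambda>x. q1 x - q2 x) \<le> K1 * DN_difference_norm s \<Omega> W\<^sub>2 m q1 q2 (\<lambda>j. f1)"
      using K1(2)[rule_format, OF q] by (elim bexE conjE)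
    obtain f2 where f2: "f2 \<in> Hs_tilde s W\<^sub>2" "Hs_norm s f2 = 1" "0 \<le> DN_difference_norm s \<Omega> W\<^sub>1 m q1 q2 (\<lambda>j. f2)"
      "Linf_norm \<Omega> (\<lambda>x. q1 x - q2 x) \<le> K2 * DN_difference_norm s \<Omega> W\<^sub>1 m q1 q2 (\<lambda>j. f2)"
      using K2(2)[rule_format, OF q] by (elim bexE conjE)
    have "K1 * DN_difference_norm s \<Omega> W\<^sub>2 m q1 q2 (\<lambda>j. f1) \<le> K * DN_difference_norm s \<Omega> W\<^sub>2 m q1 q2 (\<lambda>j. f1)"
      using f1(3) K2(1) unfolding K_def by (intro mult_right_mono) auto
    moreover have "K2 * DN_difference_norm s \<Omega> W\<^sub>1 m q1 q2 (\<lambda>j. f2) \<le> K * DN_difference_norm s \<Omega> W\<^sub>1 m q1 q2 (\<lambda>j. f2)"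
      using f2(3) K1(1) unfolding K_def by (intro mult_right_mono) auto
    ultimately have "Linf_norm \<Omega> (\<lambda>x. q1 x - q2 x) \<le>
        K * min (DN_difference_norm s \<Omega> W\<^sub>2 m q1 q2 (\<lambda>j. f1)) (DN_difference_norm s \<Omega> W\<^sub>1 m q1 q2 (\<lambda>j. f2))"
      using f1(4) f2(4) by (simp add: min_def)
    then show "\<exists>f\<^sub>1 f\<^sub>2.
      (\<forall>j\<in>{1..m}. f\<^sub>1 j \<in> Hs_tilde s W\<^sub>1 \<and> Hs_norm s (f\<^sub>1 j) = 1) \<and>
      (\<forall>j\<in>{1..m}. f\<^sub>2 j \<in> Hs_tilde s W\<^sub>2 \<and> Hs_norm s (f\<^sub>2 j) = 1) \<and>
      Linf_norm \<Omega> (\<lambda>x. q1 x - q2 x) \<le>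
        K * min (DN_difference_norm s \<Omega> W\<^sub>2 m q1 q2 f\<^sub>1) (DN_difference_norm s \<Omega> W\<^sub>1 m q1 q2 f\<^sub>2)"
      using f1(1,2) f2(1,2) by (intro exI[of _ "\<lambda>j. f1"] exI[of _ "\<lambda>j. f2"]) simp
  qed
qed

end
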